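(* For $\nu>0$ consider the Cauchy target $\pi_\nu\propto\exp(-V_\nu)$ on $\mathbb{R}^d$ with $V_\nu(x)=\frac{d+\nu}{2}\ln(1+|x|^2)$, and consider the stable proximal sampler with $\alpha=1$, target $\pi_\nu$, standard Gaussian initialization, and the restricted $1$-stable oracle implemented by the rejection sampler $\mathcal{R}$ of the context. (1) When $\nu\ge1$, if the step size is $\eta=\Theta\big(d^{-1/2}(d+\nu)^{-4}\big)$, the expected number of iterations required by the stable proximal sampler to output a sample which is $\varepsilon$-close to the target in $\chi^2$-divergence is of order $\mathcal{O}\big(C_{\mathrm{FPI}(1)}\,d^{1/2}(d+\nu)^4\log(d/\varepsilon)\big)$, where $C_{\mathrm{FPI}(1)}$ is the $1$-fractional Poincaré parameter of $\pi_\nu$. (2) When $\nu\in(0,1)$, if the step size is $\eta=\Theta\big(d^{-1/2}(d+\nu)^{-4/\nu}\big)$, the expected number of iterations required by the stable proximal sampler to output a sample which is $\varepsilon$-close to the target in $\chi^2$-divergence is of order $$\tilde{\mathcal{O}}\Big(\max\big\{c^{\frac1\nu}d^{\frac{1}{2\nu}+\frac{4}{\nu^2}},\;c\,d^{\frac12+\frac4\nu}\varepsilon^{-\frac1\nu+1}\big\}\Big),$$ where $c>0$ is a constant such that $\pi_\nu$ satisfies the $1$-weak fractional Poincaré inequality with parameter function $r\mapsto c\,(1+r^{-(1-\nu)/\nu})$. Here $\tilde{\mathcal{O}}$ hides polylogarithmic factors in $d$ and $1/\varepsilon$.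
   Context: $\chi^2(\rho|\pi)=\int(\rho/\pi-1)^2\pi\,\mathrm{d}x$; "$\varepsilon$-close" means $\chi^2(\mathrm{Law}|\pi_\nu)\le\varepsilon$. $\mathcal{O}$ and $\tilde{\mathcal{O}}$ may also hide constants depending on $\nu$. Let $p^{(1)}(\eta;x,y)=p_\eta^{(1)}(y-x)$, where $p_\eta^{(1)}(z)\propto(|z|^2+\eta^2)^{-(d+1)/2}$ is the isotropic $1$-stable (Cauchy) density. Stable proximal sampler with $\alpha=1$, step $\eta$, target $\pi^X\propto e^{-V}$: started from $x_0$, at each iteration $k=0,1,\dots$ (i) sample $y_k\mid x_k\sim p^{(1)}(\eta;x_k,\cdot)$; (ii) sample $x_{k+1}\mid y_k$ from the density proportional to $\pi^X(\cdot)\,p^{(1)}(\eta;\cdot,y_k)$ (a call to the restricted $1$-stable oracle). Rejection sampler $\mathcal{R}$ implementing step (ii): given $V$, a minimizer $x^*$ of $V$, $\eta>0$ and $y\in\mathbb{R}^d$, repeat: draw independent $Z_1\sim\mathcal{N}(0,I_d)$, $Z_2\sim\mathcal{N}(0,1)$, $u\sim U[0,1]$; set $x=y+\eta Z_1/|Z_2|$; if $u\le\exp(-V(x)+V(x^* ))$, return $x$ and stop. Dirichlet form: $\mathcal{E}_\mu^{(1)}(\phi)=c_{d,1}\iint_{\{x\ne y\}}\frac{(\phi(x)-\phi(y))^2}{|x-y|^{d+1}}\,\mathrm{d}x\,\mu(y)\,\mathrm{d}y$ with $c_{d,1}=\frac{2\,\Gamma((d+1)/2)}{\pi^{d/2}|\Gamma(-1/2)|}$.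 A probability density $\mu$ satisfies the $1$-fractional Poincaré inequality with parameter $C_{\mathrm{FPI}(1)}>0$ if $\mathrm{Var}_\mu(\phi)\le C_{\mathrm{FPI}(1)}\mathcal{E}_\mu^{(1)}(\phi)$ for every $\phi$ in the domain of $\mathcal{E}_\mu^{(1)}$; it satisfies the $1$-weak fractional Poincaré inequality with (decreasing) parameter function $\beta:\mathbb{R}_+\to\mathbb{R}_+$ if $\mu(\phi^2)\le\beta(r)\mathcal{E}_\mu^{(1)}(\phi)+r\|\phi\|_\infty^2$ for all $r>0$ and every $\phi$ in the domain of $\mathcal{E}_\mu^{(1)}$ with $\mu(\phi)=0$. It is a known result (Wang and Wang, 2015) that $\pi_\nu$ satisfies the former for $\nu\ge1$ and the latter, with parameter function of the stated form, for $\nu\in(0,1)$. *)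

theory Defs
  imports "HOL-Probability.Probability"
begin

text \<open>
  The constants hidden in the asymptotic notation have to be uniform in the dimension, so $d$ must
  be quantified inside the statement. Points of $\mathbb{R}^d$ are therefore extensional functions
  on \<open>{..<d}\<close>; the Euclidean norm of \<open>x\<close> is \<open>L2_set x {..<d}\<close>.
\<close>

definition Rd :: "nat \<Rightarrow> (nat \<Rightarrow> real) measure" where
  "Rd d = (\<Pi>\<^sub>M i\<in>{..<d}. lborel)"

definition dist_Rd :: "nat \<Rightarrow> (nat \<Rightarrow> real) \<Rightarrow> (nat \<Rightarrow> real) \<Rightarrow> real" where
  "dist_Rd d x y = L2_set (\<lambda>i. x i - y i) {..<d}"

definition std_gaussian :: "nat \<Rightarrow> (nat \<Rightarrow> real) measure" where
  "std_gaussian d = (\<Pi>\<^sub>M i\<in>{..<d}. std_normal_distribution)"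

definition normalized :: "nat \<Rightarrow> ((nat \<Rightarrow> real) \<Rightarrow> real) \<Rightarrow> (nat \<Rightarrow> real) \<Rightarrow> real" where
  "normalized d f x = f x / (LINT z|Rd d. f z)"

definition minimizer :: "nat \<Rightarrow> ((nat \<Rightarrow> real) \<Rightarrow> real) \<Rightarrow> (nat \<Rightarrow> real) \<Rightarrow> bool" where
  "minimizer d V xm \<longleftrightarrow> xm \<in> space (Rd d) \<and> (\<forall>x\<in>space (Rd d). V xm \<le> V x)"

section \<open>The Cauchy target\<close>

definition cauchy_potential :: "nat \<Rightarrow> real \<Rightarrow> (nat \<Rightarrow> real) \<Rightarrow> real" where
  "cauchy_potential d \<nu> x = (real d + \<nu>) / 2 * ln (1 + (L2_set x {..<d})\<^sup>2)"

definition cauchy_target :: "nat \<Rightarrow> real \<Rightarrow> (nat \<Rightarrow> real) \<Rightarrow> real" where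
  "cauchy_target d \<nu> = normalized d (\<lambda>x. exp (- cauchy_potential d \<nu> x))"

section \<open>The chi-square divergence of a law from a probability density\<close>

text \<open>
  The law \<open>M\<close> is given as a measure; its Lebesgue density is recovered by \<open>RN_deriv\<close>. A law
  without a Lebesgue density is at infinite divergence (densities \<open>p\<close> are positive here).
\<close>

definition chi_square_div ::
    "nat \<Rightarrow> (nat \<Rightarrow> real) measure \<Rightarrow> ((nat \<Rightarrow> real) \<Rightarrow> real) \<Rightarrow> ennreal" where
  "chi_square_div d M p =
    (if sets M = sets (Rd d) \<and> absolutely_continuous (Rd d) M
     then \<integral>\<^sup>+ x. ennreal ((enn2real (RN_deriv (Rd d) M x) / p x - 1)\<^sup>2 * p x) \<partial>Rd d
     else \<infinity>)"

section \<open>The stable proximal sampler with parameter one\<close>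

definition stable_density :: "nat \<Rightarrow> real \<Rightarrow> (nat \<Rightarrow> real) \<Rightarrow> real" where
  "stable_density d \<eta> =
    normalized d (\<lambda>z. ((L2_set z {..<d})\<^sup>2 + \<eta>\<^sup>2) powr (- (real d + 1) / 2))"

definition stable_step :: "nat \<Rightarrow> real \<Rightarrow> (nat \<Rightarrow> real) \<Rightarrow> (nat \<Rightarrow> real) measure" where
  "stable_step d \<eta> x =
    density (Rd d) (\<lambda>y. ennreal (stable_density d \<eta> (\<lambda>i\<in>{..<d}. y i - x i)))"

text \<open>
  The rejection sampler is driven by an i.i.d. sequence of trials \<open>(Z\<^sub>1, Z\<^sub>2, u)\<close> and returns
  the proposal of the first accepted trial. The event that no trial is accepted is null, so the
  value that \<open>LEAST\<close> takes there is irrelevant.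
\<close>

type_synonym trial = "(nat \<Rightarrow> real) \<times> real \<times> real"

definition trial_law :: "nat \<Rightarrow> trial measure" where
  "trial_law d =
    std_gaussian d \<Otimes>\<^sub>M (std_normal_distribution \<Otimes>\<^sub>M uniform_measure lborel {0..1})"

definition proposal :: "nat \<Rightarrow> real \<Rightarrow> (nat \<Rightarrow> real) \<Rightarrow> trial \<Rightarrow> (nat \<Rightarrow> real)" where
  "proposal d \<eta> y = (\<lambda>(z1, z2, u). \<lambda>i\<in>{..<d}. y i + \<eta> * z1 i / \<bar>z2\<bar>)"

definition accepted ::
    "nat \<Rightarrow> ((nat \<Rightarrow> real) \<Rightarrow> real) \<Rightarrow> (nat \<Rightarrow> real) \<Rightarrow> real \<Rightarrow> (nat \<Rightarrow> real) \<Rightarrow> trial \<Rightarrow> bool" where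
  "accepted d V xm \<eta> y t \<longleftrightarrow> snd (snd t) \<le> exp (- V (proposal d \<eta> y t) + V xm)"

definition rejection_law ::
    "nat \<Rightarrow> ((nat \<Rightarrow> real) \<Rightarrow> real) \<Rightarrow> (nat \<Rightarrow> real) \<Rightarrow> real \<Rightarrow> (nat \<Rightarrow> real) \<Rightarrow> (nat \<Rightarrow> real) measure"
  where
  "rejection_law d V xm \<eta> y =
    distr (\<Pi>\<^sub>M j\<in>(UNIV :: nat set). trial_law d) (Rd d)
      (\<lambda>\<omega>. proposal d \<eta> y (\<omega> (LEAST j. accepted d V xm \<eta> y (\<omega> j))))"

text \<open>The law of $x_k$, for a potential \<open>V\<close> with minimizer \<open>xm\<close> and initial law \<open>\<mu>0\<close>.\<close>

primrec proximal_law ::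
    "nat \<Rightarrow> ((nat \<Rightarrow> real) \<Rightarrow> real) \<Rightarrow> (nat \<Rightarrow> real) \<Rightarrow> real \<Rightarrow> (nat \<Rightarrow> real) measure
      \<Rightarrow> nat \<Rightarrow> (nat \<Rightarrow> real) measure" where
  "proximal_law d V xm \<eta> \<mu>0 0 = \<mu>0"
| "proximal_law d V xm \<eta> \<mu>0 (Suc k) =
    proximal_law d V xm \<eta> \<mu>0 k \<bind> (\<lambda>x. stable_step d \<eta> x \<bind> rejection_law d V xm \<eta>)"

text \<open>
  The number of iterations $k$ of the proximal sampler, each of them one step (i) followed by one
  complete oracle call (ii), after which $x_k$ is \<open>\<epsilon>\<close>-close to the target; it is \<open>\<infinity>\<close> if there is
  no such $k$. Being \<open>\<epsilon>\<close>-close is a property of the law of $x_k$, so this number is not random and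
  coincides with its expectation. The trials inside an oracle call are not counted: the acceptance
  probability given $y$ is proportional to the density at $y$ of $\pi_\nu$ convolved with the
  1-stable density, and its reciprocal has infinite expectation already for $y = y_0$.
\<close>

definition iterations_required :: "nat \<Rightarrow> real \<Rightarrow> real \<Rightarrow> (nat \<Rightarrow> real) \<Rightarrow> real \<Rightarrow> ennreal" where
  "iterations_required d \<nu> \<eta> xm \<epsilon> =
    (INF k \<in> {k. chi_square_div d
                   (proximal_law d (cauchy_potential d \<nu>) xm \<eta> (std_gaussian d) k)
                   (cauchy_target d \<nu>) \<le> ennreal \<epsilon>}. of_nat k)"

section \<open>Fractional Poincare inequalities\<close>

definition c_frac :: "nat \<Rightarrow> real" where
  "c_frac d = 2 * Gamma ((real d + 1) / 2) / (pi powr (real d / 2) * \<bar>Gamma (- 1 / 2)\<bar>)"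

definition density_law :: "nat \<Rightarrow> ((nat \<Rightarrow> real) \<Rightarrow> real) \<Rightarrow> (nat \<Rightarrow> real) measure" where
  "density_law d p = density (Rd d) (\<lambda>x. ennreal (p x))"

definition dirichlet_form ::
    "nat \<Rightarrow> ((nat \<Rightarrow> real) \<Rightarrow> real) \<Rightarrow> ((nat \<Rightarrow> real) \<Rightarrow> real) \<Rightarrow> ennreal" where
  "dirichlet_form d p \<phi> =
    ennreal (c_frac d) *
      (\<integral>\<^sup>+ y. (\<integral>\<^sup>+ x. ennreal (if x = y then 0 else (\<phi> x - \<phi> y)\<^sup>2 / dist_Rd d x y ^ (d + 1))
         \<partial>Rd d) \<partial>density_law d p)"

definition dirichlet_domain ::
    "nat \<Rightarrow> ((nat \<Rightarrow> real) \<Rightarrow> real) \<Rightarrow> ((nat \<Rightarrow> real) \<Rightarrow> real) set" where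
  "dirichlet_domain d p =
    {\<phi> \<in> borel_measurable (Rd d).
       integrable (density_law d p) (\<lambda>x. (\<phi> x)\<^sup>2) \<and> dirichlet_form d p \<phi> < \<infinity>}"

definition satisfies_FPI :: "nat \<Rightarrow> ((nat \<Rightarrow> real) \<Rightarrow> real) \<Rightarrow> real \<Rightarrow> bool" where
  "satisfies_FPI d p C \<longleftrightarrow>
    C > 0 \<and>
    (\<forall>\<phi>\<in>dirichlet_domain d p.
       (\<integral>\<^sup>+ x. ennreal ((\<phi> x - (LINT z|density_law d p. \<phi> z))\<^sup>2) \<partial>density_law d p)
         \<le> ennreal C * dirichlet_form d p \<phi>)"

text \<open>
  The sup norm is the essential supremum in \<open>ennreal\<close>, so that the inequality is trivially true for
  unbounded \<open>\<phi>\<close>.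
\<close>

definition satisfies_weak_FPI ::
    "nat \<Rightarrow> ((nat \<Rightarrow> real) \<Rightarrow> real) \<Rightarrow> (real \<Rightarrow> real) \<Rightarrow> bool" where
  "satisfies_weak_FPI d p \<beta> \<longleftrightarrow>
    (\<forall>r>0. \<beta> r \<ge> 0) \<and> antimono_on {0<..} \<beta> \<and>
    (\<forall>r>0. \<forall>\<phi>\<in>dirichlet_domain d p. (LINT z|density_law d p. \<phi> z) = 0 \<longrightarrow>
       (\<integral>\<^sup>+ x. ennreal ((\<phi> x)\<^sup>2) \<partial>density_law d p)
         \<le> ennreal (\<beta> r) * dirichlet_form d p \<phi>
            + ennreal r * (esssup (density_law d p) (\<lambda>x. ennreal \<bar>\<phi> x\<bar>))\<^sup>2)"

end

theory Submission
  imports Defs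
begin

text \<open>
  Put \<open>f\<^sub>k\<close> for the density of the law of \<open>x\<^sub>k\<close> relative to the target \<open>\<pi>\<close>. One iteration maps
  \<open>f\<^sub>k\<close> to \<open>P (G f\<^sub>k)\<close>, where \<open>P\<close> is the Cauchy semigroup at time \<open>\<eta>\<close> and \<open>G\<close> its adjoint in
  $L^2(\pi)$. Splitting the time \<open>\<eta>\<close> into short pieces shows that one iteration decreases the
  chi-square divergence by at least \<open>\<eta>\<close> times the Dirichlet form of \<open>f\<^sub>k\<^sub>+\<^sub>1\<close>. The semigroup
  property is read off from the representation of the Cauchy vector as a Gaussian vector divided by
  the modulus of an independent normal variable. As the starting density is at most a constant times
  \<open>\<surd>d\<close>, the fractional Poincare inequality gives (1).

  For (2), the weak inequality with the sup norm \<open>\<surd>d\<close> would lose powers of \<open>d\<close>. The iterates are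
  radial, and a radial \<open>f\<close> satisfies a Poincare inequality with explicit constant $B^{1-\nu}$ up to
  a tail term, the second moment of \<open>f\<close> over the region beyond \<open>B \<surd>d\<close>. There \<open>f\<^sub>k\<close> is bounded by an
  absolute constant up to an error of small mean: a far point returns to the origin by a single jump,
  whose landing distribution is comparable to \<open>\<pi>\<close> because the Cauchy density is nearly constant on
  the ball of radius \<open>|y| / (8 d)\<close> around \<open>y\<close>, and by stationarity the other moves at that scale are
  rare. With $B^\nu$ of order $\max(d^{1/2 + 4/\nu}, 1/\varepsilon)$, up to a logarithm, the tail is below
  \<open>\<epsilon>\<close>. The constant \<open>c\<close> enters only through the lower bound given by the test function
  $\min(1, |x| / \sqrt d)$.
\<close>

section \<open>Gaussian vectors\<close>

text \<open>The semigroup acts last in an iteration, so the energy lost is that of the new density,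
  the very function to which a Poincare inequality is then applied. Each step therefore contracts
  the divergence by \<open>1 / (1 + \<eta> / C)\<close>, as in an implicit Euler scheme, whatever
  the size of \<eta>. The powers of d in both rates are then little more than the inverse step size.
  Polar coordinates are avoided: the Cauchy density and the jump kernel
  \<open>1 / nrm d z ^ (d + 1)\<close> are both mixtures of the Gaussians G / n over a scale n, with
  half-normal and with constant weight. Constants depending on d then come out of Gaussian moments.
  Since the bounds have a product form uniform in d, additive terms such as rounding or ln K have to
  be absorbed into them. This is why the Poincare constants need lower bounds that do not depend on
  d. In (2) jumps accumulate, so the bound far from the origin deteriorates linearly with the number
  of steps. The iteration count thus enters its own error budget, and the budget closes only because
  the step size is a high negative power of d.\<close>

abbreviation nrm :: "nat \<Rightarrow> (nat \<Rightarrow> real) \<Rightarrow> real" where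
  "nrm d x \<equiv> L2_set x {..<d}"

definition vadd :: "nat \<Rightarrow> (nat \<Rightarrow> real) \<Rightarrow> (nat \<Rightarrow> real) \<Rightarrow> nat \<Rightarrow> real" where
  "vadd d x y = (\<lambda>i\<in>{..<d}. x i + y i)"

definition vsub :: "nat \<Rightarrow> (nat \<Rightarrow> real) \<Rightarrow> (nat \<Rightarrow> real) \<Rightarrow> nat \<Rightarrow> real" where
  "vsub d x y = (\<lambda>i\<in>{..<d}. x i - y i)"

definition vscale :: "nat \<Rightarrow> real \<Rightarrow> (nat \<Rightarrow> real) \<Rightarrow> nat \<Rightarrow> real" where
  "vscale d a x = (\<lambda>i\<in>{..<d}. a * x i)"

definition dotp :: "nat \<Rightarrow> (nat \<Rightarrow> real) \<Rightarrow> (nat \<Rightarrow> real) \<Rightarrow> real" where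
  "dotp d x y = (\<Sum>i<d. x i * y i)"

lemma vadd_apply [simp]: "i < d \<Longrightarrow> vadd d x y i = x i + y i"
  and vsub_apply [simp]: "i < d \<Longrightarrow> vsub d x y i = x i - y i"
  and vscale_apply [simp]: "i < d \<Longrightarrow> vscale d a x i = a * x i"
  by (auto simp: vadd_def vsub_def vscale_def)

lemma space_Rd: "space (Rd d) = extensional {..<d}"
  by (auto simp: Rd_def space_PiM PiE_def)

lemma vadd_in_space [simp]: "vadd d x y \<in> space (Rd d)"
  and vsub_in_space [simp]: "vsub d x y \<in> space (Rd d)"
  and vscale_in_space [simp]: "vscale d a x \<in> space (Rd d)"
  by (auto simp: space_Rd vadd_def vsub_def vscale_def)

lemma Rd_eqI: "x \<in> space (Rd d) \<Longrightarrow> y \<in> space (Rd d) \<Longrightarrow> (\<And>i. i < d \<Longrightarrow> x i = y i) \<Longrightarrow> x = y"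
  by (auto simp: space_Rd intro: extensionalityI)

lemma vadd_vsub_cancel [simp]: "x \<in> space (Rd d) \<Longrightarrow> vadd d y (vsub d x y) = x"
  by (rule Rd_eqI) auto

lemma vsub_vadd_cancel [simp]: "x \<in> space (Rd d) \<Longrightarrow> vsub d (vadd d y x) y = x"
  by (rule Rd_eqI) auto

lemma vadd_commute: "vadd d x y = vadd d y x"
  by (auto simp: vadd_def)

lemma nrm_cong: "(\<And>i. i < d \<Longrightarrow> x i = y i) \<Longrightarrow> nrm d x = nrm d y"
  by (rule L2_set_cong) auto

lemma nrm_sq: "(nrm d x)\<^sup>2 = (\<Sum>i<d. (x i)\<^sup>2)"
  by (simp add: L2_set_def sum_nonneg)

lemma nrm_vadd_sq: "(nrm d (vadd d x y))\<^sup>2 = (nrm d x)\<^sup>2 + 2 * dotp d x y + (nrm d y)\<^sup>2"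
proof -
  have "(nrm d (vadd d x y))\<^sup>2 = (\<Sum>i<d. (x i + y i)\<^sup>2)"
    by (simp add: nrm_sq)
  also have "\<dots> = (\<Sum>i<d. (x i)\<^sup>2 + 2 * (x i * y i) + (y i)\<^sup>2)"
    by (intro sum.cong) (auto simp: power2_eq_square algebra_simps)
  finally show ?thesis
    by (simp add: nrm_sq dotp_def sum.distrib sum_distrib_left)
qed

lemma nrm_vscale [simp]: "nrm d (vscale d a x) = \<bar>a\<bar> * nrm d x"
proof -
  have "(nrm d (vscale d a x))\<^sup>2 = (\<bar>a\<bar> * nrm d x)\<^sup>2"
    by (simp add: nrm_sq power_mult_distrib sum_distrib_left)
  then show ?thesis by (simp add: power2_eq_iff_nonneg)
qed

lemma dotp_vscale [simp]: "dotp d x (vscale d a y) = a * dotp d x y"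
  by (simp add: dotp_def sum_distrib_left algebra_simps)

lemma nrm_triangle: "nrm d (vadd d x y) \<le> nrm d x + nrm d y"
proof -
  have "nrm d (vadd d x y) = nrm d (\<lambda>i. x i + y i)" by (rule nrm_cong) simp
  then show ?thesis using L2_set_triangle_ineq[of x y "{..<d}"] by simp
qed

lemma nrm_triangle_lower: "nrm d x - nrm d y \<le> nrm d (vadd d x y)"
proof -
  have "nrm d x = nrm d (vadd d (vadd d x y) (vscale d (-1) y))" by (rule nrm_cong) simp
  also have "\<dots> \<le> nrm d (vadd d x y) + nrm d y" using nrm_triangle[of d _ "vscale d (-1) y"] by simp
  finally show ?thesis by simp
qed

lemma nrm_vsub_commute: "nrm d (vsub d x y) = nrm d (vsub d y x)"
proof -
  have "nrm d (vsub d x y) = nrm d (vscale d (-1) (vsub d y x))" by (rule nrm_cong) simp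
  then show ?thesis by simp
qed

section \<open>Measurability and product measures on d-dimensional space\<close>

lemma Rd_component:
  "f \<in> measurable M (Rd d) \<Longrightarrow> i \<in> {..<d} \<Longrightarrow> (\<lambda>x. f x i) \<in> borel_measurable M"
  unfolding Rd_def
  by (rule measurable_compose[of f M "PiM {..<d} (\<lambda>_. lborel)" "\<lambda>x. x i"])
    (auto intro: measurable_component_singleton[of i "{..<d}" "\<lambda>_. lborel", simplified])

lemma measurable_Rd_restrict [measurable (raw)]:
  assumes "\<And>i. i < d \<Longrightarrow> (\<lambda>x. f x i) \<in> borel_measurable M"
  shows "(\<lambda>x. \<lambda>i\<in>{..<d}. f x i) \<in> measurable M (Rd d)"
  unfolding Rd_def using assms by (intro measurable_restrict) auto

lemma measurable_vadd [measurable (raw)]: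
  assumes [measurable]: "f \<in> measurable M (Rd d)" "g \<in> measurable M (Rd d)"
  shows "(\<lambda>x. vadd d (f x) (g x)) \<in> measurable M (Rd d)"
  unfolding vadd_def by (intro measurable_Rd_restrict borel_measurable_add Rd_component assms) auto

lemma measurable_vsub [measurable (raw)]:
  assumes [measurable]: "f \<in> measurable M (Rd d)" "g \<in> measurable M (Rd d)"
  shows "(\<lambda>x. vsub d (f x) (g x)) \<in> measurable M (Rd d)"
  unfolding vsub_def by (intro measurable_Rd_restrict borel_measurable_diff Rd_component assms) auto

lemma measurable_vscale [measurable (raw)]:
  assumes [measurable]: "f \<in> borel_measurable M" "g \<in> measurable M (Rd d)"
  shows "(\<lambda>x. vscale d (f x) (g x)) \<in> measurable M (Rd d)"
  unfolding vscale_def by (intro measurable_Rd_restrict borel_measurable_times Rd_component assms) auto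

lemma measurable_nrm [measurable (raw)]:
  assumes [measurable]: "f \<in> measurable M (Rd d)"
  shows "(\<lambda>x. nrm d (f x)) \<in> borel_measurable M"
proof -
  have "(\<lambda>x. f x i) \<in> borel_measurable M" if "i < d" for i using Rd_component[OF assms] that by simp
  then show ?thesis
    unfolding L2_set_def by (intro measurable_compose[OF _ borel_measurable_sqrt] borel_measurable_sum borel_measurable_power) auto
qed

lemma product_sigma_finite_lborel: "product_sigma_finite (\<lambda>_::nat. lborel :: real measure)"
  by standard

lemma sigma_finite_Rd: "sigma_finite_measure (Rd d)"
  unfolding Rd_def by (rule product_sigma_finite.sigma_finite[OF product_sigma_finite_lborel]) simp

lemma prob_space_std_gaussian: "prob_space (std_gaussian d)"
  unfolding std_gaussian_def
  by (intro prob_space_PiM) (simp add: prob_space_normal_density)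

lemma sets_std_gaussian [measurable_cong, simp]: "sets (std_gaussian d) = sets (Rd d)"
  unfolding std_gaussian_def Rd_def by (rule sets_PiM_cong) auto

lemma space_std_gaussian [simp]: "space (std_gaussian d) = space (Rd d)"
  by (rule sets_eq_imp_space_eq) simp

text \<open>Rectangles determine a finite product measure, and the preimage of a rectangle under a
  coordinatewise map is again one. Translation and reflection of Lebesgue measure and affine images
  of Gaussian vectors are the instances below.\<close>

lemma distr_PiM_coordinatewise:
  assumes fin: "finite I" and M: "product_sigma_finite M" and N: "product_sigma_finite N"
    and f: "\<And>i. i \<in> I \<Longrightarrow> f i \<in> measurable (M i) (N i)"
    and eq: "\<And>i. i \<in> I \<Longrightarrow> distr (M i) (N i) (f i) = N i"
  shows "distr (PiM I M) (PiM I N) (\<lambda>x. \<lambda>i\<in>I. f i (x i)) = PiM I N"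
proof (rule product_sigma_finite.PiM_eqI[OF N fin])
  interpret M: product_sigma_finite M by fact
  have m: "(\<lambda>x. \<lambda>i\<in>I. f i (x i)) \<in> measurable (PiM I M) (PiM I N)"
    using f by (intro measurable_restrict measurable_compose[OF measurable_component_singleton]) auto
  fix A assume A: "\<And>i. i \<in> I \<Longrightarrow> A i \<in> sets (N i)"
  have "(\<lambda>x. \<lambda>i\<in>I. f i (x i)) -` Pi\<^sub>E I A \<inter> space (PiM I M) = Pi\<^sub>E I (\<lambda>i. f i -` A i \<inter> space (M i))"
    by (auto simp: space_PiM PiE_iff)
  moreover have "f i -` A i \<inter> space (M i) \<in> sets (M i)" if "i \<in> I" for i
    using measurable_sets[OF f[OF that] A[OF that]] .
  moreover have "emeasure (M i) (f i -` A i \<inter> space (M i)) = emeasure (N i) (A i)" if "i \<in> I" for i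
    by (subst eq[OF that, symmetric]) (simp add: emeasure_distr f A that)
  ultimately show "emeasure (distr (PiM I M) (PiM I N) (\<lambda>x. \<lambda>i\<in>I. f i (x i))) (Pi\<^sub>E I A) =
      (\<Prod>i\<in>I. emeasure (N i) (A i))"
    using fin A by (subst emeasure_distr[OF m])
      (auto intro!: sets_PiM_I_finite prod.cong simp: M.emeasure_PiM)
qed auto

text \<open>Checked on rectangles, where the indicator factorises together with the density. It
  gives a product of one-dimensional normal laws a Lebesgue density.\<close>

lemma PiM_density_lborel:
  assumes fin: "finite I" and g: "\<And>i. g i \<in> borel_measurable borel"
    and sf: "\<And>i. sigma_finite_measure (density lborel (g i))"
  shows "PiM I (\<lambda>i. density lborel (g i)) = density (PiM I (\<lambda>_::nat. lborel::real measure)) (\<lambda>x. \<Prod>i\<in>I. g i (x i))"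
proof (rule product_sigma_finite.PiM_eqI[symmetric, OF _ fin])
  show "product_sigma_finite (\<lambda>i. density lborel (g i))" using sf by unfold_locales (auto simp: sigma_finite_measure_def)
  interpret L: product_sigma_finite "\<lambda>_::nat. lborel :: real measure" by (rule product_sigma_finite_lborel)
  note g [measurable]
  have m[measurable]: "(\<lambda>x. \<Prod>i\<in>I. g i (x i)) \<in> borel_measurable (PiM I (\<lambda>_::nat. lborel::real measure))"
    by (intro borel_measurable_prod_ennreal measurable_compose[OF measurable_component_singleton]) auto
  show "sets (density (PiM I (\<lambda>_. lborel)) (\<lambda>x. \<Prod>i\<in>I. g i (x i))) = sets (PiM I (\<lambda>i. density lborel (g i)))"
    by (simp cong: sets_PiM_cong)
  fix A assume "\<And>i. i \<in> I \<Longrightarrow> A i \<in> sets (density lborel (g i))"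
  then have A: "\<And>i. i \<in> I \<Longrightarrow> A i \<in> sets lborel" by simp
  have PA: "Pi\<^sub>E I A \<in> sets (PiM I (\<lambda>_. lborel))" using A fin by (intro sets_PiM_I_finite) auto
  have "emeasure (density (PiM I (\<lambda>_. lborel)) (\<lambda>x. \<Prod>i\<in>I. g i (x i))) (Pi\<^sub>E I A) =
     (\<integral>\<^sup>+x. (\<Prod>i\<in>I. g i (x i)) * indicator (Pi\<^sub>E I A) x \<partial>PiM I (\<lambda>_. lborel))"
    by (rule emeasure_density[OF m PA])
  also have "\<dots> = (\<integral>\<^sup>+x. (\<Prod>i\<in>I. g i (x i) * indicator (A i) (x i)) \<partial>PiM I (\<lambda>_. lborel))"
  proof (intro nn_integral_cong)
    fix x :: "nat \<Rightarrow> real" assume x: "x \<in> space (PiM I (\<lambda>_. lborel))"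
    have "indicator (Pi\<^sub>E I A) x = (\<Prod>i\<in>I. indicator (A i) (x i) :: ennreal)"
    proof (cases "\<forall>i\<in>I. x i \<in> A i")
      case True then show ?thesis using x by (auto simp: space_PiM PiE_iff)
    next
      case False
      then obtain i where "i \<in> I" "x i \<notin> A i" by auto
      then have "(\<Prod>i\<in>I. indicator (A i) (x i) :: ennreal) = 0" "x \<notin> Pi\<^sub>E I A"
        using fin by (auto simp: PiE_iff intro!: prod_zero bexI[of _ i])
      then show ?thesis by simp
    qed
    then show "(\<Prod>i\<in>I. g i (x i)) * indicator (Pi\<^sub>E I A) x = (\<Prod>i\<in>I. g i (x i) * indicator (A i) (x i))"
      by (simp add: prod.distrib)
  qed
  also have "\<dots> = (\<Prod>i\<in>I. \<integral>\<^sup>+t. g i t * indicator (A i) t \<partial>lborel)"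
    using A by (intro L.product_nn_integral_prod[OF fin]) auto
  also have "\<dots> = (\<Prod>i\<in>I. emeasure (density lborel (g i)) (A i))"
    using A by (intro prod.cong) (auto simp: emeasure_density)
  finally show "emeasure (density (PiM I (\<lambda>_. lborel)) (\<lambda>x. \<Prod>i\<in>I. g i (x i))) (Pi\<^sub>E I A) = \<dots>" .
qed

lemma distr_Rd_vadd: "distr (Rd d) (Rd d) (vadd d y) = Rd d"
proof -
  have "distr lborel lborel (\<lambda>t. y i + t) = (lborel :: real measure)" for i
    using lborel_distr_plus[of "y i"] by (simp cong: distr_cong)
  then show ?thesis
    unfolding Rd_def vadd_def
    by (intro distr_PiM_coordinatewise product_sigma_finite_lborel) auto
qed

lemma distr_Rd_neg: "distr (Rd d) (Rd d) (vscale d (-1)) = Rd d"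
proof -
  have "distr lborel lborel (\<lambda>t. -1 * t) = (lborel :: real measure)"
    using lborel_distr_uminus by (simp cong: distr_cong)
  then show ?thesis
    unfolding Rd_def vscale_def
    by (intro distr_PiM_coordinatewise product_sigma_finite_lborel) auto
qed

lemma nn_integral_Rd_vadd:
  assumes [measurable]: "\<psi> \<in> borel_measurable (Rd d)"
  shows "(\<integral>\<^sup>+z. \<psi> (vadd d y z) \<partial>Rd d) = (\<integral>\<^sup>+z. \<psi> z \<partial>Rd d)"
proof (cases "y \<in> space (Rd d)")
  case True
  then have [measurable]: "vadd d y \<in> measurable (Rd d) (Rd d)" by measurable
  show ?thesis by (subst (2) distr_Rd_vadd[symmetric, of _ y]) (simp add: nn_integral_distr)
next
  case False
  \<comment> \<open>\<open>vadd d y\<close> reads only the coordinates of \<open>y\<close> below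
    \<open>d\<close>, so a vector outside the space may be replaced by its restriction.\<close>
  define y' where "y' = vadd d y (\<lambda>_. 0)"
  have [measurable]: "vadd d y' \<in> measurable (Rd d) (Rd d)" by (simp add: y'_def)
  have *: "vadd d y = vadd d y'" by (auto simp: y'_def vadd_def fun_eq_iff)
  show ?thesis unfolding * by (subst (2) distr_Rd_vadd[symmetric, of _ y']) (simp add: nn_integral_distr)
qed

lemma nn_integral_Rd_neg:
  assumes [measurable]: "\<psi> \<in> borel_measurable (Rd d)"
  shows "(\<integral>\<^sup>+z. \<psi> (vscale d (-1) z) \<partial>Rd d) = (\<integral>\<^sup>+z. \<psi> z \<partial>Rd d)"
  by (subst (2) distr_Rd_neg[symmetric]) (simp add: nn_integral_distr)

section \<open>Centred isotropic Gaussian densities\<close>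

definition gden :: "nat \<Rightarrow> real \<Rightarrow> (nat \<Rightarrow> real) \<Rightarrow> real" where
  "gden d a z = (1 / (sqrt (2 * pi) * a)) ^ d * exp (- (nrm d z)\<^sup>2 / (2 * a\<^sup>2))"

lemma gden_nonneg [simp]: "a > 0 \<Longrightarrow> 0 \<le> gden d a z"
  by (simp add: gden_def)

lemma gden_eq_prod: "a > 0 \<Longrightarrow> gden d a (\<lambda>i. x i - y i) = (\<Prod>i<d. normal_density (y i) a (x i))"
proof -
  assume a: "a > 0"
  have "(\<Prod>i<d. normal_density (y i) a (x i)) =
     (\<Prod>i<d. (1 / (sqrt (2 * pi) * a)) * exp (- (x i - y i)\<^sup>2 / (2 * a\<^sup>2)))"
    using a by (intro prod.cong) (auto simp: normal_density_def real_sqrt_mult)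
  also have "\<dots> = (1 / (sqrt (2 * pi) * a)) ^ d * exp (\<Sum>i<d. - (x i - y i)\<^sup>2 / (2 * a\<^sup>2))"
    by (simp only: prod.distrib exp_sum finite_lessThan prod_constant card_lessThan)
  also have "(\<Sum>i<d. - (x i - y i)\<^sup>2 / (2 * a\<^sup>2)) = - (nrm d (\<lambda>i. x i - y i))\<^sup>2 / (2 * a\<^sup>2)"
    by (simp add: nrm_sq sum_negf sum_divide_distrib)
  finally show ?thesis by (simp add: gden_def)
qed

lemma measurable_gden [measurable (raw)]:
  assumes [measurable]: "f \<in> borel_measurable M" "g \<in> measurable M (Rd d)"
  shows "(\<lambda>x. gden d (f x) (g x)) \<in> borel_measurable M"
  unfolding gden_def by measurable

lemma distr_std_normal_affine:
  assumes "a > 0"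
  shows "distr std_normal_distribution borel (\<lambda>t. y + a * t) = density lborel (normal_density y a)"
proof -
  interpret prob_space std_normal_distribution by (rule prob_space_normal_density) simp
  have "distributed std_normal_distribution lborel (\<lambda>t. t) (normal_density 0 1)"
    using distr_id[of std_normal_distribution] by (auto simp: distributed_def id_def cong: distr_cong)
  from normal_density_affine[OF this, of a y] assms
  have "distributed std_normal_distribution lborel (\<lambda>t. y + a * t) (normal_density y a)"
    by simp
  then show ?thesis by (auto simp: distributed_def cong: distr_cong)
qed

lemma distr_std_gaussian_affine:
  assumes a: "a > 0"
  shows "distr (std_gaussian d) (Rd d) (\<lambda>z. \<lambda>i\<in>{..<d}. y i + a * z i) =
    density (Rd d) (\<lambda>x. ennreal (gden d a (\<lambda>i. x i - y i)))"
proof -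
  have sf: "sigma_finite_measure (density lborel (normal_density (y i) a))" for i
    using prob_space_normal_density[OF a] prob_space_imp_sigma_finite by blast
  have psN: "product_sigma_finite (\<lambda>i. density lborel (normal_density (y i) a))"
    using sf by unfold_locales (auto simp: sigma_finite_measure_def)
  have sf1: "sigma_finite_measure std_normal_distribution"
    using prob_space_normal_density[of 1 0] prob_space_imp_sigma_finite by simp
  have psM: "product_sigma_finite (\<lambda>i::nat. std_normal_distribution)"
    using sf1 by unfold_locales (auto simp: sigma_finite_measure_def)
  have "distr (std_gaussian d) (Rd d) (\<lambda>z. \<lambda>i\<in>{..<d}. y i + a * z i) =
     distr (std_gaussian d) (PiM {..<d} (\<lambda>i. density lborel (normal_density (y i) a))) (\<lambda>z. \<lambda>i\<in>{..<d}. y i + a * z i)"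
    by (rule distr_cong) (auto simp: Rd_def intro!: sets_PiM_cong)
  also have "\<dots> = PiM {..<d} (\<lambda>i. density lborel (normal_density (y i) a))"
    unfolding std_gaussian_def
  proof (rule distr_PiM_coordinatewise[OF _ psM psN])
    fix i assume "i \<in> {..<d}"
    have "distr std_normal_distribution (density lborel (normal_density (y i) a)) (\<lambda>t. y i + a * t) =
      distr std_normal_distribution borel (\<lambda>t. y i + a * t)"
      by (rule distr_cong) auto
    then show "distr std_normal_distribution (density lborel (normal_density (y i) a)) (\<lambda>t. y i + a * t) =
      density lborel (normal_density (y i) a)"
      by (simp add: distr_std_normal_affine[OF a])
  qed auto
  also have "\<dots> = density (Rd d) (\<lambda>x. \<Prod>i<d. ennreal (normal_density (y i) a (x i)))"
    unfolding Rd_def using sf by (intro PiM_density_lborel) auto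
  also have "\<dots> = density (Rd d) (\<lambda>x. ennreal (gden d a (\<lambda>i. x i - y i)))"
    by (simp add: gden_eq_prod[OF a] prod_ennreal)
  finally show ?thesis .
qed

lemma gden_vscale: "a > 0 \<Longrightarrow> \<psi> \<in> borel_measurable (Rd d) \<Longrightarrow>
  (\<integral>\<^sup>+z. \<psi> (vscale d a z) \<partial>std_gaussian d) = (\<integral>\<^sup>+z. \<psi> z * ennreal (gden d a z) \<partial>Rd d)"
proof -
  assume a: "a > 0" and [measurable]: "\<psi> \<in> borel_measurable (Rd d)"
  have *: "distr (std_gaussian d) (Rd d) (vscale d a) = density (Rd d) (\<lambda>x. ennreal (gden d a x))"
    using distr_std_gaussian_affine[OF a, of d "\<lambda>_. 0"] by (simp add: vscale_def[abs_def])
  have "(\<integral>\<^sup>+z. \<psi> (vscale d a z) \<partial>std_gaussian d) = (\<integral>\<^sup>+z. \<psi> z \<partial>distr (std_gaussian d) (Rd d) (vscale d a))"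
    by (simp add: nn_integral_distr)
  also have "\<dots> = (\<integral>\<^sup>+z. \<psi> z * ennreal (gden d a z) \<partial>Rd d)"
    unfolding * by (subst nn_integral_density) (auto simp: mult.commute)
  finally show ?thesis .
qed

lemma std_gaussian_eq_density: "std_gaussian d = density (Rd d) (\<lambda>x. ennreal (gden d 1 x))"
proof -
  have "distr (std_gaussian d) (Rd d) (\<lambda>z. \<lambda>i\<in>{..<d}. z i) = distr (std_gaussian d) (std_gaussian d) (\<lambda>x. x)"
    by (rule distr_cong) (auto simp: space_Rd extensional_restrict intro!: extensionalityI)
  then show ?thesis
    using distr_std_gaussian_affine[of 1 d "\<lambda>_. 0"] by (simp add: distr_id)
qed

section \<open>Student densities as Gaussian mixtures\<close>

text \<open>Monotone convergence from the rule on compact intervals. The image of the half-line is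
  written as a union of intervals because it can be bounded without containing its supremum, as
  happens in \<open>nn_integral_jump_lower_bound\<close>.\<close>

lemma nn_integral_substitution_Ici:
  fixes f :: "real \<Rightarrow> ennreal" and g g' :: "real \<Rightarrow> real"
  assumes f [measurable]: "f \<in> borel_measurable borel"
    and deriv: "\<And>x. x \<ge> 0 \<Longrightarrow> (g has_real_derivative g' x) (at x)"
    and cont: "\<And>b. continuous_on {0..b} g'"
    and nonneg: "\<And>x. x \<ge> 0 \<Longrightarrow> g' x \<ge> 0"
    and [measurable]: "g \<in> borel_measurable borel" "g' \<in> borel_measurable borel"
  shows "(\<integral>\<^sup>+x. f x * indicator (\<Union>k. {g 0..g (real (Suc k))}) x \<partial>lborel) =
    (\<integral>\<^sup>+x. f (g x) * ennreal (g' x) * indicator {0..} x \<partial>lborel)"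
proof -
  have mono: "g x \<le> g y" if "0 \<le> x" "x \<le> y" for x y
  proof (rule DERIV_nonneg_imp_nondecreasing[OF that(2)])
    fix u assume "x \<le> u" "u \<le> y"
    then have "u \<ge> 0" using that by simp
    then show "\<exists>D. (g has_real_derivative D) (at u) \<and> 0 \<le> D" using deriv nonneg by blast
  qed
  have "(\<integral>\<^sup>+x. f x * indicator (\<Union>k. {g 0..g (real (Suc k))}) x \<partial>lborel) =
      emeasure (density lborel f) (\<Union>k. {g 0..g (real (Suc k))})"
    by (subst emeasure_density) auto
  also have "\<dots> = (SUP k. emeasure (density lborel f) {g 0..g (real (Suc k))})"
  proof (rule SUP_emeasure_incseq[symmetric])
    show "incseq (\<lambda>k. {g 0..g (real (Suc k))})"
    proof (rule incseq_SucI)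
      fix k show "{g 0..g (real (Suc k))} \<subseteq> {g 0..g (real (Suc (Suc k)))}"
        using mono[of "real (Suc k)" "real (Suc (Suc k))"] by auto
    qed
  qed auto
  also have "\<dots> = (SUP k. \<integral>\<^sup>+x. f (g x) * ennreal (g' x) * indicator {0..real (Suc k)} x \<partial>lborel)"
  proof (intro SUP_cong refl)
    fix k
    have "emeasure (density lborel f) {g 0..g (real (Suc k))} =
        (\<integral>\<^sup>+x. f x * indicator {g 0..g (real (Suc k))} x \<partial>lborel)"
      by (subst emeasure_density) auto
    also have "\<dots> = (\<integral>\<^sup>+x. f (g x) * ennreal (g' x) * indicator {0..real (Suc k)} x \<partial>lborel)"
      using deriv nonneg by (intro nn_integral_substitution_aux f cont) auto
    finally show "emeasure (density lborel f) {g 0..g (real (Suc k))} = \<dots>" .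
  qed
  also have "\<dots> = (SUP k. emeasure (density lborel (\<lambda>x. f (g x) * ennreal (g' x))) {0..real (Suc k)})"
    by (intro SUP_cong refl) (subst emeasure_density, auto)
  also have "\<dots> = emeasure (density lborel (\<lambda>x. f (g x) * ennreal (g' x))) (\<Union>k. {0..real (Suc k)})"
    by (intro SUP_emeasure_incseq) (auto intro!: monoI)
  also have "(\<Union>k. {0..real (Suc k)}) = {0::real..}"
  proof -
    have "\<exists>k. x \<le> real (Suc k)" for x :: real
    proof -
      obtain k where "x \<le> real k" using real_arch_simple by blast
      then show ?thesis by (intro exI[of _ k]) simp
    qed
    then show ?thesis by (intro set_eqI) (simp del: of_nat_Suc)
  qed
  also have "emeasure (density lborel (\<lambda>x. f (g x) * ennreal (g' x))) {0..} =
    (\<integral>\<^sup>+x. f (g x) * ennreal (g' x) * indicator {0..} x \<partial>lborel)"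
    by (subst emeasure_density) auto
  finally show ?thesis .
qed

text \<open>The substitution t = b n^2 / 2 in the Gamma integral. Normalising the chi law and
  evaluating both Gaussian mixtures below all reduce to this integral.\<close>

lemma nn_integral_powr_gauss:
  assumes q: "q > 0" and b: "b > 0"
  shows "(\<integral>\<^sup>+n. ennreal (n powr (q - 1) * exp (- b * n\<^sup>2 / 2)) * indicator {0..} n \<partial>lborel) =
    ennreal (1 / 2 * Gamma (q / 2) * (2 / b) powr (q / 2))"
proof -
  define f where "f t = ennreal (t powr (q / 2 - 1) / exp t)" for t :: real
  define g where "g n = b * n\<^sup>2 / 2" for n :: real
  have [measurable]: "f \<in> borel_measurable borel" by (simp add: f_def[abs_def])
  have "x \<in> (\<Union>k. {g 0..g (real (Suc k))})" if x: "x \<ge> 0" for x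
  proof -
    obtain k where k: "2 * x / b \<le> real k" using real_arch_simple by blast
    have "real k \<le> (real (Suc k))\<^sup>2" by (simp add: power2_eq_square algebra_simps)
    then have "2 * x / b \<le> (real (Suc k))\<^sup>2" using k by linarith
    then have "x \<le> g (real (Suc k))" using b by (simp add: g_def field_simps)
    then show "x \<in> (\<Union>k. {g 0..g (real (Suc k))})" using x by (auto simp: g_def intro!: exI[of _ k])
  qed
  then have U: "(\<Union>k. {g 0..g (real (Suc k))}) = {0..}" by (auto simp: g_def)
  have "ennreal (Gamma (q / 2)) = (\<integral>\<^sup>+t. f t * indicator {0..} t \<partial>lborel)"
    using Gamma_conv_nn_integral_real[of "q / 2"] q
    by (auto simp: f_def intro!: nn_integral_cong split: split_indicator)
  also have "\<dots> = (\<integral>\<^sup>+n. f (g n) * ennreal (b * n) * indicator {0..} n \<partial>lborel)"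
  proof (rule nn_integral_substitution_Ici[of f g "\<lambda>n. b * n", unfolded U])
    show "(g has_real_derivative b * x) (at x)" for x
      unfolding g_def[abs_def] by (auto intro!: derivative_eq_intros)
  qed (use b in \<open>auto simp: g_def[abs_def] intro!: continuous_intros\<close>)
  also have "\<dots> = (\<integral>\<^sup>+n. ennreal (2 * (b / 2) powr (q / 2)) *
      (ennreal (n powr (q - 1) * exp (- b * n\<^sup>2 / 2)) * indicator {0..} n) \<partial>lborel)"
  proof (intro nn_integral_cong_AE)
    have "AE n in lborel. n \<noteq> (0::real)" by (rule AE_lborel_singleton)
    then show "AE n in lborel. f (g n) * ennreal (b * n) * indicator {0..} n = ennreal (2 * (b / 2) powr (q / 2)) *
      (ennreal (n powr (q - 1) * exp (- b * n\<^sup>2 / 2)) * indicator {0..} n)"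
    proof eventually_elim
      case (elim n)
      show ?case
      proof (cases "n > 0")
        case True
        have "g n = (b / 2) * n powr 2" using True by (simp add: g_def powr_numeral)
        then have e1: "(g n) powr (q / 2 - 1) = (b / 2) powr (q / 2 - 1) * n powr (q - 2)"
          using True b by (simp only: powr_mult powr_powr) (simp add: algebra_simps)
        have e2: "(b / 2) powr (q / 2 - 1) * b = 2 * (b / 2) powr (q / 2)"
          using b by (simp add: powr_diff)
        have e3: "n powr (q - 2) * n = n powr (q - 1)"
          using True powr_add[of n "q - 2" 1] by simp
        have e4: "1 / exp (g n) = exp (- b * n\<^sup>2 / 2)" by (simp add: g_def exp_minus inverse_eq_divide)
        have "(g n) powr (q / 2 - 1) / exp (g n) * (b * n) =
            ((b / 2) powr (q / 2 - 1) * b) * (n powr (q - 2) * n) * (1 / exp (g n))"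
          unfolding e1 by simp
        also have "\<dots> = 2 * (b / 2) powr (q / 2) * (n powr (q - 1) * exp (- b * n\<^sup>2 / 2))"
          unfolding e2 e3 e4 by (simp only: mult.assoc)
        finally have "(g n) powr (q / 2 - 1) / exp (g n) * (b * n) = \<dots>" .
        then show ?thesis using True b by (simp add: f_def ennreal_mult'[symmetric] mult.assoc)
      qed (use elim in auto)
    qed
  qed
  also have "\<dots> = ennreal (2 * (b / 2) powr (q / 2)) *
      (\<integral>\<^sup>+n. ennreal (n powr (q - 1) * exp (- b * n\<^sup>2 / 2)) * indicator {0..} n \<partial>lborel)" (is "_ = _ * ?J")
    by (rule nn_integral_cmult) measurable
  finally have eq: "ennreal (Gamma (q / 2)) = ennreal (2 * (b / 2) powr (q / 2)) * ?J" .
  have inv: "(2 / b) powr (q / 2) * (b / 2) powr (q / 2) = 1"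
    using b by (simp add: powr_mult[symmetric])
  have "ennreal (1 / 2 * (2 / b) powr (q / 2)) * ennreal (Gamma (q / 2)) =
     ennreal ((1 / 2 * (2 / b) powr (q / 2)) * (2 * (b / 2) powr (q / 2))) * ?J"
    unfolding eq mult.assoc[symmetric] by (subst ennreal_mult'[symmetric]) simp_all
  also have "(1 / 2 * (2 / b) powr (q / 2)) * (2 * (b / 2) powr (q / 2)) = 1"
    using inv by simp
  finally have "?J = ennreal (1 / 2 * (2 / b) powr (q / 2)) * ennreal (Gamma (q / 2))" by simp
  also have "\<dots> = ennreal (1 / 2 * (2 / b) powr (q / 2) * Gamma (q / 2))"
    by (rule ennreal_mult'[symmetric]) simp
  finally show ?thesis by (simp add: mult_ac)
qed

definition chi_density :: "real \<Rightarrow> real \<Rightarrow> real" where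
  "chi_density \<nu> n = (if n > 0 then 2 powr (1 - \<nu> / 2) / Gamma (\<nu> / 2) * n powr (\<nu> - 1) * exp (- n\<^sup>2 / 2) else 0)"

definition chi_law :: "real \<Rightarrow> real measure" where
  "chi_law \<nu> = density lborel (\<lambda>n. ennreal (chi_density \<nu> n))"

definition student_const :: "nat \<Rightarrow> real \<Rightarrow> real" where
  "student_const d \<nu> = Gamma ((real d + \<nu>) / 2) / (pi powr (real d / 2) * Gamma (\<nu> / 2))"

text \<open>
  The density of \<open>t G / n\<close> for a standard Gaussian vector \<open>G\<close> and an independent \<open>n\<close> with the
  \<open>\<chi>\<^sub>\<nu>\<close> law. The target is the case \<open>t = 1\<close>, the stable density is the case \<open>\<nu> = 1\<close>.
\<close>

definition student :: "nat \<Rightarrow> real \<Rightarrow> real \<Rightarrow> (nat \<Rightarrow> real) \<Rightarrow> real" where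
  "student d \<nu> t z = student_const d \<nu> * t powr \<nu> * ((nrm d z)\<^sup>2 + t\<^sup>2) powr (- (real d + \<nu>) / 2)"

lemma chi_density_nonneg [simp]: "\<nu> > 0 \<Longrightarrow> 0 \<le> chi_density \<nu> n"
  by (simp add: chi_density_def Gamma_real_nonneg)

lemma measurable_chi_density [measurable]: "chi_density \<nu> \<in> borel_measurable borel"
  unfolding chi_density_def[abs_def] by measurable

lemma sets_chi_law [measurable_cong, simp]: "sets (chi_law \<nu>) = sets borel"
  and space_chi_law [simp]: "space (chi_law \<nu>) = UNIV"
  by (auto simp: chi_law_def)

lemma student_const_pos: "\<nu> > 0 \<Longrightarrow> student_const d \<nu> > 0"
  by (auto simp: student_const_def intro!: divide_pos_pos mult_pos_pos Gamma_real_pos add_nonneg_pos)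

lemma student_pos: "\<nu> > 0 \<Longrightarrow> t > 0 \<Longrightarrow> student d \<nu> t z > 0"
  unfolding student_def using student_const_pos[of \<nu> d]
  by (intro mult_pos_pos) (auto simp: add_nonneg_eq_0_iff)

lemma student_nonneg [simp]: "\<nu> > 0 \<Longrightarrow> t > 0 \<Longrightarrow> student d \<nu> t z \<ge> 0"
  using student_pos[of \<nu> t d z] by simp

lemma measurable_student [measurable (raw)]:
  assumes [measurable]: "f \<in> borel_measurable M" "g \<in> measurable M (Rd d)"
  shows "(\<lambda>x. student d \<nu> (f x) (g x)) \<in> borel_measurable M"
  unfolding student_def by measurable

lemma AE_chi_law_pos: "AE n in chi_law \<nu>. n > 0"
  unfolding chi_law_def by (subst AE_density) (auto simp: chi_density_def)

lemma nn_integral_chi_law: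
  "f \<in> borel_measurable borel \<Longrightarrow> (\<integral>\<^sup>+n. f n \<partial>chi_law \<nu>) = (\<integral>\<^sup>+n. ennreal (chi_density \<nu> n) * f n \<partial>lborel)"
  unfolding chi_law_def by (rule nn_integral_density) auto

lemma prob_space_chi_law:
  assumes "\<nu> > 0" shows "prob_space (chi_law \<nu>)"
proof
  have "emeasure (chi_law \<nu>) (space (chi_law \<nu>)) = (\<integral>\<^sup>+n. ennreal (chi_density \<nu> n) \<partial>lborel)"
    by (simp add: chi_law_def emeasure_density)
  also have "\<dots> = (\<integral>\<^sup>+n. ennreal (2 powr (1 - \<nu> / 2) / Gamma (\<nu> / 2)) *
      (ennreal (n powr (\<nu> - 1) * exp (- 1 * n\<^sup>2 / 2)) * indicator {0..} n) \<partial>lborel)"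
    using assms
    by (intro nn_integral_cong) (auto simp: chi_density_def ennreal_mult'[symmetric] Gamma_real_nonneg mult.assoc split: split_indicator)
  also have "\<dots> = ennreal (2 powr (1 - \<nu> / 2) / Gamma (\<nu> / 2)) * ennreal (1 / 2 * Gamma (\<nu> / 2) * 2 powr (\<nu> / 2))"
    using nn_integral_powr_gauss[OF assms zero_less_one] by (subst nn_integral_cmult) simp_all
  also have "\<dots> = ennreal (2 powr (1 - \<nu> / 2) / Gamma (\<nu> / 2) * (1 / 2 * Gamma (\<nu> / 2) * 2 powr (\<nu> / 2)))"
    using assms by (intro ennreal_mult'[symmetric]) (auto simp: Gamma_real_nonneg)
  also have "2 powr (1 - \<nu> / 2) / Gamma (\<nu> / 2) * (1 / 2 * Gamma (\<nu> / 2) * 2 powr (\<nu> / 2)) = 1"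
  proof -
    have "Gamma (\<nu> / 2) \<noteq> 0" using assms by (metis Gamma_real_pos half_gt_zero less_irrefl)
    moreover have "2 powr (1 - \<nu> / 2) * 2 powr (\<nu> / 2) = (2::real)" by (simp add: powr_add[symmetric])
    ultimately show ?thesis by (simp add: field_simps)
  qed
  finally show "emeasure (chi_law \<nu>) (space (chi_law \<nu>)) = 1" by simp
qed

lemma gden_inverse_scale:
  assumes "n > 0" "t > 0"
  shows "gden d (t / n) z = (1 / (sqrt (2 * pi) * t)) ^ d * (n powr real d * exp (- (nrm d z / t)\<^sup>2 * n\<^sup>2 / 2))"
proof -
  have "(1 / (sqrt (2 * pi) * (t / n))) ^ d = (1 / (sqrt (2 * pi) * t)) ^ d * n ^ d"
    by (simp add: power_mult_distrib[symmetric])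
  moreover have "- (nrm d z)\<^sup>2 / (2 * (t / n)\<^sup>2) = - (nrm d z / t)\<^sup>2 * n\<^sup>2 / 2"
    using assms by (simp add: power_divide field_simps)
  ultimately show ?thesis using assms by (simp add: gden_def powr_realpow)
qed

lemma sqrt_2pi_power:
  assumes "t > 0"
  shows "(1 / (sqrt (2 * pi) * t)) ^ d = 2 powr (- real d / 2) * pi powr (- real d / 2) * t powr (- real d)"
proof -
  have "(1 / (sqrt (2 * pi) * t)) ^ d = (1 / (sqrt (2 * pi) * t)) powr real d"
    using assms by (simp add: powr_realpow)
  also have "\<dots> = (2 powr (- 1 / 2) * pi powr (- 1 / 2) * t powr (- 1)) powr real d"
    using assms by (simp add: powr_minus powr_half_sqrt real_sqrt_mult field_simps)
  also have "(2 powr (- 1 / 2) * pi powr (- 1 / 2) * t powr (- 1)) powr real d =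
      2 powr (- real d / 2) * pi powr (- real d / 2) * t powr (- real d)"
    using assms by (simp only: powr_mult powr_powr powr_ge_zero zero_le_mult_iff) simp
  finally show ?thesis .
qed

text \<open>The Gaussian of standard deviation t / n contributes n^d times an exponential in n^2.
  Merged with the chi density it gives the integral of \<open>nn_integral_powr_gauss\<close> with q
  = d + \<nu> and b = 1 + (|z| / t)^2, and the power of b is the Student profile.\<close>

lemma student_mixture_pointwise:
  assumes \<nu>: "\<nu> > 0" and t: "t > 0"
  shows "(\<integral>\<^sup>+n. ennreal (chi_density \<nu> n) * ennreal (gden d (t / n) z) \<partial>lborel) = ennreal (student d \<nu> t z)"
proof -
  define q where "q = real d + \<nu>"
  define b where "b = 1 + (nrm d z / t)\<^sup>2"
  define K where "K = 2 powr (1 - \<nu> / 2) / Gamma (\<nu> / 2) * (1 / (sqrt (2 * pi) * t)) ^ d"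
  have q: "q > 0" and b: "b > 0" using \<nu> by (auto simp: q_def b_def intro: add_pos_nonneg)
  have K: "K \<ge> 0" using \<nu> t by (auto simp: K_def Gamma_real_nonneg)
  have G: "Gamma (\<nu> / 2) > 0" "Gamma (q / 2) > 0" using \<nu> q by (auto intro!: Gamma_real_pos)
  have "(\<integral>\<^sup>+n. ennreal (chi_density \<nu> n) * ennreal (gden d (t / n) z) \<partial>lborel) =
     (\<integral>\<^sup>+n. ennreal K * (ennreal (n powr (q - 1) * exp (- b * n\<^sup>2 / 2)) * indicator {0..} n) \<partial>lborel)"
  proof (intro nn_integral_cong)
    fix n :: real
    show "ennreal (chi_density \<nu> n) * ennreal (gden d (t / n) z) =
       ennreal K * (ennreal (n powr (q - 1) * exp (- b * n\<^sup>2 / 2)) * indicator {0..} n)"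
    proof (cases "n > 0")
      case True
      have "exp (- n\<^sup>2 / 2) * exp (- (nrm d z / t)\<^sup>2 * n\<^sup>2 / 2) = exp (- b * n\<^sup>2 / 2)"
        by (simp add: b_def exp_add[symmetric] field_simps)
      moreover have "n powr (\<nu> - 1) * n powr real d = n powr (q - 1)"
        using True by (simp add: q_def powr_add[symmetric] algebra_simps)
      ultimately have "chi_density \<nu> n * gden d (t / n) z = K * (n powr (q - 1) * exp (- b * n\<^sup>2 / 2))"
        using True unfolding gden_inverse_scale[OF True t] by (simp add: chi_density_def K_def mult_ac)
      then show ?thesis using True K \<nu> t by (simp add: ennreal_mult'[symmetric])
    qed (auto simp: chi_density_def split: split_indicator)
  qed
  also have "\<dots> = ennreal K * ennreal (1 / 2 * Gamma (q / 2) * (2 / b) powr (q / 2))"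
    using q b by (subst nn_integral_cmult) (auto simp only: nn_integral_powr_gauss, measurable)
  also have "\<dots> = ennreal (K * (1 / 2 * Gamma (q / 2) * (2 / b) powr (q / 2)))"
    using K by (rule ennreal_mult'[symmetric])
  also have "K * (1 / 2 * Gamma (q / 2) * (2 / b) powr (q / 2)) = student d \<nu> t z"
  proof -
    have bb: "b = ((nrm d z)\<^sup>2 + t\<^sup>2) / t\<^sup>2" using t by (simp add: b_def power_divide field_simps)
    have pos: "(nrm d z)\<^sup>2 + t\<^sup>2 > 0" using t by (simp add: add_nonneg_pos)
    have "(2 / b) powr (q / 2) = 2 powr (q / 2) * b powr (- (q / 2))"
      unfolding powr_minus_divide using b by (subst powr_divide) auto
    also have "b powr (- (q / 2)) = ((nrm d z)\<^sup>2 + t\<^sup>2) powr (- (q / 2)) * (t\<^sup>2) powr (q / 2)"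
    proof -
      have "b powr (- (q / 2)) = ((nrm d z)\<^sup>2 + t\<^sup>2) powr (- (q / 2)) / (t\<^sup>2) powr (- (q / 2))"
        unfolding bb by (rule powr_divide)
      also have "(t\<^sup>2) powr (- (q / 2)) = 1 / (t\<^sup>2) powr (q / 2)" by (rule powr_minus_divide)
      finally show ?thesis by simp
    qed
    also have "(t\<^sup>2) powr (q / 2) = t powr q"
      using t powr_powr[of t 2 "q / 2"] by (simp add: powr_numeral)
    finally have 1: "(2 / b) powr (q / 2) = 2 powr (q / 2) * (((nrm d z)\<^sup>2 + t\<^sup>2) powr (- (q / 2)) * t powr q)" .
    have 2: "2 powr (1 - \<nu> / 2) * 2 powr (- real d / 2) * 2 powr (q / 2) = (2::real)"
      by (simp add: powr_add[symmetric] q_def field_simps)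
    have 3: "t powr (- real d) * t powr q = t powr \<nu>" using t by (simp add: powr_add[symmetric] q_def)
    have 5: "- (q / 2) = - (real d + \<nu>) / 2" unfolding q_def by linarith
    have 4: "pi powr (- real d / 2) = 1 / pi powr (real d / 2)"
      using powr_minus_divide[of pi "real d / 2"] by simp
    have "K * (1 / 2 * Gamma (q / 2) * (2 / b) powr (q / 2)) =
      (2 powr (1 - \<nu> / 2) * 2 powr (- real d / 2) * 2 powr (q / 2)) / 2 *
      (Gamma (q / 2) / Gamma (\<nu> / 2) * pi powr (- real d / 2)) * (t powr (- real d) * t powr q) * ((nrm d z)\<^sup>2 + t\<^sup>2) powr (- (q / 2))"
      unfolding K_def 1 sqrt_2pi_power[OF t] by (simp add: mult_ac)
    also have "\<dots> = student d \<nu> t z"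
        unfolding 2 3 4 5 student_def student_const_def by (simp add: q_def mult_ac)
    finally show ?thesis .
  qed
  finally show ?thesis .
qed

text \<open>The weight \<open>w\<close> is left free: it is the chi density in
  \<open>student_mixture\<close> and constant in \<open>singular_mixture\<close>, where the mixture
  has infinite mass.\<close>

lemma chi_gauss_swap:
  assumes [measurable]: "\<psi> \<in> borel_measurable (Rd d)" "w \<in> borel_measurable borel" and t: "t > 0"
  shows "(\<integral>\<^sup>+n. w n * (\<integral>\<^sup>+z. \<psi> (vscale d (t / n) z) \<partial>std_gaussian d) * indicator {0<..} n \<partial>lborel) =
    (\<integral>\<^sup>+z. \<psi> z * (\<integral>\<^sup>+n. w n * ennreal (gden d (t / n) z) * indicator {0<..} n \<partial>lborel) \<partial>Rd d)"
proof -
  interpret R: sigma_finite_measure "Rd d" by (rule sigma_finite_Rd)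
  interpret pair_sigma_finite "Rd d" lborel ..
  have "(\<integral>\<^sup>+n. w n * (\<integral>\<^sup>+z. \<psi> (vscale d (t / n) z) \<partial>std_gaussian d) * indicator {0<..} n \<partial>lborel) =
    (\<integral>\<^sup>+n. (\<integral>\<^sup>+z. \<psi> z * (w n * ennreal (gden d (t / n) z) * indicator {0<..} n) \<partial>Rd d) \<partial>lborel)"
  proof (intro nn_integral_cong)
    fix n :: real
    show "w n * (\<integral>\<^sup>+z. \<psi> (vscale d (t / n) z) \<partial>std_gaussian d) * indicator {0<..} n =
      (\<integral>\<^sup>+z. \<psi> z * (w n * ennreal (gden d (t / n) z) * indicator {0<..} n) \<partial>Rd d)"
    proof (cases "n > 0")
      case True
      then show ?thesis using t
        by (simp add: gden_vscale nn_integral_cmult[symmetric] mult_ac)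
    qed auto
  qed
  also have "\<dots> = (\<integral>\<^sup>+z. (\<integral>\<^sup>+n. \<psi> z * (w n * ennreal (gden d (t / n) z) * indicator {0<..} n) \<partial>lborel) \<partial>Rd d)"
    by (rule Fubini') measurable
  also have "\<dots> = (\<integral>\<^sup>+z. \<psi> z * (\<integral>\<^sup>+n. w n * ennreal (gden d (t / n) z) * indicator {0<..} n \<partial>lborel) \<partial>Rd d)"
    by (intro nn_integral_cong nn_integral_cmult) measurable
  finally show ?thesis .
qed

lemma measurable_gauss_scale_integral [measurable (raw)]:
  assumes [measurable]: "\<psi> \<in> borel_measurable (Rd d)"
  shows "(\<lambda>n. \<integral>\<^sup>+z. \<psi> (vscale d (t / n) z) \<partial>std_gaussian d) \<in> borel_measurable borel"
proof -
  interpret prob_space "std_gaussian d" by (rule prob_space_std_gaussian)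
  show ?thesis by measurable
qed

lemma student_mixture:
  assumes \<nu>: "\<nu> > 0" and t: "t > 0" and [measurable]: "\<psi> \<in> borel_measurable (Rd d)"
  shows "(\<integral>\<^sup>+z. \<psi> z * ennreal (student d \<nu> t z) \<partial>Rd d) =
    (\<integral>\<^sup>+n. (\<integral>\<^sup>+z. \<psi> (vscale d (t / n) z) \<partial>std_gaussian d) \<partial>chi_law \<nu>)"
proof -
  have ind: "ennreal (chi_density \<nu> n) * x = ennreal (chi_density \<nu> n) * x * indicator {0<..} n" for n x
    by (auto simp: chi_density_def split: split_indicator)
  have "(\<integral>\<^sup>+n. (\<integral>\<^sup>+z. \<psi> (vscale d (t / n) z) \<partial>std_gaussian d) \<partial>chi_law \<nu>) =
    (\<integral>\<^sup>+n. ennreal (chi_density \<nu> n) * (\<integral>\<^sup>+z. \<psi> (vscale d (t / n) z) \<partial>std_gaussian d) * indicator {0<..} n \<partial>lborel)"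
    by (subst nn_integral_chi_law) (simp_all add: ind[symmetric])
  also have "\<dots> = (\<integral>\<^sup>+z. \<psi> z * (\<integral>\<^sup>+n. ennreal (chi_density \<nu> n) * ennreal (gden d (t / n) z) * indicator {0<..} n \<partial>lborel) \<partial>Rd d)"
    using t by (intro chi_gauss_swap) auto
  also have "\<dots> = (\<integral>\<^sup>+z. \<psi> z * ennreal (student d \<nu> t z) \<partial>Rd d)"
    using \<nu> t by (simp add: ind[symmetric] student_mixture_pointwise)
  finally show ?thesis ..
qed

text \<open>The normalisation costs no integration over spheres: a mixture of probability laws has
  mass one, whatever its density looks like.\<close>

lemma student_nn_integral_1:
  assumes \<nu>: "\<nu> > 0" and t: "t > 0"
  shows "(\<integral>\<^sup>+z. ennreal (student d \<nu> t z) \<partial>Rd d) = 1"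
proof -
  interpret G: prob_space "std_gaussian d" by (rule prob_space_std_gaussian)
  interpret C: prob_space "chi_law \<nu>" by (rule prob_space_chi_law[OF \<nu>])
  show ?thesis using student_mixture[OF \<nu> t, of "\<lambda>_. 1" d] C.emeasure_space_1 G.emeasure_space_1 by simp
qed

lemma student_integral_1:
  assumes \<nu>: "\<nu> > 0" and t: "t > 0"
  shows "integrable (Rd d) (student d \<nu> t)" "(LINT z|Rd d. student d \<nu> t z) = 1"
  using student_nn_integral_1[OF assms, of d] student_nonneg[OF assms]
  by (auto simp: integrable_iff_bounded integral_eq_nn_integral)

lemma normalized_student:
  assumes \<nu>: "\<nu> > 0" and t: "t > 0" and z: "z \<in> space (Rd d)"
  shows "normalized d (\<lambda>z. ((nrm d z)\<^sup>2 + t\<^sup>2) powr (- (real d + \<nu>) / 2)) z = student d \<nu> t z"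
proof -
  define K where "K = student_const d \<nu> * t powr \<nu>"
  have K: "K > 0" using student_const_pos[OF \<nu>] t by (simp add: K_def)
  have "1 = (LINT z|Rd d. K * ((nrm d z)\<^sup>2 + t\<^sup>2) powr (- (real d + \<nu>) / 2))"
    using student_integral_1(2)[OF \<nu> t, of d] by (simp add: student_def[abs_def] K_def mult.assoc)
  also have "\<dots> = K * (LINT z|Rd d. ((nrm d z)\<^sup>2 + t\<^sup>2) powr (- (real d + \<nu>) / 2))" by simp
  finally have "(LINT z|Rd d. ((nrm d z)\<^sup>2 + t\<^sup>2) powr (- (real d + \<nu>) / 2)) = 1 / K"
    using K by (simp add: field_simps)
  then show ?thesis using K by (simp add: normalized_def student_def K_def)
qed

lemma stable_density_eq:
  assumes "\<eta> > 0" "z \<in> space (Rd d)"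
  shows "stable_density d \<eta> z = student d 1 \<eta> z"
  using normalized_student[of 1 \<eta> z d] assms by (simp add: stable_density_def)

lemma exp_cauchy_potential: "exp (- cauchy_potential d \<nu> x) = ((nrm d x)\<^sup>2 + 1\<^sup>2) powr (- (real d + \<nu>) / 2)"
proof -
  have "(nrm d x)\<^sup>2 + 1 > 0" by (simp add: add_nonneg_pos)
  then show ?thesis by (simp add: cauchy_potential_def powr_def add.commute algebra_simps)
qed

lemma cauchy_target_eq:
  assumes "\<nu> > 0" "x \<in> space (Rd d)"
  shows "cauchy_target d \<nu> x = student d \<nu> 1 x"
  using normalized_student[of \<nu> 1 x d] assms by (simp add: cauchy_target_def exp_cauchy_potential)

text \<open>By the recursion of Gamma at -1/2. The identity makes the constant of the Dirichlet form
  equal to the one in the limit of \<open>student d 1 t z / t\<close> as t tends to 0, so the energy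
  estimate loses no factor.\<close>

lemma c_frac_eq: "c_frac d = student_const d 1"
proof -
  have "Gamma (1/2 :: real) = (-1/2) * Gamma (-1/2)"
  proof -
    have "(-1/2 :: real) \<notin> \<int>"
    proof
      assume "(-1/2 :: real) \<in> \<int>"
      then obtain k where "(-1/2 :: real) = of_int k" by (auto elim: Ints_cases)
      then have "of_int (2 * k) = (of_int (-1) :: real)" by simp
      then have "2 * k = -1" unfolding of_int_eq_iff .
      then show False by presburger
    qed
    then have "(-1/2 :: real) \<notin> \<int>\<^sub>\<le>\<^sub>0" using nonpos_Ints_Int by blast
    from Gamma_plus1[OF this] show ?thesis by simp
  qed
  then have "\<bar>Gamma (- 1 / 2 :: real)\<bar> = 2 * sqrt pi"
    unfolding Gamma_one_half_real using real_sqrt_gt_zero[OF pi_gt_zero] by linarith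
  then show ?thesis by (simp add: c_frac_def student_const_def Gamma_one_half_real)
qed

text \<open>Small-time limit of the Cauchy mixture: in the law of t G / n with n half-normal, put n
  = t m and divide by t. As t tends to 0 the weight of m becomes the value sqrt (2 / pi) of the
  half-normal density at 0, times Lebesgue measure.\<close>

lemma singular_mixture_pointwise:
  assumes z: "nrm d z > 0"
  shows "ennreal (sqrt (2 / pi)) * (\<integral>\<^sup>+n. ennreal (gden d (1 / n) z) * indicator {0<..} n \<partial>lborel) = ennreal (c_frac d / nrm d z ^ (d + 1))"
proof -
  define q where "q = real d + 1"
  have q: "q > 0" by (simp add: q_def add_nonneg_pos)
  define K where "K = (1 / (sqrt (2 * pi) * 1)) ^ d"
  have K: "K \<ge> 0" by (simp add: K_def)
  have "(\<integral>\<^sup>+n. ennreal (gden d (1 / n) z) * indicator {0<..} n \<partial>lborel) =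
     (\<integral>\<^sup>+n. ennreal K * (ennreal (n powr (q - 1) * exp (- (nrm d z)\<^sup>2 * n\<^sup>2 / 2)) * indicator {0..} n) \<partial>lborel)"
  proof (intro nn_integral_cong_AE)
    have "AE n in lborel. n \<noteq> (0::real)" by (rule AE_lborel_singleton)
    then show "AE n in lborel. ennreal (gden d (1 / n) z) * indicator {0<..} n = ennreal K * (ennreal (n powr (q - 1) * exp (- (nrm d z)\<^sup>2 * n\<^sup>2 / 2)) * indicator {0..} n)"
    proof eventually_elim
      case (elim n)
      show ?case
      proof (cases "n > 0")
        case True
        then show ?thesis using K gden_inverse_scale[of n 1 d z]
          by (simp add: ennreal_mult'[symmetric] K_def q_def)
      qed (use elim in \<open>auto split: split_indicator\<close>)
    qed
  qed
  also have "\<dots> = ennreal K * ennreal (1 / 2 * Gamma (q / 2) * (2 / (nrm d z)\<^sup>2) powr (q / 2))"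
    using q z by (subst nn_integral_cmult) (auto simp only: nn_integral_powr_gauss zero_less_power, measurable)
  finally have "ennreal (sqrt (2 / pi)) * (\<integral>\<^sup>+n. ennreal (gden d (1 / n) z) * indicator {0<..} n \<partial>lborel) =
     ennreal (sqrt (2 / pi) * (K * (1 / 2 * Gamma (q / 2) * (2 / (nrm d z)\<^sup>2) powr (q / 2))))"
    using K by (simp only: ennreal_mult' real_sqrt_ge_zero divide_nonneg_nonneg pi_ge_zero zero_le_numeral)
  also have "sqrt (2 / pi) * (K * (1 / 2 * Gamma (q / 2) * (2 / (nrm d z)\<^sup>2) powr (q / 2))) = c_frac d / nrm d z ^ (d + 1)"
  proof -
    have 1: "(2 / (nrm d z)\<^sup>2) powr (q / 2) = 2 powr (q / 2) / nrm d z ^ (d + 1)"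
    proof -
      have "((nrm d z)\<^sup>2) powr (q / 2) = nrm d z powr q"
        using z powr_powr[of "nrm d z" 2 "q / 2"] by (simp add: powr_numeral)
      also have "\<dots> = nrm d z ^ (d + 1)" using z powr_realpow[of "nrm d z" "d + 1"] by (simp add: q_def add.commute)
      finally show ?thesis using z by (simp add: powr_divide)
    qed
    have 2: "sqrt (2 / pi) = 2 powr (1 / 2) * pi powr (- 1 / 2)"
      using powr_minus_divide[of pi "1 / 2"] by (simp add: powr_half_sqrt real_sqrt_divide)
    have 3: "2 powr (1 / 2) * 2 powr (- real d / 2) * 2 powr (q / 2) = (2::real)"
      by (simp add: powr_add[symmetric] q_def field_simps)
    have "sqrt (2 / pi) * (K * (1 / 2 * Gamma (q / 2) * (2 / (nrm d z)\<^sup>2) powr (q / 2))) =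
      (2 powr (1 / 2) * 2 powr (- real d / 2) * 2 powr (q / 2)) / 2 * Gamma (q / 2) * (pi powr (- 1 / 2) * pi powr (- real d / 2)) / nrm d z ^ (d + 1)"
      unfolding 1 2 K_def sqrt_2pi_power[OF zero_less_one] by simp
    also have "\<dots> = c_frac d / nrm d z ^ (d + 1)"
      unfolding 3 c_frac_eq student_const_def
      using powr_minus_divide[of pi "1 / 2"] powr_minus_divide[of pi "real d / 2"]
      by (simp add: q_def Gamma_one_half_real powr_half_sqrt mult_ac)
    finally show ?thesis .
  qed
  finally show ?thesis .
qed

text \<open>A vector of norm 0 lies on the hyperplane z 0 = 0, which is null as soon as there is a
  coordinate at all.\<close>

lemma AE_Rd_nrm_pos:
  assumes d: "d \<ge> 1" shows "AE z in Rd d. nrm d z > 0"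
proof -
  have "AE z in Rd d. z 0 \<noteq> 0"
  proof -
    interpret product_sigma_finite "\<lambda>_::nat. lborel :: real measure" by (rule product_sigma_finite_lborel)
    have 1: "{..<d} = insert 0 {1..<d}" using d by auto
    have "(\<integral>\<^sup>+z. indicator {z. z 0 = 0} z \<partial>Rd d) = (\<integral>\<^sup>+x. (\<integral>\<^sup>+y. indicator {0::real} y \<partial>lborel) \<partial>PiM {1..<d} (\<lambda>_. lborel :: real measure))"

    proof -
      have "0 \<in> insert 0 {1..<d}" by simp
      then have m: "indicator {z. z 0 = (0::real)} \<in> borel_measurable (PiM (insert 0 {1..<d}) (\<lambda>_. lborel :: real measure))"
        by measurable
      have "0 \<notin> {1..<d}" by simp
      from product_nn_integral_insert[OF finite_atLeastLessThan this m]
      have "(\<integral>\<^sup>+z. indicator {z. z 0 = (0::real)} z \<partial>PiM (insert 0 {1..<d}) (\<lambda>_. lborel)) =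
          (\<integral>\<^sup>+x. (\<integral>\<^sup>+y. indicator {z. z 0 = (0::real)} (x(0 := y)) \<partial>lborel) \<partial>PiM {1..<d} (\<lambda>_. lborel))"
        by simp
      also have "\<dots> = (\<integral>\<^sup>+x. (\<integral>\<^sup>+y. indicator {0::real} y \<partial>lborel) \<partial>PiM {1..<d} (\<lambda>_. lborel :: real measure))"
        by (intro nn_integral_cong) (auto split: split_indicator)
      finally show ?thesis by (simp only: Rd_def 1)
    qed
    also have "\<dots> = 0" by (subst nn_integral_indicator) auto
    finally have *: "(\<integral>\<^sup>+z. indicator {z\<in>space (Rd d). z 0 = 0} z \<partial>Rd d) = 0"
      by (subst nn_integral_cong[of _ _ "indicator {z. z 0 = 0}"]) (simp_all split: split_indicator)
    have "0 \<in> {..<d}" using d by auto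
    then have [measurable]: "(\<lambda>z. z 0) \<in> borel_measurable (Rd d)" by (intro Rd_component) auto
    have "{z\<in>space (Rd d). z 0 = 0} \<in> sets (Rd d)" by measurable
    with * show ?thesis by (auto simp: AE_iff_null null_sets_def)
  qed
  moreover have "nrm d z > 0" if "z 0 \<noteq> 0" for z
  proof -
    have "nrm d z \<noteq> 0" using that d by (auto simp: L2_set_eq_0_iff intro!: bexI[of _ 0])
    then show ?thesis using L2_set_nonneg[of z "{..<d}"] by linarith
  qed
  ultimately show ?thesis by (auto elim: eventually_mono)
qed

text \<open>Jumps are represented as z = G / n with n spread over Lebesgue measure. This takes the
  place of polar coordinates in \<open>test_fun_energy\<close> and
  \<open>dirichlet_form_radial_lower_bound\<close>.\<close>

lemma singular_mixture:
  assumes d: "d \<ge> 1" and [measurable]: "\<psi> \<in> borel_measurable (Rd d)"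
  shows "(\<integral>\<^sup>+z. \<psi> z * ennreal (c_frac d / nrm d z ^ (d + 1)) \<partial>Rd d) =
    ennreal (sqrt (2 / pi)) * (\<integral>\<^sup>+n. (\<integral>\<^sup>+z. \<psi> (vscale d (1 / n) z) \<partial>std_gaussian d) * indicator {0<..} n \<partial>lborel)"
proof -
  have "AE z in Rd d. nrm d z > 0" by (rule AE_Rd_nrm_pos[OF d])
  then have "(\<integral>\<^sup>+z. \<psi> z * ennreal (c_frac d / nrm d z ^ (d + 1)) \<partial>Rd d) =
    (\<integral>\<^sup>+z. ennreal (sqrt (2 / pi)) * (\<psi> z * (\<integral>\<^sup>+n. 1 * ennreal (gden d (1 / n) z) * indicator {0<..} n \<partial>lborel)) \<partial>Rd d)"
  proof (intro nn_integral_cong_AE, eventually_elim)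
    case (elim z)
    show ?case
      unfolding singular_mixture_pointwise[OF elim(2), symmetric] by (simp only: mult_1 mult.left_commute)
  qed
  also have "\<dots> = ennreal (sqrt (2 / pi)) * (\<integral>\<^sup>+z. \<psi> z * (\<integral>\<^sup>+n. 1 * ennreal (gden d (1 / n) z) * indicator {0<..} n \<partial>lborel) \<partial>Rd d)"
    by (rule nn_integral_cmult) measurable
  also have "(\<integral>\<^sup>+z. \<psi> z * (\<integral>\<^sup>+n. 1 * ennreal (gden d (1 / n) z) * indicator {0<..} n \<partial>lborel) \<partial>Rd d) =
    (\<integral>\<^sup>+n. 1 * (\<integral>\<^sup>+z. \<psi> (vscale d (1 / n) z) \<partial>std_gaussian d) * indicator {0<..} n \<partial>lborel)"
    by (rule chi_gauss_swap[symmetric]) auto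
  finally show ?thesis by simp
qed

section \<open>The Cauchy semigroup\<close>

text \<open>The continuous density has an antiderivative on the whole line, and the distribution
  function has the same increments, so the two differ by a constant.\<close>

lemma DERIV_cdf_std_normal:
  "(cdf std_normal_distribution has_real_derivative std_normal_density y) (at y)"
proof -
  interpret N: prob_space std_normal_distribution by (rule prob_space_normal_density) simp
  have "\<exists>\<Phi>. \<forall>x. -\<infinity> < ereal x \<longrightarrow> ereal x < \<infinity> \<longrightarrow> (\<Phi> has_vector_derivative std_normal_density x) (at x)"
    by (rule einterval_antiderivative) (auto simp: std_normal_density_def intro!: continuous_intros)
  then obtain \<Phi> where \<Phi>: "\<And>x. (\<Phi> has_real_derivative std_normal_density x) (at x)"
    by (auto simp: has_real_derivative_iff_has_vector_derivative)
  have diff: "cdf std_normal_distribution b - cdf std_normal_distribution a = \<Phi> b - \<Phi> a" if "a \<le> b" for a b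
  proof -
    have mono: "\<Phi> a \<le> \<Phi> b"
      using that \<Phi> by (intro DERIV_nonneg_imp_nondecreasing[of a b \<Phi>]) (auto intro!: exI)
    have "emeasure std_normal_distribution {a<..b} = (\<integral>\<^sup>+x. ennreal (std_normal_density x) * indicator {a<..b} x \<partial>lborel)"
      by (subst emeasure_density) auto
    also have "\<dots> = (\<integral>\<^sup>+x. ennreal (std_normal_density x) * indicator {a..b} x \<partial>lborel)"
      by (intro nn_integral_cong_AE, use AE_lborel_singleton[of a] in eventually_elim) (auto split: split_indicator)
    also have "\<dots> = ennreal (\<Phi> b - \<Phi> a)"
      using that \<Phi> by (intro nn_integral_FTC_Icc) auto
    finally have "measure std_normal_distribution {a<..b} = \<Phi> b - \<Phi> a"
      using mono by (simp add: measure_def)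
    moreover have "measure std_normal_distribution {..b} = measure std_normal_distribution {..a} + measure std_normal_distribution {a<..b}"
    proof -
      have "{..a} \<inter> {a<..b} = {}" "{..b} = {..a} \<union> {a<..b}" using that by auto
      then show ?thesis using N.finite_measure_Union[of "{..a}" "{a<..b}"] by simp
    qed
    ultimately show ?thesis by (simp add: cdf_def)
  qed
  have "cdf std_normal_distribution x = \<Phi> x + (cdf std_normal_distribution 0 - \<Phi> 0)" for x
    using diff[of 0 x] diff[of x 0] by linarith
  then have "cdf std_normal_distribution = (\<lambda>x. \<Phi> x + (cdf std_normal_distribution 0 - \<Phi> 0))"
    by (rule ext)
  moreover have "((\<lambda>x. \<Phi> x + (cdf std_normal_distribution 0 - \<Phi> 0)) has_real_derivative std_normal_density y) (at y)"
    using \<Phi>[of y] by (auto intro!: derivative_eq_intros)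
  ultimately show ?thesis by metis
qed

text \<open>
  The substitutions \<open>y = \<alpha> x - \<beta> / x\<close> and \<open>y = \<alpha> x + \<beta> / x\<close> give an explicit antiderivative in
  terms of the normal distribution function.
\<close>

lemma nn_integral_cauchy_schloemilch:
  assumes \<alpha>: "\<alpha> > 0" and \<beta>: "\<beta> > 0" and \<alpha>\<beta>: "\<alpha> + \<beta> = 1" and n: "n > 0"
  shows "(\<integral>\<^sup>+x. ennreal ((\<alpha>\<^sup>2 + \<beta>\<^sup>2 / x\<^sup>2) * exp (- n\<^sup>2 * (\<alpha> * x - \<beta> / x)\<^sup>2 / 2)) * indicator {0<..} x \<partial>lborel) =
    ennreal (sqrt (2 * pi) / (2 * n))"
proof -
  define N where "N = cdf std_normal_distribution"
  interpret P: prob_space std_normal_distribution by (rule prob_space_normal_density) simp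
  interpret R: real_distribution std_normal_distribution by standard simp_all
  define C where "C = sqrt (2 * pi) / (2 * n)"
  \<comment> \<open>(\<alpha> x + \<beta> / x)^2 exceeds (\<alpha> x - \<beta> / x)^2 by 4 \<alpha>
    \<beta>, so \<open>E\<close> turns the second normal density into the first. The weight \<alpha>
    - \<beta> in \<open>F\<close> is chosen because \<alpha> + \<beta> = 1 gives (\<alpha> + \<beta>
    / x^2) + (\<alpha> - \<beta>) (\<alpha> - \<beta> / x^2) = 2 (\<alpha>^2 + \<beta>^2 /
    x^2).\<close>
  define E where "E = exp (2 * n\<^sup>2 * \<alpha> * \<beta>)"
  define F where "F x = C * (N (n * (\<alpha> * x - \<beta> / x)) + (\<alpha> - \<beta>) * E * N (n * (\<alpha> * x + \<beta> / x)))" for x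
  define f where "f x = (\<alpha>\<^sup>2 + \<beta>\<^sup>2 / x\<^sup>2) * exp (- n\<^sup>2 * (\<alpha> * x - \<beta> / x)\<^sup>2 / 2)" for x
  have dN: "(N has_real_derivative std_normal_density y) (at y)" for y
    unfolding N_def by (rule DERIV_cdf_std_normal)
  have top: "(N \<longlongrightarrow> 1) at_top" unfolding N_def by (rule R.cdf_lim_at_top_prob)
  have bot: "(N \<longlongrightarrow> 0) at_bot" unfolding N_def by (rule R.cdf_lim_at_bot)
  have deriv: "(F has_real_derivative f x) (at x)" if x: "x > 0" for x
  proof -
    define e where "e = exp (- n\<^sup>2 * (\<alpha> * x - \<beta> / x)\<^sup>2 / 2)"
    have "((\<lambda>x. n * (\<alpha> * x - \<beta> / x)) has_real_derivative n * (\<alpha> + \<beta> / x\<^sup>2)) (at x)"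
      using x by (auto intro!: derivative_eq_intros simp: power2_eq_square)
    from DERIV_chain2[OF dN this]
    have 1: "((\<lambda>x. N (n * (\<alpha> * x - \<beta> / x))) has_real_derivative
      std_normal_density (n * (\<alpha> * x - \<beta> / x)) * (n * (\<alpha> + \<beta> / x\<^sup>2))) (at x)" .
    have "((\<lambda>x. n * (\<alpha> * x + \<beta> / x)) has_real_derivative n * (\<alpha> - \<beta> / x\<^sup>2)) (at x)"
      using x by (auto intro!: derivative_eq_intros simp: power2_eq_square)
    from DERIV_chain2[OF dN this]
    have 2: "((\<lambda>x. N (n * (\<alpha> * x + \<beta> / x))) has_real_derivative
      std_normal_density (n * (\<alpha> * x + \<beta> / x)) * (n * (\<alpha> - \<beta> / x\<^sup>2))) (at x)" .
    have s1: "std_normal_density (n * (\<alpha> * x - \<beta> / x)) = e / sqrt (2 * pi)"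
      by (simp add: std_normal_density_def e_def power_mult_distrib)
    have "(\<alpha> * x + \<beta> / x)\<^sup>2 = (\<alpha> * x - \<beta> / x)\<^sup>2 + 4 * \<alpha> * \<beta>"
      using x by (simp add: power2_eq_square field_simps)
    then have "(n * (\<alpha> * x + \<beta> / x))\<^sup>2 = n\<^sup>2 * ((\<alpha> * x - \<beta> / x)\<^sup>2 + 4 * \<alpha> * \<beta>)"
      by (simp only: power_mult_distrib)
    then have "2 * n\<^sup>2 * \<alpha> * \<beta> + - (n * (\<alpha> * x + \<beta> / x))\<^sup>2 / 2 = - n\<^sup>2 * (\<alpha> * x - \<beta> / x)\<^sup>2 / 2"
    proof -
      have "2 * n\<^sup>2 * \<alpha> * \<beta> + - (n\<^sup>2 * (w + 4 * \<alpha> * \<beta>)) / 2 = - n\<^sup>2 * w / 2" for w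
        by (simp add: field_simps)
      then show ?thesis unfolding \<open>(n * (\<alpha> * x + \<beta> / x))\<^sup>2 = _\<close> .
    qed
    then have "E * exp (- (n * (\<alpha> * x + \<beta> / x))\<^sup>2 / 2) = e"
      unfolding E_def e_def by (simp only: exp_add[symmetric])
    then have s2: "E * std_normal_density (n * (\<alpha> * x + \<beta> / x)) = e / sqrt (2 * pi)"
      by (simp add: std_normal_density_def field_simps)
    have "(F has_real_derivative C * (std_normal_density (n * (\<alpha> * x - \<beta> / x)) * (n * (\<alpha> + \<beta> / x\<^sup>2)) +
       (\<alpha> - \<beta>) * E * (std_normal_density (n * (\<alpha> * x + \<beta> / x)) * (n * (\<alpha> - \<beta> / x\<^sup>2))))) (at x)"
      unfolding F_def[abs_def] by (intro DERIV_cmult DERIV_add 1 2)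
    also have "C * (std_normal_density (n * (\<alpha> * x - \<beta> / x)) * (n * (\<alpha> + \<beta> / x\<^sup>2)) +
       (\<alpha> - \<beta>) * E * (std_normal_density (n * (\<alpha> * x + \<beta> / x)) * (n * (\<alpha> - \<beta> / x\<^sup>2)))) =
       C * n * (std_normal_density (n * (\<alpha> * x - \<beta> / x)) * (\<alpha> + \<beta> / x\<^sup>2) +
       (\<alpha> - \<beta>) * (E * std_normal_density (n * (\<alpha> * x + \<beta> / x))) * (\<alpha> - \<beta> / x\<^sup>2))"
    proof -
      have "C * (D1 * (n * p) + r * E * (D2 * (n * q))) = C * n * (D1 * p + r * (E * D2) * q)" for D1 D2 p q r
        by (simp add: algebra_simps)
      then show ?thesis .
    qed
    also have "\<dots> = C * n / sqrt (2 * pi) * e * ((\<alpha> + \<beta> / x\<^sup>2) + (\<alpha> - \<beta>) * (\<alpha> - \<beta> / x\<^sup>2))"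
    proof -
      have "C * n * (e / w * p + r * (e / w) * q) = C * n / w * e * (p + r * q)" for w p q r
        by (simp add: algebra_simps add_divide_distrib)
      then show ?thesis unfolding s1 s2 .
    qed
    also have "(\<alpha> + \<beta> / x\<^sup>2) + (\<alpha> - \<beta>) * (\<alpha> - \<beta> / x\<^sup>2) = 2 * (\<alpha>\<^sup>2 + \<beta>\<^sup>2 / x\<^sup>2)"
    proof -
      have b: "\<beta> = 1 - \<alpha>" using \<alpha>\<beta> by simp
      have "(\<alpha> + \<beta> * w) + (\<alpha> - \<beta>) * (\<alpha> - \<beta> * w) = 2 * (\<alpha>\<^sup>2 + \<beta>\<^sup>2 * w)" for w
        unfolding b by (simp add: power2_eq_square algebra_simps)
      from this[of "1 / x\<^sup>2"] show ?thesis by simp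
    qed
    also have "C * n / sqrt (2 * pi) * e * (2 * (\<alpha>\<^sup>2 + \<beta>\<^sup>2 / x\<^sup>2)) = f x"
      using n by (simp add: C_def f_def e_def)
    finally show ?thesis .
  qed
  have isc: "isCont f x" if "x > 0" for x
    unfolding f_def[abs_def] using that by (auto intro!: continuous_intros)
  \<comment> \<open>The argument of the second term of \<open>F\<close> tends to infinity at both
    ends of the half-line, so this term cancels between the boundary values. Only the first term
    remains, which climbs from 0 to 1.\<close>
  have pinf: "filterlim (\<lambda>x. n * (\<alpha> * x + \<beta> / x)) at_top (at_right 0)"
    using \<alpha> \<beta> n by real_asymp
  have pinf': "filterlim (\<lambda>x. n * (\<alpha> * x + \<beta> / x)) at_top at_top"
    using \<alpha> \<beta> n by real_asymp
  have minf: "filterlim (\<lambda>x. n * (\<alpha> * x - \<beta> / x)) at_bot (at_right 0)"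
    using \<alpha> \<beta> n by real_asymp
  have minf': "filterlim (\<lambda>x. n * (\<alpha> * x - \<beta> / x)) at_top at_top"
    using \<alpha> \<beta> n by real_asymp
  have A: "((F \<circ> real_of_ereal) \<longlongrightarrow> C * (0 + (\<alpha> - \<beta>) * E * 1)) (at_right 0)"
    unfolding zero_ereal_def ereal_tendsto_simps1 F_def[abs_def]
    by (intro tendsto_intros filterlim_compose[OF bot minf] filterlim_compose[OF top pinf])
  have B: "((F \<circ> real_of_ereal) \<longlongrightarrow> C * (1 + (\<alpha> - \<beta>) * E * 1)) (at_left \<infinity>)"
    unfolding ereal_tendsto_simps1 F_def[abs_def]
    by (intro tendsto_intros filterlim_compose[OF top minf'] filterlim_compose[OF top pinf'])
  have fnn: "f x \<ge> 0" for x by (simp add: f_def)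
  have [measurable]: "f \<in> borel_measurable borel" unfolding f_def[abs_def] by measurable
  have "set_integrable lborel (einterval 0 \<infinity>) f"
    and "(LBINT x=0..\<infinity>. f x) = C * (1 + (\<alpha> - \<beta>) * E * 1) - C * (0 + (\<alpha> - \<beta>) * E * 1)"
    using deriv isc fnn by (intro interval_integral_FTC_nonneg[of 0 \<infinity> F f, OF _ _ _ _ A B]; auto)+
  then have i: "set_integrable lborel {0<..} f" and v: "set_lebesgue_integral lborel {0<..} f = C"
    by (auto simp: interval_lebesgue_integral_def einterval_def zero_ereal_def greaterThan_def algebra_simps)
  have "(\<integral>\<^sup>+x. ennreal (f x) * indicator {0<..} x \<partial>lborel) = (\<integral>\<^sup>+x. ennreal (indicator {0<..} x * f x) \<partial>lborel)"
    by (intro nn_integral_cong) (auto split: split_indicator)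
  also have "\<dots> = ennreal C"
    using i v fnn by (subst nn_integral_eq_integral) (auto simp: set_integrable_def set_lebesgue_integral_def)
  finally show ?thesis by (simp add: f_def C_def)
qed

lemma chi_density_1: "chi_density 1 n = (if n > 0 then sqrt (2 / pi) * exp (- n\<^sup>2 / 2) else 0)"
  by (simp add: chi_density_def powr_half_sqrt Gamma_one_half_real real_sqrt_divide)

text \<open>The inverse square of a half-normal variable has the one-sided stable law of index 1/2
  (Levy), and this is its additivity. Passing to the ratio x = n / m and then rescaling m by
  \<open>\<gamma> x\<close> makes the argument of \<phi> independent of x. The exponent splits by
  (\<alpha>^2 + \<beta>^2 / x^2) (1 + x^2) = (\<alpha> + \<beta>)^2 + (\<alpha> x - \<beta> / x)^2,
  and the x-integral left over is \<open>nn_integral_cauchy_schloemilch\<close>.\<close>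

lemma levy_convolution:
  fixes \<phi> :: "real \<Rightarrow> ennreal"
  assumes [measurable]: "\<phi> \<in> borel_measurable borel" and s: "s > 0" and t: "t > 0"
  shows "(\<integral>\<^sup>+m. (\<integral>\<^sup>+n. \<phi> (s\<^sup>2 / m\<^sup>2 + t\<^sup>2 / n\<^sup>2) \<partial>chi_law 1) \<partial>chi_law 1) = (\<integral>\<^sup>+n. \<phi> ((s + t)\<^sup>2 / n\<^sup>2) \<partial>chi_law 1)"
proof -
  define \<alpha> where "\<alpha> = s / (s + t)"
  define \<beta> where "\<beta> = t / (s + t)"
  have \<alpha>: "\<alpha> > 0" and \<beta>: "\<beta> > 0" and \<alpha>\<beta>: "\<alpha> + \<beta> = 1"
    using s t by (auto simp: \<alpha>_def \<beta>_def add_divide_distrib[symmetric])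
  have s': "s = (s + t) * \<alpha>" and t': "t = (s + t) * \<beta>" using s t by (auto simp: \<alpha>_def \<beta>_def)
  define u where "u = (s + t)\<^sup>2"
  \<comment> \<open>Chosen so that m = \<open>\<gamma> x\<close> n turns the argument
    \<open>u / m\<^sup>2 * (\<gamma> x)\<^sup>2\<close> of \<phi> into
    \<open>u / n\<^sup>2\<close>.\<close>
  define \<gamma> where "\<gamma> x = sqrt (\<alpha>\<^sup>2 + \<beta>\<^sup>2 / x\<^sup>2)" for x
  have \<gamma>: "\<gamma> x > 0" "(\<gamma> x)\<^sup>2 = \<alpha>\<^sup>2 + \<beta>\<^sup>2 / x\<^sup>2" for x using \<alpha> by (auto simp: \<gamma>_def add_pos_nonneg)
  define c where "c = ennreal (sqrt (2 / pi))"
  have [measurable]: "\<gamma> \<in> borel_measurable borel" unfolding \<gamma>_def[abs_def] by measurable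
  have chi: "(\<integral>\<^sup>+n. h n \<partial>chi_law 1) = c * (\<integral>\<^sup>+n. ennreal (exp (- n\<^sup>2 / 2)) * h n * indicator {0<..} n \<partial>lborel)"
    if [measurable]: "h \<in> borel_measurable borel" for h
    unfolding c_def
    by (subst nn_integral_cmult[symmetric])
      (auto simp: nn_integral_chi_law chi_density_1 ennreal_mult' mult.assoc intro!: nn_integral_cong split: split_indicator)
  have "(\<integral>\<^sup>+m. (\<integral>\<^sup>+n. \<phi> (s\<^sup>2 / m\<^sup>2 + t\<^sup>2 / n\<^sup>2) \<partial>chi_law 1) \<partial>chi_law 1) =
     c * c * (\<integral>\<^sup>+m. ennreal (exp (- m\<^sup>2 / 2)) * (\<integral>\<^sup>+n. ennreal (exp (- n\<^sup>2 / 2)) * \<phi> (s\<^sup>2 / m\<^sup>2 + t\<^sup>2 / n\<^sup>2) * indicator {0<..} n \<partial>lborel) * indicator {0<..} m \<partial>lborel)"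
  proof -
    define I where "I m = (\<integral>\<^sup>+n. ennreal (exp (- n\<^sup>2 / 2)) * \<phi> (s\<^sup>2 / m\<^sup>2 + t\<^sup>2 / n\<^sup>2) * indicator {0<..} n \<partial>lborel)" for m
    have [measurable]: "I \<in> borel_measurable borel" unfolding I_def[abs_def] by measurable
    have "(\<integral>\<^sup>+n. \<phi> (s\<^sup>2 / m\<^sup>2 + t\<^sup>2 / n\<^sup>2) \<partial>chi_law 1) = c * I m" for m
      unfolding I_def by (rule chi) measurable
    then have "(\<integral>\<^sup>+m. (\<integral>\<^sup>+n. \<phi> (s\<^sup>2 / m\<^sup>2 + t\<^sup>2 / n\<^sup>2) \<partial>chi_law 1) \<partial>chi_law 1) = (\<integral>\<^sup>+m. c * I m \<partial>chi_law 1)"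
      by simp
    also have "\<dots> = c * (\<integral>\<^sup>+m. I m \<partial>chi_law 1)" by (rule nn_integral_cmult) measurable
    also have "\<dots> = c * (c * (\<integral>\<^sup>+m. ennreal (exp (- m\<^sup>2 / 2)) * I m * indicator {0<..} m \<partial>lborel))"
      by (subst chi) simp_all
    finally show ?thesis by (simp only: I_def mult.assoc)
  qed
  also have "(\<integral>\<^sup>+m. ennreal (exp (- m\<^sup>2 / 2)) * (\<integral>\<^sup>+n. ennreal (exp (- n\<^sup>2 / 2)) * \<phi> (s\<^sup>2 / m\<^sup>2 + t\<^sup>2 / n\<^sup>2) * indicator {0<..} n \<partial>lborel) * indicator {0<..} m \<partial>lborel) =
     (\<integral>\<^sup>+m. (\<integral>\<^sup>+x. ennreal (m * exp (- m\<^sup>2 * (1 + x\<^sup>2) / 2)) * \<phi> (u / m\<^sup>2 * (\<gamma> x)\<^sup>2) * indicator {0<..} x * indicator {0<..} m \<partial>lborel) \<partial>lborel)"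
  proof (rule nn_integral_cong)
    fix m :: real
    show "ennreal (exp (- m\<^sup>2 / 2)) * (\<integral>\<^sup>+n. ennreal (exp (- n\<^sup>2 / 2)) * \<phi> (s\<^sup>2 / m\<^sup>2 + t\<^sup>2 / n\<^sup>2) * indicator {0<..} n \<partial>lborel) * indicator {0<..} m =
      (\<integral>\<^sup>+x. ennreal (m * exp (- m\<^sup>2 * (1 + x\<^sup>2) / 2)) * \<phi> (u / m\<^sup>2 * (\<gamma> x)\<^sup>2) * indicator {0<..} x * indicator {0<..} m \<partial>lborel)"
    proof (cases "m > 0")
      case True
      have "(\<integral>\<^sup>+n. ennreal (exp (- n\<^sup>2 / 2)) * \<phi> (s\<^sup>2 / m\<^sup>2 + t\<^sup>2 / n\<^sup>2) * indicator {0<..} n \<partial>lborel) =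
        ennreal \<bar>m\<bar> * (\<integral>\<^sup>+x. ennreal (exp (- (0 + m * x)\<^sup>2 / 2)) * \<phi> (s\<^sup>2 / m\<^sup>2 + t\<^sup>2 / (0 + m * x)\<^sup>2) * indicator {0<..} (0 + m * x) \<partial>lborel)"
        using True by (intro nn_integral_real_affine) auto
      also have "(\<integral>\<^sup>+x. ennreal (exp (- (0 + m * x)\<^sup>2 / 2)) * \<phi> (s\<^sup>2 / m\<^sup>2 + t\<^sup>2 / (0 + m * x)\<^sup>2) * indicator {0<..} (0 + m * x) \<partial>lborel) =
         (\<integral>\<^sup>+x. ennreal (exp (- m\<^sup>2 * x\<^sup>2 / 2)) * \<phi> (u / m\<^sup>2 * (\<gamma> x)\<^sup>2) * indicator {0<..} x \<partial>lborel)"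
      proof (rule nn_integral_cong)
        fix x :: real
        have "s\<^sup>2 / m\<^sup>2 + t\<^sup>2 / (0 + m * x)\<^sup>2 = u / m\<^sup>2 * (\<gamma> x)\<^sup>2"
        proof -
          have "s\<^sup>2 = u * \<alpha>\<^sup>2" "t\<^sup>2 = u * \<beta>\<^sup>2"
            using s' t' by (metis power_mult_distrib u_def)+
          then show ?thesis by (simp add: \<gamma> power_mult_distrib algebra_simps)
        qed
        then show "ennreal (exp (- (0 + m * x)\<^sup>2 / 2)) * \<phi> (s\<^sup>2 / m\<^sup>2 + t\<^sup>2 / (0 + m * x)\<^sup>2) * indicator {0<..} (0 + m * x) =
          ennreal (exp (- m\<^sup>2 * x\<^sup>2 / 2)) * \<phi> (u / m\<^sup>2 * (\<gamma> x)\<^sup>2) * indicator {0<..} x"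
          using True by (auto simp: power_mult_distrib zero_less_mult_iff split: split_indicator)
      qed
      finally have eq: "(\<integral>\<^sup>+n. ennreal (exp (- n\<^sup>2 / 2)) * \<phi> (s\<^sup>2 / m\<^sup>2 + t\<^sup>2 / n\<^sup>2) * indicator {0<..} n \<partial>lborel) =
        ennreal m * (\<integral>\<^sup>+x. ennreal (exp (- m\<^sup>2 * x\<^sup>2 / 2)) * \<phi> (u / m\<^sup>2 * (\<gamma> x)\<^sup>2) * indicator {0<..} x \<partial>lborel)"
        using True by simp
      have "ennreal (exp (- m\<^sup>2 / 2)) * (ennreal m * (\<integral>\<^sup>+x. ennreal (exp (- m\<^sup>2 * x\<^sup>2 / 2)) * \<phi> (u / m\<^sup>2 * (\<gamma> x)\<^sup>2) * indicator {0<..} x \<partial>lborel)) =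
        (\<integral>\<^sup>+x. ennreal (exp (- m\<^sup>2 / 2)) * (ennreal m * (ennreal (exp (- m\<^sup>2 * x\<^sup>2 / 2)) * \<phi> (u / m\<^sup>2 * (\<gamma> x)\<^sup>2) * indicator {0<..} x)) \<partial>lborel)"
        by (simp add: nn_integral_cmult)
      also have "\<dots> = (\<integral>\<^sup>+x. ennreal (m * exp (- m\<^sup>2 * (1 + x\<^sup>2) / 2)) * \<phi> (u / m\<^sup>2 * (\<gamma> x)\<^sup>2) * indicator {0<..} x \<partial>lborel)"
      proof (rule nn_integral_cong)
        fix x :: real
        have "m * exp (- m\<^sup>2 * (1 + x\<^sup>2) / 2) = exp (- m\<^sup>2 / 2) * (m * exp (- m\<^sup>2 * x\<^sup>2 / 2))"
          by (simp add: exp_add[symmetric] field_simps)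
        then have "ennreal (m * exp (- m\<^sup>2 * (1 + x\<^sup>2) / 2)) = ennreal (exp (- m\<^sup>2 / 2)) * (ennreal m * ennreal (exp (- m\<^sup>2 * x\<^sup>2 / 2)))"
          using True by (simp add: ennreal_mult mult_ac)
        then show "ennreal (exp (- m\<^sup>2 / 2)) * (ennreal m * (ennreal (exp (- m\<^sup>2 * x\<^sup>2 / 2)) * \<phi> (u / m\<^sup>2 * (\<gamma> x)\<^sup>2) * indicator {0<..} x)) =
          ennreal (m * exp (- m\<^sup>2 * (1 + x\<^sup>2) / 2)) * \<phi> (u / m\<^sup>2 * (\<gamma> x)\<^sup>2) * indicator {0<..} x"
          by (simp only: mult.assoc)
      qed
      finally show ?thesis using True eq by simp
    qed simp
  qed
  also have "\<dots> = (\<integral>\<^sup>+x. (\<integral>\<^sup>+m. ennreal (m * exp (- m\<^sup>2 * (1 + x\<^sup>2) / 2)) * \<phi> (u / m\<^sup>2 * (\<gamma> x)\<^sup>2) * indicator {0<..} x * indicator {0<..} m \<partial>lborel) \<partial>lborel)"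
    by (rule lborel_pair.Fubini') measurable
  also have "\<dots> = (\<integral>\<^sup>+x. (\<integral>\<^sup>+n. ennreal (n * exp (- n\<^sup>2 / 2)) * \<phi> (u / n\<^sup>2) * indicator {0<..} n *
     (ennreal ((\<alpha>\<^sup>2 + \<beta>\<^sup>2 / x\<^sup>2) * exp (- n\<^sup>2 * (\<alpha> * x - \<beta> / x)\<^sup>2 / 2)) * indicator {0<..} x) \<partial>lborel) \<partial>lborel)"
  proof (rule nn_integral_cong)
    fix x :: real
    have "(\<integral>\<^sup>+m. ennreal (m * exp (- m\<^sup>2 * (1 + x\<^sup>2) / 2)) * \<phi> (u / m\<^sup>2 * (\<gamma> x)\<^sup>2) * indicator {0<..} x * indicator {0<..} m \<partial>lborel) =
      ennreal \<bar>\<gamma> x\<bar> * (\<integral>\<^sup>+n. ennreal ((0 + \<gamma> x * n) * exp (- (0 + \<gamma> x * n)\<^sup>2 * (1 + x\<^sup>2) / 2)) * \<phi> (u / (0 + \<gamma> x * n)\<^sup>2 * (\<gamma> x)\<^sup>2) * indicator {0<..} x * indicator {0<..} (0 + \<gamma> x * n) \<partial>lborel)"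
      using \<gamma>(1)[of x] by (intro nn_integral_real_affine) auto
    also have "\<dots> = (\<integral>\<^sup>+n. ennreal \<bar>\<gamma> x\<bar> * (ennreal ((0 + \<gamma> x * n) * exp (- (0 + \<gamma> x * n)\<^sup>2 * (1 + x\<^sup>2) / 2)) * \<phi> (u / (0 + \<gamma> x * n)\<^sup>2 * (\<gamma> x)\<^sup>2) * indicator {0<..} x * indicator {0<..} (0 + \<gamma> x * n)) \<partial>lborel)"
      by (rule nn_integral_cmult[symmetric]) measurable
    also have "\<dots> = (\<integral>\<^sup>+n. ennreal (n * exp (- n\<^sup>2 / 2)) * \<phi> (u / n\<^sup>2) * indicator {0<..} n *
     (ennreal ((\<alpha>\<^sup>2 + \<beta>\<^sup>2 / x\<^sup>2) * exp (- n\<^sup>2 * (\<alpha> * x - \<beta> / x)\<^sup>2 / 2)) * indicator {0<..} x) \<partial>lborel)"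
    proof (rule nn_integral_cong)
      fix n :: real
      show "ennreal \<bar>\<gamma> x\<bar> * (ennreal ((0 + \<gamma> x * n) * exp (- (0 + \<gamma> x * n)\<^sup>2 * (1 + x\<^sup>2) / 2)) * \<phi> (u / (0 + \<gamma> x * n)\<^sup>2 * (\<gamma> x)\<^sup>2) * indicator {0<..} x * indicator {0<..} (0 + \<gamma> x * n)) =
        ennreal (n * exp (- n\<^sup>2 / 2)) * \<phi> (u / n\<^sup>2) * indicator {0<..} n *
        (ennreal ((\<alpha>\<^sup>2 + \<beta>\<^sup>2 / x\<^sup>2) * exp (- n\<^sup>2 * (\<alpha> * x - \<beta> / x)\<^sup>2 / 2)) * indicator {0<..} x)"
      proof (cases "n > 0 \<and> x > 0")
        case True
        have a: "u / (0 + \<gamma> x * n)\<^sup>2 * (\<gamma> x)\<^sup>2 = u / n\<^sup>2"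
          using \<gamma>(1)[of x] by (simp add: power_mult_distrib)
        have "(\<gamma> x)\<^sup>2 * (1 + x\<^sup>2) = (\<alpha> + \<beta>)\<^sup>2 + (\<alpha> * x - \<beta> / x)\<^sup>2"
          unfolding \<gamma>(2) using True by (simp add: power2_eq_square field_simps)
        then have "(\<gamma> x)\<^sup>2 * (1 + x\<^sup>2) = 1 + (\<alpha> * x - \<beta> / x)\<^sup>2" by (simp add: \<alpha>\<beta>)
        then have "- (0 + \<gamma> x * n)\<^sup>2 * (1 + x\<^sup>2) / 2 = - n\<^sup>2 / 2 + - n\<^sup>2 * (\<alpha> * x - \<beta> / x)\<^sup>2 / 2"
          by (simp add: power_mult_distrib) (simp add: algebra_simps)
        then have "\<bar>\<gamma> x\<bar> * ((0 + \<gamma> x * n) * exp (- (0 + \<gamma> x * n)\<^sup>2 * (1 + x\<^sup>2) / 2)) =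
           (n * exp (- n\<^sup>2 / 2)) * ((\<gamma> x)\<^sup>2 * exp (- n\<^sup>2 * (\<alpha> * x - \<beta> / x)\<^sup>2 / 2))"
          using \<gamma>(1)[of x] by (simp only: exp_add) (simp add: power2_eq_square)
        then have "ennreal (\<bar>\<gamma> x\<bar> * ((0 + \<gamma> x * n) * exp (- (0 + \<gamma> x * n)\<^sup>2 * (1 + x\<^sup>2) / 2))) =
            ennreal ((n * exp (- n\<^sup>2 / 2)) * ((\<alpha>\<^sup>2 + \<beta>\<^sup>2 / x\<^sup>2) * exp (- n\<^sup>2 * (\<alpha> * x - \<beta> / x)\<^sup>2 / 2)))"
          unfolding \<gamma>(2) by (rule arg_cong)
        then have "ennreal \<bar>\<gamma> x\<bar> * ennreal ((0 + \<gamma> x * n) * exp (- (0 + \<gamma> x * n)\<^sup>2 * (1 + x\<^sup>2) / 2)) =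
           ennreal (n * exp (- n\<^sup>2 / 2)) * ennreal ((\<alpha>\<^sup>2 + \<beta>\<^sup>2 / x\<^sup>2) * exp (- n\<^sup>2 * (\<alpha> * x - \<beta> / x)\<^sup>2 / 2))"
          using True by (simp only: ennreal_mult' abs_ge_zero zero_le_mult_iff exp_ge_zero less_imp_le simp_thms)
        moreover have "A * (B * f) = C * f * D" if "A * B = C * D" for A B C D f :: ennreal
          using that by (metis mult.assoc mult.commute)
        moreover have "indicator {0<..} (0 + \<gamma> x * n) = (1::ennreal)" "indicator {0<..} n = (1::ennreal)" "indicator {0<..} x = (1::ennreal)"
          using True \<gamma>(1)[of x] by auto
        ultimately show ?thesis unfolding a by (simp only: mult_1_right)
      qed (use \<gamma>(1)[of x] in \<open>auto simp: zero_less_mult_iff split: split_indicator\<close>)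
    qed
    finally show "(\<integral>\<^sup>+m. ennreal (m * exp (- m\<^sup>2 * (1 + x\<^sup>2) / 2)) * \<phi> (u / m\<^sup>2 * (\<gamma> x)\<^sup>2) * indicator {0<..} x * indicator {0<..} m \<partial>lborel) = \<dots>" .
  qed
  also have "\<dots> = (\<integral>\<^sup>+n. (\<integral>\<^sup>+x. ennreal (n * exp (- n\<^sup>2 / 2)) * \<phi> (u / n\<^sup>2) * indicator {0<..} n *
     (ennreal ((\<alpha>\<^sup>2 + \<beta>\<^sup>2 / x\<^sup>2) * exp (- n\<^sup>2 * (\<alpha> * x - \<beta> / x)\<^sup>2 / 2)) * indicator {0<..} x) \<partial>lborel) \<partial>lborel)"
    by (rule lborel_pair.Fubini') measurable
  also have "\<dots> = (\<integral>\<^sup>+n. ennreal (sqrt (2 * pi) / 2) * (ennreal (exp (- n\<^sup>2 / 2)) * \<phi> (u / n\<^sup>2) * indicator {0<..} n) \<partial>lborel)"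
  proof (rule nn_integral_cong)
    fix n :: real
    have "(\<integral>\<^sup>+x. ennreal (n * exp (- n\<^sup>2 / 2)) * \<phi> (u / n\<^sup>2) * indicator {0<..} n *
     (ennreal ((\<alpha>\<^sup>2 + \<beta>\<^sup>2 / x\<^sup>2) * exp (- n\<^sup>2 * (\<alpha> * x - \<beta> / x)\<^sup>2 / 2)) * indicator {0<..} x) \<partial>lborel) =
      ennreal (n * exp (- n\<^sup>2 / 2)) * \<phi> (u / n\<^sup>2) * indicator {0<..} n *
      (\<integral>\<^sup>+x. ennreal ((\<alpha>\<^sup>2 + \<beta>\<^sup>2 / x\<^sup>2) * exp (- n\<^sup>2 * (\<alpha> * x - \<beta> / x)\<^sup>2 / 2)) * indicator {0<..} x \<partial>lborel)"
      by (rule nn_integral_cmult) measurable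
    also have "\<dots> = ennreal (sqrt (2 * pi) / 2) * (ennreal (exp (- n\<^sup>2 / 2)) * \<phi> (u / n\<^sup>2) * indicator {0<..} n)"
    proof (cases "n > 0")
      case True
      have "ennreal (n * exp (- n\<^sup>2 / 2)) * ennreal (sqrt (2 * pi) / (2 * n)) = ennreal (sqrt (2 * pi) / 2) * ennreal (exp (- n\<^sup>2 / 2))"
        using True by (subst (1 2) ennreal_mult[symmetric]) auto
      then show ?thesis using True nn_integral_cauchy_schloemilch[OF \<alpha> \<beta> \<alpha>\<beta> True] by (simp add: mult_ac)
    qed simp
    finally show "(\<integral>\<^sup>+x. ennreal (n * exp (- n\<^sup>2 / 2)) * \<phi> (u / n\<^sup>2) * indicator {0<..} n *
     (ennreal ((\<alpha>\<^sup>2 + \<beta>\<^sup>2 / x\<^sup>2) * exp (- n\<^sup>2 * (\<alpha> * x - \<beta> / x)\<^sup>2 / 2)) * indicator {0<..} x) \<partial>lborel) = \<dots>" .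
  qed
  also have "\<dots> = ennreal (sqrt (2 * pi) / 2) * (\<integral>\<^sup>+n. ennreal (exp (- n\<^sup>2 / 2)) * \<phi> (u / n\<^sup>2) * indicator {0<..} n \<partial>lborel)"
    by (rule nn_integral_cmult) measurable
  also have "c * c * (ennreal (sqrt (2 * pi) / 2) * (\<integral>\<^sup>+n. ennreal (exp (- n\<^sup>2 / 2)) * \<phi> (u / n\<^sup>2) * indicator {0<..} n \<partial>lborel)) =
    c * (\<integral>\<^sup>+n. ennreal (exp (- n\<^sup>2 / 2)) * \<phi> (u / n\<^sup>2) * indicator {0<..} n \<partial>lborel)"
  proof -
    have "sqrt (2 / pi) * (sqrt (2 * pi) / 2) = 1" by (simp add: real_sqrt_mult[symmetric] flip: real_sqrt_mult)
    then have "c * ennreal (sqrt (2 * pi) / 2) = 1" by (simp add: c_def ennreal_mult[symmetric])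
    then show ?thesis by (metis (no_types, lifting) mult.assoc mult.right_neutral)
  qed
  also have "\<dots> = (\<integral>\<^sup>+n. \<phi> ((s + t)\<^sup>2 / n\<^sup>2) \<partial>chi_law 1)"
    unfolding u_def by (rule chi[symmetric]) measurable
  finally show ?thesis .
qed

section \<open>Cauchy vectors and their sums\<close>

definition cauchy_law :: "nat \<Rightarrow> real \<Rightarrow> (nat \<Rightarrow> real) measure" where
  "cauchy_law d t = density (Rd d) (\<lambda>z. ennreal (student d 1 t z))"

lemma sets_cauchy_law [measurable_cong, simp]: "sets (cauchy_law d t) = sets (Rd d)"
  and space_cauchy_law [simp]: "space (cauchy_law d t) = space (Rd d)"
  by (auto simp: cauchy_law_def)

lemma prob_space_cauchy_law: "t > 0 \<Longrightarrow> prob_space (cauchy_law d t)"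
  by (rule prob_spaceI) (simp add: cauchy_law_def emeasure_density student_nn_integral_1 del: space_cauchy_law)

lemma nn_integral_cauchy_law:
  assumes "t > 0" and [measurable]: "\<psi> \<in> borel_measurable (Rd d)"
  shows "(\<integral>\<^sup>+z. \<psi> z \<partial>cauchy_law d t) = (\<integral>\<^sup>+n. (\<integral>\<^sup>+z. \<psi> (vscale d (t / n) z) \<partial>std_gaussian d) \<partial>chi_law 1)"
  using student_mixture[of 1 t \<psi> d] assms
  by (simp add: cauchy_law_def nn_integral_density mult.commute)

lemma gden_convolution:
  assumes a: "a > 0" and b: "b > 0"
  shows "(\<integral>\<^sup>+w. ennreal (gden d a (vsub d z w)) * ennreal (gden d b w) \<partial>Rd d) = ennreal (gden d (sqrt (a\<^sup>2 + b\<^sup>2)) z)"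
proof -
  interpret L: product_sigma_finite "\<lambda>_::nat. lborel :: real measure" by (rule product_sigma_finite_lborel)
  have c: "sqrt (a\<^sup>2 + b\<^sup>2) > 0" using a by (simp add: add_pos_nonneg)
  have "(\<integral>\<^sup>+w. ennreal (gden d a (vsub d z w)) * ennreal (gden d b w) \<partial>Rd d) =
    (\<integral>\<^sup>+w. (\<Prod>i<d. ennreal (normal_density 0 a (z i - w i) * normal_density 0 b (w i))) \<partial>Rd d)"
  proof (rule nn_integral_cong)
    fix w
    have "gden d a (vsub d z w) = gden d a (\<lambda>i. (z i - w i) - 0)" unfolding gden_def
      by (subst nrm_cong[of d "vsub d z w" "\<lambda>i. (z i - w i) - 0"]) auto
    also have "\<dots> = (\<Prod>i<d. normal_density 0 a (z i - w i))" using a by (rule gden_eq_prod)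
    finally have 1: "gden d a (vsub d z w) = (\<Prod>i<d. normal_density 0 a (z i - w i))" .
    have 2: "gden d b w = (\<Prod>i<d. normal_density 0 b (w i))" using gden_eq_prod[OF b, of d w "\<lambda>_. 0"] by simp
    show "ennreal (gden d a (vsub d z w)) * ennreal (gden d b w) = (\<Prod>i<d. ennreal (normal_density 0 a (z i - w i) * normal_density 0 b (w i)))"
      unfolding 1 2 by (simp add: ennreal_mult'[symmetric] prod_nonneg prod_ennreal prod.distrib)
  qed
  also have "\<dots> = (\<Prod>i<d. \<integral>\<^sup>+y. ennreal (normal_density 0 a (z i - y) * normal_density 0 b y) \<partial>lborel)"
    unfolding Rd_def by (rule L.product_nn_integral_prod) auto
  also have "\<dots> = (\<Prod>i<d. ennreal (normal_density 0 (sqrt (a\<^sup>2 + b\<^sup>2)) (z i)))"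
    using conv_normal_density_zero_mean[OF a b] by (intro prod.cong refl) (metis)
  also have "\<dots> = ennreal (gden d (sqrt (a\<^sup>2 + b\<^sup>2)) z)"
    using gden_eq_prod[OF c, of d z "\<lambda>_. 0"] by (simp add: prod_ennreal)
  finally show ?thesis .
qed

lemma gaussian_sum:
  assumes a: "a > 0" and b: "b > 0" and [measurable]: "\<psi> \<in> borel_measurable (Rd d)"
  shows "(\<integral>\<^sup>+x. (\<integral>\<^sup>+y. \<psi> (vadd d (vscale d a x) (vscale d b y)) \<partial>std_gaussian d) \<partial>std_gaussian d) =
    (\<integral>\<^sup>+x. \<psi> (vscale d (sqrt (a\<^sup>2 + b\<^sup>2)) x) \<partial>std_gaussian d)"
proof -
  interpret G: prob_space "std_gaussian d" by (rule prob_space_std_gaussian)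
  interpret R: sigma_finite_measure "Rd d" by (rule sigma_finite_Rd)
  interpret pair_sigma_finite "Rd d" "Rd d" ..
  have c: "sqrt (a\<^sup>2 + b\<^sup>2) > 0" using a by (simp add: add_pos_nonneg)
  have "(\<integral>\<^sup>+x. (\<integral>\<^sup>+y. \<psi> (vadd d (vscale d a x) (vscale d b y)) \<partial>std_gaussian d) \<partial>std_gaussian d) =
     (\<integral>\<^sup>+x. (\<integral>\<^sup>+y. \<psi> (vadd d x (vscale d b y)) \<partial>std_gaussian d) * ennreal (gden d a x) \<partial>Rd d)"
    using a by (subst gden_vscale[symmetric]) auto
  also have "\<dots> = (\<integral>\<^sup>+x. (\<integral>\<^sup>+w. \<psi> (vadd d w x) * ennreal (gden d a x) * ennreal (gden d b w) \<partial>Rd d) \<partial>Rd d)"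
  proof (rule nn_integral_cong)
    fix x assume [measurable]: "x \<in> space (Rd d)"
    have eq: "(\<integral>\<^sup>+y. \<psi> (vadd d x (vscale d b y)) \<partial>std_gaussian d) = (\<integral>\<^sup>+w. \<psi> (vadd d w x) * ennreal (gden d b w) \<partial>Rd d)"
      using b by (subst gden_vscale[symmetric]) (simp_all add: vadd_commute[of d _ x])
    show "(\<integral>\<^sup>+y. \<psi> (vadd d x (vscale d b y)) \<partial>std_gaussian d) * ennreal (gden d a x) =
      (\<integral>\<^sup>+w. \<psi> (vadd d w x) * ennreal (gden d a x) * ennreal (gden d b w) \<partial>Rd d)"
      unfolding eq
      by (subst nn_integral_multc[symmetric]) (auto intro!: nn_integral_cong simp: mult_ac)
  qed
  also have "\<dots> = (\<integral>\<^sup>+w. (\<integral>\<^sup>+x. \<psi> (vadd d w x) * ennreal (gden d a x) * ennreal (gden d b w) \<partial>Rd d) \<partial>Rd d)"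
    by (rule Fubini') measurable
  also have "\<dots> = (\<integral>\<^sup>+w. (\<integral>\<^sup>+z. \<psi> z * ennreal (gden d a (vsub d z w)) * ennreal (gden d b w) \<partial>Rd d) \<partial>Rd d)"
  proof (rule nn_integral_cong)
    fix w assume w [measurable]: "w \<in> space (Rd d)"
    have "(\<integral>\<^sup>+x. \<psi> (vadd d w x) * ennreal (gden d a x) * ennreal (gden d b w) \<partial>Rd d) =
      (\<integral>\<^sup>+x. (\<lambda>z. \<psi> z * ennreal (gden d a (vsub d z w)) * ennreal (gden d b w)) (vadd d w x) \<partial>Rd d)"
      by (intro nn_integral_cong) simp
    also have "\<dots> = (\<integral>\<^sup>+z. \<psi> z * ennreal (gden d a (vsub d z w)) * ennreal (gden d b w) \<partial>Rd d)"
      by (rule nn_integral_Rd_vadd) measurable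
    finally show "(\<integral>\<^sup>+x. \<psi> (vadd d w x) * ennreal (gden d a x) * ennreal (gden d b w) \<partial>Rd d) = \<dots>" .
  qed
  also have "\<dots> = (\<integral>\<^sup>+z. (\<integral>\<^sup>+w. \<psi> z * ennreal (gden d a (vsub d z w)) * ennreal (gden d b w) \<partial>Rd d) \<partial>Rd d)"
    by (rule Fubini') measurable
  also have "\<dots> = (\<integral>\<^sup>+z. \<psi> z * ennreal (gden d (sqrt (a\<^sup>2 + b\<^sup>2)) z) \<partial>Rd d)"
    using gden_convolution[OF a b] by (intro nn_integral_cong) (simp add: mult.assoc nn_integral_cmult)
  also have "\<dots> = (\<integral>\<^sup>+x. \<psi> (vscale d (sqrt (a\<^sup>2 + b\<^sup>2)) x) \<partial>std_gaussian d)"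
    using c by (subst gden_vscale) auto
  finally show ?thesis .
qed

text \<open>Given the two mixing variables m and n, the sum is a centred Gaussian vector with
  variance s^2 / m^2 + t^2 / n^2 in each coordinate. By \<open>levy_convolution\<close> this
  variance is distributed as that of a single Cauchy vector at time s + t.\<close>

theorem cauchy_semigroup:
  assumes s: "s > 0" and t: "t > 0" and [measurable]: "\<psi> \<in> borel_measurable (Rd d)"
  shows "(\<integral>\<^sup>+z. (\<integral>\<^sup>+w. \<psi> (vadd d z w) \<partial>cauchy_law d t) \<partial>cauchy_law d s) = (\<integral>\<^sup>+z. \<psi> z \<partial>cauchy_law d (s + t))"
proof -
  interpret G: prob_space "std_gaussian d" by (rule prob_space_std_gaussian)
  interpret C: prob_space "chi_law 1" by (rule prob_space_chi_law) simp
  interpret T: prob_space "cauchy_law d t" by (rule prob_space_cauchy_law[OF t])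
  interpret GC: pair_sigma_finite "std_gaussian d" "chi_law 1" ..
  define h where "h u = (\<integral>\<^sup>+z. \<psi> (vscale d (sqrt u) z) \<partial>std_gaussian d)" for u
  have [measurable]: "h \<in> borel_measurable borel" unfolding h_def by measurable
  have "(\<integral>\<^sup>+z. (\<integral>\<^sup>+w. \<psi> (vadd d z w) \<partial>cauchy_law d t) \<partial>cauchy_law d s) =
    (\<integral>\<^sup>+m. (\<integral>\<^sup>+x. (\<integral>\<^sup>+w. \<psi> (vadd d (vscale d (s / m) x) w) \<partial>cauchy_law d t) \<partial>std_gaussian d) \<partial>chi_law 1)"
    using s by (intro nn_integral_cauchy_law) measurable
  also have "\<dots> = (\<integral>\<^sup>+m. (\<integral>\<^sup>+x. (\<integral>\<^sup>+n. (\<integral>\<^sup>+y. \<psi> (vadd d (vscale d (s / m) x) (vscale d (t / n) y)) \<partial>std_gaussian d) \<partial>chi_law 1) \<partial>std_gaussian d) \<partial>chi_law 1)"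
    using t by (intro nn_integral_cong nn_integral_cauchy_law) measurable
  also have "\<dots> = (\<integral>\<^sup>+m. (\<integral>\<^sup>+n. (\<integral>\<^sup>+x. (\<integral>\<^sup>+y. \<psi> (vadd d (vscale d (s / m) x) (vscale d (t / n) y)) \<partial>std_gaussian d) \<partial>std_gaussian d) \<partial>chi_law 1) \<partial>chi_law 1)"
    by (intro nn_integral_cong GC.Fubini'[symmetric]) measurable
  also have "\<dots> = (\<integral>\<^sup>+m. (\<integral>\<^sup>+n. h (s\<^sup>2 / m\<^sup>2 + t\<^sup>2 / n\<^sup>2) \<partial>chi_law 1) \<partial>chi_law 1)"
  proof (intro nn_integral_cong_AE, use AE_chi_law_pos in eventually_elim, intro nn_integral_cong_AE, use AE_chi_law_pos in eventually_elim)
    fix m n :: real assume "m > 0" "n > 0"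
    then show "(\<integral>\<^sup>+x. (\<integral>\<^sup>+y. \<psi> (vadd d (vscale d (s / m) x) (vscale d (t / n) y)) \<partial>std_gaussian d) \<partial>std_gaussian d) = h (s\<^sup>2 / m\<^sup>2 + t\<^sup>2 / n\<^sup>2)"
      using s t gaussian_sum[of "s / m" "t / n" \<psi> d] by (simp add: h_def power_divide)
  qed
  also have "\<dots> = (\<integral>\<^sup>+n. h ((s + t)\<^sup>2 / n\<^sup>2) \<partial>chi_law 1)"
    using s t by (intro levy_convolution) auto
  also have "\<dots> = (\<integral>\<^sup>+n. (\<integral>\<^sup>+z. \<psi> (vscale d ((s + t) / n) z) \<partial>std_gaussian d) \<partial>chi_law 1)"
  proof (intro nn_integral_cong_AE, use AE_chi_law_pos in eventually_elim)
    fix n :: real assume "n > 0"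
    then have "sqrt ((s + t)\<^sup>2 / n\<^sup>2) = (s + t) / n" using s t by (simp add: real_sqrt_divide)
    then show "h ((s + t)\<^sup>2 / n\<^sup>2) = (\<integral>\<^sup>+z. \<psi> (vscale d ((s + t) / n) z) \<partial>std_gaussian d)"
      by (simp add: h_def)
  qed
  also have "\<dots> = (\<integral>\<^sup>+z. \<psi> z \<partial>cauchy_law d (s + t))"
    using s t by (intro nn_integral_cauchy_law[symmetric]) auto
  finally show ?thesis .
qed

lemma measurable_vadd_const [measurable (raw)]:
  assumes [measurable]: "g \<in> measurable M (Rd d)"
  shows "(\<lambda>z. vadd d x (g z)) \<in> measurable M (Rd d)"
  unfolding vadd_def
  by (intro measurable_Rd_restrict borel_measurable_add borel_measurable_const Rd_component assms) auto

lemma vadd_assoc: "vadd d (vadd d x y) z = vadd d x (vadd d y z)"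
  by (auto simp: vadd_def)

section \<open>Energy dissipation\<close>

text \<open>Nonnegativity is built in so that estimates can pass freely between Bochner integrals,
  where subtraction is available, and nonnegative integrals, where Tonelli's theorem is.\<close>

definition bdd :: "nat \<Rightarrow> real \<Rightarrow> ((nat \<Rightarrow> real) \<Rightarrow> real) \<Rightarrow> bool" where
  "bdd d M g \<longleftrightarrow> g \<in> borel_measurable (Rd d) \<and> (\<forall>x\<in>space (Rd d). 0 \<le> g x \<and> g x \<le> M)"

lemma bddD:
  assumes "bdd d M g"
  shows "g \<in> borel_measurable (Rd d)" "x \<in> space (Rd d) \<Longrightarrow> 0 \<le> g x" "x \<in> space (Rd d) \<Longrightarrow> g x \<le> M"
  using assms by (auto simp: bdd_def)

lemma bdd_vadd [simp]: "bdd d M g \<Longrightarrow> 0 \<le> g (vadd d x z)" "bdd d M g \<Longrightarrow> g (vadd d x z) \<le> M"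
  by (auto simp: bdd_def)

lemma bdd_M_nonneg: "bdd d M g \<Longrightarrow> 0 \<le> M"
  using bdd_vadd[of d M g undefined undefined] by linarith

lemma bdd_mult: "bdd d M f \<Longrightarrow> bdd d N g \<Longrightarrow> bdd d (M * N) (\<lambda>x. f x * g x)"
  by (auto simp: bdd_def intro!: mult_mono elim: order_trans)

lemma bdd_square: "bdd d M f \<Longrightarrow> bdd d (M\<^sup>2) (\<lambda>x. (f x)\<^sup>2)"
  using bdd_mult[of d M f M f] by (simp add: power2_eq_square)

lemma bdd_cmult: "bdd d M f \<Longrightarrow> c \<ge> 0 \<Longrightarrow> bdd d (c * M) (\<lambda>x. c * f x)"
  by (auto simp: bdd_def intro!: mult_left_mono)

lemma integrable_bdd_shift:
  assumes t: "t > 0" and g: "bdd d M g"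
  shows "integrable (cauchy_law d t) (\<lambda>z. g (vadd d x z))"
proof -
  interpret prob_space "cauchy_law d t" by (rule prob_space_cauchy_law[OF t])
  note bddD(1)[OF g, measurable]
  show ?thesis
    using bdd_vadd[OF g] by (intro integrable_const_bound[of _ M]) auto
qed

section \<open>The Cauchy semigroup on bounded functions\<close>

definition cauchy_op :: "nat \<Rightarrow> real \<Rightarrow> ((nat \<Rightarrow> real) \<Rightarrow> real) \<Rightarrow> (nat \<Rightarrow> real) \<Rightarrow> real" where
  "cauchy_op d t g x = (LINT z|cauchy_law d t. g (vadd d x z))"

lemma cauchy_op_bounds:
  assumes t: "t > 0" and g: "bdd d M g"
  shows "0 \<le> cauchy_op d t g x" "cauchy_op d t g x \<le> M"
proof -
  interpret prob_space "cauchy_law d t" by (rule prob_space_cauchy_law[OF t])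
  show "0 \<le> cauchy_op d t g x" unfolding cauchy_op_def using g by (intro integral_nonneg_AE) auto
  have "cauchy_op d t g x \<le> (LINT z|cauchy_law d t. M)"
    unfolding cauchy_op_def using g by (intro integral_mono integrable_bdd_shift[OF t g]) auto
  then show "cauchy_op d t g x \<le> M" using prob_space by simp
qed

lemma measurable_cauchy_op:
  assumes t: "t > 0" and [measurable]: "g \<in> borel_measurable (Rd d)"
  shows "cauchy_op d t g \<in> borel_measurable (Rd d)"
proof -
  interpret prob_space "cauchy_law d t" by (rule prob_space_cauchy_law[OF t])
  show ?thesis unfolding cauchy_op_def[abs_def] by measurable
qed

lemma bdd_cauchy_op: "t > 0 \<Longrightarrow> bdd d M g \<Longrightarrow> bdd d M (cauchy_op d t g)"
  using cauchy_op_bounds[of t d M g] measurable_cauchy_op[of t g d] by (auto simp: bdd_def)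

lemma ennreal_cauchy_op:
  assumes t: "t > 0" and g: "bdd d M g"
  shows "ennreal (cauchy_op d t g x) = (\<integral>\<^sup>+z. ennreal (g (vadd d x z)) \<partial>cauchy_law d t)"
  unfolding cauchy_op_def using g integrable_bdd_shift[OF t g] by (intro nn_integral_eq_integral[symmetric]) auto

lemma cauchy_op_semigroup:
  assumes s: "s > 0" and t: "t > 0" and g: "bdd d M g"
  shows "cauchy_op d s (cauchy_op d t g) x = cauchy_op d (s + t) g x"
proof -
  note bddD(1)[OF g, measurable]
  have "ennreal (cauchy_op d s (cauchy_op d t g) x) =
      (\<integral>\<^sup>+z. (\<integral>\<^sup>+w. ennreal (g (vadd d x (vadd d z w))) \<partial>cauchy_law d t) \<partial>cauchy_law d s)"
    by (simp add: ennreal_cauchy_op[OF s bdd_cauchy_op[OF t g]] ennreal_cauchy_op[OF t g] vadd_assoc)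
  also have "\<dots> = ennreal (cauchy_op d (s + t) g x)"
    using s t by (subst cauchy_semigroup[OF s t, of "\<lambda>z. ennreal (g (vadd d x z))"])
      (simp_all add: ennreal_cauchy_op[OF _ g])
  finally show ?thesis
    using s t cauchy_op_bounds[OF _ bdd_cauchy_op[OF t g]] cauchy_op_bounds[OF _ g] by simp
qed

lemma cauchy_op_add:
  assumes "t > 0" "bdd d M f" "bdd d N g"
  shows "cauchy_op d t (\<lambda>x. f x + g x) x = cauchy_op d t f x + cauchy_op d t g x"
  using assms unfolding cauchy_op_def by (intro Bochner_Integration.integral_add integrable_bdd_shift)

lemma cauchy_op_cmult: "cauchy_op d t (\<lambda>x. c * f x) x = c * cauchy_op d t f x"
  by (simp add: cauchy_op_def)

lemma cauchy_op_mono: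
  assumes "t > 0" "bdd d M f" "bdd d N g" "\<And>x. x \<in> space (Rd d) \<Longrightarrow> f x \<le> g x"
  shows "cauchy_op d t f x \<le> cauchy_op d t g x"
  using assms unfolding cauchy_op_def by (intro integral_mono integrable_bdd_shift) auto

section \<open>Conditional variances along the semigroup\<close>

definition cauchy_var :: "nat \<Rightarrow> real \<Rightarrow> ((nat \<Rightarrow> real) \<Rightarrow> real) \<Rightarrow> (nat \<Rightarrow> real) \<Rightarrow> real" where
  "cauchy_var d t g x = (LINT z|cauchy_law d t. (g (vadd d x z) - cauchy_op d t g x)\<^sup>2)"

lemma cauchy_var_eq:
  assumes t: "t > 0" and g: "bdd d M g"
  shows "cauchy_var d t g x = cauchy_op d t (\<lambda>x. (g x)\<^sup>2) x - (cauchy_op d t g x)\<^sup>2"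
proof -
  interpret prob_space "cauchy_law d t" by (rule prob_space_cauchy_law[OF t])
  define c where "c = cauchy_op d t g x"
  have "cauchy_var d t g x = (LINT z|cauchy_law d t. (g (vadd d x z))\<^sup>2 - 2 * c * g (vadd d x z) + c\<^sup>2)"
    unfolding cauchy_var_def c_def[symmetric] by (simp add: power2_eq_square algebra_simps)
  also have "\<dots> = (LINT z|cauchy_law d t. (g (vadd d x z))\<^sup>2) - 2 * c * (LINT z|cauchy_law d t. g (vadd d x z)) + c\<^sup>2"
    using integrable_bdd_shift[OF t bdd_square[OF g], of x] integrable_bdd_shift[OF t g, of x] prob_space by simp
  also have "(LINT z|cauchy_law d t. (g (vadd d x z))\<^sup>2) = cauchy_op d t (\<lambda>x. (g x)\<^sup>2) x"
    by (simp add: cauchy_op_def)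
  also have "(LINT z|cauchy_law d t. g (vadd d x z)) = c" by (simp add: cauchy_op_def c_def)
  finally show ?thesis by (simp add: c_def power2_eq_square)
qed

lemma cauchy_var_bounds:
  assumes t: "t > 0" and g: "bdd d M g"
  shows "0 \<le> cauchy_var d t g x" "cauchy_var d t g x \<le> M\<^sup>2"
proof -
  show "0 \<le> cauchy_var d t g x" by (simp add: cauchy_var_def)
  show "cauchy_var d t g x \<le> M\<^sup>2"
    using cauchy_op_bounds(2)[OF t bdd_square[OF g], of x] cauchy_var_eq[OF t g, of x]
      zero_le_power2[of "cauchy_op d t g x"] by linarith
qed

lemma bdd_cauchy_var:
  assumes t: "t > 0" and g: "bdd d M g"
  shows "bdd d (M\<^sup>2) (cauchy_var d t g)"
proof -
  note [measurable] = measurable_cauchy_op[OF t] bddD(1)[OF g]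
  have "cauchy_var d t g = (\<lambda>x. cauchy_op d t (\<lambda>x. (g x)\<^sup>2) x - (cauchy_op d t g x)\<^sup>2)"
    by (rule ext) (rule cauchy_var_eq[OF t g])
  then have "cauchy_var d t g \<in> borel_measurable (Rd d)" by simp
  then show ?thesis using cauchy_var_bounds[OF t g] by (auto simp: bdd_def)
qed

text \<open>The law of total variance for a walk of duration s followed by one of duration t, with
  the semigroup property identifying the composed means.\<close>

lemma cauchy_var_add:
  assumes s: "s > 0" and t: "t > 0" and g: "bdd d M g"
  shows "cauchy_var d (s + t) g x = cauchy_var d s (cauchy_op d t g) x + cauchy_op d s (cauchy_var d t g) x"
proof -
  have "cauchy_op d s (\<lambda>x. cauchy_var d t g x + (cauchy_op d t g x)\<^sup>2) x =
     cauchy_op d s (cauchy_var d t g) x + cauchy_op d s (\<lambda>x. (cauchy_op d t g x)\<^sup>2) x"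
    by (rule cauchy_op_add[OF s bdd_cauchy_var[OF t g] bdd_square[OF bdd_cauchy_op[OF t g]]])
  moreover have "(\<lambda>x. cauchy_var d t g x + (cauchy_op d t g x)\<^sup>2) = cauchy_op d t (\<lambda>x. (g x)\<^sup>2)"
    by (auto simp: cauchy_var_eq[OF t g])
  moreover have "s + t > 0" using s t by simp
  ultimately show ?thesis
    using s t cauchy_op_semigroup[OF s t g, of x] cauchy_op_semigroup[OF s t bdd_square[OF g], of x]
    by (simp add: cauchy_var_eq[OF _ g] cauchy_var_eq[OF s bdd_cauchy_op[OF t g]])
qed

text \<open>The analogue for convolution semigroups of the commutation between gradient and heat
  flow: the centred increments of the averaged function are averages of the centred increments of
  \<open>g\<close> seen from shifted points, so Jensen's inequality applies.\<close>

lemma cauchy_var_op_le: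
  assumes h: "h > 0" and s: "s > 0" and g: "bdd d M g"
  shows "cauchy_var d h (cauchy_op d s g) x \<le> cauchy_op d s (cauchy_var d h g) x"
proof -
  interpret H: prob_space "cauchy_law d h" by (rule prob_space_cauchy_law[OF h])
  interpret S: prob_space "cauchy_law d s" by (rule prob_space_cauchy_law[OF s])
  interpret HS: pair_prob_space "cauchy_law d h" "cauchy_law d s" ..
  note [measurable] = measurable_cauchy_op[OF h] measurable_cauchy_op[OF s] bddD(1)[OF g]
  \<comment> \<open>Averaged over \<open>w\<close>, this is the increment of
    \<open>cauchy_op d s g\<close> along \<open>z\<close>, centred at its mean over
    \<open>z\<close>. Averaged square over \<open>z\<close> at fixed \<open>w\<close>, it is the
    variance of \<open>g\<close> from the point shifted by \<open>w\<close>.\<close>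
  define k where "k z w = g (vadd d x (vadd d z w)) - cauchy_op d h g (vadd d x w)" for z w
  have km [measurable]: "(\<lambda>(z, w). k z w) \<in> borel_measurable (cauchy_law d h \<Otimes>\<^sub>M cauchy_law d s)"
    unfolding k_def by measurable
  have [measurable]: "k z \<in> borel_measurable (Rd d)" for z unfolding k_def by measurable
  have kb: "\<bar>k z w\<bar> \<le> M" for z w
    using bdd_vadd[OF g] cauchy_op_bounds[OF h g] unfolding k_def by (smt (verit))
  have kb2: "(k z w)\<^sup>2 \<le> M\<^sup>2" for z w
    using kb[of z w] by (metis abs_le_square_iff abs_of_nonneg bdd_M_nonneg[OF g])
  have ki: "integrable (cauchy_law d s) (k z)" for z
    using kb by (intro S.integrable_const_bound[of _ M]) auto
  have ki2: "integrable (cauchy_law d s) (\<lambda>w. (k z w)\<^sup>2)" for z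
    using kb2 by (intro S.integrable_const_bound[of _ "M\<^sup>2"]) auto
  have kpi: "integrable (cauchy_law d h \<Otimes>\<^sub>M cauchy_law d s) (\<lambda>(z, w). (k z w)\<^sup>2)"
    using kb2 by (intro HS.integrable_const_bound[of _ "M\<^sup>2"]) auto
  have "cauchy_op d h (cauchy_op d s g) x = cauchy_op d s (cauchy_op d h g) x"
    by (simp add: cauchy_op_semigroup[OF h s g] cauchy_op_semigroup[OF s h g] add.commute)
  then have "cauchy_op d s g (vadd d x z) - cauchy_op d h (cauchy_op d s g) x = (LINT w|cauchy_law d s. k z w)" for z
    unfolding k_def using integrable_bdd_shift[OF s g, of "vadd d x z"]
      integrable_bdd_shift[OF s bdd_cauchy_op[OF h g], of x]
    by (simp add: cauchy_op_def[of d s] vadd_assoc)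
  then have "cauchy_var d h (cauchy_op d s g) x = (LINT z|cauchy_law d h. (LINT w|cauchy_law d s. k z w)\<^sup>2)"
    by (simp add: cauchy_var_def)
  also have "\<dots> \<le> (LINT z|cauchy_law d h. (LINT w|cauchy_law d s. (k z w)\<^sup>2))"
  proof (rule integral_mono)
    have jensen: "(LINT w|cauchy_law d s. k z w)\<^sup>2 \<le> (LINT w|cauchy_law d s. (k z w)\<^sup>2)" for z
      using S.variance_positive[of "k z"] S.variance_eq[OF ki ki2, of z] by simp
    show "(LINT w|cauchy_law d s. k z w)\<^sup>2 \<le> (LINT w|cauchy_law d s. (k z w)\<^sup>2)" for z by (rule jensen)
    have le: "(LINT w|cauchy_law d s. (k z w)\<^sup>2) \<le> M\<^sup>2" for z
      using integral_mono[OF ki2 S.integrable_const[of "M\<^sup>2"] kb2, of z] S.prob_space by simp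
    show "integrable (cauchy_law d h) (\<lambda>z. LINT w|cauchy_law d s. (k z w)\<^sup>2)"
      using le by (intro H.integrable_const_bound[of _ "M\<^sup>2"]) auto
    show "integrable (cauchy_law d h) (\<lambda>z. (LINT w|cauchy_law d s. k z w)\<^sup>2)"
      using order_trans[OF jensen le] by (intro H.integrable_const_bound[of _ "M\<^sup>2"]) auto
  qed
  also have "\<dots> = (LINT w|cauchy_law d s. (LINT z|cauchy_law d h. (k z w)\<^sup>2))"
    using HS.Fubini_integral[OF kpi] by simp
  also have "\<dots> = cauchy_op d s (cauchy_var d h g) x"
  proof -
    have "vadd d x (vadd d z w) = vadd d (vadd d x w) z" for z w by (auto simp: vadd_def)
    then show ?thesis unfolding cauchy_op_def[of d s] cauchy_var_def k_def by simp
  qed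
  finally show ?thesis .
qed

text \<open>Discrete form of the bound of the variance by time multiplied with the carre du champ of
  the final function: \<open>cauchy_var_add\<close> peels off one piece of length h, and
  \<open>cauchy_var_op_le\<close> moves the remaining operator inside. Counting from two pieces
  keeps the smoothing time (n + 1) h positive, where \<open>cauchy_op\<close> represents the
  semigroup.\<close>

lemma cauchy_var_iterate:
  assumes h: "h > 0" and g: "bdd d M g"
  shows "cauchy_var d (real (n + 2) * h) g x \<ge> real (n + 2) * cauchy_var d h (cauchy_op d (real (n + 1) * h) g) x"
proof (induction n arbitrary: x)
  case 0
  have "cauchy_var d (h + h) g x = cauchy_var d h (cauchy_op d h g) x + cauchy_op d h (cauchy_var d h g) x"
    by (rule cauchy_var_add[OF h h g])
  then show ?case using cauchy_var_op_le[OF h h g, of x] by (simp add: algebra_simps)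
next
  case (Suc n)
  define t where "t = real (n + 2) * h"
  define r where "r = real (n + 1) * h"
  have t: "t > 0" and r: "r > 0" using h by (auto simp: t_def r_def)
  have hr: "h + r = t" by (simp add: t_def r_def algebra_simps)
  have t2: "real (Suc n + 2) * h = h + t" by (simp add: t_def algebra_simps)
  have b: "bdd d M (cauchy_op d r g)" by (rule bdd_cauchy_op[OF r g])
  have "cauchy_op d h (\<lambda>y. real (n + 2) * cauchy_var d h (cauchy_op d r g) y) x \<le> cauchy_op d h (cauchy_var d t g) x"
    using Suc.IH by (intro cauchy_op_mono[OF h bdd_cmult[OF bdd_cauchy_var[OF h b]] bdd_cauchy_var[OF t g]])
      (auto simp: t_def r_def)
  moreover have "cauchy_var d h (cauchy_op d h (cauchy_op d r g)) x \<le> cauchy_op d h (cauchy_var d h (cauchy_op d r g)) x"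
    by (rule cauchy_var_op_le[OF h h b])
  moreover have "cauchy_op d h (cauchy_op d r g) = cauchy_op d t g"
    using cauchy_op_semigroup[OF h r g] by (auto simp: hr)
  ultimately have "real (n + 2) * cauchy_var d h (cauchy_op d t g) x \<le> cauchy_op d h (cauchy_var d t g) x"
    by (simp add: cauchy_op_cmult) (meson mult_left_mono of_nat_0_le_iff order_trans add_nonneg_nonneg zero_le_numeral)
  then show ?case
    unfolding t2 cauchy_var_add[OF h t g] by (simp add: t_def algebra_simps)
qed

text \<open>The dominating function for letting the time tend to \<eta> from below: the factor t at
  most doubles against \<eta> / 2, and the rest decreases in t.\<close>

lemma student_le_double:
  assumes "\<eta> > 0" "\<eta> / 2 \<le> t" "t \<le> \<eta>"
  shows "student d 1 t z \<le> 2 * student d 1 (\<eta> / 2) z"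
proof -
  have "((nrm d z)\<^sup>2 + t\<^sup>2) powr (- (real d + 1) / 2) \<le> ((nrm d z)\<^sup>2 + (\<eta> / 2)\<^sup>2) powr (- (real d + 1) / 2)"
    using assms by (intro powr_mono2') (auto simp: add_nonneg_pos intro!: power_mono)
  then show ?thesis
    using assms student_const_pos[of 1 d] unfolding student_def
    by (simp add: mult.assoc mult_left_mono mult_mono)
qed

lemma integral_cauchy_law:
  assumes t: "t > 0" and [measurable]: "f \<in> borel_measurable (Rd d)"
  shows "(LINT z|cauchy_law d t. f z) = (LINT z|Rd d. student d 1 t z * f z)"
  unfolding cauchy_law_def using t by (subst integral_density) auto

lemma cauchy_op_continuous_time:
  assumes \<eta>: "\<eta> > 0" and g: "bdd d M g"
  shows "(\<lambda>n. cauchy_op d (\<eta> - \<eta> / real (n + 2)) g x) \<longlonglongrightarrow> cauchy_op d \<eta> g x"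
proof -
  note [measurable] = bddD(1)[OF g]
  define t where "t n = \<eta> - \<eta> / real (n + 2)" for n :: nat
  have t: "t n > 0" "\<eta> / 2 \<le> t n" "t n \<le> \<eta>" for n
  proof -
    have "\<eta> / real (n + 2) \<le> \<eta> / 2" using \<eta> by (intro divide_left_mono) auto
    moreover have "\<eta> / real (n + 2) > 0" using \<eta> by simp
    ultimately show "t n > 0" "\<eta> / 2 \<le> t n" "t n \<le> \<eta>" using \<eta> unfolding t_def by linarith+
  qed
  have lim: "t \<longlonglongrightarrow> \<eta>" unfolding t_def by real_asymp
  have "(\<lambda>n. LINT z|Rd d. student d 1 (t n) z * g (vadd d x z)) \<longlonglongrightarrow> (LINT z|Rd d. student d 1 \<eta> z * g (vadd d x z))"
  proof (rule integral_dominated_convergence[where w = "\<lambda>z. 2 * student d 1 (\<eta> / 2) z * M"])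
    show "integrable (Rd d) (\<lambda>z. 2 * student d 1 (\<eta> / 2) z * M)"
      using student_integral_1(1)[of 1 "\<eta> / 2" d] \<eta> by simp
    show "AE z in Rd d. (\<lambda>n. student d 1 (t n) z * g (vadd d x z)) \<longlonglongrightarrow> student d 1 \<eta> z * g (vadd d x z)"
    proof (rule AE_I2)
      fix z
      have "(nrm d z)\<^sup>2 + \<eta>\<^sup>2 \<noteq> 0" using \<eta> by (simp add: add_nonneg_eq_0_iff)
      then show "(\<lambda>n. student d 1 (t n) z * g (vadd d x z)) \<longlonglongrightarrow> student d 1 \<eta> z * g (vadd d x z)"
        unfolding student_def using \<eta> by (intro tendsto_intros lim) auto
    qed
    show "AE z in Rd d. norm (student d 1 (t n) z * g (vadd d x z)) \<le> 2 * student d 1 (\<eta> / 2) z * M" for n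
    proof (rule AE_I2)
      fix z
      have "student d 1 (t n) z * g (vadd d x z) \<le> 2 * student d 1 (\<eta> / 2) z * M"
        using student_le_double[OF \<eta> t(2)[of n] t(3)[of n], where d = d and z = z] g t(1) \<eta>
        by (intro mult_mono) (auto simp: bdd_M_nonneg)
      then show "norm (student d 1 (t n) z * g (vadd d x z)) \<le> 2 * student d 1 (\<eta> / 2) z * M"
        using g t(1)[of n] by (simp add: abs_mult)
    qed
  qed measurable
  then show ?thesis
    using t \<eta> unfolding t_def[symmetric] cauchy_op_def by (simp add: integral_cauchy_law)
qed

text \<open>
  Splitting the time interval into \<open>n\<close> pieces bounds the variance from below by
  \<open>n\<close> short-time variances, which converge to the carre du champ of the Cauchy semigroup.
\<close>

theorem cauchy_var_ge_energy:
  assumes d: "d \<ge> 1" and \<eta>: "\<eta> > 0" and g: "bdd d M g" and x: "x \<in> space (Rd d)"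
  shows "ennreal \<eta> * (\<integral>\<^sup>+z. ennreal ((cauchy_op d \<eta> g (vadd d x z) - cauchy_op d \<eta> g x)\<^sup>2) *
      ennreal (c_frac d / nrm d z ^ (d + 1)) \<partial>Rd d) \<le> ennreal (cauchy_var d \<eta> g x)"
proof -
  note [measurable] = bddD(1)[OF g] x
  define c where "c = cauchy_op d \<eta> g x"
  define u where "u n = cauchy_op d (\<eta> - \<eta> / real (n + 2)) g" for n :: nat
  \<comment> \<open>The weight is n + 2 times the Cauchy density at time \<eta> / (n + 2). It tends
    to \<eta> times the jump kernel, while the squared increment tends to that of
    \<open>cauchy_op d \<eta> g\<close>. Fatou's lemma suffices, since the variance is bounded from
    below.\<close>
  define F where "F n z = ennreal ((u n (vadd d x z) - c)\<^sup>2) * ennreal (real (n + 2) * student d 1 (\<eta> / real (n + 2)) z)" for n :: nat and z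
  have pos: "\<eta> / real (n + 2) > 0" "\<eta> - \<eta> / real (n + 2) > 0" for n
  proof -
    have "\<eta> / real (n + 2) \<le> \<eta> / 2" using \<eta> by (intro divide_left_mono) auto
    moreover show "\<eta> / real (n + 2) > 0" using \<eta> by simp
    ultimately show "\<eta> - \<eta> / real (n + 2) > 0" using \<eta> by linarith
  qed
  have [measurable]: "u n \<in> borel_measurable (Rd d)" for n
    unfolding u_def by (rule measurable_cauchy_op[OF pos(2)]) measurable
  have [measurable]: "cauchy_op d \<eta> g \<in> borel_measurable (Rd d)" by (rule measurable_cauchy_op[OF \<eta>]) measurable
  have bu: "bdd d M (u n)" for n unfolding u_def by (rule bdd_cauchy_op[OF pos(2) g])
  have Fm [measurable]: "F n \<in> borel_measurable (Rd d)" for n unfolding F_def by measurable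
  have int: "(\<integral>\<^sup>+z. F n z \<partial>Rd d) \<le> ennreal (cauchy_var d \<eta> g x)" for n
  proof -
    define h where "h = \<eta> / real (n + 2)"
    have h: "h > 0" using pos(1) by (simp add: h_def)
    have eq1: "real (n + 2) * h = \<eta>" by (simp add: h_def)
    have eq2: "real (n + 1) * h = \<eta> - \<eta> / real (n + 2)" by (simp add: h_def field_simps)
    have eq3: "h + (\<eta> - \<eta> / real (n + 2)) = \<eta>" by (simp add: h_def)
    \<comment> \<open>The short step and the remaining time add up to \<eta>, so the centre is the
      same for all n and the integral of \<open>F n\<close> is exactly n + 2 short-time
      variances.\<close>
    have cc: "cauchy_op d h (u n) x = c"
      unfolding u_def c_def using cauchy_op_semigroup[OF h pos(2) g] by (simp only: eq3)
    interpret H: prob_space "cauchy_law d h" by (rule prob_space_cauchy_law[OF h])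
    have bnd: "(u n (vadd d x z) - c)\<^sup>2 \<le> M\<^sup>2" for z
    proof -
      have "\<bar>u n (vadd d x z) - c\<bar> \<le> M"
        using bdd_vadd[OF bu, of n x z] cauchy_op_bounds[OF \<eta> g, of x] unfolding c_def by linarith
      then show ?thesis by (metis abs_le_square_iff abs_of_nonneg bdd_M_nonneg[OF g])
    qed
    have "(\<integral>\<^sup>+z. F n z \<partial>Rd d) = ennreal (real (n + 2)) * (\<integral>\<^sup>+z. ennreal ((u n (vadd d x z) - c)\<^sup>2) \<partial>cauchy_law d h)"
      using h unfolding F_def h_def[symmetric] cauchy_law_def
      by (subst nn_integral_density) (auto simp: nn_integral_cmult[symmetric] ennreal_mult' mult_ac intro!: nn_integral_cong)
    also have "(\<integral>\<^sup>+z. ennreal ((u n (vadd d x z) - c)\<^sup>2) \<partial>cauchy_law d h) = ennreal (cauchy_var d h (u n) x)"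
      unfolding cauchy_var_def cc using bnd
      by (intro nn_integral_eq_integral H.integrable_const_bound[of _ "M\<^sup>2"]) auto
    also have "ennreal (real (n + 2)) * ennreal (cauchy_var d h (u n) x) = ennreal (real (n + 2) * cauchy_var d h (u n) x)"
      by (rule ennreal_mult'[symmetric]) simp
    also have "\<dots> \<le> ennreal (cauchy_var d \<eta> g x)"
      using cauchy_var_iterate[OF h g, of n x] unfolding eq1 eq2 u_def by (rule ennreal_leI)
    finally show ?thesis .
  qed
  have "AE z in Rd d. nrm d z > 0" by (rule AE_Rd_nrm_pos[OF d])
  then have lim: "AE z in Rd d. liminf (\<lambda>n. F n z) =
      ennreal \<eta> * (ennreal ((cauchy_op d \<eta> g (vadd d x z) - c)\<^sup>2) * ennreal (c_frac d / nrm d z ^ (d + 1)))"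
  proof eventually_elim
    case (elim z)
    have z2: "(nrm d z)\<^sup>2 + 0\<^sup>2 \<noteq> 0" using elim by simp
    have e0: "(\<lambda>n. \<eta> / real (n + 2)) \<longlonglongrightarrow> 0" by real_asymp
    have "(\<lambda>n. c_frac d * \<eta> * ((nrm d z)\<^sup>2 + (\<eta> / real (n + 2))\<^sup>2) powr (- (real d + 1) / 2)) \<longlonglongrightarrow>
       c_frac d * \<eta> * ((nrm d z)\<^sup>2 + 0\<^sup>2) powr (- (real d + 1) / 2)"
      using z2 by (intro tendsto_intros e0) auto
    moreover have "real (n + 2) * student d 1 (\<eta> / real (n + 2)) z = c_frac d * \<eta> * ((nrm d z)\<^sup>2 + (\<eta> / real (n + 2))\<^sup>2) powr (- (real d + 1) / 2)" for n
      using \<eta> by (simp add: student_def c_frac_eq)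
    moreover have "((nrm d z)\<^sup>2 + 0\<^sup>2) powr (- (real d + 1) / 2) = 1 / nrm d z ^ (d + 1)"
    proof -
      have "((nrm d z)\<^sup>2) powr (- (real d + 1) / 2) = nrm d z powr (- (real d + 1))"
      proof -
        have "2 * (- (real d + 1) / 2) = - (real d + 1)" by simp
        then show ?thesis
          using elim powr_powr[of "nrm d z" 2 "- (real d + 1) / 2"] by (simp only: powr_numeral)
      qed
      also have "\<dots> = 1 / nrm d z powr (real d + 1)" by (rule powr_minus_divide)
      also have "nrm d z powr (real d + 1) = nrm d z ^ (d + 1)"
        using elim powr_realpow[of "nrm d z" "d + 1"] by (simp add: add.commute)
      finally show ?thesis by simp
    qed
    ultimately have l1: "(\<lambda>n. real (n + 2) * student d 1 (\<eta> / real (n + 2)) z) \<longlonglongrightarrow> \<eta> * (c_frac d / nrm d z ^ (d + 1))"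
      by (simp add: mult.commute)
    have l2: "(\<lambda>n. (u n (vadd d x z) - c)\<^sup>2) \<longlonglongrightarrow> (cauchy_op d \<eta> g (vadd d x z) - c)\<^sup>2"
      unfolding u_def by (intro tendsto_intros cauchy_op_continuous_time[OF \<eta> g])
    have "(\<lambda>n. ennreal ((u n (vadd d x z) - c)\<^sup>2 * (real (n + 2) * student d 1 (\<eta> / real (n + 2)) z))) \<longlonglongrightarrow>
       ennreal ((cauchy_op d \<eta> g (vadd d x z) - c)\<^sup>2 * (\<eta> * (c_frac d / nrm d z ^ (d + 1))))"
      by (intro tendsto_ennrealI tendsto_mult l1 l2)
    then have "(\<lambda>n. F n z) \<longlonglongrightarrow> ennreal ((cauchy_op d \<eta> g (vadd d x z) - c)\<^sup>2 * (\<eta> * (c_frac d / nrm d z ^ (d + 1))))"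
      unfolding F_def by (simp add: ennreal_mult')
    then have "liminf (\<lambda>n. F n z) = ennreal ((cauchy_op d \<eta> g (vadd d x z) - c)\<^sup>2 * (\<eta> * (c_frac d / nrm d z ^ (d + 1))))"
      by (intro lim_imp_Liminf) auto
    also have "\<dots> = ennreal \<eta> * (ennreal ((cauchy_op d \<eta> g (vadd d x z) - c)\<^sup>2) * ennreal (c_frac d / nrm d z ^ (d + 1)))"
    proof -
      have aux: "ennreal (A * (\<eta> * B)) = ennreal \<eta> * (ennreal A * ennreal B)" if "A \<ge> 0" for A B
        using that \<eta> by (simp only: ennreal_mult' less_imp_le mult.left_commute)
      from aux[OF zero_le_power2] show ?thesis .
    qed
    finally show ?case .
  qed
  have "ennreal \<eta> * (\<integral>\<^sup>+z. ennreal ((cauchy_op d \<eta> g (vadd d x z) - c)\<^sup>2) * ennreal (c_frac d / nrm d z ^ (d + 1)) \<partial>Rd d) =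
     (\<integral>\<^sup>+z. liminf (\<lambda>n. F n z) \<partial>Rd d)"
    using lim by (subst nn_integral_cmult[symmetric], measurable) (auto intro!: nn_integral_cong_AE)
  also have "\<dots> \<le> liminf (\<lambda>n. \<integral>\<^sup>+z. F n z \<partial>Rd d)"
    by (rule nn_integral_liminf) measurable
  also have "\<dots> \<le> liminf (\<lambda>n. ennreal (cauchy_var d \<eta> g x))"
    using int by (intro Liminf_mono) auto
  also have "\<dots> = ennreal (cauchy_var d \<eta> g x)" by (simp add: Liminf_const)
  finally show ?thesis unfolding c_def .
qed

section \<open>One iteration of the sampler\<close>

lemma nn_integral_cauchy_law_neg:
  assumes [measurable]: "\<phi> \<in> borel_measurable (Rd d)" and t: "t > 0"
  shows "(\<integral>\<^sup>+z. \<phi> (vscale d (-1) z) \<partial>cauchy_law d t) = (\<integral>\<^sup>+z. \<phi> z \<partial>cauchy_law d t)"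
proof -
  have "(\<integral>\<^sup>+z. \<phi> (vscale d (-1) z) \<partial>cauchy_law d t) = (\<integral>\<^sup>+z. (\<lambda>z. ennreal (student d 1 t z) * \<phi> z) (vscale d (-1) z) \<partial>Rd d)"
    by (simp add: cauchy_law_def nn_integral_density student_def)
  also have "\<dots> = (\<integral>\<^sup>+z. ennreal (student d 1 t z) * \<phi> z \<partial>Rd d)"
    by (rule nn_integral_Rd_neg) measurable
  finally show ?thesis by (simp add: cauchy_law_def nn_integral_density)
qed

text \<open>Self-adjointness with respect to Lebesgue measure, which is translation invariant,
  because the Cauchy kernel is even.\<close>

lemma nn_integral_cauchy_op_symmetric:
  assumes t: "t > 0" and a: "bdd d M a" and b: "bdd d N b"
  shows "(\<integral>\<^sup>+y. ennreal (a y) * ennreal (cauchy_op d t b y) \<partial>Rd d) = (\<integral>\<^sup>+y. ennreal (cauchy_op d t a y) * ennreal (b y) \<partial>Rd d)"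
proof -
  interpret C: prob_space "cauchy_law d t" by (rule prob_space_cauchy_law[OF t])
  interpret R: sigma_finite_measure "Rd d" by (rule sigma_finite_Rd)
  interpret pair_sigma_finite "Rd d" "cauchy_law d t" ..
  note [measurable] = bddD(1)[OF a] bddD(1)[OF b]
  have "(\<integral>\<^sup>+y. ennreal (a y) * ennreal (cauchy_op d t b y) \<partial>Rd d) =
     (\<integral>\<^sup>+y. (\<integral>\<^sup>+z. ennreal (a y) * ennreal (b (vadd d y z)) \<partial>cauchy_law d t) \<partial>Rd d)"
    by (simp add: ennreal_cauchy_op[OF t b] nn_integral_cmult)
  also have "\<dots> = (\<integral>\<^sup>+z. (\<integral>\<^sup>+y. ennreal (a y) * ennreal (b (vadd d y z)) \<partial>Rd d) \<partial>cauchy_law d t)"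
    by (rule Fubini'[symmetric]) measurable
  also have "\<dots> = (\<integral>\<^sup>+z. (\<integral>\<^sup>+y. ennreal (a (vadd d y (vscale d (-1) z))) * ennreal (b y) \<partial>Rd d) \<partial>cauchy_law d t)"
  proof (rule nn_integral_cong)
    fix z assume "z \<in> space (cauchy_law d t)"
    then have [measurable]: "z \<in> space (Rd d)" by simp
    have "(\<integral>\<^sup>+y. ennreal (a y) * ennreal (b (vadd d y z)) \<partial>Rd d) =
       (\<integral>\<^sup>+y. (\<lambda>y. ennreal (a y) * ennreal (b (vadd d y z))) (vadd d (vscale d (-1) z) y) \<partial>Rd d)"
      by (rule nn_integral_Rd_vadd[symmetric]) measurable
    also have "\<dots> = (\<integral>\<^sup>+y. ennreal (a (vadd d y (vscale d (-1) z))) * ennreal (b y) \<partial>Rd d)"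
    proof (rule nn_integral_cong)
      fix y assume y: "y \<in> space (Rd d)"
      have "vadd d (vadd d (vscale d (-1) z) y) z = y" using y by (intro Rd_eqI[of _ d]) auto
      then show "ennreal (a (vadd d (vscale d (-1) z) y)) * ennreal (b (vadd d (vadd d (vscale d (-1) z) y) z)) =
        ennreal (a (vadd d y (vscale d (-1) z))) * ennreal (b y)"
        by (simp add: vadd_commute[of d _ y])
    qed
    finally show "(\<integral>\<^sup>+y. ennreal (a y) * ennreal (b (vadd d y z)) \<partial>Rd d) = \<dots>" .
  qed
  also have "\<dots> = (\<integral>\<^sup>+y. (\<integral>\<^sup>+z. ennreal (a (vadd d y (vscale d (-1) z))) * ennreal (b y) \<partial>cauchy_law d t) \<partial>Rd d)"
    by (rule Fubini') measurable
  also have "\<dots> = (\<integral>\<^sup>+y. (\<integral>\<^sup>+z. ennreal (a (vadd d y z)) * ennreal (b y) \<partial>cauchy_law d t) \<partial>Rd d)"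
    by (intro nn_integral_cong nn_integral_cauchy_law_neg t) measurable
  also have "\<dots> = (\<integral>\<^sup>+y. ennreal (cauchy_op d t a y) * ennreal (b y) \<partial>Rd d)"
    by (simp add: ennreal_cauchy_op[OF t a] nn_integral_multc)
  finally show ?thesis .
qed

lemma cauchy_op_1: "t > 0 \<Longrightarrow> cauchy_op d t (\<lambda>_. 1) x = 1"
  using prob_space.prob_space[OF prob_space_cauchy_law] by (simp add: cauchy_op_def)

lemma nn_integral_cauchy_op:
  assumes t: "t > 0" and b: "bdd d N b"
  shows "(\<integral>\<^sup>+y. ennreal (cauchy_op d t b y) \<partial>Rd d) = (\<integral>\<^sup>+y. ennreal (b y) \<partial>Rd d)"
proof -
  have "bdd d 1 (\<lambda>_. 1)" by (simp add: bdd_def)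
  from nn_integral_cauchy_op_symmetric[OF t this b] show ?thesis by (simp add: cauchy_op_1[OF t])
qed

lemma student_le_const: "\<nu> > 0 \<Longrightarrow> student d \<nu> 1 z \<le> student_const d \<nu>"
proof -
  assume \<nu>: "\<nu> > 0"
  have "((nrm d z)\<^sup>2 + 1\<^sup>2) powr (- (real d + \<nu>) / 2) \<le> 1 powr (- (real d + \<nu>) / 2)"
    using \<nu> by (intro powr_mono2') auto
  then show ?thesis using student_const_pos[OF \<nu>, of d]
    by (simp add: student_def mult_left_le)
qed

lemma bdd_student: "\<nu> > 0 \<Longrightarrow> bdd d (student_const d \<nu>) (student d \<nu> 1)"
  by (auto simp: bdd_def student_le_const)

lemma cauchy_op_student_pos:
  assumes t: "t > 0" and \<nu>: "\<nu> > 0"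
  shows "cauchy_op d t (student d \<nu> 1) y > 0"
proof -
  interpret C: prob_space "cauchy_law d t" by (rule prob_space_cauchy_law[OF t])
  have "cauchy_op d t (student d \<nu> 1) y \<noteq> 0"
  proof
    assume "cauchy_op d t (student d \<nu> 1) y = 0"
    then have "AE z in cauchy_law d t. student d \<nu> 1 (vadd d y z) = 0"
      unfolding cauchy_op_def using \<nu>
      by (subst (asm) integral_nonneg_eq_0_iff_AE[OF integrable_bdd_shift[OF t bdd_student[OF \<nu>]]]) auto
    then have "AE z in cauchy_law d t. False"
      using student_pos[OF \<nu> zero_less_one] by (elim eventually_mono) (metis less_irrefl)
    then show False by simp
  qed
  then show ?thesis using cauchy_op_bounds(1)[OF t bdd_student[OF \<nu>, of d], of y] by linarith
qed

text \<open>
  One iteration, acting on densities relative to the target: \<open>back_op\<close> is the density of \<open>y\<^sub>k\<close>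
  relative to the law of \<open>y\<close> at stationarity, \<open>step_op\<close> that of the next \<open>x\<close>.
\<close>

definition back_op :: "nat \<Rightarrow> real \<Rightarrow> real \<Rightarrow> ((nat \<Rightarrow> real) \<Rightarrow> real) \<Rightarrow> (nat \<Rightarrow> real) \<Rightarrow> real" where
  "back_op d \<nu> \<eta> f y = cauchy_op d \<eta> (\<lambda>x. f x * student d \<nu> 1 x) y / cauchy_op d \<eta> (student d \<nu> 1) y"

definition step_op :: "nat \<Rightarrow> real \<Rightarrow> real \<Rightarrow> ((nat \<Rightarrow> real) \<Rightarrow> real) \<Rightarrow> (nat \<Rightarrow> real) \<Rightarrow> real" where
  "step_op d \<nu> \<eta> f = cauchy_op d \<eta> (back_op d \<nu> \<eta> f)"

abbreviation target_law :: "nat \<Rightarrow> real \<Rightarrow> (nat \<Rightarrow> real) measure" where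
  "target_law d \<nu> \<equiv> density_law d (student d \<nu> 1)"

lemma sets_density_law [measurable_cong, simp]: "sets (density_law d p) = sets (Rd d)"
  and space_density_law [simp]: "space (density_law d p) = space (Rd d)"
  by (auto simp: density_law_def)

lemma density_law_cong:
  assumes "\<And>x. x \<in> space (Rd d) \<Longrightarrow> p x = q x" "q \<in> borel_measurable (Rd d)"
  shows "density_law d p = density_law d q"
proof -
  have "p \<in> borel_measurable (Rd d)" using assms measurable_cong by blast
  then show ?thesis unfolding density_law_def using assms by (intro density_cong) auto
qed

lemma density_law_cauchy_target: "\<nu> > 0 \<Longrightarrow> density_law d (cauchy_target d \<nu>) = target_law d \<nu>"
  by (intro density_law_cong) (auto simp: cauchy_target_eq)

lemma prob_space_target_law: "\<nu> > 0 \<Longrightarrow> prob_space (target_law d \<nu>)"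
  by (rule prob_spaceI) (simp add: density_law_def emeasure_density student_nn_integral_1 del: space_density_law)

lemma nn_integral_target_law:
  assumes "\<nu> > 0" "\<psi> \<in> borel_measurable (Rd d)"
  shows "(\<integral>\<^sup>+x. \<psi> x \<partial>target_law d \<nu>) = (\<integral>\<^sup>+x. ennreal (student d \<nu> 1 x) * \<psi> x \<partial>Rd d)"
  unfolding density_law_def using assms by (subst nn_integral_density) auto

lemma back_op_bdd:
  assumes \<eta>: "\<eta> > 0" and \<nu>: "\<nu> > 0" and f: "bdd d M f"
  shows "bdd d M (back_op d \<nu> \<eta> f)"
proof -
  note b = bdd_student[OF \<nu>, of d]
  note fb = bdd_mult[OF f b]
  note [measurable] = bddD(1)[OF bdd_cauchy_op[OF \<eta> fb]] bddD(1)[OF bdd_cauchy_op[OF \<eta> b]]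
  have m: "back_op d \<nu> \<eta> f \<in> borel_measurable (Rd d)" unfolding back_op_def[abs_def] by measurable
  have "cauchy_op d \<eta> (\<lambda>x. f x * student d \<nu> 1 x) y \<le> M * cauchy_op d \<eta> (student d \<nu> 1) y" for y
    unfolding cauchy_op_cmult[symmetric] using bddD(3)[OF f] \<nu>
    by (intro cauchy_op_mono[OF \<eta> fb bdd_cmult[OF b bdd_M_nonneg[OF f]]] mult_right_mono) auto
  then show ?thesis
    using m cauchy_op_bounds(1)[OF \<eta> fb] cauchy_op_student_pos[OF \<eta> \<nu>, of d]
    by (auto simp: bdd_def back_op_def pos_divide_le_eq less_imp_le)
qed

lemma step_op_bdd: "\<eta> > 0 \<Longrightarrow> \<nu> > 0 \<Longrightarrow> bdd d M f \<Longrightarrow> bdd d M (step_op d \<nu> \<eta> f)"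
  unfolding step_op_def by (intro bdd_cauchy_op back_op_bdd)

text \<open>\<open>cauchy_op d \<eta> (student d \<nu> 1)\<close> is the density of y at
  stationarity. Weighting with it cancels the denominator of \<open>back_op\<close>, which is how
  this lemma gets used.\<close>

lemma nn_integral_target_cauchy_op:
  assumes \<eta>: "\<eta> > 0" and \<nu>: "\<nu> > 0" and g: "bdd d M g"
  shows "(\<integral>\<^sup>+x. ennreal (cauchy_op d \<eta> g x) \<partial>target_law d \<nu>) =
    (\<integral>\<^sup>+y. ennreal (g y * cauchy_op d \<eta> (student d \<nu> 1) y) \<partial>Rd d)"
proof -
  note b = bdd_student[OF \<nu>, of d]
  note [measurable] = bddD(1)[OF bdd_cauchy_op[OF \<eta> g]] bddD(1)[OF g] bddD(1)[OF bdd_cauchy_op[OF \<eta> b]]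
  have "(\<integral>\<^sup>+x. ennreal (cauchy_op d \<eta> g x) \<partial>target_law d \<nu>) =
    (\<integral>\<^sup>+x. ennreal (student d \<nu> 1 x) * ennreal (cauchy_op d \<eta> g x) \<partial>Rd d)"
    using \<nu> by (intro nn_integral_target_law) measurable
  also have "\<dots> = (\<integral>\<^sup>+x. ennreal (cauchy_op d \<eta> (student d \<nu> 1) x) * ennreal (g x) \<partial>Rd d)"
    by (rule nn_integral_cauchy_op_symmetric[OF \<eta> b g])
  also have "\<dots> = (\<integral>\<^sup>+y. ennreal (g y * cauchy_op d \<eta> (student d \<nu> 1) y) \<partial>Rd d)"
    using bddD(2)[OF g] by (intro nn_integral_cong) (simp add: ennreal_mult' mult.commute)
  finally show ?thesis .
qed

lemma step_op_mass:
  assumes \<eta>: "\<eta> > 0" and \<nu>: "\<nu> > 0" and f: "bdd d M f"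
  shows "(\<integral>\<^sup>+x. ennreal (step_op d \<nu> \<eta> f x) \<partial>target_law d \<nu>) = (\<integral>\<^sup>+x. ennreal (f x) \<partial>target_law d \<nu>)"
proof -
  note b = bdd_student[OF \<nu>, of d]
  note fb = bdd_mult[OF f b]
  have "(\<integral>\<^sup>+x. ennreal (step_op d \<nu> \<eta> f x) \<partial>target_law d \<nu>) =
      (\<integral>\<^sup>+y. ennreal (back_op d \<nu> \<eta> f y * cauchy_op d \<eta> (student d \<nu> 1) y) \<partial>Rd d)"
    unfolding step_op_def by (rule nn_integral_target_cauchy_op[OF \<eta> \<nu> back_op_bdd[OF \<eta> \<nu> f]])
  also have "\<dots> = (\<integral>\<^sup>+y. ennreal (cauchy_op d \<eta> (\<lambda>x. f x * student d \<nu> 1 x) y) \<partial>Rd d)"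
    using cauchy_op_student_pos[OF \<eta> \<nu>] by (intro nn_integral_cong) (simp add: back_op_def less_imp_neq[symmetric])
  also have "\<dots> = (\<integral>\<^sup>+y. ennreal (f y * student d \<nu> 1 y) \<partial>Rd d)"
    by (rule nn_integral_cauchy_op[OF \<eta> fb])
  also have "\<dots> = (\<integral>\<^sup>+x. ennreal (f x) \<partial>target_law d \<nu>)"
    using \<nu> bddD(1,2)[OF f] by (subst nn_integral_target_law)
      (auto intro!: nn_integral_cong simp: ennreal_mult' mult.commute)
  finally show ?thesis .
qed

section \<open>Energy lost in one iteration\<close>

lemma dirichlet_form_eq:
  assumes [measurable]: "\<phi> \<in> borel_measurable (Rd d)"
  shows "dirichlet_form d p \<phi> = (\<integral>\<^sup>+y. (\<integral>\<^sup>+z. ennreal ((\<phi> (vadd d y z) - \<phi> y)\<^sup>2) *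
    ennreal (c_frac d / nrm d z ^ (d + 1)) \<partial>Rd d) \<partial>density_law d p)"
proof -
  interpret R: sigma_finite_measure "Rd d" by (rule sigma_finite_Rd)
  have c: "c_frac d > 0" using student_const_pos[of 1 d] by (simp add: c_frac_eq)
  have dist: "dist_Rd d x y = nrm d (vsub d x y)" for x y unfolding dist_Rd_def by (rule nrm_cong) simp
  define I where "I y x = ennreal (if x = y then 0 else (\<phi> x - \<phi> y)\<^sup>2 / dist_Rd d x y ^ (d + 1))" for x y
  define J where "J y x = ennreal ((\<phi> x - \<phi> y)\<^sup>2 / nrm d (vsub d x y) ^ (d + 1))" for x y
  \<comment> \<open>On the diagonal the numerator vanishes, so the quotient is 0 there and the case
    distinction disappears.\<close>
  have IJ: "I y x = J y x" for x y by (simp add: I_def J_def dist)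
  have [measurable]: "(\<lambda>(y, x). J y x) \<in> borel_measurable (Rd d \<Otimes>\<^sub>M Rd d)" unfolding J_def by measurable
  have "dirichlet_form d p \<phi> = ennreal (c_frac d) * (\<integral>\<^sup>+y. (\<integral>\<^sup>+x. J y x \<partial>Rd d) \<partial>density_law d p)"
    unfolding dirichlet_form_def I_def[symmetric] IJ ..
  also have "\<dots> = (\<integral>\<^sup>+y. (\<integral>\<^sup>+x. ennreal (c_frac d) * J y x \<partial>Rd d) \<partial>density_law d p)"
    by (subst nn_integral_cmult[symmetric], measurable) (intro nn_integral_cong nn_integral_cmult[symmetric], measurable)
  also have "\<dots> = (\<integral>\<^sup>+y. (\<integral>\<^sup>+z. ennreal ((\<phi> (vadd d y z) - \<phi> y)\<^sup>2) *
    ennreal (c_frac d / nrm d z ^ (d + 1)) \<partial>Rd d) \<partial>density_law d p)"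
  proof (rule nn_integral_cong)
    fix y assume "y \<in> space (density_law d p)"
    then have [measurable]: "y \<in> space (Rd d)" by simp
    have "(\<integral>\<^sup>+x. ennreal (c_frac d) * J y x \<partial>Rd d) = (\<integral>\<^sup>+z. (\<lambda>x. ennreal (c_frac d) * J y x) (vadd d y z) \<partial>Rd d)"
      by (rule nn_integral_Rd_vadd[symmetric]) measurable
    also have "\<dots> = (\<integral>\<^sup>+z. ennreal ((\<phi> (vadd d y z) - \<phi> y)\<^sup>2) * ennreal (c_frac d / nrm d z ^ (d + 1)) \<partial>Rd d)"
    proof (rule nn_integral_cong)
      fix z assume z: "z \<in> space (Rd d)"
      have aux: "ennreal c * ennreal (a / b) = ennreal a * ennreal (c / b)" if "c \<ge> 0" "a \<ge> 0" "b \<ge> 0" for a b c :: real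
        using that by (simp add: ennreal_mult[symmetric])
      show "ennreal (c_frac d) * J y (vadd d y z) = ennreal ((\<phi> (vadd d y z) - \<phi> y)\<^sup>2) * ennreal (c_frac d / nrm d z ^ (d + 1))"
        unfolding J_def vsub_vadd_cancel[OF z] using c by (intro aux) auto
    qed
    finally show "(\<integral>\<^sup>+x. ennreal (c_frac d) * J y x \<partial>Rd d) = \<dots>" .
  qed
  finally show ?thesis .
qed

lemma dirichlet_form_cauchy_target: "\<nu> > 0 \<Longrightarrow> dirichlet_form d (cauchy_target d \<nu>) = dirichlet_form d (student d \<nu> 1)"
  by (rule ext) (simp add: dirichlet_form_def density_law_cauchy_target)

text \<open>\<open>back_op d \<nu> \<eta> f y\<close> is the mean of \<open>f\<close> under the
  conditional law of x given y at stationarity. Expanding the nonnegative weighted integral of (f -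
  mean)^2 gives the claim.\<close>

lemma back_op_cauchy_schwarz:
  assumes \<eta>: "\<eta> > 0" and \<nu>: "\<nu> > 0" and f: "bdd d M f"
  shows "(back_op d \<nu> \<eta> f y)\<^sup>2 * cauchy_op d \<eta> (student d \<nu> 1) y \<le> cauchy_op d \<eta> (\<lambda>x. (f x)\<^sup>2 * student d \<nu> 1 x) y"
proof -
  note b = bdd_student[OF \<nu>, of d]
  note i0 = integrable_bdd_shift[OF \<eta> b, of y]
  note i1 = integrable_bdd_shift[OF \<eta> bdd_mult[OF f b], of y]
  note i2 = integrable_bdd_shift[OF \<eta> bdd_mult[OF bdd_square[OF f] b], of y]
  define p where "p = cauchy_op d \<eta> (student d \<nu> 1) y"
  define g where "g = back_op d \<nu> \<eta> f y"
  have p: "p > 0" unfolding p_def by (rule cauchy_op_student_pos[OF \<eta> \<nu>])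
  have g: "g * p = (LINT z|cauchy_law d \<eta>. f (vadd d y z) * student d \<nu> 1 (vadd d y z))"
    using p by (simp add: g_def back_op_def p_def[symmetric]) (simp add: cauchy_op_def)
  have "0 \<le> (LINT z|cauchy_law d \<eta>. (f (vadd d y z) - g)\<^sup>2 * student d \<nu> 1 (vadd d y z))"
    using \<nu> by (intro integral_nonneg_AE) auto
  also have "\<dots> = (LINT z|cauchy_law d \<eta>. (f (vadd d y z))\<^sup>2 * student d \<nu> 1 (vadd d y z)
      - 2 * g * (f (vadd d y z) * student d \<nu> 1 (vadd d y z)) + g\<^sup>2 * student d \<nu> 1 (vadd d y z))"
    by (simp add: power2_eq_square algebra_simps)
  also have "\<dots> = cauchy_op d \<eta> (\<lambda>x. (f x)\<^sup>2 * student d \<nu> 1 x) y - 2 * g * (g * p) + g\<^sup>2 * p"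
    using i0 i1 i2 by (simp add: g) (simp add: cauchy_op_def p_def)
  finally show ?thesis unfolding p_def[symmetric] g_def[symmetric] by (simp add: power2_eq_square algebra_simps)
qed

text \<open>With g = \<open>back_op d \<nu> \<eta> f\<close>, the second moment of the new density
  is the mean of \<open>cauchy_op d \<eta>\<close> applied to g^2 minus the mean conditional
  variance. The former is at most the second moment of \<open>f\<close> by conditional Jensen, and
  the latter is at least \<eta> times the energy by \<open>cauchy_var_ge_energy\<close>.\<close>

theorem step_op_energy:
  assumes d: "d \<ge> 1" and \<eta>: "\<eta> > 0" and \<nu>: "\<nu> > 0" and f: "bdd d M f"
  shows "(\<integral>\<^sup>+x. ennreal ((step_op d \<nu> \<eta> f x)\<^sup>2) \<partial>target_law d \<nu>) +
      ennreal \<eta> * dirichlet_form d (student d \<nu> 1) (step_op d \<nu> \<eta> f) \<le>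
    (\<integral>\<^sup>+x. ennreal ((f x)\<^sup>2) \<partial>target_law d \<nu>)"
proof -
  note b = bdd_student[OF \<nu>, of d]
  define g where "g = back_op d \<nu> \<eta> f"
  define h where "h = step_op d \<nu> \<eta> f"
  have hg: "h = cauchy_op d \<eta> g" by (simp add: h_def g_def step_op_def)
  have g: "bdd d M g" unfolding g_def by (rule back_op_bdd[OF \<eta> \<nu> f])
  have h: "bdd d M h" unfolding hg by (rule bdd_cauchy_op[OF \<eta> g])
  note [measurable] = bddD(1)[OF g] bddD(1)[OF h] bddD(1)[OF bdd_cauchy_var[OF \<eta> g]]
  interpret R: sigma_finite_measure "Rd d" by (rule sigma_finite_Rd)
  define E where "E x = (\<integral>\<^sup>+z. ennreal ((h (vadd d x z) - h x)\<^sup>2) * ennreal (c_frac d / nrm d z ^ (d + 1)) \<partial>Rd d)" for x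
  have [measurable]: "E \<in> borel_measurable (Rd d)" unfolding E_def by measurable
  have "(\<integral>\<^sup>+x. ennreal ((h x)\<^sup>2) \<partial>target_law d \<nu>) + ennreal \<eta> * dirichlet_form d (student d \<nu> 1) h =
     (\<integral>\<^sup>+x. ennreal ((h x)\<^sup>2) + ennreal \<eta> * E x \<partial>target_law d \<nu>)"
  proof -
    have "dirichlet_form d (student d \<nu> 1) h = (\<integral>\<^sup>+x. E x \<partial>target_law d \<nu>)"
      unfolding E_def by (rule dirichlet_form_eq) measurable
    then show ?thesis by (simp add: nn_integral_cmult nn_integral_add)
  qed
  also have "\<dots> \<le> (\<integral>\<^sup>+x. ennreal (cauchy_op d \<eta> (\<lambda>x. (g x)\<^sup>2) x) \<partial>target_law d \<nu>)"
  proof (rule nn_integral_mono)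
    fix x assume "x \<in> space (target_law d \<nu>)"
    then have x: "x \<in> space (Rd d)" by simp
    have "ennreal ((h x)\<^sup>2) + ennreal \<eta> * E x \<le> ennreal ((h x)\<^sup>2) + ennreal (cauchy_var d \<eta> g x)"
      using cauchy_var_ge_energy[OF d \<eta> g x] by (intro add_left_mono) (simp add: E_def hg)
    also have "\<dots> = ennreal ((h x)\<^sup>2 + cauchy_var d \<eta> g x)"
      using cauchy_var_bounds(1)[OF \<eta> g] by (intro ennreal_plus[symmetric]) auto
    also have "(h x)\<^sup>2 + cauchy_var d \<eta> g x = cauchy_op d \<eta> (\<lambda>x. (g x)\<^sup>2) x"
      by (simp add: cauchy_var_eq[OF \<eta> g] hg)
    finally show "ennreal ((h x)\<^sup>2) + ennreal \<eta> * E x \<le> ennreal (cauchy_op d \<eta> (\<lambda>x. (g x)\<^sup>2) x)" .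
  qed
  also have "\<dots> = (\<integral>\<^sup>+y. ennreal ((g y)\<^sup>2 * cauchy_op d \<eta> (student d \<nu> 1) y) \<partial>Rd d)"
    by (rule nn_integral_target_cauchy_op[OF \<eta> \<nu> bdd_square[OF g]])
  also have "\<dots> \<le> (\<integral>\<^sup>+y. ennreal (cauchy_op d \<eta> (\<lambda>x. (f x)\<^sup>2 * student d \<nu> 1 x) y) \<partial>Rd d)"
    unfolding g_def by (intro nn_integral_mono ennreal_leI back_op_cauchy_schwarz[OF \<eta> \<nu> f])
  also have "\<dots> = (\<integral>\<^sup>+y. ennreal ((f y)\<^sup>2 * student d \<nu> 1 y) \<partial>Rd d)"
    by (rule nn_integral_cauchy_op[OF \<eta> bdd_mult[OF bdd_square[OF f] b]])
  also have "\<dots> = (\<integral>\<^sup>+x. ennreal ((f x)\<^sup>2) \<partial>target_law d \<nu>)"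
    using \<nu> bddD(1)[OF f] by (subst nn_integral_target_law)
      (auto intro!: nn_integral_cong simp: ennreal_mult' mult.commute)
  finally show ?thesis unfolding h_def .
qed

section \<open>The law of the rejection sampler\<close>

text \<open>
  Both the event that nothing is accepted and the event that the returned value lies in \<open>A\<close> satisfy a
  one-step recursion on the first trial.
\<close>

lemma emeasure_first_accepted:
  fixes M :: "'a measure" and h :: "'a \<Rightarrow> 'b"
  assumes M: "prob_space M" and acc [measurable]: "Measurable.pred M acc"
    and h [measurable]: "h \<in> measurable M N" and A [measurable]: "A \<in> sets N"
    and pos: "emeasure M {x\<in>space M. acc x} > 0"
  shows "emeasure (distr (PiM (UNIV :: nat set) (\<lambda>_. M)) N (\<lambda>\<omega>. h (\<omega> (LEAST j. acc (\<omega> j))))) A * emeasure M {x\<in>space M. acc x} =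
    emeasure M {x\<in>space M. acc x \<and> h x \<in> A}"
proof -
  interpret M: prob_space M by fact
  interpret sequence_space M ..
  have sf: "sigma_finite_measure S" by (intro prob_space_imp_sigma_finite prob_space_PiM M)
  define res where "res \<omega> = h (\<omega> (LEAST j. acc (\<omega> j)))" for \<omega> :: "nat \<Rightarrow> 'a"
  have comp [measurable]: "(\<lambda>\<omega>. \<omega> j) \<in> measurable S M" for j by (rule measurable_component_singleton) simp
  have L [measurable]: "(\<lambda>\<omega>. LEAST j. acc (\<omega> j)) \<in> measurable S (count_space UNIV)" by measurable
  have res [measurable]: "res \<in> measurable S N"
    unfolding res_def
    by (rule measurable_compose_countable[where f = "\<lambda>j \<omega>. h (\<omega> j)" and g = "\<lambda>\<omega>. LEAST j. acc (\<omega> j)"]) measurable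
  define p where "p = emeasure M {x\<in>space M. acc x}"
  define r where "r = emeasure M {x\<in>space M. \<not> acc x}"
  have pr: "p + r = 1"
  proof -
    have "{x\<in>space M. acc x} \<union> {x\<in>space M. \<not> acc x} = space M" by auto
    moreover have "emeasure M ({x\<in>space M. acc x} \<union> {x\<in>space M. \<not> acc x}) = p + r"
      unfolding p_def r_def by (rule plus_emeasure[symmetric]) auto
    ultimately show ?thesis using M.emeasure_space_1 by simp
  qed
  have r_fin: "r < \<infinity>" unfolding r_def by (simp add: less_top[symmetric])
  \<comment> \<open>Solves the recursion by subtracting \<open>r * U\<close> from both sides. In the
    extended reals this needs \<open>r * U\<close> to be finite, hence the bound on
    \<open>U\<close>.\<close>
  have cancel: "U * p = q" if "U = q + r * U" "U \<le> 1" for U q :: ennreal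
  proof -
    have "r * U + U * p = r * U + q" using that(1) pr by (metis add.commute distrib_left mult.commute mult.right_neutral)
    moreover have "r * U < \<infinity>" using r_fin that(2) by (simp add: ennreal_mult_less_top le_less_trans)
    ultimately show ?thesis by (auto simp: ennreal_add_left_cancel)
  qed
  \<comment> \<open>The sequence of trials is split into its first member \<open>s\<close> and an
    independent sequence with the same law.\<close>
  have iter: "(\<integral>\<^sup>+\<omega>. F \<omega> \<partial>S) = (\<integral>\<^sup>+s. (\<integral>\<^sup>+\<omega>. F (case_nat s \<omega>) \<partial>S) \<partial>M)" if [measurable]: "F \<in> borel_measurable S" for F
  proof -
    have "(\<integral>\<^sup>+\<omega>. F \<omega> \<partial>S) = (\<integral>\<^sup>+\<omega>. F \<omega> \<partial>distr (M \<Otimes>\<^sub>M S) S (\<lambda>(s, \<omega>). case_nat s \<omega>))"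
      by (simp add: PiM_iter)
    also have "\<dots> = (\<integral>\<^sup>+x. F (case x of (s, \<omega>) \<Rightarrow> case_nat s \<omega>) \<partial>(M \<Otimes>\<^sub>M S))"
      by (rule nn_integral_distr) measurable
    also have "\<dots> = (\<integral>\<^sup>+s. (\<integral>\<^sup>+\<omega>. F (case_nat s \<omega>) \<partial>S) \<partial>M)"
      by (subst sigma_finite_measure.nn_integral_fst[OF sf, symmetric]) auto
    finally show ?thesis .
  qed
  \<comment> \<open>If nothing is ever accepted, the first trial fails and the remaining ones fail
    too, so the probability equals r times itself.\<close>
  have never: "AE \<omega> in S. \<exists>j. acc (\<omega> j)"
  proof -
    define N0 where "N0 = {\<omega>\<in>space S. \<forall>j. \<not> acc (\<omega> j)}"
    have [measurable]: "N0 \<in> sets S" unfolding N0_def by measurable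
    have "emeasure S N0 = (\<integral>\<^sup>+s. (\<integral>\<^sup>+\<omega>. indicator N0 (case_nat s \<omega>) \<partial>S) \<partial>M)"
      by (subst iter[symmetric]) auto
    also have "\<dots> = (\<integral>\<^sup>+s. indicator {x\<in>space M. \<not> acc x} s * emeasure S N0 \<partial>M)"
    proof (rule nn_integral_cong)
      fix s assume s: "s \<in> space M"
      have "(\<integral>\<^sup>+\<omega>. indicator N0 (case_nat s \<omega>) \<partial>S) = (\<integral>\<^sup>+\<omega>. indicator {x\<in>space M. \<not> acc x} s * indicator N0 \<omega> \<partial>S)"
      proof (rule nn_integral_cong)
        fix \<omega> assume w: "\<omega> \<in> space S"
        have "case_nat s \<omega> \<in> space S" using s w by (auto simp: space_PiM PiE_iff split: nat.splits)
        moreover have "(\<forall>j. \<not> acc (case_nat s \<omega> j)) \<longleftrightarrow> \<not> acc s \<and> (\<forall>j. \<not> acc (\<omega> j))"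
          by (metis nat.case(1) nat.case(2) nat.exhaust)
        ultimately show "(indicator N0 (case_nat s \<omega>) :: ennreal) = indicator {x\<in>space M. \<not> acc x} s * indicator N0 \<omega>"
          using s w by (auto simp: N0_def split: split_indicator)
      qed
      then show "(\<integral>\<^sup>+\<omega>. indicator N0 (case_nat s \<omega>) \<partial>S) = indicator {x\<in>space M. \<not> acc x} s * emeasure S N0"
        by (simp add: nn_integral_cmult)
    qed
    also have "\<dots> = r * emeasure S N0" by (simp add: nn_integral_multc r_def)
    finally have "emeasure S N0 = 0 + r * emeasure S N0" by simp
    then have "emeasure S N0 * p = 0" by (rule cancel) (rule measure_le_1)
    then have "N0 \<in> null_sets S" using pos by (auto simp: p_def)
    then show ?thesis by (rule AE_I') (auto simp: N0_def)
  qed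
  define U where "U = emeasure S {\<omega>\<in>space S. res \<omega> \<in> A}"
  define q where "q = emeasure M {x\<in>space M. acc x \<and> h x \<in> A}"
  have "U = (\<integral>\<^sup>+\<omega>. indicator {\<omega>\<in>space S. res \<omega> \<in> A} \<omega> \<partial>S)" by (simp add: U_def)
  also have "\<dots> = (\<integral>\<^sup>+s. (\<integral>\<^sup>+\<omega>. indicator {\<omega>\<in>space S. res \<omega> \<in> A} (case_nat s \<omega>) \<partial>S) \<partial>M)"
    by (rule iter) measurable
  also have "\<dots> = (\<integral>\<^sup>+s. indicator {x\<in>space M. acc x \<and> h x \<in> A} s + indicator {x\<in>space M. \<not> acc x} s * U \<partial>M)"
  proof (rule nn_integral_cong)
    fix s assume s: "s \<in> space M"
    have "(\<integral>\<^sup>+\<omega>. indicator {\<omega>\<in>space S. res \<omega> \<in> A} (case_nat s \<omega>) \<partial>S) =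
      (\<integral>\<^sup>+\<omega>. indicator {x\<in>space M. acc x \<and> h x \<in> A} s + indicator {x\<in>space M. \<not> acc x} s * indicator {\<omega>\<in>space S. res \<omega> \<in> A} \<omega> \<partial>S)"
    \<comment> \<open>The shift of \<open>LEAST\<close> by one after a rejected first trial needs
      some later acceptance; it may fail on the null event, so the comparison is only almost
      sure.\<close>
    proof (rule nn_integral_cong_AE, use never AE_space in eventually_elim)
      fix \<omega> assume ex: "\<exists>j. acc (\<omega> j)" and w: "\<omega> \<in> space S"
      have cs: "case_nat s \<omega> \<in> space S" using s w by (auto simp: space_PiM PiE_iff split: nat.splits)
      have "res (case_nat s \<omega>) = (if acc s then h s else res \<omega>)"
      proof (cases "acc s")
        case True
        then have "(LEAST j. acc (case_nat s \<omega> j)) = 0" by (intro Least_equality) auto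
        then show ?thesis using True by (simp add: res_def)
      next
        case False
        obtain j where j: "acc (\<omega> j)" using ex by blast
        have "(LEAST j. acc (case_nat s \<omega> j)) = Suc (LEAST j. acc (\<omega> j))"
          by (rule Least_Suc2[of _ "Suc j" _ j]) (use j False in auto)
        then show ?thesis using False by (simp add: res_def)
      qed
      then show "(indicator {\<omega>\<in>space S. res \<omega> \<in> A} (case_nat s \<omega>) :: ennreal) =
        indicator {x\<in>space M. acc x \<and> h x \<in> A} s + indicator {x\<in>space M. \<not> acc x} s * indicator {\<omega>\<in>space S. res \<omega> \<in> A} \<omega>"
        using cs s w by (auto split: split_indicator)
    qed
    also have "\<dots> = indicator {x\<in>space M. acc x \<and> h x \<in> A} s + indicator {x\<in>space M. \<not> acc x} s * U"
      by (simp add: nn_integral_add nn_integral_cmult U_def emeasure_space_1)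
    finally show "(\<integral>\<^sup>+\<omega>. indicator {\<omega>\<in>space S. res \<omega> \<in> A} (case_nat s \<omega>) \<partial>S) = \<dots>" .
  qed
  also have "\<dots> = q + r * U" by (simp add: nn_integral_add nn_integral_multc q_def r_def)
  finally have "U = q + r * U" .
  then have "U * p = q" by (rule cancel) (simp add: U_def measure_le_1)
  moreover have "emeasure (distr S N (\<lambda>\<omega>. h (\<omega> (LEAST j. acc (\<omega> j))))) A = U"
    unfolding res_def[symmetric] U_def by (subst emeasure_distr) (auto intro!: arg_cong[of _ _ "emeasure S"])
  ultimately show ?thesis unfolding p_def q_def by simp
qed

text \<open>Identifies the modulus of the scalar normal in a trial with the mixing variable of the
  Cauchy law, so that a proposal is y plus a Cauchy vector.\<close>

lemma nn_integral_half_normal: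
  assumes [measurable]: "k \<in> borel_measurable borel"
  shows "(\<integral>\<^sup>+x. k \<bar>x\<bar> \<partial>std_normal_distribution) = (\<integral>\<^sup>+n. k n \<partial>chi_law 1)"
proof -
  define F where "F x = ennreal (std_normal_density x) * k \<bar>x\<bar>" for x :: real
  have [measurable]: "F \<in> borel_measurable borel" unfolding F_def[abs_def] by measurable
  have Fm: "F (- x) = F x" for x by (simp add: F_def std_normal_density_def)
  have "(\<integral>\<^sup>+x. k \<bar>x\<bar> \<partial>std_normal_distribution) = (\<integral>\<^sup>+x. F x \<partial>lborel)"
    by (subst nn_integral_density) (auto simp: F_def[abs_def])
  also have "\<dots> = (\<integral>\<^sup>+x. F x * indicator {0<..} x + F x * indicator {..<0} x \<partial>lborel)"
    by (intro nn_integral_cong_AE, use AE_lborel_singleton[of 0] in eventually_elim) (auto split: split_indicator)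
  also have "\<dots> = (\<integral>\<^sup>+x. F x * indicator {0<..} x \<partial>lborel) + (\<integral>\<^sup>+x. F x * indicator {..<0} x \<partial>lborel)"
    by (rule nn_integral_add) measurable
  also have "(\<integral>\<^sup>+x. F x * indicator {..<0} x \<partial>lborel) = (\<integral>\<^sup>+x. F x * indicator {0<..} x \<partial>lborel)"
  proof -
    have "(\<integral>\<^sup>+x. F x * indicator {..<0} x \<partial>lborel) = ennreal \<bar>-1\<bar> * (\<integral>\<^sup>+x. F (0 + -1 * x) * indicator {..<0} (0 + -1 * x) \<partial>lborel)"
      by (rule nn_integral_real_affine) auto
    also have "\<dots> = (\<integral>\<^sup>+x. F x * indicator {0<..} x \<partial>lborel)"
      by (auto simp: Fm intro!: nn_integral_cong split: split_indicator)
    finally show ?thesis .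
  qed
  also have "(\<integral>\<^sup>+x. F x * indicator {0<..} x \<partial>lborel) + (\<integral>\<^sup>+x. F x * indicator {0<..} x \<partial>lborel) = (\<integral>\<^sup>+x. 2 * (F x * indicator {0<..} x) \<partial>lborel)"
    by (subst nn_integral_cmult) (auto simp: mult_2)
  also have "\<dots> = (\<integral>\<^sup>+n. k n \<partial>chi_law 1)"
  proof (subst nn_integral_chi_law, measurable, rule nn_integral_cong)
    fix x :: real
    show "2 * (F x * indicator {0<..} x) = ennreal (chi_density 1 x) * k x"
    proof (cases "x > 0")
      case True
      have "2 / sqrt (2 * pi) = sqrt (2 / pi)"
        by (simp add: real_sqrt_mult real_sqrt_divide field_simps)
      then have "chi_density 1 x = 2 * std_normal_density x"
        using True by (simp add: chi_density_1 std_normal_density_def) (metis times_divide_eq_left)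
      then have "ennreal (chi_density 1 x) = 2 * ennreal (std_normal_density x)"
        by (simp add: ennreal_mult')
      then show ?thesis using True by (simp add: F_def mult.assoc)
    qed (simp add: chi_density_def)
  qed
  finally show ?thesis .
qed

section \<open>One trial of the rejection sampler\<close>

lemma proposal_eq: "proposal d \<eta> y t = vadd d y (vscale d (\<eta> / \<bar>fst (snd t)\<bar>) (fst t))"
  by (cases t) (auto simp: proposal_def vadd_def vscale_def)

lemma sets_trial_law [measurable_cong]: "sets (trial_law d) = sets (Rd d \<Otimes>\<^sub>M (borel \<Otimes>\<^sub>M borel))"
  unfolding trial_law_def by (intro sets_pair_measure_cong) auto

lemma prob_space_uniform_01: "prob_space (uniform_measure lborel {0..1::real})"
  by (rule prob_space_uniform_measure) auto

lemma prob_space_trial_law: "prob_space (trial_law d)"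
  unfolding trial_law_def
  by (intro prob_space_pair prob_space_std_gaussian prob_space_uniform_01 prob_space_normal_density) simp

lemma measurable_proposal [measurable]: "proposal d \<eta> y \<in> measurable (trial_law d) (Rd d)"
  unfolding proposal_eq[abs_def] by measurable

lemma measurable_cauchy_potential [measurable]: "cauchy_potential d \<nu> \<in> borel_measurable (Rd d)"
  unfolding cauchy_potential_def[abs_def] by measurable

lemma measurable_accepted [measurable]: "Measurable.pred (trial_law d) (accepted d (cauchy_potential d \<nu>) xm \<eta> y)"
  unfolding accepted_def[abs_def] by measurable

text \<open>Given the proposal x, the uniform variable accepts with probability exp (- V x), which
  is at most 1 because the minimum of the potential is 0. This probability is the target density up
  to the factor \<open>student_const\<close>, and the proposal is a Cauchy jump from y.\<close>

lemma emeasure_trial_accepted: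
  assumes \<eta>: "\<eta> > 0" and \<nu>: "\<nu> > 0" and V0: "cauchy_potential d \<nu> xm = 0" and [measurable]: "A \<in> sets (Rd d)"
  shows "emeasure (trial_law d) {t\<in>space (trial_law d). accepted d (cauchy_potential d \<nu>) xm \<eta> y t \<and> proposal d \<eta> y t \<in> A} =
    ennreal (cauchy_op d \<eta> (\<lambda>x. indicator A x * student d \<nu> 1 x) y / student_const d \<nu>)"
proof -
  interpret G: prob_space "std_gaussian d" by (rule prob_space_std_gaussian)
  interpret N: prob_space std_normal_distribution by (rule prob_space_normal_density) simp
  interpret U: prob_space "uniform_measure lborel {0..1::real}" by (rule prob_space_uniform_01)
  interpret NUp: prob_space "std_normal_distribution \<Otimes>\<^sub>M uniform_measure lborel {0..1::real}"
    by (intro prob_space_pair prob_space_uniform_01 prob_space_normal_density) simp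
  interpret GN: pair_sigma_finite "std_gaussian d" std_normal_distribution ..
  define V where "V = cauchy_potential d \<nu>"
  have [measurable]: "V \<in> borel_measurable (Rd d)" unfolding V_def by measurable
  have Vn: "V x \<ge> 0" for x using \<nu> unfolding V_def cauchy_potential_def by (intro mult_nonneg_nonneg) auto
  define H where "H x = ennreal (exp (- V x)) * indicator A x" for x
  have [measurable]: "H \<in> borel_measurable (Rd d)" unfolding H_def[abs_def] by measurable
  define P where "P a z = vadd d y (vscale d (\<eta> / a) z)" for a z
  have [measurable]: "(\<lambda>(z, a). P a z) \<in> measurable (Rd d \<Otimes>\<^sub>M borel) (Rd d)" unfolding P_def by measurable
  have "emeasure (trial_law d) {t\<in>space (trial_law d). accepted d V xm \<eta> y t \<and> proposal d \<eta> y t \<in> A} =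
    (\<integral>\<^sup>+t. indicator {t\<in>space (trial_law d). accepted d V xm \<eta> y t \<and> proposal d \<eta> y t \<in> A} t \<partial>trial_law d)"
    unfolding V_def by simp
  also have "\<dots> = (\<integral>\<^sup>+t. indicator {..exp (- V (P \<bar>fst (snd t)\<bar> (fst t)))} (snd (snd t)) * indicator A (P \<bar>fst (snd t)\<bar> (fst t)) \<partial>trial_law d)"
    using V0 by (intro nn_integral_cong) (auto simp: accepted_def proposal_eq P_def V_def split: split_indicator)
  also have "\<dots> = (\<integral>\<^sup>+z. (\<integral>\<^sup>+a. (\<integral>\<^sup>+u. indicator {..exp (- V (P \<bar>a\<bar> z))} u * indicator A (P \<bar>a\<bar> z) \<partial>uniform_measure lborel {0..1}) \<partial>std_normal_distribution) \<partial>std_gaussian d)"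
  proof -
    define F where "F t = (indicator {..exp (- V (P \<bar>fst (snd t)\<bar> (fst t)))} (snd (snd t)) * indicator A (P \<bar>fst (snd t)\<bar> (fst t)) :: ennreal)" for t
    have F [measurable]: "F \<in> borel_measurable (std_gaussian d \<Otimes>\<^sub>M (std_normal_distribution \<Otimes>\<^sub>M uniform_measure lborel {0..1}))"
      unfolding F_def[abs_def] indicator_def atMost_iff by measurable
    have "(\<integral>\<^sup>+t. F t \<partial>trial_law d) = (\<integral>\<^sup>+z. (\<integral>\<^sup>+w. F (z, w) \<partial>(std_normal_distribution \<Otimes>\<^sub>M uniform_measure lborel {0..1})) \<partial>std_gaussian d)"
      unfolding trial_law_def by (rule NUp.nn_integral_fst[OF F, symmetric])
    also have "\<dots> = (\<integral>\<^sup>+z. (\<integral>\<^sup>+a. (\<integral>\<^sup>+u. F (z, (a, u)) \<partial>uniform_measure lborel {0..1}) \<partial>std_normal_distribution) \<partial>std_gaussian d)"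
      by (intro nn_integral_cong U.nn_integral_fst[symmetric]) measurable
    finally show ?thesis by (simp add: F_def)
  qed
  also have "\<dots> = (\<integral>\<^sup>+z. (\<integral>\<^sup>+a. H (P \<bar>a\<bar> z) \<partial>std_normal_distribution) \<partial>std_gaussian d)"
  proof (intro nn_integral_cong)
    fix z and a :: real
    define e where "e = exp (- V (P \<bar>a\<bar> z))"
    have e: "0 \<le> e" "e \<le> 1" using Vn by (auto simp: e_def)
    have "(\<integral>\<^sup>+u. indicator {..e} u \<partial>uniform_measure lborel {0..1::real}) = (\<integral>\<^sup>+u. indicator {0..e} u \<partial>lborel)"
    proof -
      have "(\<integral>\<^sup>+u. indicator {..e} u \<partial>uniform_measure lborel {0..1::real}) =
          (\<integral>\<^sup>+u. indicator {..e} u * indicator {0..1} u \<partial>lborel) / emeasure lborel {0..1::real}"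
        by (rule nn_integral_uniform_measure) auto
      also have "(\<integral>\<^sup>+u. indicator {..e} u * indicator {0..1} u \<partial>lborel) = (\<integral>\<^sup>+u. indicator {0..e} u \<partial>lborel)"
        using e by (intro nn_integral_cong) (auto split: split_indicator)
      finally show ?thesis by (simp add: divide_ennreal_def)
    qed
    also have "\<dots> = ennreal e" using e by simp
    finally show "(\<integral>\<^sup>+u. indicator {..exp (- V (P \<bar>a\<bar> z))} u * indicator A (P \<bar>a\<bar> z) \<partial>uniform_measure lborel {0..1}) = H (P \<bar>a\<bar> z)"
      by (simp add: nn_integral_multc e_def H_def)
  qed
  also have "\<dots> = (\<integral>\<^sup>+a. (\<integral>\<^sup>+z. H (P \<bar>a\<bar> z) \<partial>std_gaussian d) \<partial>std_normal_distribution)"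
    by (rule GN.Fubini'[symmetric]) measurable
  also have "\<dots> = (\<integral>\<^sup>+n. (\<integral>\<^sup>+z. H (P n z) \<partial>std_gaussian d) \<partial>chi_law 1)"
    by (rule nn_integral_half_normal[of "\<lambda>n. \<integral>\<^sup>+z. H (P n z) \<partial>std_gaussian d"]) measurable
  also have "\<dots> = (\<integral>\<^sup>+z. H (vadd d y z) \<partial>cauchy_law d \<eta>)"
    unfolding P_def using \<eta> by (intro nn_integral_cauchy_law[symmetric]) measurable
  also have "\<dots> = (\<integral>\<^sup>+z. ennreal (indicator A (vadd d y z) * student d \<nu> 1 (vadd d y z) / student_const d \<nu>) \<partial>cauchy_law d \<eta>)"
    using student_const_pos[OF \<nu>, of d]
    by (intro nn_integral_cong) (auto simp: H_def V_def exp_cauchy_potential student_def split: split_indicator)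
  also have "\<dots> = ennreal (cauchy_op d \<eta> (\<lambda>x. indicator A x * student d \<nu> 1 x / student_const d \<nu>) y)"
  proof (rule ennreal_cauchy_op[OF \<eta>, symmetric])
    show "bdd d 1 (\<lambda>x. indicator A x * student d \<nu> 1 x / student_const d \<nu>)"
      using student_const_pos[OF \<nu>, of d] student_le_const[OF \<nu>, of d] \<nu>
      by (auto simp: bdd_def split: split_indicator)
  qed
  finally show ?thesis unfolding V_def by (simp add: cauchy_op_def)
qed

lemma cauchy_potential_minimizer:
  assumes \<nu>: "\<nu> > 0" and m: "minimizer d (cauchy_potential d \<nu>) xm"
  shows "cauchy_potential d \<nu> xm = 0"
proof -
  have nn: "cauchy_potential d \<nu> x \<ge> 0" for x
    using \<nu> unfolding cauchy_potential_def by (intro mult_nonneg_nonneg) auto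
  have "(\<lambda>i\<in>{..<d}. 0) \<in> space (Rd d)" by (simp add: space_Rd)
  moreover have "nrm d (\<lambda>i\<in>{..<d}. 0) = 0" by (simp add: L2_set_eq_0_iff)
  ultimately have "cauchy_potential d \<nu> xm \<le> 0"
    using m unfolding minimizer_def by (metis cauchy_potential_def add.right_neutral ln_one mult_zero_right power_zero_numeral)
  then show ?thesis using nn[of xm] by linarith
qed

lemma bdd_indicator: "A \<in> sets (Rd d) \<Longrightarrow> bdd d 1 (indicator A)"
  by (auto simp: bdd_def split: split_indicator)

lemma sets_rejection_law [simp]: "sets (rejection_law d V xm \<eta> y) = sets (Rd d)"
  by (simp add: rejection_law_def)

text \<open>A quotient of two instances of \<open>emeasure_trial_accepted\<close>, for
  \<open>A\<close> and for the whole space; the unknown normalising constant of the target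
  cancels.\<close>

lemma emeasure_rejection_law:
  assumes \<eta>: "\<eta> > 0" and \<nu>: "\<nu> > 0" and m: "minimizer d (cauchy_potential d \<nu>) xm" and A [measurable]: "A \<in> sets (Rd d)"
  shows "emeasure (rejection_law d (cauchy_potential d \<nu>) xm \<eta> y) A = ennreal (back_op d \<nu> \<eta> (indicator A) y)"
proof -
  note V0 = cauchy_potential_minimizer[OF \<nu> m]
  define c where "c = student_const d \<nu>"
  define a where "a = cauchy_op d \<eta> (student d \<nu> 1) y"
  define q where "q = cauchy_op d \<eta> (\<lambda>x. indicator A x * student d \<nu> 1 x) y"
  have c: "c > 0" unfolding c_def by (rule student_const_pos[OF \<nu>])
  have a: "a > 0" unfolding a_def by (rule cauchy_op_student_pos[OF \<eta> \<nu>])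
  have q: "q \<ge> 0" unfolding q_def by (rule cauchy_op_bounds(1)[OF \<eta> bdd_mult[OF bdd_indicator[OF A] bdd_student[OF \<nu>]]])
  have "emeasure (trial_law d) {t\<in>space (trial_law d). accepted d (cauchy_potential d \<nu>) xm \<eta> y t} =
    emeasure (trial_law d) {t\<in>space (trial_law d). accepted d (cauchy_potential d \<nu>) xm \<eta> y t \<and> proposal d \<eta> y t \<in> space (Rd d)}"
    by (intro arg_cong[of _ _ "emeasure _"]) (auto simp: proposal_eq)
  also have "\<dots> = ennreal (cauchy_op d \<eta> (\<lambda>x. indicator (space (Rd d)) x * student d \<nu> 1 x) y / c)"
    unfolding c_def by (rule emeasure_trial_accepted[OF \<eta> \<nu> V0]) auto
  also have "cauchy_op d \<eta> (\<lambda>x. indicator (space (Rd d)) x * student d \<nu> 1 x) y = a"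
    unfolding a_def cauchy_op_def by simp
  finally have p: "emeasure (trial_law d) {t\<in>space (trial_law d). accepted d (cauchy_potential d \<nu>) xm \<eta> y t} = ennreal (a / c)" .
  then have pos: "emeasure (trial_law d) {t\<in>space (trial_law d). accepted d (cauchy_potential d \<nu>) xm \<eta> y t} > 0"
    using a c by simp
  have "emeasure (rejection_law d (cauchy_potential d \<nu>) xm \<eta> y) A * ennreal (a / c) = ennreal (q / c)"
    unfolding p[symmetric] unfolding rejection_law_def q_def c_def emeasure_trial_accepted[OF \<eta> \<nu> V0 A, symmetric]
    by (rule emeasure_first_accepted[OF prob_space_trial_law measurable_accepted measurable_proposal A pos])
  then have "emeasure (rejection_law d (cauchy_potential d \<nu>) xm \<eta> y) A * ennreal (a / c) * ennreal (c / a) = ennreal (q / c) * ennreal (c / a)"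
    by simp
  moreover have "ennreal (a / c) * ennreal (c / a) = 1" using a c by (simp add: ennreal_mult[symmetric])
  moreover have "ennreal (q / c) * ennreal (c / a) = ennreal (q / a)" using a c q by (simp add: ennreal_mult[symmetric])
  ultimately show ?thesis by (simp add: mult.assoc back_op_def q_def a_def)
qed

lemma subprob_rejection_law:
  assumes \<eta>: "\<eta> > 0" and \<nu>: "\<nu> > 0" and m: "minimizer d (cauchy_potential d \<nu>) xm"
  shows "rejection_law d (cauchy_potential d \<nu>) xm \<eta> \<in> measurable (Rd d) (subprob_algebra (Rd d))"
proof (rule measurable_subprob_algebra)
  note e = emeasure_rejection_law[OF \<eta> \<nu> m]
  fix y
  show "subprob_space (rejection_law d (cauchy_potential d \<nu>) xm \<eta> y)"
  proof
    have sp: "space (rejection_law d (cauchy_potential d \<nu>) xm \<eta> y) = space (Rd d)"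
      by (rule sets_eq_imp_space_eq) simp
    then show "space (rejection_law d (cauchy_potential d \<nu>) xm \<eta> y) \<noteq> {}"
      using vadd_in_space by (metis empty_iff)
    show "emeasure (rejection_law d (cauchy_potential d \<nu>) xm \<eta> y) (space (rejection_law d (cauchy_potential d \<nu>) xm \<eta> y)) \<le> 1"
    proof -
      \<comment> \<open>\<open>back_op\<close> sees its argument only through
        \<open>vadd d y\<close>, so a point outside the space can be replaced by its restriction,
        for which the bound is known.\<close>
      define y' where "y' = vadd d y (\<lambda>_. 0)"
      have "vadd d y = vadd d y'" by (auto simp: y'_def vadd_def fun_eq_iff)
      then have "back_op d \<nu> \<eta> g y = back_op d \<nu> \<eta> g y'" for g by (simp add: back_op_def cauchy_op_def)
      then show ?thesis unfolding sp e[OF sets.top]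
        using bddD(3)[OF back_op_bdd[OF \<eta> \<nu> bdd_indicator[OF sets.top]], of y' d] by (simp add: y'_def)
    qed
  qed
  fix A assume "A \<in> sets (Rd d)"
  then show "(\<lambda>y. emeasure (rejection_law d (cauchy_potential d \<nu>) xm \<eta> y) A) \<in> borel_measurable (Rd d)"
    using bddD(1)[OF back_op_bdd[OF \<eta> \<nu> bdd_indicator]] by (simp add: e)
qed simp

lemma vsub_restrict: "(\<lambda>i\<in>{..<d}. y i - x i) = vsub d y x"
  by (simp add: vsub_def)

lemma nn_integral_stable_step:
  assumes \<eta>: "\<eta> > 0" and x: "x \<in> space (Rd d)" and [measurable]: "\<psi> \<in> borel_measurable (Rd d)"
  shows "(\<integral>\<^sup>+y. \<psi> y \<partial>stable_step d \<eta> x) = (\<integral>\<^sup>+z. \<psi> (vadd d x z) \<partial>cauchy_law d \<eta>)"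
proof -
  note [measurable] = x
  have "(\<integral>\<^sup>+y. \<psi> y \<partial>stable_step d \<eta> x) = (\<integral>\<^sup>+y. ennreal (student d 1 \<eta> (vsub d y x)) * \<psi> y \<partial>Rd d)"
    unfolding stable_step_def vsub_restrict stable_density_eq[OF \<eta> vsub_in_space]
    by (rule nn_integral_density) measurable
  also have "\<dots> = (\<integral>\<^sup>+z. (\<lambda>y. ennreal (student d 1 \<eta> (vsub d y x)) * \<psi> y) (vadd d x z) \<partial>Rd d)"
    by (rule nn_integral_Rd_vadd[symmetric]) measurable
  also have "\<dots> = (\<integral>\<^sup>+z. ennreal (student d 1 \<eta> z) * \<psi> (vadd d x z) \<partial>Rd d)"
    by (intro nn_integral_cong) simp
  finally show ?thesis unfolding cauchy_law_def by (subst nn_integral_density) auto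
qed

lemma subprob_stable_step:
  assumes \<eta>: "\<eta> > 0"
  shows "stable_step d \<eta> \<in> measurable (Rd d) (subprob_algebra (Rd d))"
proof (rule measurable_subprob_algebra)
  interpret C: prob_space "cauchy_law d \<eta>" by (rule prob_space_cauchy_law[OF \<eta>])
  have e: "emeasure (stable_step d \<eta> x) A = (\<integral>\<^sup>+z. indicator A (vadd d x z) \<partial>cauchy_law d \<eta>)"
    if "x \<in> space (Rd d)" and [measurable]: "A \<in> sets (Rd d)" for x A
    using nn_integral_stable_step[OF \<eta> that(1), of "indicator A"] by (simp add: stable_step_def)
  fix x assume x: "x \<in> space (Rd d)"
  show "subprob_space (stable_step d \<eta> x)"
  proof
    show "emeasure (stable_step d \<eta> x) (space (stable_step d \<eta> x)) \<le> 1"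
      using e[OF x sets.top] C.emeasure_space_1 by (simp add: stable_step_def)
    show "space (stable_step d \<eta> x) \<noteq> {}" using x by (auto simp: stable_step_def)
  qed
next
  interpret C: prob_space "cauchy_law d \<eta>" by (rule prob_space_cauchy_law[OF \<eta>])
  fix A assume [measurable]: "A \<in> sets (Rd d)"
  have "(\<lambda>x. \<integral>\<^sup>+z. indicator A (vadd d x z) \<partial>cauchy_law d \<eta>) \<in> borel_measurable (Rd d)" by measurable
  moreover have "emeasure (stable_step d \<eta> x) A = (\<integral>\<^sup>+z. indicator A (vadd d x z) \<partial>cauchy_law d \<eta>)"
    if "x \<in> space (Rd d)" for x
    using nn_integral_stable_step[OF \<eta> that(1), of "indicator A"] by (simp add: stable_step_def)
  ultimately show "(\<lambda>x. emeasure (stable_step d \<eta> x) A) \<in> borel_measurable (Rd d)"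
    by (subst measurable_cong) auto
qed (simp add: stable_step_def)

text \<open>A duality computation using the symmetry of \<open>cauchy_op\<close> twice. The
  numerators of \<open>back_op\<close> for \<open>f\<close> and for the indicator of A are g p and H
  p with the same stationary density p of y; hence the factor p can be moved from one to the other,
  which exchanges the roles of \<open>f\<close> and A.\<close>

lemma proximal_step_law:
  assumes \<eta>: "\<eta> > 0" and \<nu>: "\<nu> > 0" and m: "minimizer d (cauchy_potential d \<nu>) xm" and f: "bdd d M f"
  shows "Giry_Monad.bind (density_law d (\<lambda>x. f x * student d \<nu> 1 x))
      (\<lambda>x. Giry_Monad.bind (stable_step d \<eta> x) (rejection_law d (cauchy_potential d \<nu>) xm \<eta>)) =
    density_law d (\<lambda>x. step_op d \<nu> \<eta> f x * student d \<nu> 1 x)"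
    (is "Giry_Monad.bind ?\<mu> ?K = ?R")
proof (rule measure_eqI)
  note b = bdd_student[OF \<nu>, of d]
  note fb = bdd_mult[OF f b]
  note [measurable] = bddD(1)[OF f] subprob_rejection_law[OF \<eta> \<nu> m] subprob_stable_step[OF \<eta>]
  have ne: "space (Rd d) \<noteq> {}" using vadd_in_space by (metis empty_iff)
  have K [measurable]: "?K \<in> measurable (Rd d) (subprob_algebra (Rd d))" by measurable
  then have K': "?K \<in> measurable ?\<mu> (subprob_algebra (Rd d))" by (simp cong: measurable_cong_sets)
  show sets: "sets (Giry_Monad.bind ?\<mu> ?K) = sets ?R"
    using sets_bind[of ?\<mu> ?K "Rd d"] sets_kernel[OF K'] ne by simp
  fix A assume "A \<in> sets (Giry_Monad.bind ?\<mu> ?K)"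
  then have A [measurable]: "A \<in> sets (Rd d)" using sets by simp
  define H where "H = back_op d \<nu> \<eta> (indicator A)"
  define g where "g = back_op d \<nu> \<eta> f"
  define p where "p = cauchy_op d \<eta> (student d \<nu> 1)"
  have p: "p y > 0" for y unfolding p_def by (rule cauchy_op_student_pos[OF \<eta> \<nu>])
  note iA = bdd_indicator[OF A]
  note iAb = bdd_mult[OF iA b]
  have H: "bdd d 1 H" unfolding H_def by (rule back_op_bdd[OF \<eta> \<nu> iA])
  have g: "bdd d M g" unfolding g_def by (rule back_op_bdd[OF \<eta> \<nu> f])
  note [measurable] = bddD(1)[OF H] bddD(1)[OF g] bddD(1)[OF step_op_bdd[OF \<eta> \<nu> f]]
  have "emeasure (Giry_Monad.bind ?\<mu> ?K) A = (\<integral>\<^sup>+x. emeasure (?K x) A \<partial>?\<mu>)"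
    by (rule emeasure_bind[OF _ K' A]) (use ne in simp)
  also have "\<dots> = (\<integral>\<^sup>+x. ennreal (cauchy_op d \<eta> H x) \<partial>?\<mu>)"
  proof (rule nn_integral_cong)
    fix x assume "x \<in> space ?\<mu>"
    then have x: "x \<in> space (Rd d)" by simp
    have "emeasure (?K x) A = (\<integral>\<^sup>+y. emeasure (rejection_law d (cauchy_potential d \<nu>) xm \<eta> y) A \<partial>stable_step d \<eta> x)"
    proof (rule emeasure_bind[OF _ _ A])
      have "sets (stable_step d \<eta> x) = sets (Rd d)" by (simp add: stable_step_def)
      then show "rejection_law d (cauchy_potential d \<nu>) xm \<eta> \<in> measurable (stable_step d \<eta> x) (subprob_algebra (Rd d))"
        using subprob_rejection_law[OF \<eta> \<nu> m] by (simp cong: measurable_cong_sets)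
    qed (use ne in \<open>simp add: stable_step_def\<close>)
    also have "\<dots> = (\<integral>\<^sup>+y. ennreal (H y) \<partial>stable_step d \<eta> x)"
      by (simp add: emeasure_rejection_law[OF \<eta> \<nu> m A] H_def)
    also have "\<dots> = (\<integral>\<^sup>+z. ennreal (H (vadd d x z)) \<partial>cauchy_law d \<eta>)"
      by (rule nn_integral_stable_step[OF \<eta> x]) measurable
    also have "\<dots> = ennreal (cauchy_op d \<eta> H x)" by (rule ennreal_cauchy_op[OF \<eta> H, symmetric])
    finally show "emeasure (?K x) A = ennreal (cauchy_op d \<eta> H x)" .
  qed
  also have "\<dots> = (\<integral>\<^sup>+x. ennreal (f x * student d \<nu> 1 x) * ennreal (cauchy_op d \<eta> H x) \<partial>Rd d)"
    unfolding density_law_def using bddD(1)[OF bdd_cauchy_op[OF \<eta> H]] by (intro nn_integral_density) auto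
  also have "\<dots> = (\<integral>\<^sup>+y. ennreal (cauchy_op d \<eta> (\<lambda>x. f x * student d \<nu> 1 x) y) * ennreal (H y) \<partial>Rd d)"
    by (rule nn_integral_cauchy_op_symmetric[OF \<eta> fb H])
  also have "\<dots> = (\<integral>\<^sup>+y. ennreal (g y) * ennreal (cauchy_op d \<eta> (\<lambda>x. indicator A x * student d \<nu> 1 x) y) \<partial>Rd d)"
  proof (rule nn_integral_cong)
    fix y
    have "cauchy_op d \<eta> (\<lambda>x. f x * student d \<nu> 1 x) y = g y * p y"
      "cauchy_op d \<eta> (\<lambda>x. indicator A x * student d \<nu> 1 x) y = H y * p y"
      using p[of y] by (simp_all add: g_def H_def back_op_def p_def)
    moreover have "g y \<ge> 0" "H y \<ge> 0"
      using cauchy_op_bounds(1)[OF \<eta> fb, of y] cauchy_op_bounds(1)[OF \<eta> iAb, of y] cauchy_op_bounds(1)[OF \<eta> b, of y]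
      by (auto simp: g_def H_def back_op_def)
    ultimately show "ennreal (cauchy_op d \<eta> (\<lambda>x. f x * student d \<nu> 1 x) y) * ennreal (H y) =
      ennreal (g y) * ennreal (cauchy_op d \<eta> (\<lambda>x. indicator A x * student d \<nu> 1 x) y)"
      using p[of y] by (simp add: ennreal_mult mult_ac)
  qed
  also have "\<dots> = (\<integral>\<^sup>+y. ennreal (cauchy_op d \<eta> g y) * ennreal (indicator A y * student d \<nu> 1 y) \<partial>Rd d)"
    by (rule nn_integral_cauchy_op_symmetric[OF \<eta> g iAb])
  also have "\<dots> = (\<integral>\<^sup>+y. ennreal (step_op d \<nu> \<eta> f y * student d \<nu> 1 y) * indicator A y \<partial>Rd d)"
  proof (rule nn_integral_cong)
    fix y assume "y \<in> space (Rd d)"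
    then have "step_op d \<nu> \<eta> f y \<ge> 0" using bddD(2)[OF step_op_bdd[OF \<eta> \<nu> f]] by simp
    then show "ennreal (cauchy_op d \<eta> g y) * ennreal (indicator A y * student d \<nu> 1 y) = ennreal (step_op d \<nu> \<eta> f y * student d \<nu> 1 y) * indicator A y"
      by (auto simp: step_op_def g_def ennreal_mult' split: split_indicator)
  qed
  also have "\<dots> = emeasure ?R A"
    unfolding density_law_def by (rule emeasure_density[symmetric]) measurable
  finally show "emeasure (Giry_Monad.bind ?\<mu> ?K) A = emeasure ?R A" .
qed

section \<open>Densities of the iterates relative to the target\<close>

definition initial_density :: "nat \<Rightarrow> real \<Rightarrow> (nat \<Rightarrow> real) \<Rightarrow> real" where
  "initial_density d \<nu> x = gden d 1 x / student d \<nu> 1 x"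

definition iterate :: "nat \<Rightarrow> real \<Rightarrow> real \<Rightarrow> nat \<Rightarrow> (nat \<Rightarrow> real) \<Rightarrow> real" where
  "iterate d \<nu> \<eta> k = (step_op d \<nu> \<eta> ^^ k) (initial_density d \<nu>)"

lemma iterate_0: "iterate d \<nu> \<eta> 0 = initial_density d \<nu>"
  and iterate_Suc: "iterate d \<nu> \<eta> (Suc k) = step_op d \<nu> \<eta> (iterate d \<nu> \<eta> k)"
  by (simp_all add: iterate_def)

lemma iterate_bdd:
  assumes "\<eta> > 0" "\<nu> > 0" "bdd d M (initial_density d \<nu>)"
  shows "bdd d M (iterate d \<nu> \<eta> k)"
  using assms by (induction k) (auto simp: iterate_0 iterate_Suc intro!: step_op_bdd)

lemma proximal_law_eq:
  assumes "\<eta> > 0" "\<nu> > 0" "minimizer d (cauchy_potential d \<nu>) xm" "bdd d M (initial_density d \<nu>)"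
  shows "proximal_law d (cauchy_potential d \<nu>) xm \<eta> (std_gaussian d) k =
    density_law d (\<lambda>x. iterate d \<nu> \<eta> k x * student d \<nu> 1 x)"
proof (induction k)
  case 0
  have "student d \<nu> 1 x \<noteq> 0" for x using student_pos[OF assms(2) zero_less_one, of d x] by simp
  then show ?case
    by (simp add: iterate_0 initial_density_def density_law_def std_gaussian_eq_density)
next
  case (Suc k)
  then show ?case
    using proximal_step_law[OF assms(1-3) iterate_bdd[OF assms(1,2,4)]] by (simp add: iterate_Suc)
qed

lemma iterate_mass:
  assumes "\<eta> > 0" "\<nu> > 0" "bdd d M (initial_density d \<nu>)"
  shows "(\<integral>\<^sup>+x. ennreal (iterate d \<nu> \<eta> k x) \<partial>target_law d \<nu>) = 1"
proof (induction k)
  case 0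
  have "(\<integral>\<^sup>+x. ennreal (initial_density d \<nu> x) \<partial>target_law d \<nu>) = (\<integral>\<^sup>+x. ennreal (gden d 1 x) \<partial>Rd d)"
    using assms student_pos[OF assms(2) zero_less_one]
    by (subst nn_integral_target_law)
      (auto simp: bdd_def initial_density_def ennreal_mult'[symmetric] less_imp_le less_imp_neq[symmetric] intro!: nn_integral_cong)
  also have "\<dots> = emeasure (std_gaussian d) (space (std_gaussian d))"
    unfolding std_gaussian_eq_density by (simp add: emeasure_density)
  finally show ?case using prob_space.emeasure_space_1[OF prob_space_std_gaussian] by (simp add: iterate_0)
next
  case (Suc k)
  then show ?case using step_op_mass[OF assms(1,2) iterate_bdd[OF assms]] by (simp add: iterate_Suc)
qed

text \<open>The Radon-Nikodym derivative agrees almost everywhere with the given density, and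
  dividing by the positive target density leaves \<open>f\<close>.\<close>

lemma chi_square_div_density_law:
  assumes \<nu>: "\<nu> > 0" and f: "bdd d M f"
  shows "chi_square_div d (density_law d (\<lambda>x. f x * student d \<nu> 1 x)) (cauchy_target d \<nu>) =
    (\<integral>\<^sup>+x. ennreal ((f x - 1)\<^sup>2) \<partial>target_law d \<nu>)"
proof -
  interpret R: sigma_finite_measure "Rd d" by (rule sigma_finite_Rd)
  note [measurable] = bddD(1)[OF f]
  define M where "M = density_law d (\<lambda>x. f x * student d \<nu> 1 x)"
  have ac: "absolutely_continuous (Rd d) M"
    unfolding M_def density_law_def by (intro absolutely_continuousI_density) measurable
  have "AE x in Rd d. ennreal (f x * student d \<nu> 1 x) = RN_deriv (Rd d) M x"
    unfolding M_def density_law_def by (rule R.RN_deriv_unique) auto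
  note rn = this
  have "(\<integral>\<^sup>+x. ennreal ((enn2real (RN_deriv (Rd d) M x) / cauchy_target d \<nu> x - 1)\<^sup>2 * cauchy_target d \<nu> x) \<partial>Rd d) =
    (\<integral>\<^sup>+x. ennreal (student d \<nu> 1 x) * ennreal ((f x - 1)\<^sup>2) \<partial>Rd d)"
  proof (rule nn_integral_cong_AE, use rn AE_space in eventually_elim)
    fix x assume eq: "ennreal (f x * student d \<nu> 1 x) = RN_deriv (Rd d) M x" and x: "x \<in> space (Rd d)"
    have p: "student d \<nu> 1 x > 0" by (rule student_pos[OF \<nu>]) simp
    have "enn2real (RN_deriv (Rd d) M x) = f x * student d \<nu> 1 x"
      unfolding eq[symmetric] using bddD(2)[OF f x] p by simp
    then show "ennreal ((enn2real (RN_deriv (Rd d) M x) / cauchy_target d \<nu> x - 1)\<^sup>2 * cauchy_target d \<nu> x) =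
      ennreal (student d \<nu> 1 x) * ennreal ((f x - 1)\<^sup>2)"
      using p by (simp add: cauchy_target_eq[OF \<nu> x] ennreal_mult mult.commute)
  qed
  moreover have "sets M = sets (Rd d)" by (simp add: M_def)
  ultimately have "chi_square_div d M (cauchy_target d \<nu>) = (\<integral>\<^sup>+x. ennreal (student d \<nu> 1 x) * ennreal ((f x - 1)\<^sup>2) \<partial>Rd d)"
    using ac by (simp add: chi_square_div_def)
  also have "\<dots> = (\<integral>\<^sup>+x. ennreal ((f x - 1)\<^sup>2) \<partial>target_law d \<nu>)"
    using \<nu> by (subst nn_integral_target_law) auto
  finally show ?thesis unfolding M_def .
qed

lemma iterations_required_le:
  assumes "\<eta> > 0" "\<nu> > 0" "minimizer d (cauchy_potential d \<nu>) xm" "bdd d M (initial_density d \<nu>)"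
    and "(\<integral>\<^sup>+x. ennreal ((iterate d \<nu> \<eta> k x - 1)\<^sup>2) \<partial>target_law d \<nu>) \<le> ennreal \<epsilon>"
  shows "iterations_required d \<nu> \<eta> xm \<epsilon> \<le> of_nat k"
  unfolding iterations_required_def using assms(5)
  by (intro INF_lower) (simp add: proximal_law_eq[OF assms(1-4)]
      chi_square_div_density_law[OF assms(2) iterate_bdd[OF assms(1,2,4)]])

section \<open>Lower bounds for the Poincare constants\<close>

lemma chi_density_lower_bound:
  assumes \<nu>: "\<nu> > 0" and a: "0 < a"
  obtains c where "c > 0" "\<And>n. a \<le> n \<Longrightarrow> n \<le> b \<Longrightarrow> chi_density \<nu> n \<ge> c"
proof
  define K where "K = 2 powr (1 - \<nu> / 2) / Gamma (\<nu> / 2)"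
  have K: "K > 0" using \<nu> by (auto simp: K_def intro!: divide_pos_pos Gamma_real_pos)
  \<comment> \<open>The power is monotone, in a direction that depends on whether \<nu> is at least
    1, so its minimum is at an endpoint. \<open>max a b\<close> keeps the constant positive for an
    empty interval as well.\<close>
  define c where "c = K * min (a powr (\<nu> - 1)) ((max a b) powr (\<nu> - 1)) * exp (- (max a b)\<^sup>2 / 2)"
  show "c > 0" using K a by (simp add: c_def)
  show "chi_density \<nu> n \<ge> c" if n: "a \<le> n" "n \<le> b" for n
  proof -
    have n0: "n > 0" using n a by simp
    have "min (a powr (\<nu> - 1)) ((max a b) powr (\<nu> - 1)) \<le> n powr (\<nu> - 1)"
    proof (cases "\<nu> \<ge> 1")
      case True
      then have "a powr (\<nu> - 1) \<le> n powr (\<nu> - 1)" using n a by (intro powr_mono2) auto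
      then show ?thesis by (simp add: min.coboundedI1)
    next
      case False
      then have "(max a b) powr (\<nu> - 1) \<le> n powr (\<nu> - 1)" using n n0 by (intro powr_mono2') auto
      then show ?thesis by (simp add: min.coboundedI2)
    qed
    moreover have "exp (- (max a b)\<^sup>2 / 2) \<le> exp (- n\<^sup>2 / 2)"
      using n n0 by (simp add: power_mono)
    ultimately have "c \<le> K * n powr (\<nu> - 1) * exp (- n\<^sup>2 / 2)"
      unfolding c_def using K a by (intro mult_mono) auto
    then show ?thesis using n0 by (simp add: chi_density_def K_def)
  qed
qed

lemma gden_ratio:
  assumes n: "n > 0"
  shows "gden d (1 / n) x = gden d 1 x * exp (real d * ln n - (n\<^sup>2 - 1) * (nrm d x)\<^sup>2 / 2)"
proof -
  define r where "r = (nrm d x)\<^sup>2"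
  define c where "c = (1 / (sqrt (2 * pi) * 1)) ^ d"
  have nd: "n powr real d = exp (real d * ln n)" using n by (simp add: powr_def)
  have "gden d (1 / n) x = c * (exp (real d * ln n) * exp (- r * n\<^sup>2 / 2))"
    using gden_inverse_scale[OF n zero_less_one, of d x] by (simp add: nd r_def c_def)
  also have "exp (real d * ln n) * exp (- r * n\<^sup>2 / 2) = exp (- r / 2) * exp (real d * ln n - (n\<^sup>2 - 1) * r / 2)"
    unfolding exp_add[symmetric] by (rule arg_cong[of _ _ exp]) (simp add: field_simps)
  also have "c * (exp (- r / 2) * exp (real d * ln n - (n\<^sup>2 - 1) * r / 2)) = gden d 1 x * exp (real d * ln n - (n\<^sup>2 - 1) * r / 2)"
    by (simp add: gden_def c_def r_def)
  finally show ?thesis by (simp add: r_def)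
qed

text \<open>The log-ratio is d ln n - (n^2 - 1) |x|^2 / 2. On the sphere |x|^2 = d its terms of
  first order in \<sigma> cancel, and n is moved to the side where a deviation from the sphere only
  helps. What remains is at least -5/2 d \<sigma>^2, and d \<sigma>^2 is at most 1/4.\<close>

lemma gden_ratio_lower:
  assumes d: "d \<ge> 1" and \<sigma>: "0 \<le> \<sigma>" "\<sigma> \<le> 1 / (2 * sqrt (real d))"
  shows "(nrm d x)\<^sup>2 \<le> real d \<Longrightarrow> gden d (1 / (1 + \<sigma>)) x \<ge> exp (-1) * gden d 1 x"
    and "(nrm d x)\<^sup>2 \<ge> real d \<Longrightarrow> gden d (1 / (1 - \<sigma>)) x \<ge> exp (-1) * gden d 1 x"
proof -
  have sd: "sqrt (real d) \<ge> 1" using d by simp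
  then have "1 / (2 * sqrt (real d)) \<le> 1 / 2" by (simp add: field_simps)
  then have s1: "\<sigma> \<le> 1 / 2" using \<sigma> by linarith
  have "\<sigma>\<^sup>2 \<le> (1 / (2 * sqrt (real d)))\<^sup>2" using \<sigma> by (intro power_mono)
  also have "\<dots> = 1 / (4 * real d)" using d by (simp add: power_mult_distrib power_divide)
  finally have ds: "real d * \<sigma>\<^sup>2 \<le> 1 / 4" using d by (simp add: field_simps)
  define r where "r = (nrm d x)\<^sup>2"
  {
    assume r: "(nrm d x)\<^sup>2 \<le> real d"
    have "\<sigma> - \<sigma>\<^sup>2 \<le> ln (1 + \<sigma>)" using \<sigma> s1 by (intro ln_one_plus_pos_lower_bound) auto
    then have "real d * (\<sigma> - \<sigma>\<^sup>2) \<le> real d * ln (1 + \<sigma>)" by (rule mult_left_mono) simp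
    moreover have "((1 + \<sigma>)\<^sup>2 - 1) * r / 2 \<le> ((1 + \<sigma>)\<^sup>2 - 1) * real d / 2"
      using r \<sigma> by (intro divide_right_mono mult_left_mono) (auto simp: r_def power2_eq_square algebra_simps)
    moreover have "real d * (\<sigma> - \<sigma>\<^sup>2) - ((1 + \<sigma>)\<^sup>2 - 1) * real d / 2 = - 3 / 2 * (real d * \<sigma>\<^sup>2)"
      by (simp add: power2_eq_square field_simps)
    ultimately have "-1 \<le> real d * ln (1 + \<sigma>) - ((1 + \<sigma>)\<^sup>2 - 1) * r / 2" using ds by linarith
    then have "exp (-1) \<le> exp (real d * ln (1 + \<sigma>) - ((1 + \<sigma>)\<^sup>2 - 1) * (nrm d x)\<^sup>2 / 2)" by (simp add: r_def)
    from mult_left_mono[OF this gden_nonneg[OF zero_less_one, of d x]]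
    show "gden d (1 / (1 + \<sigma>)) x \<ge> exp (-1) * gden d 1 x"
      using gden_ratio[of "1 + \<sigma>" d x] \<sigma> by (simp add: mult.commute)
  }
  {
    assume r: "(nrm d x)\<^sup>2 \<ge> real d"
    have "- \<sigma> - 2 * \<sigma>\<^sup>2 \<le> ln (1 - \<sigma>)" using \<sigma> s1 by (intro ln_one_minus_pos_lower_bound) auto
    then have "real d * (- \<sigma> - 2 * \<sigma>\<^sup>2) \<le> real d * ln (1 - \<sigma>)" by (rule mult_left_mono) simp
    moreover have "(1 - (1 - \<sigma>)\<^sup>2) * real d / 2 \<le> (1 - (1 - \<sigma>)\<^sup>2) * r / 2"
    proof -
      have "(1 - \<sigma>)\<^sup>2 \<le> 1\<^sup>2" using \<sigma> s1 by (intro power_mono) auto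
      then show ?thesis using r by (intro divide_right_mono mult_left_mono) (auto simp: r_def)
    qed
    moreover have "real d * (- \<sigma> - 2 * \<sigma>\<^sup>2) + (1 - (1 - \<sigma>)\<^sup>2) * real d / 2 = - 5 / 2 * (real d * \<sigma>\<^sup>2)"
      by (simp add: power2_eq_square field_simps)
    moreover have "(1 - (1 - \<sigma>)\<^sup>2) * r / 2 = - (((1 - \<sigma>)\<^sup>2 - 1) * r / 2)"
    proof -
      have "(1 - A) * r / 2 = - ((A - 1) * r / 2)" for A :: real by (simp add: field_simps)
      then show ?thesis .
    qed
    ultimately have "-1 \<le> real d * ln (1 - \<sigma>) - ((1 - \<sigma>)\<^sup>2 - 1) * r / 2" using ds by linarith
    then have "exp (-1) \<le> exp (real d * ln (1 - \<sigma>) - ((1 - \<sigma>)\<^sup>2 - 1) * (nrm d x)\<^sup>2 / 2)" by (simp add: r_def)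
    from mult_left_mono[OF this gden_nonneg[OF zero_less_one, of d x]]
    show "gden d (1 / (1 - \<sigma>)) x \<ge> exp (-1) * gden d 1 x"
      using gden_ratio[of "1 - \<sigma>" d x] \<sigma> s1 by (simp add: mult.commute)
  }
qed

text \<open>
  The Gaussian is concentrated on a shell of width \<open>O(1)\<close>, the target spreads over scales of order
  \<open>\<surd>d\<close>; restricting the mixing variable to a window of length \<open>1 / (2 \<surd>d)\<close> around 1 gives the sharp
  order of the supremum.
\<close>

lemma initial_density_bound:
  assumes \<nu>: "\<nu> > 0"
  obtains K where "K \<ge> 1" "\<And>d. d \<ge> 1 \<Longrightarrow> bdd d (K * sqrt (real d)) (initial_density d \<nu>)"
proof -
  obtain c where c: "c > 0" "\<And>n. 1 / 2 \<le> n \<Longrightarrow> n \<le> 2 \<Longrightarrow> chi_density \<nu> n \<ge> c"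
    using chi_density_lower_bound[OF \<nu>, of "1 / 2" 2] by auto
  \<comment> \<open>From the bound c on the chi density, the factor exp (-1) of
    \<open>gden_ratio_lower\<close> and the window length 1 / (2 sqrt d).\<close>
  define K where "K = max 1 (2 * exp 1 / c)"
  have "bdd d (K * sqrt (real d)) (initial_density d \<nu>)" if d: "d \<ge> 1" for d
  proof -
    have sd: "sqrt (real d) \<ge> 1" using d by simp
    define w where "w = 1 / (2 * sqrt (real d))"
    have w: "0 < w" "w \<le> 1 / 2" using sd by (auto simp: w_def field_simps)
    have "gden d 1 x \<le> K * sqrt (real d) * student d \<nu> 1 x" for x
    proof -
      \<comment> \<open>The window lies above 1 for points inside the sphere of radius sqrt d and
        below 1 for points outside, following the two halves of
        \<open>gden_ratio_lower\<close>.\<close>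
      obtain l where l: "1 / 2 \<le> l" "l + w \<le> 2" "\<And>n. l \<le> n \<Longrightarrow> n \<le> l + w \<Longrightarrow> gden d (1 / n) x \<ge> exp (-1) * gden d 1 x"
      proof (cases "(nrm d x)\<^sup>2 \<le> real d")
        case True
        have "gden d (1 / n) x \<ge> exp (-1) * gden d 1 x" if "1 \<le> n" "n \<le> 1 + w" for n
          using gden_ratio_lower(1)[OF d _ _ True, of "n - 1"] that by (simp add: w_def)
        then show ?thesis using w by (intro that[of 1]) auto
      next
        case False
        have "gden d (1 / n) x \<ge> exp (-1) * gden d 1 x" if "1 - w \<le> n" "n \<le> 1" for n
          using gden_ratio_lower(2)[OF d, of "1 - n" x] that False by (simp add: w_def)
        then show ?thesis using w by (intro that[of "1 - w"]) auto
      qed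
      have "ennreal (c * (exp (-1) * gden d 1 x)) * ennreal w = (\<integral>\<^sup>+n. ennreal (c * (exp (-1) * gden d 1 x)) * indicator {l..l + w} n \<partial>lborel)"
        using w by (subst nn_integral_cmult_indicator) auto
      also have "\<dots> \<le> (\<integral>\<^sup>+n. ennreal (chi_density \<nu> n) * ennreal (gden d (1 / n) x) \<partial>lborel)"
      proof (rule nn_integral_mono)
        fix n :: real
        show "ennreal (c * (exp (-1) * gden d 1 x)) * indicator {l..l + w} n \<le> ennreal (chi_density \<nu> n) * ennreal (gden d (1 / n) x)"
        proof (cases "n \<in> {l..l + w}")
          case True
          then have "c * (exp (-1) * gden d 1 x) \<le> chi_density \<nu> n * gden d (1 / n) x"
            using l c \<nu> by (intro mult_mono) auto
          then show ?thesis using True \<nu> by (simp add: ennreal_mult'[symmetric] ennreal_leI)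
        qed simp
      qed
      also have "\<dots> = ennreal (student d \<nu> 1 x)" by (rule student_mixture_pointwise[OF \<nu> zero_less_one])
      finally have "c * (exp (-1) * gden d 1 x) * w \<le> student d \<nu> 1 x"
        using w \<nu> c by (simp add: ennreal_mult''[symmetric])
      then have "gden d 1 x \<le> 2 * exp 1 / c * sqrt (real d) * student d \<nu> 1 x"
        using c(1) sd by (simp add: w_def exp_minus field_simps)
      also have "\<dots> \<le> K * sqrt (real d) * student d \<nu> 1 x"
        using \<nu> by (intro mult_right_mono) (auto simp: K_def)
      finally show ?thesis .
    qed
    moreover have "initial_density d \<nu> \<in> borel_measurable (Rd d)" unfolding initial_density_def[abs_def] by measurable
    ultimately show ?thesis
      using student_pos[OF \<nu> zero_less_one, of d] \<nu> by (auto simp: bdd_def initial_density_def pos_divide_le_eq)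
  qed
  then show thesis by (intro that[of K]) (auto simp: K_def)
qed

section \<open>Concentration of the norm of a Gaussian vector\<close>

lemma gaussian_second_moment: "(\<integral>\<^sup>+z. ennreal ((nrm d z)\<^sup>2) \<partial>std_gaussian d) = ennreal (real d)"
proof -
  have one: "(\<integral>\<^sup>+t. ennreal (t\<^sup>2) \<partial>std_normal_distribution) = 1"
  proof -
    have "has_bochner_integral lborel (\<lambda>x. std_normal_density x * x ^ (2 * 1)) (fact (2 * 1) / (2 ^ 1 * fact 1))"
      by (rule std_normal_moment_even)
    then have "(\<integral>\<^sup>+t. ennreal (std_normal_density t * t\<^sup>2) \<partial>lborel) = 1"
      by (subst nn_integral_eq_integral) (auto simp: has_bochner_integral_iff)
    then show ?thesis by (subst nn_integral_density) (auto simp: ennreal_mult')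
  qed
  have comp: "(\<integral>\<^sup>+z. ennreal ((z i)\<^sup>2) \<partial>std_gaussian d) = 1" if i: "i < d" for i
  proof -
    have D: "distr (std_gaussian d) std_normal_distribution (\<lambda>z. z i) = std_normal_distribution"
      unfolding std_gaussian_def using i
      by (intro distr_PiM_component prob_space_normal_density) auto
    have m: "(\<lambda>z. z i) \<in> measurable (std_gaussian d) std_normal_distribution"
      using Rd_component[of "\<lambda>z. z" "Rd d" d i] i by (simp cong: measurable_cong_sets)
    show ?thesis
      unfolding one[symmetric] by (subst D[symmetric], subst nn_integral_distr[OF m]) auto
  qed
  have [measurable]: "(\<lambda>z. z i) \<in> borel_measurable (Rd d)" if "i < d" for i
    using Rd_component[of "\<lambda>z. z" "Rd d" d i] that by simp
  have "(\<integral>\<^sup>+z. ennreal ((nrm d z)\<^sup>2) \<partial>std_gaussian d) = (\<integral>\<^sup>+z. (\<Sum>i<d. ennreal ((z i)\<^sup>2)) \<partial>std_gaussian d)"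
    by (simp add: nrm_sq sum_ennreal)
  also have "\<dots> = (\<Sum>i<d. \<integral>\<^sup>+z. ennreal ((z i)\<^sup>2) \<partial>std_gaussian d)"
    by (rule nn_integral_sum) auto
  also have "\<dots> = ennreal (real d)" by (simp add: comp ennreal_of_nat_eq_real_of_nat)
  finally show ?thesis .
qed

lemma one_le_ennreal: "1 \<le> ennreal x \<longleftrightarrow> 1 \<le> x"
  using ennreal_le_iff2[of 1 x] by auto

lemma gaussian_norm_upper:
  assumes d: "d \<ge> 1" and s: "s > 0"
  shows "emeasure (std_gaussian d) {z\<in>space (Rd d). nrm d z \<ge> s * sqrt (real d)} \<le> ennreal (1 / s\<^sup>2)"
proof -
  have c: "s\<^sup>2 * real d > 0" using d s by simp
  have "{z\<in>space (Rd d). nrm d z \<ge> s * sqrt (real d)} = {z\<in>space (std_gaussian d). 1 \<le> ennreal (1 / (s\<^sup>2 * real d)) * ennreal ((nrm d z)\<^sup>2)}"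
  proof -
    have "nrm d z \<ge> s * sqrt (real d) \<longleftrightarrow> 1 \<le> ennreal (1 / (s\<^sup>2 * real d)) * ennreal ((nrm d z)\<^sup>2)" for z
    proof -
      have "nrm d z \<ge> s * sqrt (real d) \<longleftrightarrow> (s * sqrt (real d))\<^sup>2 \<le> (nrm d z)\<^sup>2"
        using s by (subst power2_le_iff_abs_le) (auto simp: L2_set_nonneg)
      also have "\<dots> \<longleftrightarrow> 1 \<le> (nrm d z)\<^sup>2 / (s\<^sup>2 * real d)" using c by (simp add: power_mult_distrib le_divide_eq)
      also have "\<dots> \<longleftrightarrow> 1 \<le> ennreal ((nrm d z)\<^sup>2 / (s\<^sup>2 * real d))" by (simp add: one_le_ennreal)
      finally show ?thesis using c by (simp add: ennreal_mult[symmetric])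
    qed
    then show ?thesis by simp
  qed
  also have "emeasure (std_gaussian d) \<dots> \<le> ennreal (1 / (s\<^sup>2 * real d)) * (\<integral>\<^sup>+z. ennreal ((nrm d z)\<^sup>2) * indicator (space (std_gaussian d)) z \<partial>std_gaussian d)"
    by (rule order_trans[OF _ nn_integral_Markov_inequality]) (auto intro!: emeasure_mono)
  also have "\<dots> = ennreal (1 / (s\<^sup>2 * real d)) * ennreal (real d)"
    by (subst gaussian_second_moment[symmetric]) (auto intro!: arg_cong2[of _ _ _ _ "(*)"] nn_integral_cong)
  also have "\<dots> = ennreal (1 / s\<^sup>2)" using d by (simp add: ennreal_mult[symmetric])
  finally show ?thesis .
qed

text \<open>Chernoff's bound with exp (- |z|^2), whose mean is 3^(- d / 2) since tilting by it again
  produces a Gaussian. Geometric decay in d is wanted because this probability is later multiplied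
  by the square of the bound of order sqrt d on the starting density.\<close>

lemma gaussian_norm_lower:
  "emeasure (std_gaussian d) {z\<in>space (Rd d). nrm d z \<le> sqrt (real d) / 2} \<le> ennreal ((3 / 4) ^ d)"
proof -
  have "emeasure (std_gaussian d) {z\<in>space (Rd d). nrm d z \<le> sqrt (real d) / 2} =
    (\<integral>\<^sup>+z. indicator {z\<in>space (Rd d). nrm d z \<le> sqrt (real d) / 2} z \<partial>std_gaussian d)" by simp
  also have "\<dots> \<le> (\<integral>\<^sup>+z. ennreal (exp (real d / 4)) * ennreal (exp (- (nrm d z)\<^sup>2)) \<partial>std_gaussian d)"
  proof (rule nn_integral_mono)
    fix z
    have "1 \<le> exp (real d / 4) * exp (- (nrm d z)\<^sup>2)" if "nrm d z \<le> sqrt (real d) / 2"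
    proof -
      have "(nrm d z)\<^sup>2 \<le> (sqrt (real d) / 2)\<^sup>2" using that by (intro power_mono) (auto simp: L2_set_nonneg)
      then have "(nrm d z)\<^sup>2 \<le> real d / 4" by (simp add: power_divide)
      then show ?thesis by (simp add: exp_add[symmetric])
    qed
    then show "indicator {z\<in>space (Rd d). nrm d z \<le> sqrt (real d) / 2} z \<le> ennreal (exp (real d / 4)) * ennreal (exp (- (nrm d z)\<^sup>2))"
      by (auto simp: ennreal_mult[symmetric] one_le_ennreal split: split_indicator)
  qed
  also have "\<dots> = ennreal (exp (real d / 4)) * (\<integral>\<^sup>+z. ennreal (exp (- (nrm d z)\<^sup>2)) * ennreal (gden d 1 z) \<partial>Rd d)"
    unfolding std_gaussian_eq_density
    by (subst nn_integral_density) (auto simp: nn_integral_cmult[symmetric] mult_ac intro!: nn_integral_cong)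
  also have "(\<integral>\<^sup>+z. ennreal (exp (- (nrm d z)\<^sup>2)) * ennreal (gden d 1 z) \<partial>Rd d) =
     (\<integral>\<^sup>+z. ennreal ((1 / sqrt 3) ^ d) * ennreal (gden d (1 / sqrt 3) z) \<partial>Rd d)"
  proof (rule nn_integral_cong)
    fix z
    have e: "exp (- (nrm d z)\<^sup>2) * exp (- (nrm d z)\<^sup>2 / 2) = exp (- (nrm d z)\<^sup>2 / (2 * (1 / sqrt 3)\<^sup>2))"
      unfolding exp_add[symmetric] by (rule arg_cong[of _ _ exp]) (simp add: power_divide)
    have p: "(1 / sqrt (2 * pi)) ^ d = (1 / sqrt 3) ^ d * (1 / (sqrt (2 * pi) * (1 / sqrt 3))) ^ d"
      unfolding power_mult_distrib[symmetric] by simp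
    have "exp (- (nrm d z)\<^sup>2) * gden d 1 z = (1 / sqrt (2 * pi)) ^ d * (exp (- (nrm d z)\<^sup>2) * exp (- (nrm d z)\<^sup>2 / 2))"
      by (simp add: gden_def)
    also have "\<dots> = (1 / sqrt 3) ^ d * gden d (1 / sqrt 3) z"
      unfolding e p gden_def by (simp only: mult.assoc)
    finally have "exp (- (nrm d z)\<^sup>2) * gden d 1 z = (1 / sqrt 3) ^ d * gden d (1 / sqrt 3) z" .
    then show "ennreal (exp (- (nrm d z)\<^sup>2)) * ennreal (gden d 1 z) = ennreal ((1 / sqrt 3) ^ d) * ennreal (gden d (1 / sqrt 3) z)"
      by (simp add: ennreal_mult'[symmetric])
  qed
  also have "\<dots> = ennreal ((1 / sqrt 3) ^ d) * (\<integral>\<^sup>+z. ennreal (gden d (1 / sqrt 3) z) \<partial>Rd d)"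
    by (rule nn_integral_cmult) measurable
  also have "(\<integral>\<^sup>+z. ennreal (gden d (1 / sqrt 3) z) \<partial>Rd d) = 1"
    using gden_vscale[of "1 / sqrt 3" "\<lambda>_. 1" d] prob_space.emeasure_space_1[OF prob_space_std_gaussian, of d] by simp
  also have "ennreal (exp (real d / 4)) * (ennreal ((1 / sqrt 3) ^ d) * 1) = ennreal ((exp (1 / 4) / sqrt 3) ^ d)"
    by (simp add: ennreal_mult[symmetric] power_divide exp_of_nat_mult[symmetric])
  also have "\<dots> \<le> ennreal ((3 / 4) ^ d)"
  proof (intro ennreal_leI power_mono)
    \<comment> \<open>Taking fourth powers reduces the claim to e <= 729 / 256, about 2.85.\<close>
    have "(exp (1 / 4)) ^ 4 \<le> (3 / 4 * sqrt 3 :: real) ^ 4"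
    proof -
      have "(exp (1 / 4 :: real)) ^ 4 = exp 1" by (simp add: exp_of_nat_mult[symmetric])
      moreover have "(sqrt 3 :: real) ^ 4 = 9" using power_mult[of "sqrt 3 :: real" 2 2] by simp
      ultimately show ?thesis using e_less_272 by (simp add: power_mult_distrib power_divide)
    qed
    then have "exp (1 / 4) \<le> 3 / 4 * sqrt (3::real)" by (rule power_le_imp_le_base[of _ 3, simplified numeral_eq_Suc, simplified]) (auto simp: numeral_eq_Suc)
    then show "exp (1 / 4) / sqrt 3 \<le> 3 / (4::real)" by (simp add: field_simps)
  qed simp
  finally show ?thesis .
qed

lemma target_mixture:
  assumes "\<nu> > 0" "\<psi> \<in> borel_measurable (Rd d)"
  shows "(\<integral>\<^sup>+x. \<psi> x \<partial>target_law d \<nu>) = (\<integral>\<^sup>+n. (\<integral>\<^sup>+z. \<psi> (vscale d (1 / n) z) \<partial>std_gaussian d) \<partial>chi_law \<nu>)"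
  using student_mixture[of \<nu> 1 \<psi> d] assms by (simp add: nn_integral_target_law mult.commute)

lemma chi_law_interval_pos:
  assumes \<nu>: "\<nu> > 0" and "0 < a" "a < b"
  shows "emeasure (chi_law \<nu>) {a..b} > 0"
proof -
  obtain c where c: "c > 0" "\<And>n. a \<le> n \<Longrightarrow> n \<le> b \<Longrightarrow> chi_density \<nu> n \<ge> c"
    using chi_density_lower_bound[OF \<nu> assms(2), of b] by auto
  have "0 < ennreal (c * (b - a))" using assms c by simp
  also have "\<dots> = (\<integral>\<^sup>+n. ennreal c * indicator {a..b} n \<partial>lborel)"
    using assms c by (subst nn_integral_cmult_indicator) (auto simp: ennreal_mult)
  also have "\<dots> \<le> (\<integral>\<^sup>+n. ennreal (chi_density \<nu> n) * indicator {a..b} n \<partial>lborel)"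
    using c by (intro nn_integral_mono) (auto intro!: ennreal_leI split: split_indicator)
  also have "\<dots> = emeasure (chi_law \<nu>) {a..b}" unfolding chi_law_def by (subst emeasure_density) auto
  finally show ?thesis .
qed

section \<open>A test function at the scale of the target\<close>

definition test_fun :: "nat \<Rightarrow> (nat \<Rightarrow> real) \<Rightarrow> real" where
  "test_fun d x = min 1 (nrm d x / sqrt (real d))"

lemma measurable_test_fun [measurable]: "test_fun d \<in> borel_measurable (Rd d)"
  unfolding test_fun_def[abs_def] by measurable

lemma test_fun_bounds: "0 \<le> test_fun d x" "test_fun d x \<le> 1"
  by (auto simp: test_fun_def L2_set_nonneg)

text \<open>The mixing law does not depend on d. For n between 1/4 and 1/2 the point G / n has norm
  at least sqrt d with probability at least 1/4, so the function is 1; for n between 4 and 5 it is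
  at most 1/2 with such a probability. Whatever m is, one of the two events keeps the function at
  distance 1/4 from m.\<close>

lemma test_fun_variance:
  assumes \<nu>: "\<nu> > 0"
  obtains \<kappa> where "\<kappa> > 0" "\<And>d m. d \<ge> 1 \<Longrightarrow> ennreal \<kappa> \<le> (\<integral>\<^sup>+x. ennreal ((test_fun d x - m)\<^sup>2) \<partial>target_law d \<nu>)"
proof -
  define k1 where "k1 = emeasure (chi_law \<nu>) {1/4..1/2}"
  define k2 where "k2 = emeasure (chi_law \<nu>) {4..5}"
  have k: "k1 > 0" "k2 > 0" unfolding k1_def k2_def using chi_law_interval_pos[OF \<nu>] by auto
  interpret C: prob_space "chi_law \<nu>" by (rule prob_space_chi_law[OF \<nu>])
  have "k1 * ennreal (1 / 4) > 0" "k2 * ennreal (1 / 4) > 0" using k by (auto simp: ennreal_zero_less_mult_iff)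
  then have "min (k1 * ennreal (1 / 4)) (k2 * ennreal (1 / 4)) > 0" by (simp add: min_def)
  then obtain q where q: "q > 0" "ennreal q \<le> min (k1 * ennreal (1 / 4)) (k2 * ennreal (1 / 4))"
  proof -
    assume *: "\<And>q. 0 < q \<Longrightarrow> ennreal q \<le> min (k1 * ennreal (1 / 4)) (k2 * ennreal (1 / 4)) \<Longrightarrow> thesis"
      and pos: "0 < min (k1 * ennreal (1 / 4)) (k2 * ennreal (1 / 4))"
    define v where "v = min (k1 * ennreal (1 / 4)) (k2 * ennreal (1 / 4))"
    have "k1 < \<infinity>" unfolding k1_def by (simp add: less_top[symmetric])
    then have "k1 * ennreal (1 / 4) < \<infinity>" by (simp add: ennreal_mult_less_top)
    then have "v < \<infinity>" unfolding v_def by (simp add: min.strict_coboundedI1)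
    then have "ennreal (enn2real v) = v" by simp
    moreover have "enn2real v > 0" using pos \<open>v < \<infinity>\<close> unfolding v_def[symmetric] by (simp add: enn2real_positive_iff)
    ultimately show thesis using *[of "enn2real v"] by (simp add: v_def)
  qed
  have main: "ennreal (q / 16) \<le> (\<integral>\<^sup>+x. ennreal ((test_fun d x - m)\<^sup>2) \<partial>target_law d \<nu>)" if d: "d \<ge> 1" for d m
  proof -
    interpret G: prob_space "std_gaussian d" by (rule prob_space_std_gaussian)
    have sd: "sqrt (real d) > 0" using d by simp
    have key: "ennreal (1 / 16) * (emeasure (chi_law \<nu>) I * ennreal (1 / 4)) \<le> (\<integral>\<^sup>+x. ennreal ((test_fun d x - m)\<^sup>2) \<partial>target_law d \<nu>)"
      if I: "I \<in> sets borel" and J: "J \<in> sets (Rd d)" "emeasure (std_gaussian d) J \<ge> ennreal (1 / 4)"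
        and le: "\<And>n z. n \<in> I \<Longrightarrow> z \<in> J \<Longrightarrow> (test_fun d (vscale d (1 / n) z) - m)\<^sup>2 \<ge> 1 / 16" for I J
    proof -
      have "ennreal (1 / 16) * (emeasure (chi_law \<nu>) I * ennreal (1 / 4)) \<le> ennreal (1 / 16) * (emeasure (chi_law \<nu>) I * emeasure (std_gaussian d) J)"
        by (intro mult_left_mono J) auto
      also have "\<dots> = (\<integral>\<^sup>+n. (\<integral>\<^sup>+z. ennreal (1 / 16) * (indicator I n * indicator J z) \<partial>std_gaussian d) \<partial>chi_law \<nu>)"
        using I J by (simp add: nn_integral_cmult nn_integral_multc)
      also have "\<dots> \<le> (\<integral>\<^sup>+n. (\<integral>\<^sup>+z. ennreal ((test_fun d (vscale d (1 / n) z) - m)\<^sup>2) \<partial>std_gaussian d) \<partial>chi_law \<nu>)"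
        using le by (intro nn_integral_mono) (auto intro!: ennreal_leI split: split_indicator)
      also have "\<dots> = (\<integral>\<^sup>+x. ennreal ((test_fun d x - m)\<^sup>2) \<partial>target_law d \<nu>)"
        using \<nu> by (intro target_mixture[symmetric]) auto
      finally show ?thesis .
    qed
    have sq: "(a - m)\<^sup>2 \<ge> 1 / 16" if "\<bar>a - m\<bar> \<ge> 1 / 4" for a :: real
    proof -
      have "(1 / 4)\<^sup>2 \<le> \<bar>a - m\<bar>\<^sup>2" using that by (intro power_mono) auto
      then show ?thesis by (simp add: power2_eq_square)
    qed
    have "ennreal (1 / 16) * ennreal q \<le> (\<integral>\<^sup>+x. ennreal ((test_fun d x - m)\<^sup>2) \<partial>target_law d \<nu>)"
    proof (cases "m \<le> 3 / 4")
      case True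
      define J where "J = {z\<in>space (Rd d). nrm d z > sqrt (real d) / 2}"
      have J [measurable]: "J \<in> sets (Rd d)" unfolding J_def by measurable
      have "G.prob {z\<in>space (Rd d). nrm d z \<le> sqrt (real d) / 2} \<le> (3 / 4) ^ d"
        using gaussian_norm_lower[of d] by (simp add: G.emeasure_eq_measure)
      also have "\<dots> \<le> 3 / 4" using power_decreasing[OF d, of "3 / 4 :: real"] by simp
      finally have "G.prob {z\<in>space (Rd d). nrm d z \<le> sqrt (real d) / 2} \<le> 3 / 4" .
      moreover have "J = space (std_gaussian d) - {z\<in>space (Rd d). nrm d z \<le> sqrt (real d) / 2}" by (auto simp: J_def)
      moreover have "G.prob (space (std_gaussian d) - S) = 1 - G.prob S" if "S \<in> sets (Rd d)" for S
        using that by (intro G.prob_compl) simp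
      ultimately have "G.prob J \<ge> 1 / 4" by simp
      then have "emeasure (std_gaussian d) J \<ge> ennreal (1 / 4)" by (simp add: G.emeasure_eq_measure ennreal_leI)
      moreover have "(test_fun d (vscale d (1 / n) z) - m)\<^sup>2 \<ge> 1 / 16" if "n \<in> {1/4..1/2}" "z \<in> J" for n z
      proof (rule sq)
        have "1 / n \<ge> 2" using that by (simp add: field_simps)
        then have "(1 / n) * nrm d z \<ge> 2 * (sqrt (real d) / 2)" using that sd by (intro mult_mono) (auto simp: J_def)
        then have "test_fun d (vscale d (1 / n) z) = 1" using that sd by (simp add: test_fun_def min_def le_divide_eq mult.commute)
        then show "\<bar>test_fun d (vscale d (1 / n) z) - m\<bar> \<ge> 1 / 4" using True by simp
      qed
      ultimately have "ennreal (1 / 16) * (k1 * ennreal (1 / 4)) \<le> (\<integral>\<^sup>+x. ennreal ((test_fun d x - m)\<^sup>2) \<partial>target_law d \<nu>)"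
        unfolding k1_def using J by (intro key) auto
      then show ?thesis using q(2) by (meson min.boundedE mult_left_mono order_trans zero_le)
    next
      case False
      define J where "J = {z\<in>space (Rd d). nrm d z < 2 * sqrt (real d)}"
      have J [measurable]: "J \<in> sets (Rd d)" unfolding J_def by measurable
      have "G.prob {z\<in>space (Rd d). nrm d z \<ge> 2 * sqrt (real d)} \<le> 1 / 4"
        using gaussian_norm_upper[OF d, of 2] by (simp add: G.emeasure_eq_measure)
      moreover have "J = space (std_gaussian d) - {z\<in>space (Rd d). nrm d z \<ge> 2 * sqrt (real d)}" by (auto simp: J_def)
      moreover have "G.prob (space (std_gaussian d) - S) = 1 - G.prob S" if "S \<in> sets (Rd d)" for S
        using that by (intro G.prob_compl) simp
      ultimately have "G.prob J \<ge> 1 / 4" by simp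
      then have "emeasure (std_gaussian d) J \<ge> ennreal (1 / 4)" by (simp add: G.emeasure_eq_measure ennreal_leI)
      moreover have "(test_fun d (vscale d (1 / n) z) - m)\<^sup>2 \<ge> 1 / 16" if "n \<in> {4..5}" "z \<in> J" for n z
      proof (rule sq)
        have "1 / n \<le> 1 / 4" "1 / n \<ge> 0" using that by (auto simp: field_simps)
        then have "(1 / n) * nrm d z \<le> 1 / 4 * (2 * sqrt (real d))" using that by (intro mult_mono) (auto simp: J_def)
        then have "nrm d (vscale d (1 / n) z) / sqrt (real d) \<le> 1 / 2" using that sd by (simp add: divide_le_eq mult.commute)
        then have "test_fun d (vscale d (1 / n) z) \<le> 1 / 2" unfolding test_fun_def by linarith
        then show "\<bar>test_fun d (vscale d (1 / n) z) - m\<bar> \<ge> 1 / 4" using False by simp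
      qed
      ultimately have "ennreal (1 / 16) * (k2 * ennreal (1 / 4)) \<le> (\<integral>\<^sup>+x. ennreal ((test_fun d x - m)\<^sup>2) \<partial>target_law d \<nu>)"
        unfolding k2_def using J by (intro key) auto
      then show ?thesis using q(2) by (meson min.boundedE mult_left_mono order_trans zero_le)
    qed
    then show ?thesis using q(1) by (simp add: ennreal_mult[symmetric])
  qed
  show thesis by (rule that[of "q / 16"]) (use q(1) main in auto)
qed

lemma test_fun_lipschitz: "d \<ge> 1 \<Longrightarrow> \<bar>test_fun d (vadd d y z) - test_fun d y\<bar> \<le> nrm d z / sqrt (real d)"
proof -
  assume d: "d \<ge> 1"
  have "\<bar>nrm d (vadd d y z) - nrm d y\<bar> \<le> nrm d z"
    using nrm_triangle[of d y z] nrm_triangle_lower[of y d z] by linarith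
  then have "\<bar>nrm d (vadd d y z) / sqrt (real d) - nrm d y / sqrt (real d)\<bar> \<le> nrm d z / sqrt (real d)"
    using d by (simp add: diff_divide_distrib[symmetric] divide_right_mono)
  then show ?thesis unfolding test_fun_def by linarith
qed

text \<open>With jumps written as G / n, those with n <= 1 change the function by at most 1. For n
  >= 1 the Lipschitz constant 1 / sqrt d against the second moment d of G gives 1 / n^2. Both ranges
  integrate to at most 1, uniformly in d.\<close>

lemma test_fun_energy:
  assumes d: "d \<ge> 1" and \<nu>: "\<nu> > 0"
  shows "dirichlet_form d (student d \<nu> 1) (\<lambda>x. test_fun d x - m) \<le> ennreal 2"
proof -
  interpret T: prob_space "target_law d \<nu>" by (rule prob_space_target_law[OF \<nu>])
  interpret G: prob_space "std_gaussian d" by (rule prob_space_std_gaussian)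
  have inner: "(\<integral>\<^sup>+z. ennreal ((test_fun d (vadd d y z) - test_fun d y)\<^sup>2) * ennreal (c_frac d / nrm d z ^ (d + 1)) \<partial>Rd d) \<le> ennreal 2"
    if [measurable]: "y \<in> space (Rd d)" for y
  proof -
    have bound: "(\<integral>\<^sup>+z. ennreal ((test_fun d (vadd d y (vscale d (1 / n) z)) - test_fun d y)\<^sup>2) \<partial>std_gaussian d) * indicator {0<..} n \<le>
      indicator {0..1} n + ennreal (1 / n\<^sup>2) * indicator {1..} n" for n :: real
    proof -
      have a: "(\<integral>\<^sup>+z. ennreal ((test_fun d (vadd d y (vscale d (1 / n) z)) - test_fun d y)\<^sup>2) \<partial>std_gaussian d) \<le> 1"
      proof -
        have "(\<integral>\<^sup>+z. ennreal ((test_fun d (vadd d y (vscale d (1 / n) z)) - test_fun d y)\<^sup>2) \<partial>std_gaussian d) \<le> (\<integral>\<^sup>+z. 1 \<partial>std_gaussian d)"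
        proof (rule nn_integral_mono)
          fix z
          have "\<bar>test_fun d (vadd d y (vscale d (1 / n) z)) - test_fun d y\<bar> \<le> 1"
            using test_fun_bounds[of d y] test_fun_bounds[of d "vadd d y (vscale d (1 / n) z)"] by linarith
          then have "(test_fun d (vadd d y (vscale d (1 / n) z)) - test_fun d y)\<^sup>2 \<le> 1" by (simp add: abs_square_le_1)
          then show "ennreal ((test_fun d (vadd d y (vscale d (1 / n) z)) - test_fun d y)\<^sup>2) \<le> 1" by simp
        qed
        then show ?thesis using G.emeasure_space_1 by simp
      qed
      have b: "(\<integral>\<^sup>+z. ennreal ((test_fun d (vadd d y (vscale d (1 / n) z)) - test_fun d y)\<^sup>2) \<partial>std_gaussian d) \<le> ennreal (1 / n\<^sup>2)"
      proof -
        have "(\<integral>\<^sup>+z. ennreal ((test_fun d (vadd d y (vscale d (1 / n) z)) - test_fun d y)\<^sup>2) \<partial>std_gaussian d) \<le>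
          (\<integral>\<^sup>+z. ennreal (1 / (n\<^sup>2 * real d)) * ennreal ((nrm d z)\<^sup>2) \<partial>std_gaussian d)"
        proof (rule nn_integral_mono)
          fix z
          have "\<bar>test_fun d (vadd d y (vscale d (1 / n) z)) - test_fun d y\<bar>\<^sup>2 \<le> (nrm d (vscale d (1 / n) z) / sqrt (real d))\<^sup>2"
            by (intro power_mono test_fun_lipschitz[OF d]) simp
          then have "(test_fun d (vadd d y (vscale d (1 / n) z)) - test_fun d y)\<^sup>2 \<le> 1 / (n\<^sup>2 * real d) * (nrm d z)\<^sup>2"
            by (simp add: power_mult_distrib power_divide)
          then show "ennreal ((test_fun d (vadd d y (vscale d (1 / n) z)) - test_fun d y)\<^sup>2) \<le> ennreal (1 / (n\<^sup>2 * real d)) * ennreal ((nrm d z)\<^sup>2)"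
            by (simp only: ennreal_mult''[symmetric] zero_le_power2 ennreal_leI)
        qed
        also have "\<dots> = ennreal (1 / (n\<^sup>2 * real d)) * ennreal (real d)"
          by (subst nn_integral_cmult) (auto simp: gaussian_second_moment)
        also have "\<dots> = ennreal (1 / n\<^sup>2)" using d by (simp add: ennreal_mult''[symmetric])
        finally show ?thesis .
      qed
      show ?thesis
      proof (cases "n \<le> 1")
        case True
        have "(\<integral>\<^sup>+z. ennreal ((test_fun d (vadd d y (vscale d (1 / n) z)) - test_fun d y)\<^sup>2) \<partial>std_gaussian d) * indicator {0<..} n \<le> indicator {0..1} n"
          using a True by (auto split: split_indicator)
        then show ?thesis by (rule add_increasing2[rotated]) simp
      qed (use b in auto)
    qed
    have tail: "(\<integral>\<^sup>+n. ennreal (1 / n\<^sup>2) * indicator {1..} n \<partial>lborel) = ennreal (0 - (- 1 / 1))"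
    proof (rule nn_integral_FTC_atLeast[where F = "\<lambda>x. - 1 / x" and T = 0])
      show "DERIV (\<lambda>x. - 1 / x) x :> 1 / x\<^sup>2" if "1 \<le> x" for x :: real
        using that by (auto intro!: derivative_eq_intros simp: power2_eq_square)
      show "((\<lambda>x::real. - 1 / x) \<longlongrightarrow> 0) at_top" by real_asymp
    qed auto
    have "(\<integral>\<^sup>+z. ennreal ((test_fun d (vadd d y z) - test_fun d y)\<^sup>2) * ennreal (c_frac d / nrm d z ^ (d + 1)) \<partial>Rd d) =
      ennreal (sqrt (2 / pi)) * (\<integral>\<^sup>+n. (\<integral>\<^sup>+z. ennreal ((test_fun d (vadd d y (vscale d (1 / n) z)) - test_fun d y)\<^sup>2) \<partial>std_gaussian d) * indicator {0<..} n \<partial>lborel)"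
      by (rule singular_mixture[OF d]) measurable
    also have "\<dots> \<le> 1 * (\<integral>\<^sup>+n. indicator {0..1} n + ennreal (1 / n\<^sup>2) * indicator {1..} n \<partial>lborel)"
    proof (intro mult_mono nn_integral_mono bound)
      have "2 / pi \<le> 1" using pi_gt3 by simp
      then show "ennreal (sqrt (2 / pi)) \<le> 1" by simp
    qed auto
    also have "\<dots> = 1 + 1" by (subst nn_integral_add) (auto simp: tail)
    finally show ?thesis by (simp add: one_add_one)
  qed
  have "dirichlet_form d (student d \<nu> 1) (\<lambda>x. test_fun d x - m) \<le> (\<integral>\<^sup>+y. ennreal 2 \<partial>target_law d \<nu>)"
  proof -
    have "dirichlet_form d (student d \<nu> 1) (\<lambda>x. test_fun d x - m) =
      (\<integral>\<^sup>+y. (\<integral>\<^sup>+z. ennreal ((test_fun d (vadd d y z) - test_fun d y)\<^sup>2) * ennreal (c_frac d / nrm d z ^ (d + 1)) \<partial>Rd d) \<partial>target_law d \<nu>)"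
      by (subst dirichlet_form_eq) simp_all
    also have "\<dots> \<le> (\<integral>\<^sup>+y. ennreal 2 \<partial>target_law d \<nu>)"
      by (intro nn_integral_mono inner) simp
    finally show ?thesis .
  qed
  then show ?thesis using T.emeasure_space_1 by simp
qed

lemma dirichlet_domain_test_fun:
  assumes d: "d \<ge> 1" and \<nu>: "\<nu> > 0"
  shows "(\<lambda>x. test_fun d x - m) \<in> dirichlet_domain d (cauchy_target d \<nu>)"
proof -
  interpret T: prob_space "target_law d \<nu>" by (rule prob_space_target_law[OF \<nu>])
  have "integrable (target_law d \<nu>) (\<lambda>x. (test_fun d x - m)\<^sup>2)"
  proof (rule T.integrable_const_bound[of _ "(1 + \<bar>m\<bar>)\<^sup>2"])
    have "\<bar>test_fun d x - m\<bar>\<^sup>2 \<le> (1 + \<bar>m\<bar>)\<^sup>2" for x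
      using test_fun_bounds[of d x] by (intro power_mono) auto
    then show "AE x in target_law d \<nu>. norm ((test_fun d x - m)\<^sup>2) \<le> (1 + \<bar>m\<bar>)\<^sup>2" by simp
  qed measurable
  moreover have "dirichlet_form d (student d \<nu> 1) (\<lambda>x. test_fun d x - m) < \<infinity>"
    using test_fun_energy[OF assms, of m] by (rule le_less_trans) simp
  ultimately show ?thesis
    using \<nu> by (simp add: dirichlet_domain_def density_law_cauchy_target dirichlet_form_cauchy_target)
qed

text \<open>Variance of order one against energy of order one. The bound is uniform in d, which lets
  the product bound on the number of iterations absorb additive constants.\<close>

lemma FPI_constant_lower_bound:
  assumes \<nu>: "\<nu> > 0"
  obtains \<kappa> where "\<kappa> > 0" "\<And>d C. d \<ge> 1 \<Longrightarrow> satisfies_FPI d (cauchy_target d \<nu>) C \<Longrightarrow> C \<ge> \<kappa>"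
proof -
  obtain \<kappa> where \<kappa>: "\<kappa> > 0" "\<And>d m. d \<ge> 1 \<Longrightarrow> ennreal \<kappa> \<le> (\<integral>\<^sup>+x. ennreal ((test_fun d x - m)\<^sup>2) \<partial>target_law d \<nu>)"
    using test_fun_variance[OF \<nu>] by blast
  have "C \<ge> \<kappa> / 2" if d: "d \<ge> 1" and F: "satisfies_FPI d (cauchy_target d \<nu>) C" for d C
  proof -
    have C: "C > 0" using F by (simp add: satisfies_FPI_def)
    have "ennreal \<kappa> \<le> ennreal C * dirichlet_form d (student d \<nu> 1) (\<lambda>x. test_fun d x - 0)"
      using F dirichlet_domain_test_fun[OF d \<nu>, of 0] \<kappa>(2)[OF d] \<nu>
      by (auto simp: satisfies_FPI_def density_law_cauchy_target dirichlet_form_cauchy_target elim!: ballE intro: order_trans)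
    also have "\<dots> \<le> ennreal C * ennreal 2" by (intro mult_left_mono test_fun_energy[OF d \<nu>]) simp
    also have "\<dots> = ennreal (C * 2)" using C by (simp add: ennreal_mult)
    finally show ?thesis using C by simp
  qed
  then show thesis using \<kappa>(1) by (intro that[of "\<kappa> / 2"]) auto
qed

text \<open>The centred test function has sup norm at most 1, so choosing r as half of its variance
  bound leaves the other half to be paid by the energy term.\<close>

lemma weak_FPI_constant_lower_bound:
  assumes \<nu>: "\<nu> > 0"
  obtains \<kappa> where "\<kappa> > 0" "\<And>d c. d \<ge> 1 \<Longrightarrow> c > 0 \<Longrightarrow>
    satisfies_weak_FPI d (cauchy_target d \<nu>) (\<lambda>r. c * (1 + r powr (- (1 - \<nu>) / \<nu>))) \<Longrightarrow> c \<ge> \<kappa>"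
proof -
  obtain \<kappa> where \<kappa>: "\<kappa> > 0" "\<And>d m. d \<ge> 1 \<Longrightarrow> ennreal \<kappa> \<le> (\<integral>\<^sup>+x. ennreal ((test_fun d x - m)\<^sup>2) \<partial>target_law d \<nu>)"
    using test_fun_variance[OF \<nu>] by blast
  \<comment> \<open>The parameter function at r = \<kappa> / 2, divided by c. The energy 2 and the
    remaining half of \<kappa> then give the factor 4.\<close>
  define b where "b = 1 + (\<kappa> / 2) powr (- (1 - \<nu>) / \<nu>)"
  have b: "b > 0" by (simp add: b_def add_pos_nonneg)
  have "c \<ge> \<kappa> / (4 * b)" if d: "d \<ge> 1" and c: "c > 0"
    and F: "satisfies_weak_FPI d (cauchy_target d \<nu>) (\<lambda>r. c * (1 + r powr (- (1 - \<nu>) / \<nu>)))" for d c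
  proof -
    interpret T: prob_space "target_law d \<nu>" by (rule prob_space_target_law[OF \<nu>])
    define m where "m = (LINT x|target_law d \<nu>. test_fun d x)"
    have int: "integrable (target_law d \<nu>) (test_fun d)"
      using test_fun_bounds by (intro T.integrable_const_bound[of _ 1]) auto
    have mb: "0 \<le> m" "m \<le> 1"
      unfolding m_def using T.integral_le_const[OF int, of 1] test_fun_bounds
      by (auto intro!: integral_nonneg_AE)
    have mean: "(LINT x|target_law d \<nu>. test_fun d x - m) = 0"
      using int T.prob_space by (simp add: m_def)
    have sup: "esssup (target_law d \<nu>) (\<lambda>x. ennreal \<bar>test_fun d x - m\<bar>) \<le> 1"
    proof (rule esssup_I)
      have "\<bar>test_fun d x - m\<bar> \<le> 1" for x using test_fun_bounds[of d x] mb by linarith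
      then show "AE x in target_law d \<nu>. ennreal \<bar>test_fun d x - m\<bar> \<le> 1" by simp
    qed measurable
    have "ennreal \<kappa> \<le> (\<integral>\<^sup>+x. ennreal ((test_fun d x - m)\<^sup>2) \<partial>target_law d \<nu>)" by (rule \<kappa>(2)[OF d])
    also have "\<dots> \<le> ennreal (c * b) * dirichlet_form d (student d \<nu> 1) (\<lambda>x. test_fun d x - m)
       + ennreal (\<kappa> / 2) * (esssup (target_law d \<nu>) (\<lambda>x. ennreal \<bar>test_fun d x - m\<bar>))\<^sup>2"
      using F dirichlet_domain_test_fun[OF d \<nu>, of m] mean \<kappa>(1) \<nu>
      unfolding satisfies_weak_FPI_def density_law_cauchy_target[OF \<nu>] dirichlet_form_cauchy_target[OF \<nu>] b_def
      by (meson half_gt_zero)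
    also have "\<dots> \<le> ennreal (c * b) * ennreal 2 + ennreal (\<kappa> / 2) * 1\<^sup>2"
      by (intro add_mono mult_left_mono test_fun_energy[OF d \<nu>] power_mono sup) auto
    also have "\<dots> = ennreal (c * b * 2 + \<kappa> / 2)"
    proof -
      have "ennreal (c * b * 2) = ennreal (c * b) * ennreal 2" using c b by (intro ennreal_mult) auto
      moreover have "ennreal (c * b * 2 + \<kappa> / 2) = ennreal (c * b * 2) + ennreal (\<kappa> / 2)"
        using c b \<kappa>(1) by (intro ennreal_plus) auto
      ultimately show ?thesis by (simp only: power_one mult_1_right)
    qed
    finally have "\<kappa> \<le> c * b * 2 + \<kappa> / 2" using c b \<kappa>(1) by (subst (asm) ennreal_le_iff) auto
    then show ?thesis using b by (simp add: field_simps)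
  qed
  then show thesis using \<kappa>(1) b by (intro that[of "\<kappa> / (4 * b)"]) auto
qed

section \<open>The case $\nu \ge 1$\<close>

text \<open>Uses ln (1 + \<delta>) >= \<delta> / (1 + \<delta>), valid for large \<delta> as well as
  small, whence the factor 1 + 1 / \<delta>. The leading 1 pays for rounding up.\<close>

lemma geometric_decay:
  fixes x :: "nat \<Rightarrow> real"
  assumes \<delta>: "\<delta> > 0" and step: "\<And>k. x (Suc k) * (1 + \<delta>) \<le> x k" and x0: "x 0 \<le> W"
    and \<epsilon>: "\<epsilon> > 0" and W: "\<epsilon> \<le> W"
  shows "\<exists>k. real k \<le> 1 + (1 + 1 / \<delta>) * ln (W / \<epsilon>) \<and> x k \<le> \<epsilon>"
proof -
  have bound: "x k \<le> W / (1 + \<delta>) ^ k" for k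
  proof (induction k)
    case (Suc k)
    have "x (Suc k) \<le> x k / (1 + \<delta>)" using step[of k] \<delta> by (simp add: le_divide_eq)
    also have "\<dots> \<le> W / (1 + \<delta>) ^ k / (1 + \<delta>)" using Suc \<delta> by (intro divide_right_mono) auto
    finally show ?case by (simp add: mult.commute)
  qed (use x0 in simp)
  define L where "L = ln (W / \<epsilon>)"
  have L: "L \<ge> 0" using W \<epsilon> by (simp add: L_def)
  define k where "k = nat \<lceil>(1 + 1 / \<delta>) * L\<rceil>"
  have nn: "(1 + 1 / \<delta>) * L \<ge> 0" using L \<delta> by simp
  have k1: "real k \<ge> (1 + 1 / \<delta>) * L" and k2: "real k \<le> 1 + (1 + 1 / \<delta>) * L"
    using nn unfolding k_def by linarith+
  have "\<delta> / (1 + \<delta>) \<le> ln (1 + \<delta>)"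
  proof -
    have "ln (1 / (1 + \<delta>)) \<le> 1 / (1 + \<delta>) - 1" using \<delta> by (intro ln_le_minus_one) auto
    then show ?thesis using \<delta> by (simp add: ln_div field_simps)
  qed
  then have "real k * (\<delta> / (1 + \<delta>)) \<le> real k * ln (1 + \<delta>)" by (rule mult_left_mono) simp
  moreover have "L \<le> real k * (\<delta> / (1 + \<delta>))"
  proof -
    have "1 + 1 / \<delta> = (1 + \<delta>) / \<delta>" using \<delta> by (simp add: add_divide_distrib)
    then have "(1 + 1 / \<delta>) * (\<delta> / (1 + \<delta>)) = 1" using \<delta> by simp
    then have "L = (1 + 1 / \<delta>) * L * (\<delta> / (1 + \<delta>))" by (metis mult.commute mult.left_commute mult.right_neutral)
    also have "\<dots> \<le> real k * (\<delta> / (1 + \<delta>))" using k1 \<delta> by (intro mult_right_mono) auto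
    finally show ?thesis .
  qed
  ultimately have "ln (W / \<epsilon>) \<le> ln ((1 + \<delta>) ^ k)" using \<delta> by (simp add: L_def ln_realpow)
  then have "W / \<epsilon> \<le> (1 + \<delta>) ^ k" using \<delta> W \<epsilon> by (subst (asm) ln_le_cancel_iff) auto
  then have "W / (1 + \<delta>) ^ k \<le> \<epsilon>" using \<delta> \<epsilon> by (simp add: field_simps)
  with bound[of k] have "x k \<le> \<epsilon>" by linarith
  then show ?thesis using k2 by (auto simp: L_def)
qed

section \<open>Chi-square divergence along the iteration\<close>

lemma second_moment_eq:
  assumes \<nu>: "\<nu> > 0" and f: "bdd d M f" and mass: "(\<integral>\<^sup>+x. ennreal (f x) \<partial>target_law d \<nu>) = 1"
  shows "(\<integral>\<^sup>+x. ennreal ((f x)\<^sup>2) \<partial>target_law d \<nu>) = (\<integral>\<^sup>+x. ennreal ((f x - 1)\<^sup>2) \<partial>target_law d \<nu>) + 1"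
    and "(LINT x|target_law d \<nu>. f x) = 1"
    and "(\<integral>\<^sup>+x. ennreal ((f x - 1)\<^sup>2) \<partial>target_law d \<nu>) \<le> ennreal (M\<^sup>2)" and "M \<ge> 1"
proof -
  interpret T: prob_space "target_law d \<nu>" by (rule prob_space_target_law[OF \<nu>])
  note [measurable] = bddD(1)[OF f]
  have fb: "0 \<le> f x" "f x \<le> M" if "x \<in> space (target_law d \<nu>)" for x using bddD(2,3)[OF f] that by auto
  have i1: "integrable (target_law d \<nu>) f"
    using fb by (intro T.integrable_const_bound[of _ M]) auto
  have i2: "integrable (target_law d \<nu>) (\<lambda>x. (f x)\<^sup>2)"
    using fb by (intro T.integrable_const_bound[of _ "M\<^sup>2"]) (auto intro!: power_mono AE_I2)
  show I: "(LINT x|target_law d \<nu>. f x) = 1"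
    using mass fb by (subst integral_eq_nn_integral) (auto intro!: AE_I2)
  show M: "M \<ge> 1"
  proof -
    have "AE x in target_law d \<nu>. f x \<le> M" using fb by (intro AE_I2)
    from T.integral_le_const[OF i1 this] show ?thesis by (simp add: I)
  qed
  have e: "(f x - 1)\<^sup>2 = (f x)\<^sup>2 - 2 * f x + 1" for x by (simp add: power2_eq_square algebra_simps)
  have i3: "integrable (target_law d \<nu>) (\<lambda>x. (f x - 1)\<^sup>2)" unfolding e using i1 i2 by auto
  have "(LINT x|target_law d \<nu>. (f x - 1)\<^sup>2) + 1 = (LINT x|target_law d \<nu>. (f x)\<^sup>2)"
    unfolding e using i1 i2 I T.prob_space by simp
  then have "ennreal (LINT x|target_law d \<nu>. (f x)\<^sup>2) = ennreal ((LINT x|target_law d \<nu>. (f x - 1)\<^sup>2) + 1)" by simp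
  also have "\<dots> = ennreal (LINT x|target_law d \<nu>. (f x - 1)\<^sup>2) + 1" by (subst ennreal_plus) (auto intro!: integral_nonneg_AE)
  finally show "(\<integral>\<^sup>+x. ennreal ((f x)\<^sup>2) \<partial>target_law d \<nu>) = (\<integral>\<^sup>+x. ennreal ((f x - 1)\<^sup>2) \<partial>target_law d \<nu>) + 1"
    using i2 i3 by (simp add: nn_integral_eq_integral)
  have "(\<integral>\<^sup>+x. ennreal ((f x - 1)\<^sup>2) \<partial>target_law d \<nu>) \<le> (\<integral>\<^sup>+x. ennreal (M\<^sup>2) \<partial>target_law d \<nu>)"
  proof (intro nn_integral_mono ennreal_leI)
    fix x assume "x \<in> space (target_law d \<nu>)"
    then have "\<bar>f x - 1\<bar> \<le> M" using fb[of x] M by linarith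
    then show "(f x - 1)\<^sup>2 \<le> M\<^sup>2" using M by (metis abs_le_square_iff abs_of_nonneg order_trans zero_le_one)
  qed
  then show "(\<integral>\<^sup>+x. ennreal ((f x - 1)\<^sup>2) \<partial>target_law d \<nu>) \<le> ennreal (M\<^sup>2)" using T.emeasure_space_1 by simp
qed

text \<open>The iterates have mean one under the target, so second moments exceed divergences by
  exactly 1, which cancels from \<open>step_op_energy\<close>.\<close>

lemma chi_square_energy:
  assumes d: "d \<ge> 1" and \<eta>: "\<eta> > 0" and \<nu>: "\<nu> > 0" and b: "bdd d M (initial_density d \<nu>)"
  shows "(\<integral>\<^sup>+x. ennreal ((iterate d \<nu> \<eta> (Suc k) x - 1)\<^sup>2) \<partial>target_law d \<nu>) +
      ennreal \<eta> * dirichlet_form d (student d \<nu> 1) (iterate d \<nu> \<eta> (Suc k)) \<le>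
    (\<integral>\<^sup>+x. ennreal ((iterate d \<nu> \<eta> k x - 1)\<^sup>2) \<partial>target_law d \<nu>)"
proof -
  note f = iterate_bdd[OF \<eta> \<nu> b]
  note m = second_moment_eq(1)[OF \<nu> f iterate_mass[OF \<eta> \<nu> b]]
  define v where "v k = (\<integral>\<^sup>+x. ennreal ((iterate d \<nu> \<eta> k x - 1)\<^sup>2) \<partial>target_law d \<nu>)" for k
  define E where "E = ennreal \<eta> * dirichlet_form d (student d \<nu> 1) (iterate d \<nu> \<eta> (Suc k))"
  have "(v (Suc k) + 1) + E \<le> v k + 1"
    using step_op_energy[OF d \<eta> \<nu> f[of k]] unfolding v_def E_def m[symmetric] by (simp add: iterate_Suc)
  then have "1 + (v (Suc k) + E) \<le> 1 + v k" by (simp add: ac_simps)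
  then show ?thesis unfolding v_def[symmetric] E_def[symmetric] by (simp add: ennreal_add_left_cancel_le)
qed

definition chi2 :: "nat \<Rightarrow> real \<Rightarrow> real \<Rightarrow> nat \<Rightarrow> real" where
  "chi2 d \<nu> \<eta> k = enn2real (\<integral>\<^sup>+x. ennreal ((iterate d \<nu> \<eta> k x - 1)\<^sup>2) \<partial>target_law d \<nu>)"

lemma ennreal_chi2:
  assumes "\<eta> > 0" "\<nu> > 0" "bdd d M (initial_density d \<nu>)"
  shows "ennreal (chi2 d \<nu> \<eta> k) = (\<integral>\<^sup>+x. ennreal ((iterate d \<nu> \<eta> k x - 1)\<^sup>2) \<partial>target_law d \<nu>)"
    and "chi2 d \<nu> \<eta> k \<le> M\<^sup>2" and "chi2 d \<nu> \<eta> k \<ge> 0"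
proof -
  have le: "(\<integral>\<^sup>+x. ennreal ((iterate d \<nu> \<eta> k x - 1)\<^sup>2) \<partial>target_law d \<nu>) \<le> ennreal (M\<^sup>2)"
    by (rule second_moment_eq(3)[OF assms(2) iterate_bdd[OF assms] iterate_mass[OF assms]])
  then have "(\<integral>\<^sup>+x. ennreal ((iterate d \<nu> \<eta> k x - 1)\<^sup>2) \<partial>target_law d \<nu>) < \<infinity>"
    by (rule le_less_trans) simp
  then show "ennreal (chi2 d \<nu> \<eta> k) = (\<integral>\<^sup>+x. ennreal ((iterate d \<nu> \<eta> k x - 1)\<^sup>2) \<partial>target_law d \<nu>)"
    by (simp add: chi2_def)
  with le have "ennreal (chi2 d \<nu> \<eta> k) \<le> ennreal (M\<^sup>2)" by simp
  then show "chi2 d \<nu> \<eta> k \<le> M\<^sup>2" by (subst (asm) ennreal_le_iff) auto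
qed (simp add: chi2_def)

lemma iterations_required_le_chi2:
  assumes "\<eta> > 0" "\<nu> > 0" "minimizer d (cauchy_potential d \<nu>) xm" "bdd d M (initial_density d \<nu>)"
    and "chi2 d \<nu> \<eta> k \<le> \<epsilon>" and "real k \<le> B"
  shows "iterations_required d \<nu> \<eta> xm \<epsilon> \<le> ennreal B"
proof -
  have "iterations_required d \<nu> \<eta> xm \<epsilon> \<le> of_nat k"
    using assms(1-5) ennreal_chi2(1)[OF assms(1,2,4), of k, symmetric]
    by (intro iterations_required_le[OF assms(1-4)]) (simp add: ennreal_leI)
  also have "\<dots> \<le> ennreal B" using assms(6) by (simp add: ennreal_of_nat_eq_real_of_nat ennreal_leI)
  finally show ?thesis .
qed

text \<open>The inequality is applied to the density after the step, whose energy is the one that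
  was lost; hence 1 + \<eta> / C stands on the left-hand side and no smallness of \<eta> / C
  enters.\<close>

lemma chi2_contraction_FPI:
  assumes d: "d \<ge> 1" and \<eta>: "\<eta> > 0" and \<nu>: "\<nu> > 0" and b: "bdd d M (initial_density d \<nu>)"
    and F: "satisfies_FPI d (cauchy_target d \<nu>) C"
  shows "chi2 d \<nu> \<eta> (Suc k) * (1 + \<eta> / C) \<le> chi2 d \<nu> \<eta> k"
proof -
  note f = iterate_bdd[OF \<eta> \<nu> b, of "Suc k"]
  note mass = iterate_mass[OF \<eta> \<nu> b, of "Suc k"]
  note ch = ennreal_chi2[OF \<eta> \<nu> b]
  interpret T: prob_space "target_law d \<nu>" by (rule prob_space_target_law[OF \<nu>])
  define h where "h = iterate d \<nu> \<eta> (Suc k)"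
  define E where "E = dirichlet_form d (student d \<nu> 1) h"
  have C: "C > 0" using F by (simp add: satisfies_FPI_def)
  have en: "ennreal (chi2 d \<nu> \<eta> (Suc k)) + ennreal \<eta> * E \<le> ennreal (chi2 d \<nu> \<eta> k)"
    using chi_square_energy[OF d \<eta> \<nu> b, of k] unfolding E_def h_def ch(1) .
  \<comment> \<open>Membership in the domain of the form comes from the dissipation estimate itself:
    \<eta> times the energy is bounded by a finite divergence.\<close>
  have Efin: "E < \<infinity>"
  proof (rule ccontr)
    assume "\<not> E < \<infinity>"
    then have "ennreal \<eta> * E = \<top>" using \<eta> by (simp add: less_top[symmetric] ennreal_mult_eq_top_iff)
    then show False using en by (simp add: top_unique)
  qed
  have [measurable]: "h \<in> borel_measurable (Rd d)" using bddD(1)[OF f] by (simp add: h_def)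
  have "integrable (target_law d \<nu>) (\<lambda>x. (h x)\<^sup>2)"
    using bddD(2,3)[OF f] unfolding h_def[symmetric]
    by (intro T.integrable_const_bound[of _ "M\<^sup>2"]) (auto intro!: power_mono AE_I2)
  then have "h \<in> dirichlet_domain d (cauchy_target d \<nu>)"
    using Efin \<nu> by (simp add: dirichlet_domain_def density_law_cauchy_target dirichlet_form_cauchy_target E_def)
  then have "(\<integral>\<^sup>+x. ennreal ((h x - (LINT z|target_law d \<nu>. h z))\<^sup>2) \<partial>target_law d \<nu>) \<le> ennreal C * E"
    using F \<nu> by (simp add: satisfies_FPI_def density_law_cauchy_target dirichlet_form_cauchy_target E_def)
  then have "ennreal (chi2 d \<nu> \<eta> (Suc k)) \<le> ennreal C * E"
    using second_moment_eq(2)[OF \<nu> f mass] by (simp add: ch(1) h_def)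
  moreover obtain e where e: "E = ennreal e" "e \<ge> 0" using Efin by (cases E) auto
  ultimately have 1: "chi2 d \<nu> \<eta> (Suc k) \<le> C * e" using C by (simp add: ennreal_mult[symmetric])
  have "chi2 d \<nu> \<eta> (Suc k) + \<eta> * e \<le> chi2 d \<nu> \<eta> k"
    using en e \<eta> ch(3) by (simp add: ennreal_mult[symmetric] ennreal_plus[symmetric] del: ennreal_plus)
  moreover have "\<eta> / C * chi2 d \<nu> \<eta> (Suc k) \<le> \<eta> * e"
    using mult_left_mono[OF 1, of "\<eta> / C"] \<eta> C by simp
  ultimately show ?thesis by (simp add: algebra_simps)
qed

theorem iterations_FPI:
  fixes \<nu> a \<epsilon>0 :: real
  assumes \<nu>: "\<nu> \<ge> 1" and a: "a > 0" and \<epsilon>0: "0 < \<epsilon>0" "\<epsilon>0 < 1"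
  shows "\<exists>K>0. \<forall>d::nat. \<forall>\<eta> \<epsilon> C :: real. \<forall>xm.
    d \<ge> 1 \<longrightarrow> 0 < \<epsilon> \<longrightarrow> \<epsilon> \<le> \<epsilon>0 \<longrightarrow>
    a * (real d powr (- 1 / 2) * (real d + \<nu>) powr (- 4)) \<le> \<eta> \<longrightarrow>
    minimizer d (cauchy_potential d \<nu>) xm \<longrightarrow>
    satisfies_FPI d (cauchy_target d \<nu>) C \<longrightarrow>
    iterations_required d \<nu> \<eta> xm \<epsilon> \<le> ennreal (K * (C * real d powr (1 / 2) * (real d + \<nu>) ^ 4 * ln (real d / \<epsilon>)))"
proof -
  have \<nu>0: "\<nu> > 0" using \<nu> by simp
  obtain K0 where K0: "K0 \<ge> 1" "\<And>d. d \<ge> 1 \<Longrightarrow> bdd d (K0 * sqrt (real d)) (initial_density d \<nu>)"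
    using initial_density_bound[OF \<nu>0] by blast
  obtain \<kappa> where \<kappa>: "\<kappa> > 0" "\<And>d C. d \<ge> 1 \<Longrightarrow> satisfies_FPI d (cauchy_target d \<nu>) C \<Longrightarrow> C \<ge> \<kappa>"
    using FPI_constant_lower_bound[OF \<nu>0] by blast
  \<comment> \<open>A positive lower bound for \<open>ln (real d / \<epsilon>)\<close>, uniform over
    d >= 1 and \<epsilon> <= \<epsilon>0. It lets \<open>K1\<close> absorb the summand 2 ln K0 of
    the logarithm of the starting divergence.\<close>
  define L0 where "L0 = ln (1 / \<epsilon>0)"
  have L0: "L0 > 0" using \<epsilon>0 by (simp add: L0_def)
  define K1 where "K1 = 2 * ln K0 / L0 + 1"
  have K1: "K1 \<ge> 1" using K0 L0 by (simp add: K1_def)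
  \<comment> \<open>The first summand absorbs the leading 1 of \<open>geometric_decay\<close>,
    through C >= \<kappa> and L >= L0. In the second, 1 / \<kappa> and 1 / a correspond to the two
    summands of 1 + C / \<eta>.\<close>
  define K where "K = 1 / (\<kappa> * L0) + (1 / \<kappa> + 1 / a) * K1"
  have K: "K > 0" using \<kappa> L0 a K1 unfolding K_def by (intro add_pos_pos mult_pos_pos) auto
  have main: "iterations_required d \<nu> \<eta> xm \<epsilon> \<le> ennreal (K * (C * real d powr (1 / 2) * (real d + \<nu>) ^ 4 * ln (real d / \<epsilon>)))"
    if d: "d \<ge> 1" and \<epsilon>: "0 < \<epsilon>" "\<epsilon> \<le> \<epsilon>0" and \<eta>: "a * (real d powr (- 1 / 2) * (real d + \<nu>) powr (- 4)) \<le> \<eta>"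
      and m: "minimizer d (cauchy_potential d \<nu>) xm" and F: "satisfies_FPI d (cauchy_target d \<nu>) C"
    for d \<eta> \<epsilon> C xm
  proof -
    define Y where "Y = real d powr (1 / 2) * (real d + \<nu>) ^ 4"
    have d1: "real d \<ge> 1" using d by simp
    have dn: "real d + \<nu> \<ge> 1" using d1 \<nu> by simp
    have "1 * 1 \<le> Y" unfolding Y_def
      by (intro mult_mono ge_one_powr_ge_zero one_le_power d1 dn) auto
    then have Y: "Y \<ge> 1" by simp
    have Yinv: "real d powr (- 1 / 2) * (real d + \<nu>) powr (- 4) = 1 / Y"
    proof -
      have "real d powr (- 1 / 2) = 1 / real d powr (1 / 2)" using powr_minus_divide[of "real d" "1 / 2"] by simp
      moreover have "(real d + \<nu>) powr (- 4) = 1 / (real d + \<nu>) ^ 4"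
        using powr_minus_divide[of "real d + \<nu>" 4] dn by (simp add: powr_numeral)
      ultimately show ?thesis by (simp add: Y_def)
    qed
    have e1: "a / Y \<le> \<eta>" using \<eta> unfolding Yinv by simp
    have \<eta>0: "\<eta> > 0" using e1 a Y by (meson divide_pos_pos less_le_trans zero_less_one)
    have inv\<eta>: "1 / \<eta> \<le> Y / a" using e1 a Y \<eta>0 by (simp add: field_simps)
    note b = K0(2)[OF d]
    have C: "C \<ge> \<kappa>" by (rule \<kappa>(2)[OF d F])
    have C0: "C > 0" using C \<kappa>(1) by simp
    define M where "M = K0 * sqrt (real d)"
    define L where "L = ln (real d / \<epsilon>)"
    have "1 / \<epsilon>0 \<le> real d / \<epsilon>" using d1 \<epsilon> \<epsilon>0 by (intro frac_le) auto
    then have L: "L \<ge> L0" unfolding L_def L0_def using \<epsilon>0 \<epsilon> d1 by (subst ln_le_cancel_iff) auto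
    have M2: "M\<^sup>2 = K0\<^sup>2 * real d" using d by (simp add: M_def power_mult_distrib)
    have K02: "K0\<^sup>2 \<ge> 1" using K0(1) by simp
    have "1 * 1 \<le> K0\<^sup>2 * real d" using K02 d1 by (intro mult_mono) auto
    then have W: "\<epsilon> \<le> M\<^sup>2" using \<epsilon> \<epsilon>0 by (simp add: M2)
    obtain k where k: "real k \<le> 1 + (1 + 1 / (\<eta> / C)) * ln (M\<^sup>2 / \<epsilon>)" "chi2 d \<nu> \<eta> k \<le> \<epsilon>"
      using geometric_decay[of "\<eta> / C" "chi2 d \<nu> \<eta>" "M\<^sup>2" \<epsilon>] chi2_contraction_FPI[OF d \<eta>0 \<nu>0 b F]
        ennreal_chi2(2)[OF \<eta>0 \<nu>0 b, of 0] \<epsilon>(1) W C0 \<eta>0 by (auto simp: M_def)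
    have "ln (M\<^sup>2 / \<epsilon>) = 2 * ln K0 + L"
    proof -
      have "M\<^sup>2 / \<epsilon> = K0\<^sup>2 * (real d / \<epsilon>)" by (simp add: M2)
      moreover have "real d / \<epsilon> > 0" "K0\<^sup>2 > 0" using d1 \<epsilon> K02 by auto
      ultimately have "ln (M\<^sup>2 / \<epsilon>) = ln (K0\<^sup>2) + ln (real d / \<epsilon>)" by (simp only: ln_mult) auto
      then show ?thesis using K0(1) by (simp add: L_def ln_realpow)
    qed
    also have "\<dots> \<le> K1 * L"
    proof -
      have "2 * ln K0 / L0 * L0 \<le> 2 * ln K0 / L0 * L" using L K0(1) L0 by (intro mult_left_mono) auto
      then show ?thesis using L0 by (simp add: K1_def algebra_simps)
    qed
    finally have lnb: "ln (M\<^sup>2 / \<epsilon>) \<le> K1 * L" .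
    have L': "L > 0" using L L0 by simp
    have "1 \<le> 1 / (\<kappa> * L0) * (C * Y * L)"
    proof -
      have "\<kappa> * 1 * L0 \<le> C * Y * L" using C Y L \<kappa>(1) L0 C0 by (intro mult_mono) auto
      then show ?thesis using \<kappa>(1) L0 by (simp add: field_simps)
    qed
    moreover have "(1 + 1 / (\<eta> / C)) * ln (M\<^sup>2 / \<epsilon>) \<le> (1 / \<kappa> + 1 / a) * K1 * (C * Y * L)"
    proof -
      have "1 \<le> 1 / \<kappa> * (C * Y)"
      proof -
        have "\<kappa> * 1 \<le> C * Y" using C Y \<kappa>(1) C0 by (intro mult_mono) auto
        then show ?thesis using \<kappa>(1) by (simp add: field_simps)
      qed
      moreover have "1 / (\<eta> / C) \<le> 1 / a * (C * Y)" using mult_left_mono[OF inv\<eta>, of C] C0 by (simp add: mult_ac)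
      ultimately have "1 + 1 / (\<eta> / C) \<le> (1 / \<kappa> + 1 / a) * (C * Y)" by (simp add: algebra_simps)
      then have "(1 + 1 / (\<eta> / C)) * ln (M\<^sup>2 / \<epsilon>) \<le> ((1 / \<kappa> + 1 / a) * (C * Y)) * (K1 * L)"
        using lnb W \<epsilon>(1) C0 \<kappa>(1) a Y by (intro mult_mono) auto
      then show ?thesis by (simp add: mult_ac)
    qed
    ultimately have "real k \<le> K * (C * Y * L)" using k(1) unfolding K_def by (simp add: algebra_simps)
    then have "real k \<le> K * (C * real d powr (1 / 2) * (real d + \<nu>) ^ 4 * ln (real d / \<epsilon>))"
      by (simp add: Y_def L_def mult.assoc)
    then show ?thesis by (rule iterations_required_le_chi2[OF \<eta>0 \<nu>0 m b k(2)])
  qed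
  show ?thesis using K main by blast
qed

section \<open>Rotation invariance\<close>

definition shear :: "nat \<Rightarrow> nat \<Rightarrow> real \<Rightarrow> (nat \<Rightarrow> real) \<Rightarrow> nat \<Rightarrow> real" where
  "shear i j \<tau> x = x(i := x i + \<tau> * x j)"

lemma measurable_shear:
  assumes "i < d" "j < d"
  shows "shear i j \<tau> \<in> measurable (Rd d) (Rd d)"
proof -
  have comp: "(\<lambda>x. x k) \<in> borel_measurable (Rd d)" if "k < d" for k
    using Rd_component[of "\<lambda>z. z" "Rd d" d k] that by simp
  have "(\<lambda>x. \<lambda>k\<in>{..<d}. if k = i then x i + \<tau> * x j else x k) \<in> measurable (Rd d) (Rd d)"
    using assms comp by (intro measurable_Rd_restrict) auto
  moreover have "shear i j \<tau> x = (\<lambda>k\<in>{..<d}. if k = i then x i + \<tau> * x j else x k)" if "x \<in> space (Rd d)" for x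
    using that assms by (auto simp: shear_def space_Rd fun_eq_iff extensional_def)
  ultimately show ?thesis by (subst measurable_cong) auto
qed

text \<open>With coordinate i integrated innermost, all others are frozen and the shear is a
  translation by \<tau> x j.\<close>

lemma nn_integral_Rd_shear:
  assumes i: "i < d" and j: "j < d" and ij: "i \<noteq> j" and \<psi> [measurable]: "\<psi> \<in> borel_measurable (Rd d)"
  shows "(\<integral>\<^sup>+x. \<psi> (shear i j \<tau> x) \<partial>Rd d) = (\<integral>\<^sup>+x. \<psi> x \<partial>Rd d)"
proof -
  interpret product_sigma_finite "\<lambda>_::nat. lborel :: real measure" by (rule product_sigma_finite_lborel)
  define I where "I = {..<d} - {i}"
  have I: "insert i I = {..<d}" "i \<notin> I" "finite I" using i by (auto simp: I_def)
  have R: "Rd d = PiM (insert i I) (\<lambda>_. lborel)" by (simp add: Rd_def I)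
  have m1: "\<psi> \<in> borel_measurable (PiM (insert i I) (\<lambda>_. lborel))" using \<psi> by (simp add: R)
  have m2: "(\<lambda>x. \<psi> (shear i j \<tau> x)) \<in> borel_measurable (PiM (insert i I) (\<lambda>_. lborel))"
    using measurable_compose[OF measurable_shear[OF i j] \<psi>] by (simp add: R)
  have "(\<integral>\<^sup>+x. \<psi> (shear i j \<tau> x) \<partial>Rd d) = (\<integral>\<^sup>+x. (\<integral>\<^sup>+y. \<psi> (shear i j \<tau> (x(i := y))) \<partial>lborel) \<partial>PiM I (\<lambda>_. lborel))"
    unfolding R by (rule product_nn_integral_insert[OF I(3,2) m2])
  also have "\<dots> = (\<integral>\<^sup>+x. (\<integral>\<^sup>+y. \<psi> (x(i := y)) \<partial>lborel) \<partial>PiM I (\<lambda>_. lborel))"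
  proof (rule nn_integral_cong)
    fix x :: "nat \<Rightarrow> real" assume x: "x \<in> space (PiM I (\<lambda>_. lborel))"
    have m: "(\<lambda>y. \<psi> (x(i := y))) \<in> borel_measurable borel"
      using measurable_compose[OF measurable_component_update[OF x I(2)] m1] by simp
    have "(\<integral>\<^sup>+y. \<psi> (x(i := y)) \<partial>lborel) = ennreal \<bar>1\<bar> * (\<integral>\<^sup>+y. \<psi> (x(i := \<tau> * x j + 1 * y)) \<partial>lborel)"
      by (rule nn_integral_real_affine[OF m]) simp
    also have "\<dots> = (\<integral>\<^sup>+y. \<psi> (shear i j \<tau> (x(i := y))) \<partial>lborel)"
      using ij by (auto simp: shear_def add.commute intro!: nn_integral_cong)
    finally show "(\<integral>\<^sup>+y. \<psi> (shear i j \<tau> (x(i := y))) \<partial>lborel) = (\<integral>\<^sup>+y. \<psi> (x(i := y)) \<partial>lborel)" ..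
  qed
  also have "\<dots> = (\<integral>\<^sup>+x. \<psi> x \<partial>Rd d)"
    unfolding R by (rule product_nn_integral_insert[OF I(3,2) m1, symmetric])
  finally show ?thesis .
qed

text \<open>Records what invariance proofs consume about a linear isometry. These closure properties
  pass directly through compositions, so neither matrices nor determinants have to be
  introduced.\<close>

definition isom :: "nat \<Rightarrow> ((nat \<Rightarrow> real) \<Rightarrow> nat \<Rightarrow> real) \<Rightarrow> bool" where
  "isom d T \<longleftrightarrow> T \<in> measurable (Rd d) (Rd d) \<and> (\<forall>x\<in>space (Rd d). nrm d (T x) = nrm d x) \<and>
    (\<forall>x\<in>space (Rd d). \<forall>z\<in>space (Rd d). T (vadd d x z) = vadd d (T x) (T z)) \<and>
    (\<forall>\<psi>\<in>borel_measurable (Rd d). (\<integral>\<^sup>+x. \<psi> (T x) \<partial>Rd d) = (\<integral>\<^sup>+x. (\<psi> x :: ennreal) \<partial>Rd d))"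

lemma isomD:
  assumes "isom d T"
  shows "T \<in> measurable (Rd d) (Rd d)" "x \<in> space (Rd d) \<Longrightarrow> nrm d (T x) = nrm d x"
    "x \<in> space (Rd d) \<Longrightarrow> z \<in> space (Rd d) \<Longrightarrow> T (vadd d x z) = vadd d (T x) (T z)"
    "\<psi> \<in> borel_measurable (Rd d) \<Longrightarrow> (\<integral>\<^sup>+x. \<psi> (T x) \<partial>Rd d) = (\<integral>\<^sup>+x. (\<psi> x :: ennreal) \<partial>Rd d)"
    "x \<in> space (Rd d) \<Longrightarrow> T x \<in> space (Rd d)"
  using assms measurable_space[of T "Rd d" "Rd d" x] by (auto simp: isom_def)

lemma isom_comp:
  assumes S: "isom d S" and T: "isom d T"
  shows "isom d (\<lambda>x. S (T x))"
  unfolding isom_def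
proof (intro conjI ballI)
  show "(\<lambda>x. S (T x)) \<in> measurable (Rd d) (Rd d)" by (rule measurable_compose[OF isomD(1)[OF T] isomD(1)[OF S]])
next
  fix x assume x: "x \<in> space (Rd d)"
  show "nrm d (S (T x)) = nrm d x" using x by (simp add: isomD(2,5)[OF S] isomD(2,5)[OF T])
  fix z assume z: "z \<in> space (Rd d)"
  show "S (T (vadd d x z)) = vadd d (S (T x)) (S (T z))" using x z by (simp add: isomD(3,5)[OF S] isomD(3,5)[OF T])
next
  fix \<psi> :: "(nat \<Rightarrow> real) \<Rightarrow> ennreal" assume \<psi>: "\<psi> \<in> borel_measurable (Rd d)"
  have "(\<lambda>x. \<psi> (S x)) \<in> borel_measurable (Rd d)" by (rule measurable_compose[OF isomD(1)[OF S] \<psi>])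
  then show "(\<integral>\<^sup>+x. \<psi> (S (T x)) \<partial>Rd d) = (\<integral>\<^sup>+x. \<psi> x \<partial>Rd d)"
    using isomD(4)[OF T, of "\<lambda>x. \<psi> (S x)"] isomD(4)[OF S \<psi>] by simp
qed

lemma isom_id: "isom d (\<lambda>x. x)"
  by (auto simp: isom_def)

lemma isom_neg: "isom d (vscale d (-1))"
  unfolding isom_def
proof (intro conjI ballI)
  show "vscale d (-1) \<in> measurable (Rd d) (Rd d)" by measurable
  show "nrm d (vscale d (-1) x) = nrm d x" for x by (simp add: nrm_vscale)
  show "vscale d (-1) (vadd d x z) = vadd d (vscale d (-1) x) (vscale d (-1) z)" for x z
    by (auto simp: vscale_def vadd_def fun_eq_iff)
  show "(\<integral>\<^sup>+x. \<psi> (vscale d (-1) x) \<partial>Rd d) = (\<integral>\<^sup>+x. \<psi> x \<partial>Rd d)" if "\<psi> \<in> borel_measurable (Rd d)" for \<psi> :: "(nat \<Rightarrow> real) \<Rightarrow> ennreal"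
    using that by (rule nn_integral_Rd_neg)
qed

definition givens :: "nat \<Rightarrow> real \<Rightarrow> real \<Rightarrow> (nat \<Rightarrow> real) \<Rightarrow> nat \<Rightarrow> real" where
  "givens j c s x = x(0 := c * x 0 - s * x j, j := s * x 0 + c * x j)"

text \<open>
  Shears preserve Lebesgue measure by Tonelli's theorem, hence so does a rotation in a coordinate
  plane, being a product of three shears.
\<close>

lemma givens_shears:
  assumes "c\<^sup>2 + s\<^sup>2 = 1" "s \<noteq> 0" "j \<noteq> 0"
  shows "givens j c s x = shear 0 j ((c - 1) / s) (shear j 0 s (shear 0 j ((c - 1) / s) x))"
proof -
  \<comment> \<open>If c and s are the cosine and sine of an angle, this is minus the tangent of
    half the angle.\<close>
  define \<tau> where "\<tau> = (c - 1) / s"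
  have 1: "1 + s * \<tau> = c" using assms(2) by (simp add: \<tau>_def)
  have "\<tau> * s = c - 1" using assms(2) by (simp add: \<tau>_def)
  then have "\<tau> * (1 + c) * s = (c - 1) * (1 + c)" by (simp add: mult.commute mult.left_commute)
  also have "\<dots> = - s * s" using assms(1) by (simp add: power2_eq_square algebra_simps)
  finally have 2: "\<tau> * (1 + c) = - s" using assms(2) by (metis mult_right_cancel)
  have a: "x j + s * (x 0 + \<tau> * x j) = s * x 0 + c * x j"
    unfolding 1[symmetric] by (simp add: algebra_simps)
  have "x 0 + \<tau> * x j + \<tau> * (s * x 0 + c * x j) = (1 + s * \<tau>) * x 0 + \<tau> * (1 + c) * x j" by (simp add: algebra_simps)
  then have b: "x 0 + \<tau> * x j + \<tau> * (s * x 0 + c * x j) = c * x 0 - s * x j" unfolding 1 2 by simp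
  show ?thesis
    unfolding \<tau>_def[symmetric] using assms(3) a b
    by (auto simp: givens_def shear_def fun_eq_iff)
qed

lemma isom_givens:
  assumes j: "0 < j" "j < d" and cs: "c\<^sup>2 + s\<^sup>2 = 1" and s: "s \<noteq> 0"
  shows "isom d (givens j c s)"
proof -
  define \<tau> where "\<tau> = (c - 1) / s"
  have d0: "0 < d" and j0: "j \<noteq> 0" using j by auto
  have g: "givens j c s = (\<lambda>x. shear 0 j \<tau> (shear j 0 s (shear 0 j \<tau> x)))"
    using givens_shears[OF cs s j0] by (auto simp: \<tau>_def)
  note m1 = measurable_shear[OF d0 j(2), of \<tau>]
  note m2 = measurable_shear[OF j(2) d0, of s]
  have m12: "(\<lambda>x. shear j 0 s (shear 0 j \<tau> x)) \<in> measurable (Rd d) (Rd d)" by (rule measurable_compose[OF m1 m2])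
  have meas: "givens j c s \<in> measurable (Rd d) (Rd d)"
    unfolding g by (rule measurable_compose[OF m12 m1])
  have pres: "(\<integral>\<^sup>+x. \<psi> (givens j c s x) \<partial>Rd d) = (\<integral>\<^sup>+x. (\<psi> x :: ennreal) \<partial>Rd d)" if \<psi>: "\<psi> \<in> borel_measurable (Rd d)" for \<psi>
  proof -
    have a: "(\<lambda>x. \<psi> (shear 0 j \<tau> x)) \<in> borel_measurable (Rd d)" by (rule measurable_compose[OF m1 \<psi>])
    have b: "(\<lambda>x. \<psi> (shear 0 j \<tau> (shear j 0 s x))) \<in> borel_measurable (Rd d)" by (rule measurable_compose[OF m2 a])
    show ?thesis
      unfolding g using j0 nn_integral_Rd_shear[OF d0 j(2) _ b, of \<tau>] nn_integral_Rd_shear[OF j(2) d0 _ a, of s]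
        nn_integral_Rd_shear[OF d0 j(2) _ \<psi>, of \<tau>] by simp
  qed
  have nrm: "nrm d (givens j c s x) = nrm d x" for x
  proof -
    have split: "(\<Sum>i<d. (y i)\<^sup>2) = (y 0)\<^sup>2 + (y j)\<^sup>2 + (\<Sum>i\<in>{..<d} - {0, j}. (y i)\<^sup>2)" for y :: "nat \<Rightarrow> real"
    proof -
      have "{..<d} = insert 0 (insert j ({..<d} - {0, j}))" using j by auto
      then have "(\<Sum>i<d. (y i)\<^sup>2) = (\<Sum>i\<in>insert 0 (insert j ({..<d} - {0, j})). (y i)\<^sup>2)" by simp
      also have "\<dots> = (y 0)\<^sup>2 + (y j)\<^sup>2 + (\<Sum>i\<in>{..<d} - {0, j}. (y i)\<^sup>2)" using j0 by (simp add: add.assoc)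
      finally show ?thesis .
    qed
    have "(c * x 0 - s * x j)\<^sup>2 + (s * x 0 + c * x j)\<^sup>2 = (c\<^sup>2 + s\<^sup>2) * ((x 0)\<^sup>2 + (x j)\<^sup>2)"
      by (simp add: power2_eq_square algebra_simps)
    then have "(nrm d (givens j c s x))\<^sup>2 = (nrm d x)\<^sup>2"
      unfolding nrm_sq split[of "givens j c s x"] split[of x] using j0 cs by (simp add: givens_def)
    then show ?thesis by (simp add: power2_eq_iff_nonneg)
  qed
  have lin: "givens j c s (vadd d x z) = vadd d (givens j c s x) (givens j c s z)" for x z
    using j by (auto simp: givens_def vadd_def fun_eq_iff algebra_simps)
  show ?thesis unfolding isom_def using meas pres nrm lin by blast
qed

section \<open>Moving a vector to the first axis\<close>

definition axis_vec :: "nat \<Rightarrow> real \<Rightarrow> nat \<Rightarrow> real" where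
  "axis_vec d r = (\<lambda>i\<in>{..<d}. if i = 0 then r else 0)"

lemma measurable_axis_vec [measurable]: "axis_vec d \<in> measurable borel (Rd d)"
  unfolding axis_vec_def[abs_def] by (intro measurable_Rd_restrict) auto

lemma axis_vec_in_space [simp]: "axis_vec d r \<in> space (Rd d)"
  by (auto simp: axis_vec_def space_Rd)

lemma nrm_axis_vec: "d \<ge> 1 \<Longrightarrow> nrm d (axis_vec d r) = \<bar>r\<bar>"
proof -
  assume d: "d \<ge> 1"
  have "(nrm d (axis_vec d r))\<^sup>2 = (\<Sum>i<d. if i = 0 then r\<^sup>2 else 0)"
    unfolding nrm_sq by (intro sum.cong) (auto simp: axis_vec_def)
  also have "\<dots> = r\<^sup>2" using d by (simp add: sum.delta)
  finally show ?thesis by (metis L2_set_nonneg abs_of_nonneg power2_eq_iff_nonneg abs_ge_zero power2_abs)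
qed

text \<open>Givens elimination: m bounds the coordinates that may still be nonzero, and each
  rotation pushes the last of them into coordinate 0. At the end a reflection through the origin
  repairs the sign.\<close>

lemma isom_to_axis:
  assumes d: "d \<ge> 1" and x: "x \<in> space (Rd d)"
  shows "\<exists>T. isom d T \<and> T x = axis_vec d (nrm d x)"
proof -
  have "\<exists>T. isom d T \<and> T x = axis_vec d (nrm d x)"
    if "x \<in> space (Rd d)" "1 \<le> m" "m \<le> d" "\<forall>i. m \<le> i \<and> i < d \<longrightarrow> x i = 0" for x m
    using that(2,1,3,4)
  proof (induction m arbitrary: x rule: dec_induct)
    case base
    have "x i = axis_vec d (x 0) i" if "i < d" for i
      using that base.prems(3) by (cases "i = 0") (auto simp: axis_vec_def)
    then have eq: "x = axis_vec d (x 0)" by (rule Rd_eqI[OF base.prems(1) axis_vec_in_space])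
    show ?case
    proof (cases "x 0 \<ge> 0")
      case True
      then have "x = axis_vec d (nrm d x)" using eq nrm_axis_vec[OF d, of "x 0"] by simp
      then show ?thesis using isom_id[of d] by blast
    next
      case False
      then have n: "nrm d x = - x 0" using eq nrm_axis_vec[OF d, of "x 0"] by simp
      have "vscale d (-1) x i = axis_vec d (nrm d x) i" if "i < d" for i
        using that base.prems(3) unfolding n by (cases "i = 0") (auto simp: axis_vec_def vscale_def)
      then have "vscale d (-1) x = axis_vec d (nrm d x)" by (intro Rd_eqI[of _ d]) auto
      then show ?thesis using isom_neg[of d] by blast
    qed
  next
    case (step m)
    have m: "0 < m" "m < d" using step by auto
    show ?case
    proof (cases "x m = 0")
      case True
      have "\<forall>i. m \<le> i \<and> i < d \<longrightarrow> x i = 0" using step True by (metis Suc_leI le_neq_implies_less)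
      then show ?thesis using step m by (intro step.IH) auto
    next
      case False
      define h where "h = sqrt ((x 0)\<^sup>2 + (x m)\<^sup>2)"
      define c where "c = x 0 / h"
      \<comment> \<open>The sign makes the rotated coordinate s x 0 + c x m vanish.\<close>
      define s where "s = - x m / h"
      have h2: "h\<^sup>2 = (x 0)\<^sup>2 + (x m)\<^sup>2" by (simp add: h_def)
      have h: "h > 0" using False by (simp add: h_def add_nonneg_pos)
      have cs: "c\<^sup>2 + s\<^sup>2 = 1"
        using h by (simp add: c_def s_def power_divide add_divide_distrib[symmetric] h2[symmetric])
      have s0: "s \<noteq> 0" using False h by (simp add: s_def)
      note G = isom_givens[OF m cs s0]
      define y where "y = givens m c s x"
      have y: "y \<in> space (Rd d)" unfolding y_def by (rule isomD(5)[OF G step.prems(1)])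
      have "y m = 0" by (simp add: y_def givens_def c_def s_def)
      moreover have "y i = 0" if "m < i" "i < d" for i using that step.prems m by (simp add: y_def givens_def)
      ultimately have "\<forall>i. m \<le> i \<and> i < d \<longrightarrow> y i = 0" by (metis le_neq_implies_less)
      then obtain T where T: "isom d T" "T y = axis_vec d (nrm d y)" using step.IH[OF y] m by auto
      have "isom d (\<lambda>x. T (givens m c s x))" by (rule isom_comp[OF T(1) G])
      moreover have "T (givens m c s x) = axis_vec d (nrm d x)"
        using T(2) isomD(2)[OF G step.prems(1)] by (simp add: y_def)
      ultimately show ?thesis by blast
    qed
  qed
  from this[OF x d order_refl] show ?thesis by auto
qed

section \<open>Radial functions\<close>

definition radial :: "nat \<Rightarrow> ((nat \<Rightarrow> real) \<Rightarrow> 'b) \<Rightarrow> bool" where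
  "radial d f \<longleftrightarrow> (\<forall>x\<in>space (Rd d). \<forall>y\<in>space (Rd d). nrm d x = nrm d y \<longrightarrow> f x = f y)"

lemma radialD: "radial d f \<Longrightarrow> x \<in> space (Rd d) \<Longrightarrow> y \<in> space (Rd d) \<Longrightarrow> nrm d x = nrm d y \<Longrightarrow> f x = f y"
  unfolding radial_def by blast

text \<open>Two points of equal norm are carried to the same point of the axis, so invariance under
  isometries makes their values agree.\<close>

lemma radial_isomI:
  assumes d: "d \<ge> 1" and inv: "\<And>T x. isom d T \<Longrightarrow> x \<in> space (Rd d) \<Longrightarrow> f (T x) = f x"
  shows "radial d f"
  unfolding radial_def
proof (intro ballI impI)
  fix x y assume xy: "x \<in> space (Rd d)" "y \<in> space (Rd d)" "nrm d x = nrm d y"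
  obtain T where T: "isom d T" "T x = axis_vec d (nrm d x)" using isom_to_axis[OF d xy(1)] by blast
  obtain S where S: "isom d S" "S y = axis_vec d (nrm d y)" using isom_to_axis[OF d xy(2)] by blast
  have "f x = f (T x)" using inv[OF T(1) xy(1)] ..
  also have "T x = S y" using T S xy by simp
  also have "f (S y) = f y" by (rule inv[OF S(1) xy(2)])
  finally show "f x = f y" .
qed

lemma radial_student [simp]: "radial d (student d \<nu> t)"
  by (auto simp: radial_def student_def)

lemma radial_mult: "radial d f \<Longrightarrow> radial d g \<Longrightarrow> radial d (\<lambda>x. f x * (g x :: real))"
  unfolding radial_def by metis

text \<open>Substituting T z for z leaves Lebesgue measure and the Cauchy density unchanged, and
  additivity of T turns T x + T z into T (x + z), which has the norm of x + z.\<close>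

lemma radial_cauchy_op:
  assumes d: "d \<ge> 1" and t: "t > 0" and f: "bdd d M f" and r: "radial d f"
  shows "radial d (cauchy_op d t f)"
proof (rule radial_isomI[OF d])
  fix T x assume T: "isom d T" and x: "x \<in> space (Rd d)"
  note [measurable] = bddD(1)[OF f]
  have op: "ennreal (cauchy_op d t f y) = (\<integral>\<^sup>+z. ennreal (student d 1 t z) * ennreal (f (vadd d y z)) \<partial>Rd d)" for y
    unfolding ennreal_cauchy_op[OF t f] cauchy_law_def by (subst nn_integral_density) auto
  have "ennreal (cauchy_op d t f (T x)) = (\<integral>\<^sup>+z. ennreal (student d 1 t (T z)) * ennreal (f (vadd d (T x) (T z))) \<partial>Rd d)"
    unfolding op by (rule isomD(4)[OF T, symmetric]) measurable
  also have "\<dots> = (\<integral>\<^sup>+z. ennreal (student d 1 t z) * ennreal (f (vadd d x z)) \<partial>Rd d)"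
  proof (rule nn_integral_cong)
    fix z assume z: "z \<in> space (Rd d)"
    have "f (vadd d (T x) (T z)) = f (vadd d x z)"
      using isomD(2)[OF T, of "vadd d x z"] isomD(3)[OF T x z] by (intro radialD[OF r]) auto
    moreover have "student d 1 t (T z) = student d 1 t z" by (simp add: student_def isomD(2)[OF T z])
    ultimately show "ennreal (student d 1 t (T z)) * ennreal (f (vadd d (T x) (T z))) = ennreal (student d 1 t z) * ennreal (f (vadd d x z))"
      by simp
  qed
  also have "\<dots> = ennreal (cauchy_op d t f x)" by (rule op[symmetric])
  finally show "cauchy_op d t f (T x) = cauchy_op d t f x" using cauchy_op_bounds(1)[OF t f] by simp
qed

lemma radial_back_op:
  assumes d: "d \<ge> 1" and \<eta>: "\<eta> > 0" and \<nu>: "\<nu> > 0" and f: "bdd d M f" and r: "radial d f"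
  shows "radial d (back_op d \<nu> \<eta> f)"
  unfolding radial_def back_op_def
proof (intro ballI impI)
  fix x y assume xy: "x \<in> space (Rd d)" "y \<in> space (Rd d)" "nrm d x = nrm d y"
  note a = radialD[OF radial_cauchy_op[OF d \<eta> bdd_mult[OF f bdd_student[OF \<nu>]] radial_mult[OF r radial_student]] xy]
  note b = radialD[OF radial_cauchy_op[OF d \<eta> bdd_student[OF \<nu>] radial_student] xy]
  show "cauchy_op d \<eta> (\<lambda>x. f x * student d \<nu> 1 x) x / cauchy_op d \<eta> (student d \<nu> 1) x =
    cauchy_op d \<eta> (\<lambda>x. f x * student d \<nu> 1 x) y / cauchy_op d \<eta> (student d \<nu> 1) y"
    unfolding a b ..
qed

lemma radial_iterate:
  assumes d: "d \<ge> 1" and \<eta>: "\<eta> > 0" and \<nu>: "\<nu> > 0" and b: "bdd d M (initial_density d \<nu>)"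
  shows "radial d (iterate d \<nu> \<eta> k)"
proof (induction k)
  case 0
  show ?case by (auto simp: radial_def iterate_0 initial_density_def gden_def student_def)
next
  case (Suc k)
  show ?case
    unfolding iterate_Suc step_op_def
    by (rule radial_cauchy_op[OF d \<eta> back_op_bdd[OF \<eta> \<nu> iterate_bdd[OF \<eta> \<nu> b]] radial_back_op[OF d \<eta> \<nu> iterate_bdd[OF \<eta> \<nu> b] Suc]])
qed

section \<open>A Poincare inequality for radial functions\<close>

text \<open>
  The substitution \<open>m = |G| n / |n y + G|\<close>, whose derivative is at most 1 when \<open>y \<sqdot> G \<ge> 0\<close>, compares
  a jump from \<open>y\<close> in direction \<open>G\<close> with the point \<open>G / m\<close> of the same norm.
\<close>

lemma nn_integral_jump_lower_bound:
  fixes \<psi> :: "real \<Rightarrow> ennreal"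
  assumes [measurable]: "\<psi> \<in> borel_measurable borel" and g: "g > 0" and a: "a \<ge> 0" and b: "b \<ge> 0"
  shows "(\<integral>\<^sup>+m. \<psi> (g / m) * indicator {0<..} m * indicator {m. m * sqrt a < g} m \<partial>lborel) \<le>
    (\<integral>\<^sup>+n. \<psi> (sqrt (a + 2 * (b / n) + (g / n)\<^sup>2)) * indicator {0<..} n \<partial>lborel)"
proof -
  \<comment> \<open>Here a = |y|^2, b is the inner product of y and G, and g = |G|. Then g /
    \<open>mm n\<close> is the norm of y + G / n, so G / \<open>mm n\<close> lies on the same sphere
    as the landing point.\<close>
  define mm where "mm n = g * n / sqrt (a * n\<^sup>2 + 2 * b * n + g\<^sup>2)" for n
  define mm' where "mm' n = g * (b * n + g\<^sup>2) / (sqrt (a * n\<^sup>2 + 2 * b * n + g\<^sup>2)) ^ 3" for n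
  have Spos: "a * n\<^sup>2 + 2 * b * n + g\<^sup>2 > 0" if "n \<ge> 0" for n
    using that a b g by (intro add_nonneg_pos add_nonneg_nonneg mult_nonneg_nonneg) auto
  have deriv: "(mm has_real_derivative mm' n) (at n)" if n: "n \<ge> 0" for n
  proof -
    define R where "R = a * n\<^sup>2 + 2 * b * n + g\<^sup>2"
    have R: "R > 0" unfolding R_def by (rule Spos[OF n])
    have "(mm has_real_derivative (g * sqrt (a * n\<^sup>2 + 2 * b * n + g\<^sup>2) - g * n * ((a * (2 * n) + 2 * b) / (2 * sqrt R))) / (sqrt (a * n\<^sup>2 + 2 * b * n + g\<^sup>2) * sqrt (a * n\<^sup>2 + 2 * b * n + g\<^sup>2))) (at n)"
      unfolding mm_def[abs_def]
    proof (rule DERIV_divide)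
      show "((\<lambda>n. g * n) has_real_derivative g) (at n)" by (auto intro!: derivative_eq_intros)
      have "((\<lambda>n. a * n\<^sup>2 + 2 * b * n + g\<^sup>2) has_real_derivative a * (2 * n) + 2 * b) (at n)"
        by (auto intro!: derivative_eq_intros)
      from DERIV_chain2[where f=sqrt and g="\<lambda>n. a * n\<^sup>2 + 2 * b * n + g\<^sup>2", OF DERIV_real_sqrt[OF R[unfolded R_def]] this]
      show "((\<lambda>n. sqrt (a * n\<^sup>2 + 2 * b * n + g\<^sup>2)) has_real_derivative (a * (2 * n) + 2 * b) / (2 * sqrt R)) (at n)"
        by (simp add: R_def inverse_eq_divide field_simps)
      show "sqrt (a * n\<^sup>2 + 2 * b * n + g\<^sup>2) \<noteq> 0" using R by (simp add: R_def)
    qed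
    also have "(g * sqrt (a * n\<^sup>2 + 2 * b * n + g\<^sup>2) - g * n * ((a * (2 * n) + 2 * b) / (2 * sqrt R))) / (sqrt (a * n\<^sup>2 + 2 * b * n + g\<^sup>2) * sqrt (a * n\<^sup>2 + 2 * b * n + g\<^sup>2)) = mm' n"
    proof -
      have "g * sqrt R - g * n * ((a * (2 * n) + 2 * b) / (2 * sqrt R)) = g * (R - n * (a * n + b)) / sqrt R"
      proof -
        have "sqrt R = R / sqrt R" using R by (simp add: real_div_sqrt)
        moreover have "g * n * ((a * (2 * n) + 2 * b) / (2 * sqrt R)) = g * (n * (a * n + b)) / sqrt R"
        proof -
          have "(a * (2 * n) + 2 * b) / (2 * sqrt R) = (a * n + b) / sqrt R"
            using mult_divide_mult_cancel_left[of 2 "a * n + b" "sqrt R"] by (simp add: algebra_simps)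
          then show ?thesis by (simp add: mult.assoc)
        qed
        ultimately have "g * sqrt R - g * n * ((a * (2 * n) + 2 * b) / (2 * sqrt R)) = g * (R / sqrt R) - g * (n * (a * n + b)) / sqrt R" by simp
        then show ?thesis by (simp add: diff_divide_distrib right_diff_distrib)
      qed
      moreover have "R - n * (a * n + b) = b * n + g\<^sup>2" by (simp add: R_def power2_eq_square algebra_simps)
      ultimately show ?thesis unfolding mm'_def R_def[symmetric] by (simp add: power3_eq_cube)
    qed
    finally show ?thesis .
  qed
  have mm'_nn: "mm' n \<ge> 0" if "n \<ge> 0" for n
    using that a b g Spos[OF that] unfolding mm'_def by (intro divide_nonneg_nonneg mult_nonneg_nonneg add_nonneg_nonneg) auto
  \<comment> \<open>This is where b >= 0 enters: with R = |n y + G|^2, both b n + g^2 <= R and g <=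
    sqrt R hold.\<close>
  have mm'_le: "mm' n \<le> 1" if n: "n \<ge> 0" for n
  proof -
    define R where "R = a * n\<^sup>2 + 2 * b * n + g\<^sup>2"
    have R: "R > 0" unfolding R_def by (rule Spos[OF n])
    have 1: "b * n + g\<^sup>2 \<le> R" using a b n by (simp add: R_def)
    have "g\<^sup>2 \<le> R" using a b n by (simp add: R_def)
    then have 2: "g \<le> sqrt R" using g by (simp add: real_le_rsqrt)
    have "g * (b * n + g\<^sup>2) \<le> sqrt R * R" using 1 2 R b n g by (intro mult_mono) auto
    also have "\<dots> = (sqrt R) ^ 3" using R by (simp add: power3_eq_cube)
    finally show ?thesis using R unfolding mm'_def R_def[symmetric] by (simp add: divide_le_eq_1)
  qed
  have cont: "continuous_on {0..c} mm'" for c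
  proof -
    have "sqrt (a * n\<^sup>2 + 2 * b * n + g\<^sup>2) \<noteq> 0" if "n \<in> {0..c}" for n using Spos[of n] that by auto
    then show ?thesis unfolding mm'_def[abs_def] by (intro continuous_intros) auto
  qed
  have [measurable]: "mm \<in> borel_measurable borel" "mm' \<in> borel_measurable borel"
    unfolding mm_def[abs_def] mm'_def[abs_def] by measurable
  define f where "f m = \<psi> (g / m) * indicator {0<..} m" for m
  have [measurable]: "f \<in> borel_measurable borel" unfolding f_def[abs_def] by measurable
  have "(\<integral>\<^sup>+m. \<psi> (g / m) * indicator {0<..} m * indicator {m. m * sqrt a < g} m \<partial>lborel) \<le>
     (\<integral>\<^sup>+m. f m * indicator (\<Union>k. {mm 0..mm (real (Suc k))}) m \<partial>lborel)"
  proof (rule nn_integral_mono)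
    fix m :: real
    \<comment> \<open>For n >= 1 the inequality m <= \<open>mm n\<close> follows from m^2 (2 b +
      g^2) <= n (g^2 - m^2 a), which can be met because the gap on the right is positive.\<close>
    have "m \<in> (\<Union>k. {mm 0..mm (real (Suc k))})" if m: "m > 0" "m * sqrt a < g"
    proof -
      have "(m * sqrt a)\<^sup>2 < g\<^sup>2" using m a by (intro power_strict_mono) auto
      then have gap: "g\<^sup>2 - m\<^sup>2 * a > 0" using a by (simp add: power_mult_distrib)
      obtain k where k: "m\<^sup>2 * (2 * b + g\<^sup>2) / (g\<^sup>2 - m\<^sup>2 * a) \<le> real k" using real_arch_simple by blast
      define n where "n = real (Suc k)"
      have n1: "n \<ge> 1" by (simp add: n_def)
      have "m\<^sup>2 * (2 * b + g\<^sup>2) \<le> n * (g\<^sup>2 - m\<^sup>2 * a)"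
      proof -
        have "m\<^sup>2 * (2 * b + g\<^sup>2) \<le> real k * (g\<^sup>2 - m\<^sup>2 * a)" using k gap by (simp add: divide_le_eq)
        also have "\<dots> \<le> n * (g\<^sup>2 - m\<^sup>2 * a)" using gap by (intro mult_right_mono) (auto simp: n_def)
        finally show ?thesis .
      qed
      then have "m\<^sup>2 * (2 * b + g\<^sup>2) * n \<le> n * (g\<^sup>2 - m\<^sup>2 * a) * n" using n1 by (intro mult_right_mono) auto
      moreover have "m\<^sup>2 * (2 * b * n + g\<^sup>2) \<le> m\<^sup>2 * (2 * b + g\<^sup>2) * n"
      proof -
        have "g\<^sup>2 \<le> g\<^sup>2 * n" using n1 by (simp add: mult_le_cancel_left1)
        then have "2 * b * n + g\<^sup>2 \<le> (2 * b + g\<^sup>2) * n" by (simp add: algebra_simps)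
        from mult_left_mono[OF this, of "m\<^sup>2"] show ?thesis by (simp add: mult.assoc)
      qed
      ultimately have "m\<^sup>2 * (a * n\<^sup>2 + 2 * b * n + g\<^sup>2) \<le> (g * n)\<^sup>2"
        by (simp add: power2_eq_square algebra_simps)
      then have "(m * sqrt (a * n\<^sup>2 + 2 * b * n + g\<^sup>2))\<^sup>2 \<le> (g * n)\<^sup>2"
        using Spos[of n] n1 by (simp add: power_mult_distrib)
      then have "m * sqrt (a * n\<^sup>2 + 2 * b * n + g\<^sup>2) \<le> g * n"
        by (rule power2_le_imp_le) (use g n1 in simp)
      then have "m \<le> mm n" using Spos[of n] n1 by (simp add: mm_def le_divide_eq)
      moreover have "mm 0 = 0" by (simp add: mm_def)
      ultimately show ?thesis using m by (intro UN_I[of k]) (auto simp: n_def)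
    qed
    then show "\<psi> (g / m) * indicator {0<..} m * indicator {m. m * sqrt a < g} m \<le> f m * indicator (\<Union>k. {mm 0..mm (real (Suc k))}) m"
      by (cases "m > 0 \<and> m * sqrt a < g") (auto simp: f_def)
  qed
  also have "\<dots> = (\<integral>\<^sup>+n. f (mm n) * ennreal (mm' n) * indicator {0..} n \<partial>lborel)"
    using deriv mm'_nn cont by (intro nn_integral_substitution_Ici) auto
  also have "\<dots> \<le> (\<integral>\<^sup>+n. \<psi> (sqrt (a + 2 * (b / n) + (g / n)\<^sup>2)) * indicator {0<..} n \<partial>lborel)"
  proof (rule nn_integral_mono)
    fix n :: real
    show "f (mm n) * ennreal (mm' n) * indicator {0..} n \<le> \<psi> (sqrt (a + 2 * (b / n) + (g / n)\<^sup>2)) * indicator {0<..} n"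
    proof (cases "n > 0")
      case True
      have "g / mm n = sqrt (a * n\<^sup>2 + 2 * b * n + g\<^sup>2) / n" using g True by (simp add: mm_def)
      also have "\<dots> = sqrt ((a * n\<^sup>2 + 2 * b * n + g\<^sup>2) / n\<^sup>2)" using True by (simp add: real_sqrt_divide)
      also have "(a * n\<^sup>2 + 2 * b * n + g\<^sup>2) / n\<^sup>2 = a + 2 * (b / n) + (g / n)\<^sup>2"
        using True by (simp add: add_divide_distrib power_divide power2_eq_square)
      finally have "f (mm n) \<le> \<psi> (sqrt (a + 2 * (b / n) + (g / n)\<^sup>2))"
        by (auto simp: f_def split: split_indicator)
      moreover have "ennreal (mm' n) \<le> 1" using mm'_le[of n] True by simp
      ultimately have "f (mm n) * ennreal (mm' n) \<le> \<psi> (sqrt (a + 2 * (b / n) + (g / n)\<^sup>2)) * 1" by (intro mult_mono) auto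
      then show ?thesis using True by simp
    next
      case False
      have "mm 0 = 0" by (simp add: mm_def)
      then show ?thesis using False by (cases "n = 0") (auto simp: f_def split: split_indicator)
    qed
  qed
  finally show ?thesis .
qed

lemma nn_integral_std_gaussian_neg:
  assumes [measurable]: "\<psi> \<in> borel_measurable (Rd d)"
  shows "(\<integral>\<^sup>+z. \<psi> (vscale d (-1) z) \<partial>std_gaussian d) = (\<integral>\<^sup>+z. \<psi> z \<partial>std_gaussian d)"
proof -
  have "(\<integral>\<^sup>+z. \<psi> (vscale d (-1) z) \<partial>std_gaussian d) = (\<integral>\<^sup>+z. (\<lambda>z. ennreal (gden d 1 z) * \<psi> z) (vscale d (-1) z) \<partial>Rd d)"
    unfolding std_gaussian_eq_density by (subst nn_integral_density) (auto simp: gden_def)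
  also have "\<dots> = (\<integral>\<^sup>+z. ennreal (gden d 1 z) * \<psi> z \<partial>Rd d)" by (rule nn_integral_Rd_neg) measurable
  finally show ?thesis unfolding std_gaussian_eq_density by (subst nn_integral_density) auto
qed

lemma AE_std_gaussian_nrm_pos: "d \<ge> 1 \<Longrightarrow> AE z in std_gaussian d. nrm d z > 0"
  unfolding std_gaussian_eq_density using AE_Rd_nrm_pos[of d] by (subst AE_density) auto

text \<open>The left-hand side pairs y with independent outward points z / m, since m |y| < |z| says
  that such a point has larger norm than y. The comparison of jumps is available for half of the
  directions only; as its left-hand side is even in z, reflecting the Gaussian costs a factor 2,
  which turns sqrt (2 / pi) into 1 / sqrt (2 pi).\<close>

lemma dirichlet_form_radial_lower_bound:
  assumes d: "d \<ge> 1" and \<nu>: "\<nu> > 0" and f [measurable]: "f \<in> borel_measurable (Rd d)" and r: "radial d f"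
  shows "ennreal (1 / sqrt (2 * pi)) * (\<integral>\<^sup>+y. (\<integral>\<^sup>+z. (\<integral>\<^sup>+m. ennreal ((f (vscale d (1 / m) z) - f y)\<^sup>2) *
      indicator {0<..} m * indicator {m. m * nrm d y < nrm d z} m \<partial>lborel) \<partial>std_gaussian d) \<partial>target_law d \<nu>) \<le>
    dirichlet_form d (student d \<nu> 1) f"
proof -
  interpret G: prob_space "std_gaussian d" by (rule prob_space_std_gaussian)
  interpret GL: pair_sigma_finite "std_gaussian d" lborel ..
  define F where "F r = f (axis_vec d r)" for r
  have [measurable]: "F \<in> borel_measurable borel" unfolding F_def[abs_def] by measurable
  have fF: "f x = F (nrm d x)" if "x \<in> space (Rd d)" for x
    unfolding F_def using that nrm_axis_vec[OF d, of "nrm d x"] by (intro radialD[OF r]) auto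
  define L where "L y z = (\<integral>\<^sup>+m. ennreal ((f (vscale d (1 / m) z) - f y)\<^sup>2) * indicator {0<..} m * indicator {m. m * nrm d y < nrm d z} m \<partial>lborel)" for y z
  define D where "D y z = (\<integral>\<^sup>+n. ennreal ((f (vadd d y (vscale d (1 / n) z)) - f y)\<^sup>2) * indicator {0<..} n \<partial>lborel)" for y z
  have [measurable]: "(\<lambda>(y, z). L y z) \<in> borel_measurable (Rd d \<Otimes>\<^sub>M Rd d)"
    "(\<lambda>(y, z). D y z) \<in> borel_measurable (Rd d \<Otimes>\<^sub>M Rd d)"
    unfolding L_def D_def by measurable
  have LD: "L y z \<le> D y z" if y: "y \<in> space (Rd d)" and z: "nrm d z > 0" and dot: "dotp d y z \<ge> 0" for y z
  proof -
    define \<psi> where "\<psi> s = ennreal ((F s - f y)\<^sup>2)" for s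
    have [measurable]: "\<psi> \<in> borel_measurable borel" unfolding \<psi>_def[abs_def] by measurable
    have "L y z = (\<integral>\<^sup>+m. \<psi> (nrm d z / m) * indicator {0<..} m * indicator {m. m * sqrt ((nrm d y)\<^sup>2) < nrm d z} m \<partial>lborel)"
      unfolding L_def by (intro nn_integral_cong) (auto simp: \<psi>_def fF L2_set_nonneg split: split_indicator)
    also have "\<dots> \<le> (\<integral>\<^sup>+n. \<psi> (sqrt ((nrm d y)\<^sup>2 + 2 * (dotp d y z / n) + (nrm d z / n)\<^sup>2)) * indicator {0<..} n \<partial>lborel)"
      using z dot by (intro nn_integral_jump_lower_bound) auto
    also have "\<dots> = D y z"
      unfolding D_def
    proof (rule nn_integral_cong)
      fix n :: real
      have "sqrt ((nrm d y)\<^sup>2 + 2 * (dotp d y z / n) + (nrm d z / n)\<^sup>2) = nrm d (vadd d y (vscale d (1 / n) z))" if "n > 0"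
      proof -
        have "(nrm d (vadd d y (vscale d (1 / n) z)))\<^sup>2 = (nrm d y)\<^sup>2 + 2 * (dotp d y z / n) + (nrm d z / n)\<^sup>2"
          using that by (simp add: nrm_vadd_sq)
        then show ?thesis by (metis L2_set_nonneg real_sqrt_unique)
      qed
      then show "\<psi> (sqrt ((nrm d y)\<^sup>2 + 2 * (dotp d y z / n) + (nrm d z / n)\<^sup>2)) * indicator {0<..} n =
        ennreal ((f (vadd d y (vscale d (1 / n) z)) - f y)\<^sup>2) * indicator {0<..} n"
        by (auto simp: \<psi>_def fF split: split_indicator)
    qed
    finally show ?thesis .
  qed
  \<comment> \<open>z and - z give points of equal norm, where the radial \<open>f\<close> takes the
    same value.\<close>
  have Lneg: "L y (vscale d (-1) z) = L y z" if "y \<in> space (Rd d)" for y z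
  proof -
    have "f (vscale d (1 / m) (vscale d (-1) z)) = f (vscale d (1 / m) z)" for m
      by (rule radialD[OF r]) auto
    then show ?thesis unfolding L_def by simp
  qed
  have half: "(\<integral>\<^sup>+z. L y z \<partial>std_gaussian d) \<le> 2 * (\<integral>\<^sup>+z. D y z \<partial>std_gaussian d)" if y [measurable]: "y \<in> space (Rd d)" for y
  proof -
    have "(\<integral>\<^sup>+z. L y z \<partial>std_gaussian d) \<le> (\<integral>\<^sup>+z. D y z + D y (vscale d (-1) z) \<partial>std_gaussian d)"
    proof (rule nn_integral_mono_AE, use AE_std_gaussian_nrm_pos[OF d] in eventually_elim)
      fix z assume z: "nrm d z > 0"
      show "L y z \<le> D y z + D y (vscale d (-1) z)"
      proof (cases "dotp d y z \<ge> 0")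
        case True
        then show ?thesis using LD[OF y z] by (simp add: add_increasing2)
      next
        case False
        then have "L y (vscale d (-1) z) \<le> D y (vscale d (-1) z)" using z by (intro LD[OF y]) auto
        then show ?thesis using Lneg[OF y] by (simp add: add_increasing)
      qed
    qed
    also have "\<dots> = (\<integral>\<^sup>+z. D y z \<partial>std_gaussian d) + (\<integral>\<^sup>+z. D y (vscale d (-1) z) \<partial>std_gaussian d)"
      by (rule nn_integral_add) measurable
    also have "(\<integral>\<^sup>+z. D y (vscale d (-1) z) \<partial>std_gaussian d) = (\<integral>\<^sup>+z. D y z \<partial>std_gaussian d)"
      by (rule nn_integral_std_gaussian_neg) measurable
    finally show ?thesis by (simp add: mult_2)
  qed
  have "dirichlet_form d (student d \<nu> 1) f = (\<integral>\<^sup>+y. ennreal (sqrt (2 / pi)) * (\<integral>\<^sup>+z. D y z \<partial>std_gaussian d) \<partial>target_law d \<nu>)"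
  proof (subst dirichlet_form_eq[OF f], rule nn_integral_cong)
    fix y assume "y \<in> space (target_law d \<nu>)"
    then have [measurable]: "y \<in> space (Rd d)" by simp
    have "(\<integral>\<^sup>+z. ennreal ((f (vadd d y z) - f y)\<^sup>2) * ennreal (c_frac d / nrm d z ^ (d + 1)) \<partial>Rd d) =
       ennreal (sqrt (2 / pi)) * (\<integral>\<^sup>+n. (\<integral>\<^sup>+z. ennreal ((f (vadd d y (vscale d (1 / n) z)) - f y)\<^sup>2) \<partial>std_gaussian d) * indicator {0<..} n \<partial>lborel)"
      by (rule singular_mixture[OF d]) measurable
    also have "(\<integral>\<^sup>+n. (\<integral>\<^sup>+z. ennreal ((f (vadd d y (vscale d (1 / n) z)) - f y)\<^sup>2) \<partial>std_gaussian d) * indicator {0<..} n \<partial>lborel) =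
       (\<integral>\<^sup>+n. (\<integral>\<^sup>+z. ennreal ((f (vadd d y (vscale d (1 / n) z)) - f y)\<^sup>2) * indicator {0<..} n \<partial>std_gaussian d) \<partial>lborel)"
      by (intro nn_integral_cong nn_integral_multc[symmetric]) measurable
    also have "\<dots> = (\<integral>\<^sup>+z. D y z \<partial>std_gaussian d)"
      unfolding D_def by (rule GL.Fubini') measurable
    finally show "(\<integral>\<^sup>+z. ennreal ((f (vadd d y z) - f y)\<^sup>2) * ennreal (c_frac d / nrm d z ^ (d + 1)) \<partial>Rd d) =
      ennreal (sqrt (2 / pi)) * (\<integral>\<^sup>+z. D y z \<partial>std_gaussian d)" .
  qed
  also have "\<dots> = (\<integral>\<^sup>+y. ennreal (1 / sqrt (2 * pi)) * (2 * (\<integral>\<^sup>+z. D y z \<partial>std_gaussian d)) \<partial>target_law d \<nu>)"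
  proof -
    have "sqrt (2 / pi) = 1 / sqrt (2 * pi) * 2" by (simp add: real_sqrt_mult real_sqrt_divide field_simps)
    then have "ennreal (sqrt (2 / pi)) = ennreal (1 / sqrt (2 * pi)) * 2" by (subst ennreal_numeral[symmetric]) (simp only: ennreal_mult'')
    then show ?thesis by (simp add: mult.assoc)
  qed
  also have "\<dots> \<ge> (\<integral>\<^sup>+y. ennreal (1 / sqrt (2 * pi)) * (\<integral>\<^sup>+z. L y z \<partial>std_gaussian d) \<partial>target_law d \<nu>)"
    by (intro nn_integral_mono mult_left_mono half) auto
  also have "(\<integral>\<^sup>+y. ennreal (1 / sqrt (2 * pi)) * (\<integral>\<^sup>+z. L y z \<partial>std_gaussian d) \<partial>target_law d \<nu>) =
    ennreal (1 / sqrt (2 * pi)) * (\<integral>\<^sup>+y. (\<integral>\<^sup>+z. L y z \<partial>std_gaussian d) \<partial>target_law d \<nu>)"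
    by (rule nn_integral_cmult) measurable
  finally show ?thesis unfolding L_def .
qed

section \<open>The mixing law near zero and a variance identity\<close>

definition chi_const :: "real \<Rightarrow> real" where
  "chi_const \<nu> = 2 powr (1 - \<nu> / 2) / Gamma (\<nu> / 2)"

lemma chi_const_pos: "\<nu> > 0 \<Longrightarrow> chi_const \<nu> > 0"
  by (simp add: chi_const_def Gamma_real_pos)

lemma chi_density_le:
  assumes \<nu>: "\<nu> > 0"
  shows "chi_density \<nu> n \<le> chi_const \<nu> * n powr (\<nu> - 1)"
proof (cases "n > 0")
  case True
  have "chi_const \<nu> * n powr (\<nu> - 1) * exp (- n\<^sup>2 / 2) \<le> chi_const \<nu> * n powr (\<nu> - 1) * 1"
    using chi_const_pos[OF \<nu>] by (intro mult_left_mono) auto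
  then show ?thesis using True by (simp add: chi_density_def chi_const_def)
qed (use chi_const_pos[OF \<nu>] in \<open>simp add: chi_density_def\<close>)

lemma chi_law_lower_tail:
  assumes \<nu>: "\<nu> > 0" and t: "t \<ge> 0"
  shows "emeasure (chi_law \<nu>) {..t} \<le> ennreal (chi_const \<nu> / \<nu> * t powr \<nu>)"
proof -
  note c = chi_const_pos[OF \<nu>]
  have "emeasure (chi_law \<nu>) {..t} = (\<integral>\<^sup>+n. ennreal (chi_density \<nu> n) * indicator {..t} n \<partial>lborel)"
    unfolding chi_law_def by (rule emeasure_density) auto
  also have "\<dots> \<le> (\<integral>\<^sup>+n. ennreal (indicator {0..t} n * (chi_const \<nu> * n powr (\<nu> - 1))) \<partial>lborel)"
  proof (rule nn_integral_mono)
    fix n :: real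
    have "chi_density \<nu> n = 0" if "n \<le> 0" using that by (simp add: chi_density_def)
    then show "ennreal (chi_density \<nu> n) * indicator {..t} n \<le> ennreal (indicator {0..t} n * (chi_const \<nu> * n powr (\<nu> - 1)))"
      using chi_density_le[OF \<nu>, of n] by (cases "n \<le> 0") (auto intro: ennreal_leI split: split_indicator)
  qed
  also have "\<dots> = ennreal (chi_const \<nu> * (t powr (\<nu> - 1 + 1) / (\<nu> - 1 + 1)))"
  proof (rule nn_integral_has_integral_lborel)
    have "((\<lambda>n. chi_const \<nu> * n powr (\<nu> - 1)) has_integral chi_const \<nu> * (t powr (\<nu> - 1 + 1) / (\<nu> - 1 + 1))) {0..t}"
      using \<nu> t by (intro has_integral_mult_right has_integral_powr_from_0) auto
    moreover have "(\<lambda>n. indicator {0..t} n * (chi_const \<nu> * n powr (\<nu> - 1))) =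
      (\<lambda>n. if n \<in> {0..t} then chi_const \<nu> * n powr (\<nu> - 1) else 0)" by (auto simp: fun_eq_iff)
    ultimately show "((\<lambda>n. indicator {0..t} n * (chi_const \<nu> * n powr (\<nu> - 1))) has_integral
        chi_const \<nu> * (t powr (\<nu> - 1 + 1) / (\<nu> - 1 + 1))) UNIV"
      by (simp only: has_integral_restrict_UNIV)
  qed (use c in auto)
  finally show ?thesis by simp
qed

lemma nn_integral_square_diff:
  assumes \<nu>: "\<nu> > 0" and f: "bdd d M f" and mass: "(\<integral>\<^sup>+x. ennreal (f x) \<partial>target_law d \<nu>) = 1"
  shows "(\<integral>\<^sup>+x. ennreal ((a - f x)\<^sup>2) \<partial>target_law d \<nu>) = ennreal (a\<^sup>2 - 2 * a + (LINT x|target_law d \<nu>. (f x)\<^sup>2))"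
proof -
  interpret prob_space "target_law d \<nu>" by (rule prob_space_target_law[OF \<nu>])
  note [measurable] = bddD(1)[OF f]
  note s = bddD(2,3)[OF bdd_square[OF f]]
  have i1: "integrable (target_law d \<nu>) f"
    using bddD(2,3)[OF f] by (intro integrable_const_bound[where B = M]) auto
  have i2: "integrable (target_law d \<nu>) (\<lambda>x. (f x)\<^sup>2)"
    using s by (intro integrable_const_bound[where B = "M\<^sup>2"]) auto
  have eq: "(a - f x)\<^sup>2 = a\<^sup>2 - 2 * a * f x + (f x)\<^sup>2" for x by (simp add: power2_eq_square algebra_simps)
  have "(\<integral>\<^sup>+x. ennreal ((a - f x)\<^sup>2) \<partial>target_law d \<nu>) = ennreal (LINT x|target_law d \<nu>. (a - f x)\<^sup>2)"
  proof (rule nn_integral_eq_integral)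
    show "integrable (target_law d \<nu>) (\<lambda>x. (a - f x)\<^sup>2)" unfolding eq using i1 i2 by simp
  qed simp
  also have "(LINT x|target_law d \<nu>. (a - f x)\<^sup>2) = a\<^sup>2 - 2 * a * (LINT x|target_law d \<nu>. f x) + (LINT x|target_law d \<nu>. (f x)\<^sup>2)"
    unfolding eq using i1 i2 prob_space by simp
  finally show ?thesis using second_moment_eq(2)[OF \<nu> f mass] by simp
qed

text \<open>For two independent copies the mean squared difference is twice the variance; the mean
  of \<open>f\<close> under the target is 1 by the mass assumption.\<close>

lemma nn_integral_pair_square_diff:
  assumes \<nu>: "\<nu> > 0" and f: "bdd d M f" and mass: "(\<integral>\<^sup>+x. ennreal (f x) \<partial>target_law d \<nu>) = 1"
  shows "(\<integral>\<^sup>+y. (\<integral>\<^sup>+x. ennreal ((f x - f y)\<^sup>2) \<partial>target_law d \<nu>) \<partial>target_law d \<nu>) =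
    2 * (\<integral>\<^sup>+x. ennreal ((f x - 1)\<^sup>2) \<partial>target_law d \<nu>)"
proof -
  interpret prob_space "target_law d \<nu>" by (rule prob_space_target_law[OF \<nu>])
  note [measurable] = bddD(1)[OF f]
  note sq = nn_integral_square_diff[OF \<nu> f mass]
  define s where "s = (LINT x|target_law d \<nu>. (f x)\<^sup>2)"
  have i1: "integrable (target_law d \<nu>) f"
    using bddD(2,3)[OF f] by (intro integrable_const_bound[where B = M]) auto
  have i2: "integrable (target_law d \<nu>) (\<lambda>x. (f x)\<^sup>2)"
    using bddD(2,3)[OF bdd_square[OF f]] by (intro integrable_const_bound[where B = "M\<^sup>2"]) auto
  have s1: "0 \<le> a\<^sup>2 - 2 * a + s" for a
  proof -
    have "a\<^sup>2 - 2 * a + s = (LINT x|target_law d \<nu>. a\<^sup>2 - 2 * a * f x + (f x)\<^sup>2)"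
      using i1 i2 second_moment_eq(2)[OF \<nu> f mass] prob_space by (simp add: s_def)
    also have "\<dots> \<ge> 0"
    proof (rule Bochner_Integration.integral_nonneg)
      fix x have "a\<^sup>2 - 2 * a * f x + (f x)\<^sup>2 = (a - f x)\<^sup>2" by (simp add: power2_eq_square algebra_simps)
      then show "0 \<le> a\<^sup>2 - 2 * a * f x + (f x)\<^sup>2" by simp
    qed
    finally show ?thesis .
  qed
  have "(\<integral>\<^sup>+y. (\<integral>\<^sup>+x. ennreal ((f x - f y)\<^sup>2) \<partial>target_law d \<nu>) \<partial>target_law d \<nu>) =
    (\<integral>\<^sup>+y. ennreal ((f y)\<^sup>2 - 2 * f y + s) \<partial>target_law d \<nu>)"
    by (simp add: power2_commute[of "f _" "f _"] sq s_def)
  also have "\<dots> = ennreal (LINT y|target_law d \<nu>. (f y)\<^sup>2 - 2 * f y + s)"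
    using i1 i2 s1 by (intro nn_integral_eq_integral) auto
  also have "(LINT y|target_law d \<nu>. (f y)\<^sup>2 - 2 * f y + s) = 2 * (s - 1)"
    using i1 i2 second_moment_eq(2)[OF \<nu> f mass] prob_space by (simp add: s_def)
  also have "ennreal (2 * (s - 1)) = ennreal 2 * ennreal (s - 1)" by (rule ennreal_mult') simp
  also have "ennreal (s - 1) = (\<integral>\<^sup>+x. ennreal ((f x - 1)\<^sup>2) \<partial>target_law d \<nu>)"
    using sq[of 1] by (simp add: power2_commute[of "f _" 1] s_def)
  finally show ?thesis by simp
qed

text \<open>The variance is an integral over pairs, and by symmetry over pairs with |y| < |x|; pairs
  of equal norm contribute nothing since \<open>f\<close> is radial. Writing x = G / n, the chi
  density is dominated by a constant for n > 1 / B, and what is left is the left-hand side of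
  \<open>dirichlet_form_radial_lower_bound\<close>. The scales n <= 1 / B form the tail
  term.\<close>

lemma weak_poincare_radial:
  assumes d: "d \<ge> 1" and \<nu>: "0 < \<nu>" "\<nu> < 1" and f: "bdd d M f" and r: "radial d f"
    and mass: "(\<integral>\<^sup>+x. ennreal (f x) \<partial>target_law d \<nu>) = 1" and B: "B > 0"
  shows "(\<integral>\<^sup>+x. ennreal ((f x - 1)\<^sup>2) \<partial>target_law d \<nu>) \<le>
    ennreal (sqrt (2 * pi) * chi_const \<nu> * B powr (1 - \<nu>)) * dirichlet_form d (student d \<nu> 1) f +
    ((\<integral>\<^sup>+n. (\<integral>\<^sup>+z. ennreal ((f (vscale d (1 / n) z))\<^sup>2) \<partial>std_gaussian d) * indicator {..1 / B} n \<partial>chi_law \<nu>) +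
     ((\<integral>\<^sup>+x. ennreal ((f x - 1)\<^sup>2) \<partial>target_law d \<nu>) + 1) * emeasure (chi_law \<nu>) {..1 / B})"
proof -
  interpret T: prob_space "target_law d \<nu>" by (rule prob_space_target_law[OF \<nu>(1)])
  interpret G: prob_space "std_gaussian d" by (rule prob_space_std_gaussian)
  interpret C: prob_space "chi_law \<nu>" by (rule prob_space_chi_law[OF \<nu>(1)])
  interpret TT: pair_sigma_finite "target_law d \<nu>" "target_law d \<nu>" ..
  interpret GL: pair_sigma_finite "std_gaussian d" lborel ..
  interpret TC: pair_sigma_finite "chi_law \<nu>" "target_law d \<nu>" ..
  interpret GT: pair_sigma_finite "std_gaussian d" "target_law d \<nu>" ..
  let ?T = "target_law d \<nu>" and ?\<Gamma> = "std_gaussian d"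
  note [measurable] = bddD(1)[OF f]
  define v where "v = (\<integral>\<^sup>+x. ennreal ((f x - 1)\<^sup>2) \<partial>?T)"
  define h where "h y x = ennreal ((f x - f y)\<^sup>2) * indicator {x. nrm d y < nrm d x} x" for y x
  have hm [measurable]: "(\<lambda>(y, x). h y x) \<in> borel_measurable (Rd d \<Otimes>\<^sub>M Rd d)"
    unfolding h_def by measurable
  have "2 * v = (\<integral>\<^sup>+y. (\<integral>\<^sup>+x. ennreal ((f x - f y)\<^sup>2) \<partial>?T) \<partial>?T)"
    unfolding v_def by (rule nn_integral_pair_square_diff[OF \<nu>(1) f mass, symmetric])
  also have "\<dots> = (\<integral>\<^sup>+y. (\<integral>\<^sup>+x. h y x + h x y \<partial>?T) \<partial>?T)"
  proof (rule nn_integral_cong, rule nn_integral_cong)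
    fix y x assume "y \<in> space ?T" "x \<in> space ?T"
    then have xy: "x \<in> space (Rd d)" "y \<in> space (Rd d)" by simp_all
    consider "nrm d y < nrm d x" | "nrm d x < nrm d y" | "nrm d x = nrm d y" by linarith
    then show "ennreal ((f x - f y)\<^sup>2) = h y x + h x y"
    proof cases
      case 3
      have "f x = f y" by (rule radialD[OF r xy 3])
      then show ?thesis by (simp add: h_def)
    qed (simp_all add: h_def power2_commute[of "f x" "f y"])
  qed
  also have "\<dots> = (\<integral>\<^sup>+y. (\<integral>\<^sup>+x. h y x \<partial>?T) + (\<integral>\<^sup>+x. h x y \<partial>?T) \<partial>?T)"
    by (rule nn_integral_cong, rule nn_integral_add) measurable
  also have "\<dots> = (\<integral>\<^sup>+y. (\<integral>\<^sup>+x. h y x \<partial>?T) \<partial>?T) + (\<integral>\<^sup>+y. (\<integral>\<^sup>+x. h x y \<partial>?T) \<partial>?T)"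
    by (rule nn_integral_add) measurable
  also have "(\<integral>\<^sup>+y. (\<integral>\<^sup>+x. h x y \<partial>?T) \<partial>?T) = (\<integral>\<^sup>+y. (\<integral>\<^sup>+x. h y x \<partial>?T) \<partial>?T)"
    by (rule TT.Fubini') measurable
  finally have "2 * v \<le> 2 * (\<integral>\<^sup>+y. (\<integral>\<^sup>+x. h y x \<partial>?T) \<partial>?T)" by (simp add: mult_2)
  then have vW: "v \<le> (\<integral>\<^sup>+y. (\<integral>\<^sup>+x. h y x \<partial>?T) \<partial>?T)" by (subst (asm) ennreal_mult_le_mult_iff) auto
  define c where "c = chi_const \<nu> * B powr (1 - \<nu>)"
  have c: "c \<ge> 0" using chi_const_pos[OF \<nu>(1)] by (simp add: c_def)
  define L where "L y = (\<integral>\<^sup>+z. (\<integral>\<^sup>+m. ennreal ((f (vscale d (1 / m) z) - f y)\<^sup>2) *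
      indicator {0<..} m * indicator {m. m * nrm d y < nrm d z} m \<partial>lborel) \<partial>?\<Gamma>)" for y
  define R where "R y = (\<integral>\<^sup>+n. (\<integral>\<^sup>+z. ennreal ((f (vscale d (1 / n) z) - f y)\<^sup>2) * indicator {..1 / B} n \<partial>?\<Gamma>) \<partial>chi_law \<nu>)" for y
  have [measurable]: "L \<in> borel_measurable (Rd d)" "R \<in> borel_measurable (Rd d)"
    unfolding L_def R_def by measurable
  have split: "(\<integral>\<^sup>+x. h y x \<partial>?T) \<le> ennreal c * L y + R y" if y [measurable]: "y \<in> space (Rd d)" for y
  proof -
    have [measurable]: "h y \<in> borel_measurable (Rd d)" using measurable_Pair2[OF hm y] by simp
    have "(\<integral>\<^sup>+x. h y x \<partial>?T) = (\<integral>\<^sup>+n. ennreal (chi_density \<nu> n) * (\<integral>\<^sup>+z. h y (vscale d (1 / n) z) \<partial>?\<Gamma>) \<partial>lborel)"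
      by (subst target_mixture[OF \<nu>(1)], measurable) (rule nn_integral_chi_law, measurable)
    also have "\<dots> \<le> (\<integral>\<^sup>+n. ennreal c * ((\<integral>\<^sup>+z. h y (vscale d (1 / n) z) \<partial>?\<Gamma>) * indicator {0<..} n) +
       ennreal (chi_density \<nu> n) * ((\<integral>\<^sup>+z. h y (vscale d (1 / n) z) \<partial>?\<Gamma>) * indicator {..1 / B} n) \<partial>lborel)"
    proof (rule nn_integral_mono)
      fix n :: real
      define I where "I = (\<integral>\<^sup>+z. h y (vscale d (1 / n) z) \<partial>?\<Gamma>)"
      have "ennreal (chi_density \<nu> n) * I \<le> ennreal c * (I * indicator {0<..} n) + ennreal (chi_density \<nu> n) * (I * indicator {..1 / B} n)"
      proof (cases "n > 1 / B")
        case True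
        then have n0: "n > 0" using B by (meson divide_pos_pos less_trans zero_less_one)
        \<comment> \<open>Since \<nu> < 1, the power decreases in n, so its largest value on n > 1 /
          B is approached at the edge. This is the origin of the factor B^(1 - \<nu>).\<close>
        have "n powr (\<nu> - 1) \<le> (1 / B) powr (\<nu> - 1)" using True B \<nu> by (intro powr_mono2') auto
        also have "\<dots> = B powr (1 - \<nu>)" using B by (simp add: powr_def ln_div algebra_simps)
        finally have "chi_const \<nu> * n powr (\<nu> - 1) \<le> c" unfolding c_def using chi_const_pos[OF \<nu>(1)] by (intro mult_left_mono) auto
        then have "ennreal (chi_density \<nu> n) \<le> ennreal c" using chi_density_le[OF \<nu>(1), of n] by (intro ennreal_leI) simp
        then have "ennreal (chi_density \<nu> n) * I \<le> ennreal c * I" by (intro mult_right_mono) auto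
        then show ?thesis using n0 by (simp add: add_increasing2)
      qed (simp add: add_increasing)
      then show "ennreal (chi_density \<nu> n) * (\<integral>\<^sup>+z. h y (vscale d (1 / n) z) \<partial>?\<Gamma>) \<le>
         ennreal c * ((\<integral>\<^sup>+z. h y (vscale d (1 / n) z) \<partial>?\<Gamma>) * indicator {0<..} n) +
         ennreal (chi_density \<nu> n) * ((\<integral>\<^sup>+z. h y (vscale d (1 / n) z) \<partial>?\<Gamma>) * indicator {..1 / B} n)"
        unfolding I_def .
    qed
    also have "\<dots> = ennreal c * (\<integral>\<^sup>+n. (\<integral>\<^sup>+z. h y (vscale d (1 / n) z) \<partial>?\<Gamma>) * indicator {0<..} n \<partial>lborel) +
       (\<integral>\<^sup>+n. (\<integral>\<^sup>+z. h y (vscale d (1 / n) z) \<partial>?\<Gamma>) * indicator {..1 / B} n \<partial>chi_law \<nu>)"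
      by (subst nn_integral_chi_law, measurable) (simp add: nn_integral_add nn_integral_cmult)
    also have "(\<integral>\<^sup>+n. (\<integral>\<^sup>+z. h y (vscale d (1 / n) z) \<partial>?\<Gamma>) * indicator {0<..} n \<partial>lborel) = L y"
    proof -
      have "(\<integral>\<^sup>+n. (\<integral>\<^sup>+z. h y (vscale d (1 / n) z) \<partial>?\<Gamma>) * indicator {0<..} n \<partial>lborel) =
        (\<integral>\<^sup>+n. (\<integral>\<^sup>+z. h y (vscale d (1 / n) z) * indicator {0<..} n \<partial>?\<Gamma>) \<partial>lborel)"
        by (intro nn_integral_cong nn_integral_multc[symmetric]) measurable
      also have "\<dots> = (\<integral>\<^sup>+z. (\<integral>\<^sup>+n. h y (vscale d (1 / n) z) * indicator {0<..} n \<partial>lborel) \<partial>?\<Gamma>)"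
        by (rule GL.Fubini') measurable
      also have "\<dots> = L y"
        unfolding L_def
        by (rule nn_integral_cong, rule nn_integral_cong) (auto simp: h_def less_divide_eq mult.commute split: split_indicator)
      finally show ?thesis .
    qed
    also have "(\<integral>\<^sup>+n. (\<integral>\<^sup>+z. h y (vscale d (1 / n) z) \<partial>?\<Gamma>) * indicator {..1 / B} n \<partial>chi_law \<nu>) \<le> R y"
    proof -
      have "(\<integral>\<^sup>+z. h y (vscale d (1 / n) z) \<partial>?\<Gamma>) * indicator {..1 / B} n \<le>
        (\<integral>\<^sup>+z. ennreal ((f (vscale d (1 / n) z) - f y)\<^sup>2) * indicator {..1 / B} n \<partial>?\<Gamma>)" for n :: real
        by (subst nn_integral_multc[symmetric], measurable) (auto simp: h_def intro!: nn_integral_mono split: split_indicator)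
      then show ?thesis unfolding R_def by (intro nn_integral_mono)
    qed
    finally show ?thesis by (simp add: add_left_mono)
  qed
  have "v \<le> (\<integral>\<^sup>+y. ennreal c * L y + R y \<partial>?T)"
    by (rule order_trans[OF vW nn_integral_mono]) (simp add: split)
  also have "\<dots> = ennreal c * (\<integral>\<^sup>+y. L y \<partial>?T) + (\<integral>\<^sup>+y. R y \<partial>?T)"
    by (simp add: nn_integral_add nn_integral_cmult)
  also have "ennreal c * (\<integral>\<^sup>+y. L y \<partial>?T) \<le> ennreal (sqrt (2 * pi) * chi_const \<nu> * B powr (1 - \<nu>)) * dirichlet_form d (student d \<nu> 1) f"
  proof -
    have "ennreal c * (\<integral>\<^sup>+y. L y \<partial>?T) = ennreal (sqrt (2 * pi) * c) * (ennreal (1 / sqrt (2 * pi)) * (\<integral>\<^sup>+y. L y \<partial>?T))"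
      using c by (simp add: mult.assoc[symmetric] ennreal_mult''[symmetric])
    also have "\<dots> \<le> ennreal (sqrt (2 * pi) * c) * dirichlet_form d (student d \<nu> 1) f"
      using dirichlet_form_radial_lower_bound[OF d \<nu>(1) bddD(1)[OF f] r] by (intro mult_left_mono) (simp_all add: L_def)
    finally show ?thesis by (simp add: c_def mult.assoc)
  qed
  also have "(\<integral>\<^sup>+y. R y \<partial>?T) \<le> (\<integral>\<^sup>+n. (\<integral>\<^sup>+z. ennreal ((f (vscale d (1 / n) z))\<^sup>2) \<partial>?\<Gamma>) * indicator {..1 / B} n \<partial>chi_law \<nu>) +
     (v + 1) * emeasure (chi_law \<nu>) {..1 / B}"
  proof -
    \<comment> \<open>Expanding the square produces the cross term - 2 f x, as the mean of
      \<open>f\<close> is 1; it is dropped because \<open>f\<close> is nonnegative. So no factor 2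
      appears in front of the second moments.\<close>
    have in1: "(\<integral>\<^sup>+y. ennreal ((f x - f y)\<^sup>2) \<partial>?T) \<le> ennreal ((f x)\<^sup>2) + (v + 1)" if x: "x \<in> space (Rd d)" for x
    proof -
      define s where "s = (LINT x|?T. (f x)\<^sup>2)"
      have s0: "s \<ge> 0" unfolding s_def by (rule Bochner_Integration.integral_nonneg) simp
      have "v + 1 = (\<integral>\<^sup>+y. ennreal ((0 - f y)\<^sup>2) \<partial>?T)"
        unfolding v_def using second_moment_eq(1)[OF \<nu>(1) f mass] by simp
      also have "\<dots> = ennreal s" using nn_integral_square_diff[OF \<nu>(1) f mass, of 0] by (simp add: s_def)
      finally have s: "v + 1 = ennreal s" .
      have "(\<integral>\<^sup>+y. ennreal ((f x - f y)\<^sup>2) \<partial>?T) = ennreal ((f x)\<^sup>2 - 2 * f x + s)"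
        using nn_integral_square_diff[OF \<nu>(1) f mass] by (simp add: s_def)
      also have "\<dots> \<le> ennreal ((f x)\<^sup>2 + s)" using bddD(2)[OF f x] by (intro ennreal_leI) simp
      finally show ?thesis using s s0 by simp
    qed
    have "(\<integral>\<^sup>+y. R y \<partial>?T) = (\<integral>\<^sup>+n. (\<integral>\<^sup>+y. (\<integral>\<^sup>+z. ennreal ((f (vscale d (1 / n) z) - f y)\<^sup>2) * indicator {..1 / B} n \<partial>?\<Gamma>) \<partial>?T) \<partial>chi_law \<nu>)"
      unfolding R_def by (rule TC.Fubini') measurable
    also have "\<dots> = (\<integral>\<^sup>+n. (\<integral>\<^sup>+z. (\<integral>\<^sup>+y. ennreal ((f (vscale d (1 / n) z) - f y)\<^sup>2) * indicator {..1 / B} n \<partial>?T) \<partial>?\<Gamma>) \<partial>chi_law \<nu>)"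
      by (rule nn_integral_cong, rule GT.Fubini') measurable
    also have "\<dots> \<le> (\<integral>\<^sup>+n. (\<integral>\<^sup>+z. ennreal ((f (vscale d (1 / n) z))\<^sup>2) + (v + 1) \<partial>?\<Gamma>) * indicator {..1 / B} n \<partial>chi_law \<nu>)"
    proof (rule nn_integral_mono)
      fix n :: real
      have "(\<integral>\<^sup>+z. (\<integral>\<^sup>+y. ennreal ((f (vscale d (1 / n) z) - f y)\<^sup>2) * indicator {..1 / B} n \<partial>?T) \<partial>?\<Gamma>) \<le>
        (\<integral>\<^sup>+z. (ennreal ((f (vscale d (1 / n) z))\<^sup>2) + (v + 1)) * indicator {..1 / B} n \<partial>?\<Gamma>)"
        using in1 by (intro nn_integral_mono) (auto split: split_indicator)
      also have "\<dots> = (\<integral>\<^sup>+z. ennreal ((f (vscale d (1 / n) z))\<^sup>2) + (v + 1) \<partial>?\<Gamma>) * indicator {..1 / B} n"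
        by (rule nn_integral_multc) measurable
      finally show "(\<integral>\<^sup>+z. (\<integral>\<^sup>+y. ennreal ((f (vscale d (1 / n) z) - f y)\<^sup>2) * indicator {..1 / B} n \<partial>?T) \<partial>?\<Gamma>) \<le>
        (\<integral>\<^sup>+z. ennreal ((f (vscale d (1 / n) z))\<^sup>2) + (v + 1) \<partial>?\<Gamma>) * indicator {..1 / B} n" .
    qed
    also have "\<dots> = (\<integral>\<^sup>+n. (\<integral>\<^sup>+z. ennreal ((f (vscale d (1 / n) z))\<^sup>2) \<partial>?\<Gamma>) * indicator {..1 / B} n + (v + 1) * indicator {..1 / B} n \<partial>chi_law \<nu>)"
      by (rule nn_integral_cong) (subst nn_integral_add, auto simp: G.emeasure_space_1 distrib_right simp flip: space_std_gaussian)
    also have "\<dots> = (\<integral>\<^sup>+n. (\<integral>\<^sup>+z. ennreal ((f (vscale d (1 / n) z))\<^sup>2) \<partial>?\<Gamma>) * indicator {..1 / B} n \<partial>chi_law \<nu>) +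
     (v + 1) * emeasure (chi_law \<nu>) {..1 / B}"
      by (subst nn_integral_add) (auto simp: nn_integral_cmult)
    finally show ?thesis .
  qed
  finally show ?thesis unfolding v_def by (simp add: add_mono)
qed

section \<open>Iterates far from the origin\<close>

lemma powr_neg_half_square:
  assumes "u > 0"
  shows "(u\<^sup>2) powr (- (real d + 1) / 2) = 1 / u ^ (d + 1)"
proof -
  have "(u\<^sup>2) powr (- (real d + 1) / 2) = (u powr 2) powr (- (real d + 1) / 2)" using assms by simp
  also have "\<dots> = u powr (- real (d + 1))"
  proof -
    have "2 * (- (real d + 1) / 2) = - real (d + 1)" by simp
    then show ?thesis unfolding powr_powr by (simp only:)
  qed
  also have "\<dots> = 1 / u ^ (d + 1)" using assms by (simp only: powr_minus_divide powr_realpow)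
  finally show ?thesis .
qed

text \<open>Shifting by a fraction \<theta> = 1 / (8 d) of |y| changes the base of the kernel by
  factors between (1 - \<theta>)^2 and (1 + \<theta>)^2. Bernoulli's inequality keeps (1 -
  \<theta>)^(d + 1) above 3/4, and (1 + \<theta>) (1 - \<theta>) <= 1 then keeps (1 + \<theta>)^(d +
  1) below 4/3. A radius of order |y| would cost a factor exponential in d.\<close>

lemma student_near:
  assumes d: "d \<ge> 1" and \<eta>: "\<eta> > 0" and x: "8 * real d * nrm d x \<le> nrm d y"
  shows "student d 1 \<eta> (vsub d x y) \<le> 4 / 3 * student d 1 \<eta> y"
    and "3 / 4 * student d 1 \<eta> y \<le> student d 1 \<eta> (vsub d x y)"
proof -
  define \<theta> where "\<theta> = 1 / (8 * real d)"
  have d1: "real d \<ge> 1" using d by simp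
  have \<theta>: "0 < \<theta>" "\<theta> < 1" using d1 by (auto simp: \<theta>_def)
  have xt: "nrm d x \<le> \<theta> * nrm d y" using x d1 by (simp add: \<theta>_def field_simps)
  have y0: "nrm d y \<ge> 0" by (rule L2_set_nonneg)
  have "1 + real (d + 1) * (- \<theta>) \<le> (1 + - \<theta>) ^ (d + 1)" using \<theta> by (intro Bernoulli_inequality) auto
  moreover have "real (d + 1) * \<theta> \<le> 1 / 4" using d1 by (simp add: \<theta>_def field_simps)
  ultimately have p1: "3 / 4 \<le> (1 - \<theta>) ^ (d + 1)" by simp
  have p2: "(1 + \<theta>) ^ (d + 1) \<le> 4 / 3"
  proof -
    have "((1 + \<theta>) * (1 - \<theta>)) ^ (d + 1) \<le> 1"
    proof (rule power_le_one)
      have "(1 + \<theta>) * (1 - \<theta>) = 1 - \<theta>\<^sup>2" by (simp add: power2_eq_square algebra_simps)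
      then show "(1 + \<theta>) * (1 - \<theta>) \<le> 1" by simp
      show "0 \<le> (1 + \<theta>) * (1 - \<theta>)" using \<theta> by (intro mult_nonneg_nonneg) auto
    qed
    then have "(1 + \<theta>) ^ (d + 1) * (1 - \<theta>) ^ (d + 1) \<le> 1" by (simp only: power_mult_distrib)
    moreover have "(1 + \<theta>) ^ (d + 1) * (3 / 4) \<le> (1 + \<theta>) ^ (d + 1) * (1 - \<theta>) ^ (d + 1)"
      using p1 \<theta> by (intro mult_left_mono) auto
    ultimately show ?thesis by simp
  qed
  define Q where "Q = (nrm d y)\<^sup>2 + \<eta>\<^sup>2"
  define S where "S = (nrm d (vsub d x y))\<^sup>2 + \<eta>\<^sup>2"
  define C where "C = student_const d 1 * \<eta> powr 1"
  have C: "C \<ge> 0" using \<eta> student_const_pos[of 1 d] by (simp add: C_def)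
  have pos: "Q > 0" "S > 0" using \<eta> by (auto simp: Q_def S_def intro: add_nonneg_pos)
  have e: "vadd d y (vscale d (-1) x) = vsub d y x" by (auto simp: vadd_def vscale_def vsub_def)
  have n1: "(1 - \<theta>) * nrm d y \<le> nrm d (vsub d x y)"
    using nrm_triangle_lower[where d = d and x = y and y = "vscale d (-1) x"] xt
      nrm_vsub_commute[of d x y] by (simp add: e left_diff_distrib distrib_right)
  have n2: "nrm d (vsub d x y) \<le> (1 + \<theta>) * nrm d y"
    using nrm_triangle[where d = d and x = y and y = "vscale d (-1) x"] xt
      nrm_vsub_commute[of d x y] by (simp add: e left_diff_distrib distrib_right)
  have s1: "(1 - \<theta>)\<^sup>2 * Q \<le> S"
  proof -
    have "((1 - \<theta>) * nrm d y)\<^sup>2 \<le> (nrm d (vsub d x y))\<^sup>2" using n1 \<theta> y0 by (intro power_mono) auto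
    moreover have "(1 - \<theta>)\<^sup>2 * \<eta>\<^sup>2 \<le> 1 * \<eta>\<^sup>2" using \<theta> by (intro mult_right_mono power_le_one) auto
    ultimately show ?thesis by (simp add: Q_def S_def power_mult_distrib distrib_left)
  qed
  have s2: "S \<le> (1 + \<theta>)\<^sup>2 * Q"
  proof -
    have "(nrm d (vsub d x y))\<^sup>2 \<le> ((1 + \<theta>) * nrm d y)\<^sup>2" using n2 by (intro power_mono L2_set_nonneg) auto
    moreover have "1 * \<eta>\<^sup>2 \<le> (1 + \<theta>)\<^sup>2 * \<eta>\<^sup>2" using \<theta> by (intro mult_right_mono one_le_power) auto
    ultimately show ?thesis by (simp add: Q_def S_def power_mult_distrib distrib_left)
  qed
  let ?q = "- (real d + 1) / 2"
  have "S powr ?q \<le> ((1 - \<theta>)\<^sup>2 * Q) powr ?q" using s1 pos \<theta> by (intro powr_mono2') auto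
  also have "\<dots> = ((1 - \<theta>)\<^sup>2) powr ?q * Q powr ?q" by (rule powr_mult)
  also have "\<dots> \<le> 4 / 3 * Q powr ?q"
  proof (rule mult_right_mono)
    have "1 / (1 - \<theta>) ^ (d + 1) \<le> 1 / (3 / 4)" using p1 by (intro divide_left_mono) (auto intro: mult_pos_pos \<theta>)
    then show "((1 - \<theta>)\<^sup>2) powr ?q \<le> 4 / 3" using \<theta> by (subst powr_neg_half_square) auto
  qed simp
  finally have "C * S powr ?q \<le> C * (4 / 3 * Q powr ?q)" using C by (rule mult_left_mono)
  then show "student d 1 \<eta> (vsub d x y) \<le> 4 / 3 * student d 1 \<eta> y"
    by (simp add: student_def C_def S_def Q_def mult_ac)
  have "3 / 4 * Q powr ?q \<le> ((1 + \<theta>)\<^sup>2) powr ?q * Q powr ?q"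
  proof (rule mult_right_mono)
    have "1 / (4 / 3) \<le> 1 / (1 + \<theta>) ^ (d + 1)" using p2 \<theta> by (intro divide_left_mono) auto
    then show "3 / 4 \<le> ((1 + \<theta>)\<^sup>2) powr ?q" using \<theta> by (subst powr_neg_half_square) auto
  qed simp
  also have "\<dots> = ((1 + \<theta>)\<^sup>2 * Q) powr ?q" by (rule powr_mult[symmetric])
  also have "\<dots> \<le> S powr ?q" using s2 pos by (intro powr_mono2') auto
  finally have "C * (3 / 4 * Q powr ?q) \<le> C * S powr ?q" using C by (rule mult_left_mono)
  then show "3 / 4 * student d 1 \<eta> y \<le> student d 1 \<eta> (vsub d x y)"
    by (simp add: student_def C_def S_def Q_def mult_ac)
qed

lemma ennreal_cauchy_op_kernel:
  assumes t: "t > 0" and g: "bdd d M g" and y: "y \<in> space (Rd d)"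
  shows "ennreal (cauchy_op d t g y) = (\<integral>\<^sup>+x. ennreal (student d 1 t (vsub d x y)) * ennreal (g x) \<partial>Rd d)"
proof -
  note [measurable] = bddD(1)[OF g] y
  have "ennreal (cauchy_op d t g y) = (\<integral>\<^sup>+z. ennreal (student d 1 t z) * ennreal (g (vadd d y z)) \<partial>Rd d)"
    unfolding ennreal_cauchy_op[OF t g] cauchy_law_def by (subst nn_integral_density) auto
  also have "\<dots> = (\<integral>\<^sup>+z. (\<lambda>x. ennreal (student d 1 t (vsub d x y)) * ennreal (g x)) (vadd d y z) \<partial>Rd d)"
    by (rule nn_integral_cong) simp
  also have "\<dots> = (\<integral>\<^sup>+x. ennreal (student d 1 t (vsub d x y)) * ennreal (g x) \<partial>Rd d)"
    by (rule nn_integral_Rd_vadd) measurable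
  finally show ?thesis .
qed

text \<open>On \<open>A\<close> the kernel is within a factor 4/3 of its value p at the origin. The
  left-hand side is thus at most 4/3 p because \<open>f\<close> has mass one, and the right-hand
  integral is at least 3/8 p because \<open>A\<close> carries half of the target. The ratio 32/9 is
  rounded up to 4.\<close>

lemma cauchy_op_inner_le:
  assumes d: "d \<ge> 1" and \<eta>: "\<eta> > 0" and \<nu>: "\<nu> > 0" and f: "bdd d M f" and y: "y \<in> space (Rd d)"
    and mass: "(\<integral>\<^sup>+x. ennreal (f x) \<partial>target_law d \<nu>) = 1"
    and A: "A = {x\<in>space (Rd d). 8 * real d * nrm d x \<le> nrm d y}"
    and half: "emeasure (target_law d \<nu>) A \<ge> ennreal (1 / 2)"
  shows "cauchy_op d \<eta> (\<lambda>x. indicator A x * f x * student d \<nu> 1 x) y \<le>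
    4 * cauchy_op d \<eta> (\<lambda>x. indicator A x * student d \<nu> 1 x) y"
proof -
  have [measurable]: "A \<in> sets (Rd d)" unfolding A by measurable
  note [measurable] = bddD(1)[OF f] y
  define p where "p = student d 1 \<eta> y"
  have p: "p \<ge> 0" using \<eta> by (simp add: p_def)
  note b1 = bdd_mult[OF bdd_mult[OF bdd_indicator f] bdd_student[OF \<nu>], of A]
  note b2 = bdd_mult[OF bdd_indicator bdd_student[OF \<nu>], of A]
  have "ennreal (cauchy_op d \<eta> (\<lambda>x. indicator A x * f x * student d \<nu> 1 x) y) \<le>
    (\<integral>\<^sup>+x. ennreal (4 / 3 * p) * (ennreal (student d \<nu> 1 x) * ennreal (f x)) \<partial>Rd d)"
  proof (subst ennreal_cauchy_op_kernel[OF \<eta> b1 y], measurable, rule nn_integral_mono)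
    fix x assume x: "x \<in> space (Rd d)"
    have "ennreal (student d 1 \<eta> (vsub d x y)) * ennreal (f x * student d \<nu> 1 x) \<le> ennreal (4 / 3 * p) * ennreal (f x * student d \<nu> 1 x)" if "x \<in> A"
      using student_near(1)[OF d \<eta>, of x y] that by (intro mult_right_mono ennreal_leI) (auto simp: A p_def)
    then show "ennreal (student d 1 \<eta> (vsub d x y)) * ennreal (indicator A x * f x * student d \<nu> 1 x) \<le>
      ennreal (4 / 3 * p) * (ennreal (student d \<nu> 1 x) * ennreal (f x))"
      using bddD(2)[OF f x] \<nu> by (cases "x \<in> A") (auto simp: ennreal_mult' mult.commute)
  qed
  also have "\<dots> = ennreal (4 / 3 * p)"
    using mass \<nu> by (subst nn_integral_cmult) (auto simp: nn_integral_target_law)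
  finally have 1: "cauchy_op d \<eta> (\<lambda>x. indicator A x * f x * student d \<nu> 1 x) y \<le> 4 / 3 * p"
    using p by (subst (asm) ennreal_le_iff) auto
  have "ennreal (3 / 4 * p) * ennreal (1 / 2) \<le> ennreal (3 / 4 * p) * emeasure (target_law d \<nu>) A"
    by (intro mult_left_mono half) auto
  also have "\<dots> = ennreal (3 / 4 * p) * (\<integral>\<^sup>+x. ennreal (student d \<nu> 1 x) * indicator A x \<partial>Rd d)"
    unfolding density_law_def by (subst emeasure_density) auto
  also have "\<dots> = (\<integral>\<^sup>+x. ennreal (3 / 4 * p) * (ennreal (student d \<nu> 1 x) * indicator A x) \<partial>Rd d)"
    by (rule nn_integral_cmult[symmetric]) measurable
  also have "\<dots> \<le> ennreal (cauchy_op d \<eta> (\<lambda>x. indicator A x * student d \<nu> 1 x) y)"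
  proof (subst ennreal_cauchy_op_kernel[OF \<eta> b2 y], measurable, rule nn_integral_mono)
    fix x assume x: "x \<in> space (Rd d)"
    have "ennreal (3 / 4 * p) * ennreal (student d \<nu> 1 x) \<le> ennreal (student d 1 \<eta> (vsub d x y)) * ennreal (student d \<nu> 1 x)" if "x \<in> A"
      using student_near(2)[OF d \<eta>, of x y] that by (intro mult_right_mono ennreal_leI) (auto simp: A p_def)
    then show "ennreal (3 / 4 * p) * (ennreal (student d \<nu> 1 x) * indicator A x) \<le>
      ennreal (student d 1 \<eta> (vsub d x y)) * ennreal (indicator A x * student d \<nu> 1 x)"
      by (cases "x \<in> A") auto
  qed
  finally have "ennreal (3 / 4 * p * (1 / 2)) \<le> ennreal (cauchy_op d \<eta> (\<lambda>x. indicator A x * student d \<nu> 1 x) y)"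
    using p by (subst ennreal_mult) auto
  then have 2: "3 / 4 * p * (1 / 2) \<le> cauchy_op d \<eta> (\<lambda>x. indicator A x * student d \<nu> 1 x) y"
    using cauchy_op_bounds(1)[OF \<eta> b2] by (subst (asm) ennreal_le_iff) auto
  show ?thesis using 1 2 p by linarith
qed

section \<open>Radial cutoff and jump sizes at radius R\<close>

definition cutoff :: "nat \<Rightarrow> real \<Rightarrow> (nat \<Rightarrow> real) \<Rightarrow> real" where
  "cutoff d R x = max 0 (min 1 (2 - nrm d x / R))"

lemma bdd_cutoff: "bdd d 1 (cutoff d R)"
  unfolding bdd_def cutoff_def[abs_def] by auto

definition jump :: "nat \<Rightarrow> real \<Rightarrow> (nat \<Rightarrow> real) \<Rightarrow> real" where
  "jump d R z = min 1 (nrm d z / R)"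

lemma bdd_jump: "R > 0 \<Longrightarrow> bdd d 1 (jump d R)"
  unfolding bdd_def jump_def[abs_def] by (auto simp: L2_set_nonneg)

text \<open>\<open>cutoff\<close> descends linearly from 1 at radius R to 0 at radius 2 R, so a jump
  changes it by at most its length in units of R. An indicator in its place would charge a full unit
  for short moves across the sphere.\<close>

lemma cutoff_vadd_le:
  assumes R: "R > 0"
  shows "cutoff d R (vadd d y z) \<le> cutoff d R y + jump d R z"
proof -
  have "nrm d y - nrm d z \<le> nrm d (vadd d y z)" by (rule nrm_triangle_lower)
  then have "nrm d y / R - nrm d z / R \<le> nrm d (vadd d y z) / R"
    using R by (simp add: diff_divide_distrib[symmetric] divide_right_mono)
  moreover have "nrm d z / R \<ge> 0" using R by (simp add: L2_set_nonneg)
  ultimately show ?thesis unfolding cutoff_def jump_def by linarith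
qed

definition jump_mean :: "nat \<Rightarrow> real \<Rightarrow> real \<Rightarrow> real" where
  "jump_mean d \<eta> R = (LINT z|cauchy_law d \<eta>. jump d R z)"

text \<open>
  For a far point \<open>y\<close>, the conditional mean of the length of the jump to the next point, in units
  of \<open>R\<close> and capped at 1, on the event that the next point is not close to the origin.
\<close>

definition far_jump :: "nat \<Rightarrow> real \<Rightarrow> real \<Rightarrow> real \<Rightarrow> real \<Rightarrow> (nat \<Rightarrow> real) \<Rightarrow> real" where
  "far_jump d \<nu> \<eta> R \<rho> y = (if nrm d y \<ge> R
     then (LINT z|cauchy_law d \<eta>. jump d R z * (if nrm d (vadd d y z) \<ge> \<rho> then student d \<nu> 1 (vadd d y z) else 0)) /
       cauchy_op d \<eta> (student d \<nu> 1) y else 0)"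

lemma integrable_far_jump:
  assumes \<eta>: "\<eta> > 0" and \<nu>: "\<nu> > 0" and R: "R > 0"
  shows "integrable (cauchy_law d \<eta>) (\<lambda>z. jump d R z * (if nrm d (vadd d y z) \<ge> \<rho> then student d \<nu> 1 (vadd d y z) else 0))"
proof -
  interpret C: prob_space "cauchy_law d \<eta>" by (rule prob_space_cauchy_law[OF \<eta>])
  note jb = bdd_jump[OF R, of d]
  note [measurable] = bddD(1)[OF jb]
  define g where "g z = (if nrm d (vadd d y z) \<ge> \<rho> then student d \<nu> 1 (vadd d y z) else 0)" for z
  have g: "0 \<le> g z" "g z \<le> student_const d \<nu>" for z
    using \<nu> student_le_const[OF \<nu>] student_const_pos[OF \<nu>, of d] by (auto simp: g_def)
  have [measurable]: "g \<in> borel_measurable (Rd d)" unfolding g_def[abs_def] by measurable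
  have "integrable (cauchy_law d \<eta>) (\<lambda>z. jump d R z * g z)"
  proof (rule C.integrable_const_bound[where B = "1 * student_const d \<nu>"])
    have "\<bar>jump d R z * g z\<bar> \<le> 1 * student_const d \<nu>" if "z \<in> space (Rd d)" for z
      unfolding abs_mult using bddD(2,3)[OF jb that] g by (intro mult_mono) auto
    then show "AE z in cauchy_law d \<eta>. norm (jump d R z * g z) \<le> 1 * student_const d \<nu>"
      by (intro AE_I2) simp
  qed measurable
  then show ?thesis by (simp add: g_def)
qed

text \<open>The denominator of \<open>far_jump\<close> is the stationary density of y and cancels.
  Integrating y first at a fixed jump z and translating decouples the two: the jump contributes its
  mean capped length, the point the target mass beyond \<rho>.\<close>

lemma far_jump_bounds:
  assumes \<eta>: "\<eta> > 0" and \<nu>: "\<nu> > 0" and R: "R > 0"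
  shows "bdd d 1 (far_jump d \<nu> \<eta> R \<rho>)"
    and "(\<integral>\<^sup>+y. ennreal (far_jump d \<nu> \<eta> R \<rho> y * cauchy_op d \<eta> (student d \<nu> 1) y) \<partial>Rd d) \<le>
      ennreal (jump_mean d \<eta> R) * emeasure (target_law d \<nu>) {x\<in>space (Rd d). nrm d x \<ge> \<rho>}"
proof -
  interpret C: prob_space "cauchy_law d \<eta>" by (rule prob_space_cauchy_law[OF \<eta>])
  interpret RdS: sigma_finite_measure "Rd d" by (rule sigma_finite_Rd)
  interpret RC: pair_sigma_finite "cauchy_law d \<eta>" "Rd d" ..
  note p = cauchy_op_student_pos[OF \<eta> \<nu>, of d]
  note jb = bdd_jump[OF R, of d]
  note [measurable] = bddD(1)[OF jb] bddD(1)[OF bdd_cauchy_op[OF \<eta> bdd_student[OF \<nu>]]]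
  define g where "g x = (if nrm d x \<ge> \<rho> then student d \<nu> 1 x else 0)" for x
  have gm [measurable]: "g \<in> borel_measurable (Rd d)" unfolding g_def[abs_def] by measurable
  have g: "0 \<le> g x" "g x \<le> student d \<nu> 1 x" for x using \<nu> by (auto simp: g_def)
  define I where "I y = (LINT z|cauchy_law d \<eta>. jump d R z * g (vadd d y z))" for y
  have Im [measurable]: "I \<in> borel_measurable (Rd d)" unfolding I_def by measurable
  have int: "integrable (cauchy_law d \<eta>) (\<lambda>z. jump d R z * g (vadd d y z))" for y
    unfolding g_def by (rule integrable_far_jump[OF \<eta> \<nu> R])
  have I0: "I y \<ge> 0" for y unfolding I_def using bddD(2)[OF jb] g by (intro integral_nonneg_AE AE_I2) auto
  have "I y \<le> cauchy_op d \<eta> (student d \<nu> 1) y" for y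
    unfolding I_def cauchy_op_def
  proof (rule integral_mono[OF int integrable_bdd_shift[OF \<eta> bdd_student[OF \<nu>]]])
    fix z assume "z \<in> space (cauchy_law d \<eta>)"
    then show "jump d R z * g (vadd d y z) \<le> student d \<nu> 1 (vadd d y z)"
      using mult_mono[of "jump d R z" 1 "g (vadd d y z)" "student d \<nu> 1 (vadd d y z)"] bddD(2,3)[OF jb] g \<nu> by simp
  qed
  moreover have eq: "far_jump d \<nu> \<eta> R \<rho> y = (if nrm d y \<ge> R then I y / cauchy_op d \<eta> (student d \<nu> 1) y else 0)" for y
    by (simp add: far_jump_def I_def g_def)
  ultimately show "bdd d 1 (far_jump d \<nu> \<eta> R \<rho>)"
    unfolding bdd_def using p I0 by (auto simp: eq[abs_def] less_imp_le)
  have "(\<integral>\<^sup>+y. ennreal (far_jump d \<nu> \<eta> R \<rho> y * cauchy_op d \<eta> (student d \<nu> 1) y) \<partial>Rd d) \<le> (\<integral>\<^sup>+y. ennreal (I y) \<partial>Rd d)"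
    using p I0 by (intro nn_integral_mono ennreal_leI) (auto simp: eq less_imp_neq[symmetric])
  also have "\<dots> = (\<integral>\<^sup>+y. (\<integral>\<^sup>+z. ennreal (jump d R z) * ennreal (g (vadd d y z)) \<partial>cauchy_law d \<eta>) \<partial>Rd d)"
  proof (rule nn_integral_cong)
    fix y
    have "ennreal (I y) = (\<integral>\<^sup>+z. ennreal (jump d R z * g (vadd d y z)) \<partial>cauchy_law d \<eta>)"
      unfolding I_def using bddD(2)[OF jb] g by (intro nn_integral_eq_integral[symmetric] int AE_I2) auto
    then show "ennreal (I y) = (\<integral>\<^sup>+z. ennreal (jump d R z) * ennreal (g (vadd d y z)) \<partial>cauchy_law d \<eta>)"
      using g by (simp add: ennreal_mult'')
  qed
  also have "\<dots> = (\<integral>\<^sup>+z. (\<integral>\<^sup>+y. ennreal (jump d R z) * ennreal (g (vadd d y z)) \<partial>Rd d) \<partial>cauchy_law d \<eta>)"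
    by (rule RC.Fubini') measurable
  also have "\<dots> = (\<integral>\<^sup>+z. ennreal (jump d R z) * (\<integral>\<^sup>+x. ennreal (g x) \<partial>Rd d) \<partial>cauchy_law d \<eta>)"
  proof (rule nn_integral_cong)
    fix z assume "z \<in> space (cauchy_law d \<eta>)"
    then have [measurable]: "z \<in> space (Rd d)" by simp
    have "(\<integral>\<^sup>+y. ennreal (jump d R z) * ennreal (g (vadd d y z)) \<partial>Rd d) = ennreal (jump d R z) * (\<integral>\<^sup>+y. ennreal (g (vadd d z y)) \<partial>Rd d)"
      by (subst nn_integral_cmult) (auto simp: vadd_commute[of d _ z])
    also have "(\<integral>\<^sup>+y. ennreal (g (vadd d z y)) \<partial>Rd d) = (\<integral>\<^sup>+x. ennreal (g x) \<partial>Rd d)"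
      by (rule nn_integral_Rd_vadd[where \<psi> = "\<lambda>x. ennreal (g x)"]) measurable
    finally show "(\<integral>\<^sup>+y. ennreal (jump d R z) * ennreal (g (vadd d y z)) \<partial>Rd d) = ennreal (jump d R z) * (\<integral>\<^sup>+x. ennreal (g x) \<partial>Rd d)" .
  qed
  also have "\<dots> = (\<integral>\<^sup>+z. ennreal (jump d R z) \<partial>cauchy_law d \<eta>) * (\<integral>\<^sup>+x. ennreal (g x) \<partial>Rd d)"
    by (rule nn_integral_multc) measurable
  also have "(\<integral>\<^sup>+z. ennreal (jump d R z) \<partial>cauchy_law d \<eta>) = ennreal (jump_mean d \<eta> R)"
    unfolding jump_mean_def using bddD(2,3)[OF jb]
    by (intro nn_integral_eq_integral C.integrable_const_bound[where B = 1]) (auto intro!: AE_I2)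
  also have "(\<integral>\<^sup>+x. ennreal (g x) \<partial>Rd d) = emeasure (target_law d \<nu>) {x\<in>space (Rd d). nrm d x \<ge> \<rho>}"
    unfolding density_law_def by (subst emeasure_density) (auto simp: g_def intro!: nn_integral_cong split: split_indicator)
  finally show "(\<integral>\<^sup>+y. ennreal (far_jump d \<nu> \<eta> R \<rho> y * cauchy_op d \<eta> (student d \<nu> 1) y) \<partial>Rd d) \<le>
      ennreal (jump_mean d \<eta> R) * emeasure (target_law d \<nu>) {x\<in>space (Rd d). nrm d x \<ge> \<rho>}" .
qed

lemma cutoff_eq_1: "R > 0 \<Longrightarrow> nrm d y \<le> R \<Longrightarrow> cutoff d R y = 1"
  by (simp add: cutoff_def min_def max_def divide_le_eq_1)

text \<open>For |y| < R the cutoff is 1 and the trivial bound M is enough. Otherwise the conditional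
  law of x given y is split: near the origin the mean of \<open>f\<close> is controlled by
  \<open>cauchy_op_inner_le\<close>, and elsewhere by the assumed bound, with the cutoff at x
  compared with that at y. Both parts come with the same constant 4, so it does not grow under
  iteration.\<close>

lemma back_op_far_bound:
  assumes d: "d \<ge> 1" and \<eta>: "\<eta> > 0" and \<nu>: "\<nu> > 0" and R: "R > 0" and f: "bdd d M f" and b: "bdd d N b"
    and mass: "(\<integral>\<^sup>+x. ennreal (f x) \<partial>target_law d \<nu>) = 1"
    and half: "emeasure (target_law d \<nu>) {x\<in>space (Rd d). 8 * real d * nrm d x \<le> R} \<ge> ennreal (1 / 2)"
    and le: "\<And>x. x \<in> space (Rd d) \<Longrightarrow> f x \<le> 4 + M * cutoff d R x + M * b x"
    and y: "y \<in> space (Rd d)"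
  shows "back_op d \<nu> \<eta> f y \<le>
    4 + M * cutoff d R y + M * back_op d \<nu> \<eta> b y + M * far_jump d \<nu> \<eta> R (R / (8 * real d)) y"
proof -
  have M: "M \<ge> 0" by (rule bdd_M_nonneg[OF f])
  note fb = back_op_bdd[OF \<eta> \<nu> f] and bb = back_op_bdd[OF \<eta> \<nu> b]
  note jb = far_jump_bounds(1)[OF \<eta> \<nu> R, of d "R / (8 * real d)"]
  show ?thesis
  proof (cases "nrm d y \<ge> R")
    case False
    have "back_op d \<nu> \<eta> f y \<le> M" by (rule bddD(3)[OF fb y])
    moreover have "M * back_op d \<nu> \<eta> b y \<ge> 0" "M * far_jump d \<nu> \<eta> R (R / (8 * real d)) y \<ge> 0"
      using M bddD(2)[OF bb y] bddD(2)[OF jb y] by auto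
    ultimately show ?thesis using cutoff_eq_1[OF R, of y d] False by simp
  next
    case True
    define A where "A = {x\<in>space (Rd d). 8 * real d * nrm d x \<le> nrm d y}"
    have [measurable]: "A \<in> sets (Rd d)" unfolding A_def by measurable
    define P where "P = cauchy_op d \<eta> (student d \<nu> 1) y"
    have P: "P > 0" unfolding P_def by (rule cauchy_op_student_pos[OF \<eta> \<nu>])
    define I1 where "I1 = cauchy_op d \<eta> (\<lambda>x. indicator A x * f x * student d \<nu> 1 x) y"
    define Ia where "Ia = cauchy_op d \<eta> (\<lambda>x. indicator A x * student d \<nu> 1 x) y"
    define Ib where "Ib = cauchy_op d \<eta> (\<lambda>x. b x * student d \<nu> 1 x) y"
    define G where "G z = jump d R z * (if nrm d (vadd d y z) \<ge> R / (8 * real d) then student d \<nu> 1 (vadd d y z) else 0)" for z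
    define Ij where "Ij = (LINT z|cauchy_law d \<eta>. G z)"
    note sb = bdd_student[OF \<nu>, of d]
    note i0 = integrable_bdd_shift[OF \<eta> sb, of y]
    note i1 = integrable_bdd_shift[OF \<eta> bdd_mult[OF bdd_mult[OF bdd_indicator f] sb], of A y]
    note ia = integrable_bdd_shift[OF \<eta> bdd_mult[OF bdd_indicator sb], of A y]
    note ib = integrable_bdd_shift[OF \<eta> bdd_mult[OF b sb], of y]
    note ie = integrable_bdd_shift[OF \<eta> bdd_mult[OF f sb], of y]
    note ij = integrable_far_jump[OF \<eta> \<nu> R, of d "R / (8 * real d)" y, folded G_def]
    have half': "emeasure (target_law d \<nu>) A \<ge> ennreal (1 / 2)"
      using True by (intro order_trans[OF half emeasure_mono]) (auto simp: A_def)
    have I1: "I1 \<le> 4 * Ia"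
      unfolding I1_def Ia_def by (rule cauchy_op_inner_le[OF d \<eta> \<nu> f y mass A_def half'])
    have "cauchy_op d \<eta> (\<lambda>x. f x * student d \<nu> 1 x) y \<le> I1 + 4 * (P - Ia) + M * cutoff d R y * P + M * Ib + M * Ij"
    proof -
      have "cauchy_op d \<eta> (\<lambda>x. f x * student d \<nu> 1 x) y \<le> (LINT z|cauchy_law d \<eta>.
        indicator A (vadd d y z) * f (vadd d y z) * student d \<nu> 1 (vadd d y z) +
        4 * (student d \<nu> 1 (vadd d y z) - indicator A (vadd d y z) * student d \<nu> 1 (vadd d y z)) +
        M * cutoff d R y * student d \<nu> 1 (vadd d y z) + M * (b (vadd d y z) * student d \<nu> 1 (vadd d y z)) + M * G z)"
        unfolding cauchy_op_def
      proof (rule integral_mono)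
        fix z assume "z \<in> space (cauchy_law d \<eta>)"
        then have z: "z \<in> space (Rd d)" by simp
        define x where "x = vadd d y z"
        define s where "s = student d \<nu> 1 x"
        have x: "x \<in> space (Rd d)" by (simp add: x_def)
        have s: "s \<ge> 0" using \<nu> by (simp add: s_def)
        have j0: "jump d R z \<ge> 0" using bddD(2)[OF bdd_jump[OF R] z] .
        have c0: "cutoff d R y \<ge> 0" using bddD(2)[OF bdd_cutoff y] .
        have "f x * s \<le> indicator A x * f x * s + 4 * (s - indicator A x * s) + M * cutoff d R y * s + M * (b x * s) + M * G z"
        proof (cases "x \<in> A")
          case True
          have "M * cutoff d R y * s \<ge> 0" "M * (b x * s) \<ge> 0" "M * G z \<ge> 0"
            using M s c0 j0 bddD(2)[OF b x] \<nu> by (auto simp: G_def)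
          then show ?thesis using True by simp
        next
          case False
          \<comment> \<open>Outside \<open>A\<close> the norm of x exceeds |y| / (8 d), hence R / (8
            d), so the jump is one of those counted by \<open>far_jump\<close>.\<close>
          have "8 * real d * nrm d x > R" using False x True by (simp add: A_def)
          then have "nrm d x \<ge> R / (8 * real d)" using d by (simp add: divide_le_eq mult.commute)
          then have G: "G z = jump d R z * s" by (simp add: G_def x_def s_def)
          have "f x \<le> 4 + M * (cutoff d R y + jump d R z) + M * b x"
            using le[OF x] mult_left_mono[OF cutoff_vadd_le[OF R, of d y z] M] by (simp add: x_def)
          then have "f x * s \<le> (4 + M * (cutoff d R y + jump d R z) + M * b x) * s" using s by (rule mult_right_mono)
          then show ?thesis using False by (simp add: G algebra_simps)
        qed
        then show "f (vadd d y z) * student d \<nu> 1 (vadd d y z) \<le> indicator A (vadd d y z) * f (vadd d y z) * student d \<nu> 1 (vadd d y z) +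
          4 * (student d \<nu> 1 (vadd d y z) - indicator A (vadd d y z) * student d \<nu> 1 (vadd d y z)) +
          M * cutoff d R y * student d \<nu> 1 (vadd d y z) + M * (b (vadd d y z) * student d \<nu> 1 (vadd d y z)) + M * G z"
          unfolding x_def s_def .
      qed (use i0 i1 ia ib ie ij in simp_all)
      also have "\<dots> = I1 + 4 * (P - Ia) + M * cutoff d R y * P + M * Ib + M * Ij"
        using i0 i1 ia ib ie ij by (simp add: I1_def Ia_def P_def Ib_def Ij_def cauchy_op_def)
      finally show ?thesis .
    qed
    also have "\<dots> \<le> (4 + M * cutoff d R y + M * (Ib / P) + M * (Ij / P)) * P"
      using I1 P by (simp add: algebra_simps)
    finally have "cauchy_op d \<eta> (\<lambda>x. f x * student d \<nu> 1 x) y / P \<le> 4 + M * cutoff d R y + M * (Ib / P) + M * (Ij / P)"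
      using P by (simp add: divide_le_eq)
    then show ?thesis using True
      by (simp add: back_op_def far_jump_def P_def Ib_def Ij_def G_def)
  qed
qed

text \<open>
  Far from the origin the iterates exceed the constant 4 by at most a multiple of this function:
  the mass of the starting density that is already far, plus the accumulated jumps at scale \<open>R\<close>.
\<close>

primrec excess :: "nat \<Rightarrow> real \<Rightarrow> real \<Rightarrow> real \<Rightarrow> real \<Rightarrow> nat \<Rightarrow> (nat \<Rightarrow> real) \<Rightarrow> real" where
  "excess d \<nu> \<eta> R M 0 = (\<lambda>x. indicator {x\<in>space (Rd d). nrm d x \<ge> R} x * (1 / M * initial_density d \<nu> x))"
| "excess d \<nu> \<eta> R M (Suc k) = (\<lambda>x. step_op d \<nu> \<eta> (excess d \<nu> \<eta> R M k) x +
     (cauchy_op d \<eta> (far_jump d \<nu> \<eta> R (R / (8 * real d))) x +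
      indicator {x\<in>space (Rd d). nrm d x \<ge> R} x * jump_mean d \<eta> R))"

lemma bdd_add: "bdd d M f \<Longrightarrow> bdd d N g \<Longrightarrow> bdd d (M + N) (\<lambda>x. f x + g x)"
  unfolding bdd_def by (auto intro: add_mono)

lemma bdd_const: "0 \<le> c \<Longrightarrow> bdd d c (\<lambda>_. c)"
  by (simp add: bdd_def)

lemma jump_mean_bounds:
  assumes \<eta>: "\<eta> > 0" and R: "R > 0"
  shows "0 \<le> jump_mean d \<eta> R" "jump_mean d \<eta> R \<le> 1"
    and "ennreal (jump_mean d \<eta> R) = (\<integral>\<^sup>+z. ennreal (jump d R z) \<partial>cauchy_law d \<eta>)"
    and "integrable (cauchy_law d \<eta>) (jump d R)"
proof -
  interpret C: prob_space "cauchy_law d \<eta>" by (rule prob_space_cauchy_law[OF \<eta>])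
  note jb = bdd_jump[OF R, of d]
  note [measurable] = bddD(1)[OF jb]
  show i: "integrable (cauchy_law d \<eta>) (jump d R)"
    using bddD(2,3)[OF jb] by (intro C.integrable_const_bound[where B = 1] AE_I2) auto
  show "0 \<le> jump_mean d \<eta> R" unfolding jump_mean_def using bddD(2)[OF jb] by (intro integral_nonneg_AE AE_I2) auto
  show "jump_mean d \<eta> R \<le> 1"
    unfolding jump_mean_def using bddD(3)[OF jb] by (intro C.integral_le_const i AE_I2) auto
  show "ennreal (jump_mean d \<eta> R) = (\<integral>\<^sup>+z. ennreal (jump d R z) \<partial>cauchy_law d \<eta>)"
    unfolding jump_mean_def using bddD(2)[OF jb] by (intro nn_integral_eq_integral[symmetric] i AE_I2) auto
qed

lemma bdd_far_indicator:
  assumes "bdd d M g"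
  shows "bdd d M (\<lambda>x. indicator {x\<in>space (Rd d). nrm d x \<ge> R} x * g x)"
proof -
  have "{x\<in>space (Rd d). nrm d x \<ge> R} \<in> sets (Rd d)" by measurable
  from bdd_mult[OF bdd_indicator[OF this] assms] show ?thesis by simp
qed

lemma excess_bdd:
  assumes \<eta>: "\<eta> > 0" and \<nu>: "\<nu> > 0" and R: "R > 0" and M: "M > 0" and b: "bdd d M (initial_density d \<nu>)"
  shows "bdd d (1 + 2 * real k) (excess d \<nu> \<eta> R M k)"
proof (induction k)
  case 0
  have "bdd d 1 (\<lambda>x. 1 / M * initial_density d \<nu> x)" using bdd_cmult[OF b, of "1 / M"] M by simp
  from bdd_far_indicator[OF this] show ?case by simp
next
  case (Suc k)
  note j = jump_mean_bounds[OF \<eta> R, of d]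
  have c: "bdd d 1 (\<lambda>_. jump_mean d \<eta> R)" using j by (simp add: bdd_def)
  have "bdd d ((1 + 2 * real k) + (1 + 1)) (excess d \<nu> \<eta> R M (Suc k))"
    unfolding excess.simps
    by (intro bdd_add step_op_bdd[OF \<eta> \<nu> Suc] bdd_cauchy_op[OF \<eta> far_jump_bounds(1)[OF \<eta> \<nu> R]] bdd_far_indicator c)
  then show ?case by (simp add: algebra_simps)
qed

text \<open>Induction over the iterations: \<open>back_op_far_bound\<close> handles the backward
  move. The forward move averages the bound, which enlarges the cutoff by at most the mean jump;
  this new term and the \<open>far_jump\<close> term make up the recursion of
  \<open>excess\<close>.\<close>

lemma iterate_far_bound:
  assumes d: "d \<ge> 1" and \<eta>: "\<eta> > 0" and \<nu>: "\<nu> > 0" and R: "R > 0" and M: "M > 0" and b: "bdd d M (initial_density d \<nu>)"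
    and half: "emeasure (target_law d \<nu>) {x\<in>space (Rd d). 8 * real d * nrm d x \<le> R} \<ge> ennreal (1 / 2)"
    and x: "x \<in> space (Rd d)"
  shows "iterate d \<nu> \<eta> k x \<le> 4 + M * cutoff d R x + M * excess d \<nu> \<eta> R M k x"
  using x
proof (induction k arbitrary: x)
  case 0
  show ?case
  proof (cases "nrm d x \<ge> R")
    case True
    have "M * cutoff d R x \<ge> 0" using M bddD(2)[OF bdd_cutoff 0] by simp
    then show ?thesis using True M 0 by (simp add: iterate_0)
  next
    case False
    then show ?thesis using bddD(3)[OF b 0] cutoff_eq_1[OF R, of x d] by (simp add: iterate_0)
  qed
next
  case (Suc k)
  define e where "e = excess d \<nu> \<eta> R M k"
  define J where "J = far_jump d \<nu> \<eta> R (R / (8 * real d))"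
  have eb: "bdd d (1 + 2 * real k) e" unfolding e_def by (rule excess_bdd[OF \<eta> \<nu> R M b])
  have Jb: "bdd d 1 J" unfolding J_def by (rule far_jump_bounds(1)[OF \<eta> \<nu> R])
  note fb = iterate_bdd[OF \<eta> \<nu> b, of k]
  note b2 = bdd_cmult[OF bdd_cutoff less_imp_le[OF M], of d R]
    and b3 = bdd_cmult[OF back_op_bdd[OF \<eta> \<nu> eb] less_imp_le[OF M]] and b4 = bdd_cmult[OF Jb less_imp_le[OF M]]
  have four: "bdd d 4 (\<lambda>_. 4)" by (rule bdd_const) simp
  have "iterate d \<nu> \<eta> (Suc k) x = cauchy_op d \<eta> (back_op d \<nu> \<eta> (iterate d \<nu> \<eta> k)) x"
    by (simp add: iterate_Suc step_op_def)
  also have "\<dots> \<le> cauchy_op d \<eta> (\<lambda>y. 4 + M * cutoff d R y + M * back_op d \<nu> \<eta> e y + M * J y) x"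
  proof (rule cauchy_op_mono[OF \<eta> back_op_bdd[OF \<eta> \<nu> fb] bdd_add[OF bdd_add[OF bdd_add[OF four b2] b3] b4]])
    fix y assume y: "y \<in> space (Rd d)"
    show "back_op d \<nu> \<eta> (iterate d \<nu> \<eta> k) y \<le> 4 + M * cutoff d R y + M * back_op d \<nu> \<eta> e y + M * J y"
      unfolding J_def
      by (rule back_op_far_bound[OF d \<eta> \<nu> R fb eb iterate_mass[OF \<eta> \<nu> b] half _ y]) (use Suc.IH in \<open>simp add: e_def\<close>)
  qed
  also have "\<dots> = 4 + M * cauchy_op d \<eta> (cutoff d R) x + M * step_op d \<nu> \<eta> e x + M * cauchy_op d \<eta> J x"
    unfolding cauchy_op_add[OF \<eta> bdd_add[OF bdd_add[OF four b2] b3] b4] cauchy_op_add[OF \<eta> bdd_add[OF four b2] b3]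
      cauchy_op_add[OF \<eta> four b2] cauchy_op_cmult step_op_def
    using cauchy_op_cmult[of d \<eta> 4 "\<lambda>_. 1" x] cauchy_op_1[OF \<eta>, of d x] by simp
  also have "\<dots> \<le> 4 + M * cutoff d R x + M * excess d \<nu> \<eta> R M (Suc k) x"
  proof -
    \<comment> \<open>Within radius R the cutoff already has its maximal value 1, so the mean jump
      is charged only beyond R.\<close>
    have "cauchy_op d \<eta> (cutoff d R) x \<le> cutoff d R x + indicator {x\<in>space (Rd d). nrm d x \<ge> R} x * jump_mean d \<eta> R"
    proof (cases "nrm d x \<ge> R")
      case True
      interpret C: prob_space "cauchy_law d \<eta>" by (rule prob_space_cauchy_law[OF \<eta>])
      have "cauchy_op d \<eta> (cutoff d R) x \<le> (LINT z|cauchy_law d \<eta>. cutoff d R x + jump d R z)"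
        unfolding cauchy_op_def using jump_mean_bounds(4)[OF \<eta> R]
        by (intro integral_mono integrable_bdd_shift[OF \<eta> bdd_cutoff] cutoff_vadd_le[OF R]) auto
      also have "\<dots> = cutoff d R x + jump_mean d \<eta> R"
        using jump_mean_bounds(4)[OF \<eta> R] C.prob_space by (simp add: jump_mean_def)
      finally show ?thesis using True Suc.prems by simp
    next
      case False
      then show ?thesis using cauchy_op_bounds(2)[OF \<eta> bdd_cutoff] cutoff_eq_1[OF R, of x d] by simp
    qed
    from mult_left_mono[OF this less_imp_le[OF M]] show ?thesis by (simp add: e_def J_def distrib_left)
  qed
  finally show ?case .
qed

text \<open>\<open>step_op\<close> preserves the mean under the target, so the old excess is carried
  along unchanged. Each iteration adds the mean jump times the tail of the target twice, for the
  backward and for the forward move, hence growth linear in k.\<close>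

lemma excess_mass:
  assumes d: "d \<ge> 1" and \<eta>: "\<eta> > 0" and \<nu>: "\<nu> > 0" and R: "R > 0" and M: "M > 0" and b: "bdd d M (initial_density d \<nu>)"
  shows "(\<integral>\<^sup>+x. ennreal (excess d \<nu> \<eta> R M k x) \<partial>target_law d \<nu>) \<le>
    ennreal (1 / M) * emeasure (std_gaussian d) {z\<in>space (Rd d). nrm d z \<ge> R} +
    of_nat k * (ennreal (2 * jump_mean d \<eta> R) * emeasure (target_law d \<nu>) {x\<in>space (Rd d). nrm d x \<ge> R / (8 * real d)})"
proof (induction k)
  case 0
  have [measurable]: "initial_density d \<nu> \<in> borel_measurable (Rd d)" by (rule bddD(1)[OF b])
  have "(\<integral>\<^sup>+x. ennreal (excess d \<nu> \<eta> R M 0 x) \<partial>target_law d \<nu>) =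
    (\<integral>\<^sup>+x. ennreal (1 / M) * (ennreal (gden d 1 x) * indicator {z\<in>space (Rd d). nrm d z \<ge> R} x) \<partial>Rd d)"
  proof (subst nn_integral_target_law[OF \<nu>], simp, rule nn_integral_cong)
    fix x
    have "student d \<nu> 1 x * (1 / M * initial_density d \<nu> x) = 1 / M * gden d 1 x"
      using student_pos[OF \<nu>, of 1 d x] by (simp add: initial_density_def)
    then have "ennreal (student d \<nu> 1 x) * ennreal (1 / M * initial_density d \<nu> x) = ennreal (1 / M) * ennreal (gden d 1 x)"
      using M \<nu> by (simp only: ennreal_mult'[symmetric] student_nonneg zero_less_one divide_nonneg_pos zero_le_one)
    then show "ennreal (student d \<nu> 1 x) * ennreal (excess d \<nu> \<eta> R M 0 x) =
      ennreal (1 / M) * (ennreal (gden d 1 x) * indicator {z\<in>space (Rd d). nrm d z \<ge> R} x)"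
      by (simp split: split_indicator)
  qed
  also have "\<dots> = ennreal (1 / M) * emeasure (std_gaussian d) {z\<in>space (Rd d). nrm d z \<ge> R}"
    unfolding std_gaussian_eq_density by (subst nn_integral_cmult, measurable) (subst emeasure_density, auto)
  finally show ?case by simp
next
  case (Suc k)
  define \<rho> where "\<rho> = R / (8 * real d)"
  define j where "j = jump_mean d \<eta> R"
  define t where "t = emeasure (target_law d \<nu>) {x\<in>space (Rd d). nrm d x \<ge> \<rho>}"
  have j: "0 \<le> j" unfolding j_def by (rule jump_mean_bounds(1)[OF \<eta> R])
  note eb = excess_bdd[OF \<eta> \<nu> R M b, of k]
  note jb = far_jump_bounds[OF \<eta> \<nu> R, of d \<rho>]
  note [measurable] = bddD(1)[OF step_op_bdd[OF \<eta> \<nu> eb]] bddD(1)[OF bdd_cauchy_op[OF \<eta> jb(1)]]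
  have \<rho>R: "\<rho> \<le> R" using R d by (simp add: \<rho>_def divide_le_eq)
  have "(\<integral>\<^sup>+x. ennreal (excess d \<nu> \<eta> R M (Suc k) x) \<partial>target_law d \<nu>) =
    (\<integral>\<^sup>+x. ennreal (step_op d \<nu> \<eta> (excess d \<nu> \<eta> R M k) x) + (ennreal (cauchy_op d \<eta> (far_jump d \<nu> \<eta> R \<rho>) x) +
      ennreal j * indicator {x\<in>space (Rd d). nrm d x \<ge> R} x) \<partial>target_law d \<nu>)"
  proof (rule nn_integral_cong)
    fix x assume "x \<in> space (target_law d \<nu>)"
    then have x: "x \<in> space (Rd d)" by simp
    have "0 \<le> step_op d \<nu> \<eta> (excess d \<nu> \<eta> R M k) x" by (rule bddD(2)[OF step_op_bdd[OF \<eta> \<nu> eb] x])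
    moreover have "0 \<le> cauchy_op d \<eta> (far_jump d \<nu> \<eta> R \<rho>) x" by (rule cauchy_op_bounds(1)[OF \<eta> jb(1)])
    ultimately show "ennreal (excess d \<nu> \<eta> R M (Suc k) x) = ennreal (step_op d \<nu> \<eta> (excess d \<nu> \<eta> R M k) x) +
      (ennreal (cauchy_op d \<eta> (far_jump d \<nu> \<eta> R \<rho>) x) + ennreal j * indicator {x\<in>space (Rd d). nrm d x \<ge> R} x)"
      using j by (simp add: \<rho>_def j_def split: split_indicator)
  qed
  also have "\<dots> = (\<integral>\<^sup>+x. ennreal (step_op d \<nu> \<eta> (excess d \<nu> \<eta> R M k) x) \<partial>target_law d \<nu>) +
    ((\<integral>\<^sup>+x. ennreal (cauchy_op d \<eta> (far_jump d \<nu> \<eta> R \<rho>) x) \<partial>target_law d \<nu>) +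
     ennreal j * emeasure (target_law d \<nu>) {x\<in>space (Rd d). nrm d x \<ge> R})"
  proof -
    have [measurable]: "{x\<in>space (Rd d). nrm d x \<ge> R} \<in> sets (Rd d)" by measurable
    show ?thesis
      by (subst nn_integral_add, measurable, subst nn_integral_add, measurable) (subst nn_integral_cmult_indicator, simp_all)
  qed
  also have "\<dots> \<le> (\<integral>\<^sup>+x. ennreal (excess d \<nu> \<eta> R M k x) \<partial>target_law d \<nu>) + (ennreal j * t + ennreal j * t)"
  proof (intro add_mono)
    show "(\<integral>\<^sup>+x. ennreal (step_op d \<nu> \<eta> (excess d \<nu> \<eta> R M k) x) \<partial>target_law d \<nu>) \<le>
      (\<integral>\<^sup>+x. ennreal (excess d \<nu> \<eta> R M k x) \<partial>target_law d \<nu>)" by (simp add: step_op_mass[OF \<eta> \<nu> eb])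
    show "(\<integral>\<^sup>+x. ennreal (cauchy_op d \<eta> (far_jump d \<nu> \<eta> R \<rho>) x) \<partial>target_law d \<nu>) \<le> ennreal j * t"
      unfolding nn_integral_target_cauchy_op[OF \<eta> \<nu> jb(1)] j_def t_def by (rule jb(2))
    show "ennreal j * emeasure (target_law d \<nu>) {x\<in>space (Rd d). nrm d x \<ge> R} \<le> ennreal j * t"
      unfolding t_def using \<rho>R by (intro mult_left_mono emeasure_mono) auto
  qed
  also have "ennreal j * t + ennreal j * t = ennreal (2 * j) * t"
    unfolding mult_2[of j] ennreal_plus[OF j j] distrib_right ..
  finally have "(\<integral>\<^sup>+x. ennreal (excess d \<nu> \<eta> R M (Suc k) x) \<partial>target_law d \<nu>) \<le>
    (\<integral>\<^sup>+x. ennreal (excess d \<nu> \<eta> R M k x) \<partial>target_law d \<nu>) + ennreal (2 * j) * t" .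
  also have "\<dots> \<le> ennreal (1 / M) * emeasure (std_gaussian d) {z\<in>space (Rd d). nrm d z \<ge> R} +
    of_nat k * (ennreal (2 * j) * t) + ennreal (2 * j) * t"
    using Suc.IH by (intro add_right_mono) (simp add: j_def t_def \<rho>_def)
  finally show ?case by (simp add: j_def t_def \<rho>_def distrib_right add_ac)
qed

section \<open>The case $\nu < 1$\<close>

lemma gaussian_powr_moment:
  assumes d: "d \<ge> 1" and \<theta>: "0 \<le> \<theta>" "\<theta> \<le> 2"
  shows "(\<integral>\<^sup>+z. ennreal (nrm d z powr \<theta>) \<partial>std_gaussian d) \<le> ennreal (2 * sqrt (real d) powr \<theta>)"
proof -
  interpret G: prob_space "std_gaussian d" by (rule prob_space_std_gaussian)
  have d0: "sqrt (real d) > 0" using d by simp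
  have "(\<integral>\<^sup>+z. ennreal (nrm d z powr \<theta>) \<partial>std_gaussian d) \<le>
    (\<integral>\<^sup>+z. ennreal (sqrt (real d) powr \<theta>) * (1 + ennreal (1 / real d) * ennreal ((nrm d z)\<^sup>2)) \<partial>std_gaussian d)"
  proof (rule nn_integral_mono)
    fix z
    define u where "u = nrm d z / sqrt (real d)"
    have u: "u \<ge> 0" using d0 by (simp add: u_def L2_set_nonneg)
    have "u powr \<theta> \<le> 1 + u\<^sup>2"
    proof (cases "u \<le> 1")
      case True
      then have "u powr \<theta> \<le> 1 powr \<theta>" using u \<theta> by (intro powr_mono2) auto
      then show ?thesis by (simp add: add_increasing2)
    next
      case False
      then have "u powr \<theta> \<le> u powr 2" using \<theta> by (intro powr_mono) auto
      then show ?thesis using False by simp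
    qed
    then have "sqrt (real d) powr \<theta> * u powr \<theta> \<le> sqrt (real d) powr \<theta> * (1 + u\<^sup>2)" by (intro mult_left_mono) auto
    moreover have "nrm d z powr \<theta> = sqrt (real d) powr \<theta> * u powr \<theta>"
      using d0 by (simp add: u_def powr_mult[symmetric])
    moreover have "u\<^sup>2 = 1 / real d * (nrm d z)\<^sup>2" by (simp add: u_def power_divide)
    ultimately have "ennreal (nrm d z powr \<theta>) \<le> ennreal (sqrt (real d) powr \<theta> * (1 + 1 / real d * (nrm d z)\<^sup>2))"
      by (intro ennreal_leI) simp
    also have "\<dots> = ennreal (sqrt (real d) powr \<theta>) * (1 + ennreal (1 / real d) * ennreal ((nrm d z)\<^sup>2))"
    proof -
      have "ennreal (1 + 1 / real d * (nrm d z)\<^sup>2) = ennreal 1 + ennreal (1 / real d * (nrm d z)\<^sup>2)" by (rule ennreal_plus) auto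
      also have "ennreal (1 / real d * (nrm d z)\<^sup>2) = ennreal (1 / real d) * ennreal ((nrm d z)\<^sup>2)" by (rule ennreal_mult') simp
      finally show ?thesis by (subst ennreal_mult') (simp_all only: powr_ge_zero ennreal_1)
    qed
    finally show "ennreal (nrm d z powr \<theta>) \<le> ennreal (sqrt (real d) powr \<theta>) * (1 + ennreal (1 / real d) * ennreal ((nrm d z)\<^sup>2))" .
  qed
  also have "\<dots> = ennreal (sqrt (real d) powr \<theta>) * (1 + ennreal (1 / real d) * ennreal (real d))"
    using G.emeasure_space_1 by (simp add: nn_integral_cmult nn_integral_add gaussian_second_moment)
  also have "ennreal (1 / real d) * ennreal (real d) = 1" using d by (subst ennreal_mult'[symmetric]) auto
  also have "ennreal (sqrt (real d) powr \<theta>) * (1 + 1) = ennreal (sqrt (real d) powr \<theta> * 2)" by (simp add: ennreal_mult')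
  finally show ?thesis by (simp add: mult.commute)
qed

text \<open>G / n has norm at least s exactly when n <= |G| / s. The chi law gives such n a mass of
  order (|G| / s)^\<nu>, and the moment of |G| of order \<nu> is at most 2 d^(\<nu> / 2).\<close>

lemma target_tail:
  assumes d: "d \<ge> 1" and \<nu>: "0 < \<nu>" "\<nu> \<le> 2" and s: "s > 0"
  shows "emeasure (target_law d \<nu>) {x\<in>space (Rd d). nrm d x \<ge> s} \<le> ennreal (2 * (chi_const \<nu> / \<nu>) * (sqrt (real d) / s) powr \<nu>)"
proof -
  interpret G: prob_space "std_gaussian d" by (rule prob_space_std_gaussian)
  interpret C: prob_space "chi_law \<nu>" by (rule prob_space_chi_law[OF \<nu>(1)])
  interpret CG: pair_sigma_finite "chi_law \<nu>" "std_gaussian d" ..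
  define A where "A = {x\<in>space (Rd d). nrm d x \<ge> s}"
  have [measurable]: "A \<in> sets (Rd d)" unfolding A_def by measurable
  have "emeasure (target_law d \<nu>) A = (\<integral>\<^sup>+x. indicator A x \<partial>target_law d \<nu>)" by simp
  also have "\<dots> = (\<integral>\<^sup>+n. (\<integral>\<^sup>+z. indicator A (vscale d (1 / n) z) \<partial>std_gaussian d) \<partial>chi_law \<nu>)"
    by (rule target_mixture[OF \<nu>(1)]) measurable
  also have "\<dots> \<le> (\<integral>\<^sup>+n. (\<integral>\<^sup>+z. indicator {n. n * s \<le> nrm d z} n \<partial>std_gaussian d) \<partial>chi_law \<nu>)"
  proof (rule nn_integral_mono_AE, use AE_chi_law_pos in eventually_elim)
    fix n :: real assume n: "n > 0"
    show "(\<integral>\<^sup>+z. indicator A (vscale d (1 / n) z) \<partial>std_gaussian d) \<le> (\<integral>\<^sup>+z. indicator {n. n * s \<le> nrm d z} n \<partial>std_gaussian d)"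
      using n by (intro nn_integral_mono) (auto simp: A_def le_divide_eq mult.commute split: split_indicator)
  qed
  also have "\<dots> = (\<integral>\<^sup>+z. (\<integral>\<^sup>+n. indicator {n. n * s \<le> nrm d z} n \<partial>chi_law \<nu>) \<partial>std_gaussian d)"
    by (rule CG.Fubini'[symmetric]) measurable
  also have "\<dots> \<le> (\<integral>\<^sup>+z. ennreal (chi_const \<nu> / \<nu> * (1 / s) powr \<nu>) * ennreal (nrm d z powr \<nu>) \<partial>std_gaussian d)"
  proof (rule nn_integral_mono)
    fix z
    have "{n. n * s \<le> nrm d z} = {..nrm d z / s}" using s by (auto simp: le_divide_eq)
    then have "(\<integral>\<^sup>+n. indicator {n. n * s \<le> nrm d z} n \<partial>chi_law \<nu>) = emeasure (chi_law \<nu>) {..nrm d z / s}" by simp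
    also have "\<dots> \<le> ennreal (chi_const \<nu> / \<nu> * (nrm d z / s) powr \<nu>)"
      using s by (intro chi_law_lower_tail[OF \<nu>(1)]) (simp add: L2_set_nonneg)
    also have "chi_const \<nu> / \<nu> * (nrm d z / s) powr \<nu> = chi_const \<nu> / \<nu> * (1 / s) powr \<nu> * nrm d z powr \<nu>"
      by (simp add: powr_divide)
    also have "ennreal \<dots> = ennreal (chi_const \<nu> / \<nu> * (1 / s) powr \<nu>) * ennreal (nrm d z powr \<nu>)"
      by (rule ennreal_mult'') simp
    finally show "(\<integral>\<^sup>+n. indicator {n. n * s \<le> nrm d z} n \<partial>chi_law \<nu>) \<le> ennreal (chi_const \<nu> / \<nu> * (1 / s) powr \<nu>) * ennreal (nrm d z powr \<nu>)" .
  qed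
  also have "\<dots> \<le> ennreal (chi_const \<nu> / \<nu> * (1 / s) powr \<nu>) * ennreal (2 * sqrt (real d) powr \<nu>)"
    using gaussian_powr_moment[OF d, of \<nu>] \<nu> by (subst nn_integral_cmult) (auto intro!: mult_left_mono)
  also have "\<dots> = ennreal (2 * (chi_const \<nu> / \<nu>) * (sqrt (real d) / s) powr \<nu>)"
    by (subst ennreal_mult''[symmetric]) (auto simp: powr_divide mult_ac)
  finally show ?thesis by (simp add: A_def)
qed

text \<open>The density of n stays positive at 0, so n^(- \<theta>) is integrable exactly for
  \<theta> < 1. This is the missing first moment of the Cauchy law.\<close>

lemma chi_1_negative_moment:
  assumes "0 < \<theta>" "\<theta> < 1"
  obtains C where "C > 0" "(\<integral>\<^sup>+n. ennreal (n powr (- \<theta>)) \<partial>chi_law 1) = ennreal C"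
proof
  define C where "C = sqrt (2 / pi) * (1 / 2 * Gamma ((1 - \<theta>) / 2) * (2 / 1) powr ((1 - \<theta>) / 2))"
  show "C > 0" using assms by (simp add: C_def Gamma_real_pos)
  have "(\<integral>\<^sup>+n. ennreal (n powr (- \<theta>)) \<partial>chi_law 1) = (\<integral>\<^sup>+n. ennreal (chi_density 1 n) * ennreal (n powr (- \<theta>)) \<partial>lborel)"
    by (rule nn_integral_chi_law) measurable
  also have "\<dots> = (\<integral>\<^sup>+n. ennreal (sqrt (2 / pi)) * (ennreal (n powr ((1 - \<theta>) - 1) * exp (- 1 * n\<^sup>2 / 2)) * indicator {0..} n) \<partial>lborel)"
  proof (rule nn_integral_cong)
    fix n :: real
    show "ennreal (chi_density 1 n) * ennreal (n powr (- \<theta>)) = ennreal (sqrt (2 / pi)) * (ennreal (n powr ((1 - \<theta>) - 1) * exp (- 1 * n\<^sup>2 / 2)) * indicator {0..} n)"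
    proof (cases "n > 0")
      case True
      then have "chi_density 1 n * n powr (- \<theta>) = sqrt (2 / pi) * (n powr ((1 - \<theta>) - 1) * exp (- 1 * n\<^sup>2 / 2))"
        by (simp add: chi_density_1)
      then show ?thesis using True by (simp only: ennreal_mult''[symmetric] powr_ge_zero ennreal_mult'[symmetric] real_sqrt_ge_zero) (simp add: ennreal_mult')
    next
      case False
      then show ?thesis by (cases "n = 0") (auto simp: chi_density_1)
    qed
  qed
  also have "\<dots> = ennreal (sqrt (2 / pi)) * ennreal (1 / 2 * Gamma ((1 - \<theta>) / 2) * (2 / 1) powr ((1 - \<theta>) / 2))"
    using assms by (subst nn_integral_cmult, measurable) (subst nn_integral_powr_gauss, auto)
  also have "\<dots> = ennreal C" unfolding C_def by (rule ennreal_mult'[symmetric]) simp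
  finally show "(\<integral>\<^sup>+n. ennreal (n powr (- \<theta>)) \<partial>chi_law 1) = ennreal C" .
qed

text \<open>min 1 u <= u^\<theta> reduces the capped jump to a fractional moment. The exponent has
  to stay below 1 for that moment to be finite; \<open>iterations_weak_FPI_core\<close> takes it as
  1 - \<nu> / 4.\<close>

lemma jump_mean_le:
  assumes \<theta>: "0 < \<theta>" "\<theta> < 1"
  obtains C where "C > 0" "\<And>d \<eta> R. d \<ge> 1 \<Longrightarrow> \<eta> > 0 \<Longrightarrow> R > 0 \<Longrightarrow> jump_mean d \<eta> R \<le> C * (\<eta> * sqrt (real d) / R) powr \<theta>"
proof -
  obtain C where C: "C > 0" "(\<integral>\<^sup>+n. ennreal (n powr (- \<theta>)) \<partial>chi_law 1) = ennreal C"
    using chi_1_negative_moment[OF \<theta>] .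
  have main: "jump_mean d \<eta> R \<le> 2 * C * (\<eta> * sqrt (real d) / R) powr \<theta>" if d: "d \<ge> 1" and \<eta>: "\<eta> > 0" and R: "R > 0" for d \<eta> R
  proof -
    have "ennreal (jump_mean d \<eta> R) \<le> (\<integral>\<^sup>+z. ennreal ((nrm d z / R) powr \<theta>) \<partial>cauchy_law d \<eta>)"
      unfolding jump_mean_bounds(3)[OF \<eta> R]
    proof (intro nn_integral_mono ennreal_leI)
      fix z
      define u where "u = nrm d z / R"
      have u: "u \<ge> 0" using R by (simp add: u_def L2_set_nonneg)
      have "min 1 u \<le> u powr \<theta>"
      proof (cases "u \<le> 1")
        case True
        have "u powr 1 \<le> u powr \<theta>" using u True \<theta> by (intro powr_mono') auto
        then show ?thesis using u by simp
      next
        case False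
        then show ?thesis using \<theta> ge_one_powr_ge_zero[of u \<theta>] by simp
      qed
      then show "jump d R z \<le> (nrm d z / R) powr \<theta>" by (simp add: jump_def u_def)
    qed
    also have "\<dots> = (\<integral>\<^sup>+n. (\<integral>\<^sup>+z. ennreal ((nrm d (vscale d (\<eta> / n) z) / R) powr \<theta>) \<partial>std_gaussian d) \<partial>chi_law 1)"
      using \<eta> by (intro nn_integral_cauchy_law) auto
    also have "\<dots> \<le> (\<integral>\<^sup>+n. ennreal (2 * (\<eta> * sqrt (real d) / R) powr \<theta>) * ennreal (n powr (- \<theta>)) \<partial>chi_law 1)"
    proof (rule nn_integral_mono_AE, use AE_chi_law_pos in eventually_elim)
      fix n :: real assume n: "n > 0"
      have "(\<integral>\<^sup>+z. ennreal ((nrm d (vscale d (\<eta> / n) z) / R) powr \<theta>) \<partial>std_gaussian d) =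
        (\<integral>\<^sup>+z. ennreal ((\<eta> / n / R) powr \<theta>) * ennreal (nrm d z powr \<theta>) \<partial>std_gaussian d)"
        using \<eta> n by (intro nn_integral_cong) (simp add: ennreal_mult''[symmetric] powr_mult powr_divide)
      also have "\<dots> \<le> ennreal ((\<eta> / n / R) powr \<theta>) * ennreal (2 * sqrt (real d) powr \<theta>)"
        using gaussian_powr_moment[OF d, of \<theta>] \<theta> by (subst nn_integral_cmult) (auto intro!: mult_left_mono)
      also have "\<dots> = ennreal ((\<eta> / n / R) powr \<theta> * (2 * sqrt (real d) powr \<theta>))" by (rule ennreal_mult''[symmetric]) simp
      also have "(\<eta> / n / R) powr \<theta> * (2 * sqrt (real d) powr \<theta>) = 2 * (\<eta> * sqrt (real d) / R) powr \<theta> * n powr (- \<theta>)"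
        by (simp add: powr_mult powr_divide powr_minus_divide mult_ac)
      also have "ennreal (2 * (\<eta> * sqrt (real d) / R) powr \<theta> * n powr (- \<theta>)) =
        ennreal (2 * (\<eta> * sqrt (real d) / R) powr \<theta>) * ennreal (n powr (- \<theta>))" by (rule ennreal_mult'') simp
      finally show "(\<integral>\<^sup>+z. ennreal ((nrm d (vscale d (\<eta> / n) z) / R) powr \<theta>) \<partial>std_gaussian d) \<le>
        ennreal (2 * (\<eta> * sqrt (real d) / R) powr \<theta>) * ennreal (n powr (- \<theta>))" .
    qed
    also have "\<dots> = ennreal (2 * (\<eta> * sqrt (real d) / R) powr \<theta>) * ennreal C"
      by (subst nn_integral_cmult) (auto simp: C(2))
    also have "\<dots> = ennreal (2 * (\<eta> * sqrt (real d) / R) powr \<theta> * C)" using C(1) by (intro ennreal_mult''[symmetric]) simp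
    finally have "jump_mean d \<eta> R \<le> 2 * (\<eta> * sqrt (real d) / R) powr \<theta> * C"
      using C(1) by (subst (asm) ennreal_le_iff) auto
    then show ?thesis by (simp add: mult_ac)
  qed
  show ?thesis by (rule that[of "2 * C"]) (use C main in auto)
qed

text \<open>For n <= 1 / B and |z| > sqrt d / 2 the point z / n has norm at least B sqrt d / 2 = 2
  R, where the cutoff vanishes; this explains the choice of R. The unlikely short vectors z are paid
  for with the bound M^2 and the probability (3/4)^d.\<close>

lemma far_second_moment:
  assumes d: "d \<ge> 1" and \<eta>: "\<eta> > 0" and \<nu>: "\<nu> > 0" and B: "B > 0" and R: "R = B * sqrt (real d) / 4"
    and M: "M > 0" and b: "bdd d M (initial_density d \<nu>)"
    and half: "emeasure (target_law d \<nu>) {x\<in>space (Rd d). 8 * real d * nrm d x \<le> R} \<ge> ennreal (1 / 2)"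
  shows "(\<integral>\<^sup>+n. (\<integral>\<^sup>+z. ennreal ((iterate d \<nu> \<eta> k (vscale d (1 / n) z))\<^sup>2) \<partial>std_gaussian d) * indicator {..1 / B} n \<partial>chi_law \<nu>) \<le>
    ennreal (32 + M\<^sup>2 * (3 / 4) ^ d) * emeasure (chi_law \<nu>) {..1 / B} +
    ennreal (2 * M\<^sup>2) * (\<integral>\<^sup>+x. ennreal (excess d \<nu> \<eta> R M k x) \<partial>target_law d \<nu>)"
proof -
  interpret G: prob_space "std_gaussian d" by (rule prob_space_std_gaussian)
  have R0: "R > 0" using B d by (simp add: R)
  define f where "f = iterate d \<nu> \<eta> k"
  define e where "e = excess d \<nu> \<eta> R M k"
  note fb = iterate_bdd[OF \<eta> \<nu> b, of k, folded f_def]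
  note eb = excess_bdd[OF \<eta> \<nu> R0 M b, of k, folded e_def]
  note [measurable] = bddD(1)[OF fb] bddD(1)[OF eb]
  define Z where "Z = {z\<in>space (Rd d). nrm d z \<le> sqrt (real d) / 2}"
  have [measurable]: "Z \<in> sets (Rd d)" unfolding Z_def by measurable
  have pt: "ennreal ((f (vscale d (1 / n) z))\<^sup>2) \<le> ennreal 32 + ennreal (M\<^sup>2) * indicator Z z + ennreal (2 * M\<^sup>2) * ennreal (e (vscale d (1 / n) z))"
    if n: "0 < n" "n \<le> 1 / B" and z: "z \<in> space (Rd d)" for n z
  proof -
    define x where "x = vscale d (1 / n) z"
    have x: "x \<in> space (Rd d)" by (simp add: x_def)
    note fx = bddD(2,3)[OF fb x]
    have ex: "e x \<ge> 0" by (rule bddD(2)[OF eb x])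
    have "(f x)\<^sup>2 \<le> 32 + M\<^sup>2 * indicator Z z + 2 * M\<^sup>2 * e x"
    proof (cases "z \<in> Z")
      case True
      have "(f x)\<^sup>2 \<le> M\<^sup>2" using fx by (intro power_mono) auto
      then show ?thesis using True ex by (simp add: add_increasing add_increasing2)
    next
      case False
      have "2 * R \<le> nrm d x"
      proof -
        have "2 * R = B * (sqrt (real d) / 2)" by (simp add: R)
        also have "\<dots> \<le> (1 / n) * nrm d z" using False z B n by (intro mult_mono) (auto simp: Z_def field_simps)
        finally show ?thesis using n by (simp add: x_def)
      qed
      then have "cutoff d R x = 0" using R0 by (simp add: cutoff_def le_divide_eq)
      then have 1: "f x \<le> 4 + M * e x"
        using iterate_far_bound[OF d \<eta> \<nu> R0 M b half x, of k] by (simp add: f_def e_def)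
      \<comment> \<open>Capping by \<open>f x\<close> <= M makes the squared excess at most linear,
        since (min 1 e)^2 <= e. Therefore a bound on the mean of \<open>excess\<close> is enough,
        without one on its square.\<close>
      have 2: "f x \<le> 4 + M * min 1 (e x)" using 1 fx(2) by (auto simp: min_def)
      have "(f x)\<^sup>2 \<le> (4 + M * min 1 (e x))\<^sup>2" using 2 fx(1) by (rule power_mono)
      also have "\<dots> \<le> 32 + 2 * M\<^sup>2 * (min 1 (e x))\<^sup>2"
        using zero_le_power2[of "4 - M * min 1 (e x)"] by (simp add: power2_eq_square algebra_simps)
      also have "(min 1 (e x))\<^sup>2 \<le> e x"
        using ex mult_mono[of "min 1 (e x)" 1 "min 1 (e x)" "e x"] by (simp add: power2_eq_square)
      finally show ?thesis using False by (simp add: mult_left_mono)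
    qed
    then have "ennreal ((f x)\<^sup>2) \<le> ennreal (32 + M\<^sup>2 * indicator Z z + 2 * M\<^sup>2 * e x)" by (rule ennreal_leI)
    also have "\<dots> = ennreal 32 + ennreal (M\<^sup>2) * indicator Z z + ennreal (2 * M\<^sup>2) * ennreal (e x)"
    proof -
      have "ennreal (32 + M\<^sup>2 * indicator Z z + 2 * M\<^sup>2 * e x) = ennreal 32 + ennreal (M\<^sup>2 * indicator Z z) + ennreal (2 * M\<^sup>2 * e x)"
        using ex by (simp only: ennreal_plus add_nonneg_nonneg mult_nonneg_nonneg zero_le_power2 indicator_pos_le zero_le_numeral)
      then show ?thesis using ex by (simp only: ennreal_mult' ennreal_mult'' ennreal_indicator zero_le_power2)
    qed
    finally show ?thesis by (simp add: x_def)
  qed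
  have Zm: "emeasure (std_gaussian d) Z \<le> ennreal ((3 / 4) ^ d)" unfolding Z_def by (rule gaussian_norm_lower)
  have "(\<integral>\<^sup>+n. (\<integral>\<^sup>+z. ennreal ((f (vscale d (1 / n) z))\<^sup>2) \<partial>std_gaussian d) * indicator {..1 / B} n \<partial>chi_law \<nu>) \<le>
    (\<integral>\<^sup>+n. ennreal (32 + M\<^sup>2 * (3 / 4) ^ d) * indicator {..1 / B} n +
      ennreal (2 * M\<^sup>2) * (\<integral>\<^sup>+z. ennreal (e (vscale d (1 / n) z)) \<partial>std_gaussian d) \<partial>chi_law \<nu>)"
  proof (rule nn_integral_mono_AE, use AE_chi_law_pos in eventually_elim)
    fix n :: real assume n: "n > 0"
    show "(\<integral>\<^sup>+z. ennreal ((f (vscale d (1 / n) z))\<^sup>2) \<partial>std_gaussian d) * indicator {..1 / B} n \<le>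
      ennreal (32 + M\<^sup>2 * (3 / 4) ^ d) * indicator {..1 / B} n + ennreal (2 * M\<^sup>2) * (\<integral>\<^sup>+z. ennreal (e (vscale d (1 / n) z)) \<partial>std_gaussian d)"
    proof (cases "n \<le> 1 / B")
      case True
      have "(\<integral>\<^sup>+z. ennreal ((f (vscale d (1 / n) z))\<^sup>2) \<partial>std_gaussian d) \<le>
        (\<integral>\<^sup>+z. ennreal 32 + ennreal (M\<^sup>2) * indicator Z z + ennreal (2 * M\<^sup>2) * ennreal (e (vscale d (1 / n) z)) \<partial>std_gaussian d)"
        using pt[OF n True] by (intro nn_integral_mono) simp
      also have "\<dots> = (ennreal 32 + ennreal (M\<^sup>2) * emeasure (std_gaussian d) Z) + ennreal (2 * M\<^sup>2) * (\<integral>\<^sup>+z. ennreal (e (vscale d (1 / n) z)) \<partial>std_gaussian d)"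
      proof -
        have [measurable]: "(\<lambda>z. e (vscale d (1 / n) z)) \<in> borel_measurable (std_gaussian d)" by measurable
        have 1: "(\<integral>\<^sup>+z. ennreal 32 + ennreal (M\<^sup>2) * indicator Z z + ennreal (2 * M\<^sup>2) * ennreal (e (vscale d (1 / n) z)) \<partial>std_gaussian d) =
          (\<integral>\<^sup>+z. ennreal 32 + ennreal (M\<^sup>2) * indicator Z z \<partial>std_gaussian d) + (\<integral>\<^sup>+z. ennreal (2 * M\<^sup>2) * ennreal (e (vscale d (1 / n) z)) \<partial>std_gaussian d)"
          by (rule nn_integral_add) measurable
        have 2: "(\<integral>\<^sup>+z. ennreal 32 + ennreal (M\<^sup>2) * indicator Z z \<partial>std_gaussian d) =
          (\<integral>\<^sup>+z. ennreal 32 \<partial>std_gaussian d) + (\<integral>\<^sup>+z. ennreal (M\<^sup>2) * indicator Z z \<partial>std_gaussian d)"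
          by (rule nn_integral_add) measurable
        have 3: "(\<integral>\<^sup>+z. ennreal 32 \<partial>std_gaussian d) = ennreal 32" unfolding nn_integral_const G.emeasure_space_1 by (rule mult_1_right)
        have 4: "(\<integral>\<^sup>+z. ennreal (M\<^sup>2) * indicator Z z \<partial>std_gaussian d) = ennreal (M\<^sup>2) * emeasure (std_gaussian d) Z"
          by (rule nn_integral_cmult_indicator) measurable
        have 5: "(\<integral>\<^sup>+z. ennreal (2 * M\<^sup>2) * ennreal (e (vscale d (1 / n) z)) \<partial>std_gaussian d) =
          ennreal (2 * M\<^sup>2) * (\<integral>\<^sup>+z. ennreal (e (vscale d (1 / n) z)) \<partial>std_gaussian d)"
          by (rule nn_integral_cmult) measurable
        show ?thesis unfolding 1 2 3 4 5 ..
      qed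
      also have "ennreal 32 + ennreal (M\<^sup>2) * emeasure (std_gaussian d) Z \<le> ennreal 32 + ennreal (M\<^sup>2) * ennreal ((3 / 4) ^ d)"
        by (intro add_left_mono mult_left_mono Zm) auto
      also have "\<dots> = ennreal (32 + M\<^sup>2 * (3 / 4) ^ d)"
      proof -
        have "ennreal (M\<^sup>2) * ennreal ((3 / 4) ^ d) = ennreal (M\<^sup>2 * (3 / 4) ^ d)" by (rule ennreal_mult'[symmetric]) simp
        moreover have "ennreal (32 + M\<^sup>2 * (3 / 4) ^ d) = ennreal 32 + ennreal (M\<^sup>2 * (3 / 4) ^ d)" by (rule ennreal_plus) auto
        ultimately show ?thesis by (simp only:)
      qed
      finally show ?thesis using True by (simp add: add_right_mono)
    qed simp
  qed
  also have "\<dots> = ennreal (32 + M\<^sup>2 * (3 / 4) ^ d) * emeasure (chi_law \<nu>) {..1 / B} +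
    ennreal (2 * M\<^sup>2) * (\<integral>\<^sup>+n. (\<integral>\<^sup>+z. ennreal (e (vscale d (1 / n) z)) \<partial>std_gaussian d) \<partial>chi_law \<nu>)"
    by (subst nn_integral_add, measurable) (simp add: nn_integral_cmult nn_integral_cmult_indicator)
  also have "(\<integral>\<^sup>+n. (\<integral>\<^sup>+z. ennreal (e (vscale d (1 / n) z)) \<partial>std_gaussian d) \<partial>chi_law \<nu>) = (\<integral>\<^sup>+x. ennreal (e x) \<partial>target_law d \<nu>)"
    by (rule target_mixture[OF \<nu>, symmetric]) measurable
  finally show ?thesis unfolding f_def e_def .
qed

text \<open>A version of \<open>geometric_decay\<close> for a contraction known only up to step Q.
  It is needed because the error term grows with the number of steps.\<close>

lemma geometric_decay_upto:
  fixes x :: "nat \<Rightarrow> real"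
  assumes \<delta>: "\<delta> > 0" and Q: "Q = 1 + (1 + 1 / \<delta>) * ln (W / \<epsilon>)"
    and step: "\<And>k. real (Suc k) \<le> Q \<Longrightarrow> x (Suc k) * (1 + \<delta>) \<le> x k" and x0: "x 0 \<le> W"
    and \<epsilon>: "\<epsilon> > 0" and W: "\<epsilon> \<le> W"
  shows "\<exists>k. real k \<le> Q \<and> x k \<le> \<epsilon>"
proof -
  define n where "n = nat \<lfloor>Q\<rfloor>"
  have "ln (W / \<epsilon>) \<ge> 0" using W \<epsilon> by simp
  then have "Q \<ge> 0" using \<delta> by (simp add: Q)
  then have n: "k \<le> n \<longleftrightarrow> real k \<le> Q" for k by (simp add: n_def le_nat_floor le_nat_iff le_floor_iff)
  \<comment> \<open>Beyond the last admissible index \<open>n\<close> the sequence is continued by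
    exact geometric decay. The index found is at most Q, where \<open>y\<close> and \<open>x\<close>
    agree.\<close>
  define y where "y k = x (min k n) / (1 + \<delta>) ^ (k - n)" for k
  have "\<exists>k. real k \<le> Q \<and> y k \<le> \<epsilon>"
    unfolding Q
  proof (rule geometric_decay[OF \<delta> _ _ \<epsilon> W])
    show "y 0 \<le> W" using x0 by (simp add: y_def)
    show "y (Suc k) * (1 + \<delta>) \<le> y k" for k
    proof (cases "Suc k \<le> n")
      case True
      then show ?thesis using step[of k] n[of "Suc k"] by (simp add: y_def)
    next
      case False
      then have "Suc k - n = Suc (k - n)" "min (Suc k) n = n" "min k n = n" by auto
      then show ?thesis using \<delta> by (simp add: y_def)
    qed
  qed
  then obtain k where k: "real k \<le> Q" "y k \<le> \<epsilon>" by blast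
  then have "y k = x k" using n[of k] by (simp add: y_def min_def)
  then show ?thesis using k by auto
qed

text \<open>The tail terms act as a constant source, so the distance of the divergence from 2 S
  contracts instead of the divergence itself. In S, 33 = 32 + 1 joins the bound of
  \<open>far_second_moment\<close> with the 1 in the second moment of the iterate.\<close>

lemma chi2_contraction_weak:
  assumes d: "d \<ge> 1" and \<eta>: "\<eta> > 0" and \<nu>: "0 < \<nu>" "\<nu> < 1" and B: "B > 0" and R: "R = B * sqrt (real d) / 4"
    and M: "M > 0" and b: "bdd d M (initial_density d \<nu>)"
    and half: "emeasure (target_law d \<nu>) {x\<in>space (Rd d). 8 * real d * nrm d x \<le> R} \<ge> ennreal (1 / 2)"
    and p: "emeasure (chi_law \<nu>) {..1 / B} \<le> ennreal p" "0 \<le> p" "p \<le> 1 / 2"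
    and e: "(\<integral>\<^sup>+x. ennreal (excess d \<nu> \<eta> R M (Suc k) x) \<partial>target_law d \<nu>) \<le> ennreal e" "0 \<le> e"
    and A: "A = sqrt (2 * pi) * chi_const \<nu> * B powr (1 - \<nu>)" and S: "S = (33 + M\<^sup>2 * (3 / 4) ^ d) * p + 2 * M\<^sup>2 * e"
  shows "(chi2 d \<nu> \<eta> (Suc k) - 2 * S) * (1 + \<eta> / (2 * A)) \<le> chi2 d \<nu> \<eta> k - 2 * S"
proof -
  define v where "v = chi2 d \<nu> \<eta> (Suc k)"
  define E where "E = dirichlet_form d (student d \<nu> 1) (iterate d \<nu> \<eta> (Suc k))"
  define P where "P = emeasure (chi_law \<nu>) {..1 / B}"
  note c = ennreal_chi2[OF \<eta> \<nu>(1) b]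
  have v0: "v \<ge> 0" unfolding v_def by (rule c(3))
  have A0: "A > 0" unfolding A using chi_const_pos[OF \<nu>(1)] B by simp
  have en: "ennreal v + ennreal \<eta> * E \<le> ennreal (chi2 d \<nu> \<eta> k)"
    unfolding v_def E_def c(1) by (rule chi_square_energy[OF d \<eta> \<nu>(1) b])
  have "ennreal \<eta> * E < \<infinity>"
    using order_trans[OF _ en, of "ennreal \<eta> * E"] by (simp add: order_le_less_trans[OF _ ennreal_less_top])
  then have "E < \<infinity>" using \<eta> by (auto simp: ennreal_mult_less_top)
  then obtain r where r: "r \<ge> 0" "E = ennreal r" by (cases E) auto
  note fb = iterate_bdd[OF \<eta> \<nu>(1) b, of "Suc k"]
  have "ennreal v \<le> ennreal A * E + ((\<integral>\<^sup>+n. (\<integral>\<^sup>+z. ennreal ((iterate d \<nu> \<eta> (Suc k) (vscale d (1 / n) z))\<^sup>2) \<partial>std_gaussian d) *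
      indicator {..1 / B} n \<partial>chi_law \<nu>) + (ennreal v + 1) * P)"
    unfolding v_def c(1) A E_def P_def
    by (rule weak_poincare_radial[OF d \<nu> fb radial_iterate[OF d \<eta> \<nu>(1) b] iterate_mass[OF \<eta> \<nu>(1) b] B])
  also have "\<dots> \<le> ennreal A * E + ((ennreal (32 + M\<^sup>2 * (3 / 4) ^ d) * ennreal p + ennreal (2 * M\<^sup>2) * ennreal e) + (ennreal v + 1) * ennreal p)"
  proof (intro add_left_mono add_mono mult_left_mono)
    show "P \<le> ennreal p" unfolding P_def by (rule p(1))
    have "(\<integral>\<^sup>+n. (\<integral>\<^sup>+z. ennreal ((iterate d \<nu> \<eta> (Suc k) (vscale d (1 / n) z))\<^sup>2) \<partial>std_gaussian d) * indicator {..1 / B} n \<partial>chi_law \<nu>) \<le>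
      ennreal (32 + M\<^sup>2 * (3 / 4) ^ d) * P + ennreal (2 * M\<^sup>2) * (\<integral>\<^sup>+x. ennreal (excess d \<nu> \<eta> R M (Suc k) x) \<partial>target_law d \<nu>)"
      unfolding P_def by (rule far_second_moment[OF d \<eta> \<nu>(1) B R M b half])
    also have "\<dots> \<le> ennreal (32 + M\<^sup>2 * (3 / 4) ^ d) * ennreal p + ennreal (2 * M\<^sup>2) * ennreal e"
      unfolding P_def by (intro add_mono mult_left_mono p e) auto
    finally show "(\<integral>\<^sup>+n. (\<integral>\<^sup>+z. ennreal ((iterate d \<nu> \<eta> (Suc k) (vscale d (1 / n) z))\<^sup>2) \<partial>std_gaussian d) * indicator {..1 / B} n \<partial>chi_law \<nu>) \<le>
      ennreal (32 + M\<^sup>2 * (3 / 4) ^ d) * ennreal p + ennreal (2 * M\<^sup>2) * ennreal e" .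
  qed auto
  also have "\<dots> = ennreal (A * r + (((32 + M\<^sup>2 * (3 / 4) ^ d) * p + 2 * M\<^sup>2 * e) + (v + 1) * p))"
  proof -
    have "ennreal A * E = ennreal (A * r)" unfolding r(2) using A0 by (intro ennreal_mult'[symmetric]) simp
    moreover have "ennreal (32 + M\<^sup>2 * (3 / 4) ^ d) * ennreal p = ennreal ((32 + M\<^sup>2 * (3 / 4) ^ d) * p)"
      using p by (intro ennreal_mult''[symmetric])
    moreover have "ennreal (2 * M\<^sup>2) * ennreal e = ennreal (2 * M\<^sup>2 * e)" using e by (intro ennreal_mult''[symmetric])
    moreover have "(ennreal v + 1) * ennreal p = ennreal ((v + 1) * p)"
      using v0 p by (simp add: ennreal_mult'' ennreal_plus flip: ennreal_1)
    ultimately show ?thesis using A0 r(1) p e v0 by (simp add: ennreal_plus[symmetric] del: ennreal_plus)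
  qed
  finally have "v \<le> A * r + (((32 + M\<^sup>2 * (3 / 4) ^ d) * p + 2 * M\<^sup>2 * e) + (v + 1) * p)"
    using A0 r(1) p e v0 by (subst (asm) ennreal_le_iff) auto
  \<comment> \<open>The leftover v p is at most v / 2 and moves to the left-hand side, which doubles
    both A and S.\<close>
  also have "\<dots> = A * r + S + v * p" unfolding S by (simp add: algebra_simps)
  also have "v * p \<le> v * (1 / 2)" using p v0 by (intro mult_left_mono)
  finally have "v - 2 * S \<le> 2 * A * r" by simp
  then have "(v - 2 * S) / (2 * A) \<le> r" using A0 by (simp add: divide_le_eq mult.commute)
  then have "\<eta> * ((v - 2 * S) / (2 * A)) \<le> \<eta> * r" using \<eta> by (intro mult_left_mono) auto
  moreover have "v + \<eta> * r \<le> chi2 d \<nu> \<eta> k"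
  proof -
    have "ennreal (v + \<eta> * r) = ennreal v + ennreal \<eta> * E"
      unfolding r(2) using v0 \<eta> r(1) by (simp add: ennreal_plus ennreal_mult)
    then have "ennreal (v + \<eta> * r) \<le> ennreal (chi2 d \<nu> \<eta> k)" using en by simp
    then show ?thesis using c(3)[of k] by (subst (asm) ennreal_le_iff) auto
  qed
  ultimately show ?thesis unfolding v_def[symmetric] by (simp add: algebra_simps)
qed

text \<open>The first summand is the Gaussian mass beyond R, by Markov's inequality at the multiple
  B / 4 of sqrt d. The second charges N iterations at the common rate.\<close>

lemma excess_mass_le:
  assumes d: "d \<ge> 1" and \<eta>: "\<eta> > 0" and \<nu>: "\<nu> > 0" and B: "B > 0" and R: "R = B * sqrt (real d) / 4"
    and M: "M > 0" and b: "bdd d M (initial_density d \<nu>)"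
    and t: "emeasure (target_law d \<nu>) {x\<in>space (Rd d). nrm d x \<ge> R / (8 * real d)} \<le> ennreal t" "0 \<le> t"
    and J: "jump_mean d \<eta> R \<le> J" and k: "real k \<le> N"
  shows "(\<integral>\<^sup>+x. ennreal (excess d \<nu> \<eta> R M k x) \<partial>target_law d \<nu>) \<le> ennreal (16 / (M * B\<^sup>2) + N * (2 * J * t))"
proof -
  have R0: "R > 0" using B d by (simp add: R)
  have J0: "0 \<le> J" using J jump_mean_bounds(1)[OF \<eta> R0, of d] by simp
  have N0: "0 \<le> N" using k by simp
  have "emeasure (std_gaussian d) {z\<in>space (Rd d). nrm d z \<ge> R} \<le> ennreal (1 / (B / 4)\<^sup>2)"
    using gaussian_norm_upper[OF d, of "B / 4"] B by (simp add: R)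
  then have "ennreal (1 / M) * emeasure (std_gaussian d) {z\<in>space (Rd d). nrm d z \<ge> R} \<le> ennreal (1 / M) * ennreal (1 / (B / 4)\<^sup>2)"
    by (intro mult_left_mono) auto
  also have "\<dots> = ennreal (16 / (M * B\<^sup>2))"
    using M by (subst ennreal_mult'[symmetric]) (auto simp: power_divide)
  finally have 1: "ennreal (1 / M) * emeasure (std_gaussian d) {z\<in>space (Rd d). nrm d z \<ge> R} \<le> ennreal (16 / (M * B\<^sup>2))" .
  have "of_nat k * (ennreal (2 * jump_mean d \<eta> R) * emeasure (target_law d \<nu>) {x\<in>space (Rd d). nrm d x \<ge> R / (8 * real d)}) \<le>
    ennreal N * (ennreal (2 * J) * ennreal t)"
    using k J jump_mean_bounds(1)[OF \<eta> R0, of d] by (intro mult_mono ennreal_leI t) (auto simp: ennreal_of_nat_eq_real_of_nat intro: ennreal_leI)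
  also have "\<dots> = ennreal (N * (2 * J * t))" using N0 J0 t by (simp add: ennreal_mult)
  finally have 2: "of_nat k * (ennreal (2 * jump_mean d \<eta> R) * emeasure (target_law d \<nu>) {x\<in>space (Rd d). nrm d x \<ge> R / (8 * real d)}) \<le>
    ennreal (N * (2 * J * t))" .
  have "(\<integral>\<^sup>+x. ennreal (excess d \<nu> \<eta> R M k x) \<partial>target_law d \<nu>) \<le> ennreal (16 / (M * B\<^sup>2)) + ennreal (N * (2 * J * t))"
    by (rule order_trans[OF excess_mass[OF d \<eta> \<nu> R0 M b] add_mono[OF 1 2]])
  also have "\<dots> = ennreal (16 / (M * B\<^sup>2) + N * (2 * J * t))"
    using M N0 J0 t by (intro ennreal_plus[symmetric]) auto
  finally show ?thesis .
qed

section \<open>Numerical estimates behind the choice of parameters\<close>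

lemma linear_times_geometric_le: "real d * (3 / 4) ^ d \<le> 3"
proof -
  have "1 + real d * (1 / 3) \<le> (1 + 1 / 3) ^ d" by (rule Bernoulli_inequality) simp
  then have "real d \<le> 3 * (4 / 3) ^ d" by simp
  then have "real d * (3 / 4) ^ d \<le> 3 * (4 / 3) ^ d * (3 / 4) ^ d" by (intro mult_right_mono) auto
  also have "\<dots> = 3" by (simp add: power_mult_distrib[symmetric])
  finally show ?thesis .
qed

lemma step_size_bounds:
  assumes d: "real d \<ge> 1" and \<nu>: "0 < \<nu>" "\<nu> < 1" and a: "a > 0" and b: "b > 0"
    and lo: "a * (real d powr (- 1 / 2) * (real d + \<nu>) powr (- 4 / \<nu>)) \<le> \<eta>"
    and hi: "\<eta> \<le> b * (real d powr (- 1 / 2) * (real d + \<nu>) powr (- 4 / \<nu>))"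
  shows "a * 2 powr (- 4 / \<nu>) / real d powr (1 / 2 + 4 / \<nu>) \<le> \<eta>" "\<eta> \<le> b"
proof -
  have "(2 * real d) powr (- 4 / \<nu>) \<le> (real d + \<nu>) powr (- 4 / \<nu>)" using d \<nu> by (intro powr_mono2') auto
  then have "a * (real d powr (- 1 / 2) * (2 * real d) powr (- 4 / \<nu>)) \<le> \<eta>"
    using a by (intro order_trans[OF _ lo] mult_left_mono) auto
  moreover have "real d powr (- 1 / 2) * (2 * real d) powr (- 4 / \<nu>) = 2 powr (- 4 / \<nu>) / real d powr (1 / 2 + 4 / \<nu>)"
  proof -
    have "real d powr (- 1 / 2) * (2 * real d) powr (- 4 / \<nu>) = 2 powr (- 4 / \<nu>) * (real d powr (- 1 / 2) * real d powr (- 4 / \<nu>))"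
      by (simp add: powr_mult)
    also have "real d powr (- 1 / 2) * real d powr (- 4 / \<nu>) = real d powr (- (1 / 2 + 4 / \<nu>))"
      by (simp add: powr_add[symmetric])
    also have "\<dots> = 1 / real d powr (1 / 2 + 4 / \<nu>)" by (rule powr_minus_divide)
    finally show ?thesis by simp
  qed
  ultimately show "a * 2 powr (- 4 / \<nu>) / real d powr (1 / 2 + 4 / \<nu>) \<le> \<eta>" by simp
  have "real d powr (- 1 / 2) \<le> 1" "(real d + \<nu>) powr (- 4 / \<nu>) \<le> 1"
    using d \<nu> powr_mono2'[of "- 1 / 2" 1 "real d"] powr_mono2'[of "- 4 / \<nu>" 1 "real d + \<nu>"] by auto
  then have "real d powr (- 1 / 2) * (real d + \<nu>) powr (- 4 / \<nu>) \<le> 1 * 1" by (intro mult_mono) auto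
  then have "b * (real d powr (- 1 / 2) * (real d + \<nu>) powr (- 4 / \<nu>)) \<le> b * 1" using b by (intro mult_left_mono) auto
  then show "\<eta> \<le> b" using hi by simp
qed

text \<open>The total jump error is of order d^2 times iteration count times mean jump. With B =
  X^(1 / \<nu>) and exponent 1 - \<nu> / 4 the last two combine to X^(- 3/4) \<eta>^(- \<nu> / 4). X
  >= D and \<eta> >= a / D reduce this to D^(- 1/2), which beats d^2 because D is at least
  d^(9/2).\<close>

lemma jump_budget:
  assumes d: "real d \<ge> 1" and \<nu>: "0 < \<nu>" "\<nu> < 1" and a: "a > 0"
    and D: "D = real d powr (1 / 2 + 4 / \<nu>)" and X: "D \<le> X" and \<eta>: "a / D \<le> \<eta>"
  shows "(real d)\<^sup>2 * (X powr (1 / \<nu> - 1) / \<eta> * (\<eta> / X powr (1 / \<nu>)) powr (1 - \<nu> / 4)) \<le> 1 / a powr (\<nu> / 4)"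
proof -
  have D1: "D \<ge> 1" unfolding D using d \<nu> by (intro ge_one_powr_ge_zero) auto
  have X0: "X > 0" using D1 X by simp
  have aD: "a / D > 0" using a D1 by simp
  then have \<eta>0: "\<eta> > 0" using \<eta> by linarith
  have "X powr (1 / \<nu> - 1) / \<eta> * (\<eta> / X powr (1 / \<nu>)) powr (1 - \<nu> / 4) = X powr (- (3 / 4)) * \<eta> powr (- (\<nu> / 4))"
  proof -
    have "(X powr (1 / \<nu>)) powr (1 - \<nu> / 4) = X powr (1 / \<nu> - 1 + 3 / 4)"
      using \<nu> by (simp add: powr_powr right_diff_distrib)
    also have "\<dots> = X powr (1 / \<nu> - 1) * X powr (3 / 4)" by (rule powr_add)
    finally have 1: "(X powr (1 / \<nu>)) powr (1 - \<nu> / 4) = X powr (1 / \<nu> - 1) * X powr (3 / 4)" .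
    have "\<eta> powr (1 - \<nu> / 4) = \<eta> powr 1 * \<eta> powr (- (\<nu> / 4))" by (simp only: powr_add[symmetric]) simp
    then have 2: "\<eta> powr (1 - \<nu> / 4) = \<eta> * \<eta> powr (- (\<nu> / 4))" using \<eta>0 by simp
    have "X powr (1 / \<nu> - 1) > 0" using X0 by simp
    then show ?thesis unfolding powr_divide 1 2 using \<eta>0 powr_minus_divide[of X "3 / 4"] by simp
  qed
  also have "\<dots> \<le> D powr (- (3 / 4)) * (D powr (1 / 4) / a powr (\<nu> / 4))"
  proof (rule mult_mono)
    show "X powr (- (3 / 4)) \<le> D powr (- (3 / 4))" using X D1 by (intro powr_mono2') auto
    have "\<eta> powr (- (\<nu> / 4)) \<le> (a / D) powr (- (\<nu> / 4))" using \<eta> aD \<nu> by (intro powr_mono2') auto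
    also have "\<dots> = D powr (\<nu> / 4) / a powr (\<nu> / 4)"
      using a D1 by (simp add: powr_divide powr_minus_divide)
    also have "\<dots> \<le> D powr (1 / 4) / a powr (\<nu> / 4)" using D1 \<nu> by (intro divide_right_mono powr_mono) auto
    finally show "\<eta> powr (- (\<nu> / 4)) \<le> D powr (1 / 4) / a powr (\<nu> / 4)" .
  qed auto
  also have "\<dots> = D powr (- (1 / 2)) / a powr (\<nu> / 4)"
    by (simp add: powr_add[symmetric])
  finally have le: "X powr (1 / \<nu> - 1) / \<eta> * (\<eta> / X powr (1 / \<nu>)) powr (1 - \<nu> / 4) \<le> D powr (- (1 / 2)) / a powr (\<nu> / 4)" .
  have "(real d)\<^sup>2 * D powr (- (1 / 2)) \<le> 1"
  proof -
    have "(real d)\<^sup>2 * D powr (- (1 / 2)) = real d powr 2 * real d powr ((1 / 2 + 4 / \<nu>) * (- (1 / 2)))"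
      using d by (simp add: D powr_powr)
    also have "\<dots> = real d powr (2 + (1 / 2 + 4 / \<nu>) * (- (1 / 2)))" by (rule powr_add[symmetric])
    also have "\<dots> \<le> real d powr 0"
    proof (rule powr_mono)
      have "4 / \<nu> \<ge> 4" using \<nu> by (simp add: le_divide_eq)
      then show "2 + (1 / 2 + 4 / \<nu>) * (- (1 / 2)) \<le> 0" by simp
    qed (use d in simp)
    finally show ?thesis using d by simp
  qed
  then have "(real d)\<^sup>2 * D powr (- (1 / 2)) / a powr (\<nu> / 4) \<le> 1 / a powr (\<nu> / 4)" by (intro divide_right_mono) auto
  moreover have "(real d)\<^sup>2 * (X powr (1 / \<nu> - 1) / \<eta> * (\<eta> / X powr (1 / \<nu>)) powr (1 - \<nu> / 4)) \<le>
    (real d)\<^sup>2 * (D powr (- (1 / 2)) / a powr (\<nu> / 4))" by (intro mult_left_mono le) auto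
  ultimately show ?thesis by simp
qed

text \<open>The bound contains no Poincare constant: the radial inequality has an explicit one, A =
  A0 X^\<delta>, and the number of steps is essentially A / \<eta> times a logarithm, with 1 /
  \<eta> of order d^(1/2 + 4 / \<nu>).\<close>

lemma iterations_weak_FPI_core:
  fixes \<nu> a b :: real
  assumes \<nu>: "0 < \<nu>" "\<nu> < 1" and a: "a > 0" and b: "b > 0"
  obtains K where "K > 0" "\<And>(d::nat) \<eta> \<epsilon> xm. d \<ge> 1 \<Longrightarrow> 0 < \<epsilon> \<Longrightarrow> \<epsilon> < 1 \<Longrightarrow>
    a / real d powr (1 / 2 + 4 / \<nu>) \<le> \<eta> \<Longrightarrow> \<eta> \<le> b \<Longrightarrow> minimizer d (cauchy_potential d \<nu>) xm \<Longrightarrow>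
    iterations_required d \<nu> \<eta> xm \<epsilon> \<le> ennreal (K * (real d powr (1 / 2 + 4 / \<nu>) *
      (max (real d powr (1 / 2 + 4 / \<nu>)) (1 / \<epsilon>) * (1 + ln (real d) + ln (1 / \<epsilon>))) powr (1 / \<nu> - 1) *
      (1 + ln (real d) + ln (1 / \<epsilon>))))"
proof -
  obtain K0 where K0: "K0 \<ge> 1" "\<And>d. d \<ge> 1 \<Longrightarrow> bdd d (K0 * sqrt (real d)) (initial_density d \<nu>)"
    using initial_density_bound[OF \<nu>(1)] by blast
  \<comment> \<open>Below 1 for a finite fractional moment, yet close enough to 1 for
    \<open>jump_budget\<close>.\<close>
  define \<theta> where "\<theta> = 1 - \<nu> / 4"
  have \<theta>: "0 < \<theta>" "\<theta> < 1" using \<nu> by (auto simp: \<theta>_def)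
  obtain CJ where CJ: "CJ > 0" "\<And>d \<eta> R. d \<ge> 1 \<Longrightarrow> \<eta> > 0 \<Longrightarrow> R > 0 \<Longrightarrow> jump_mean d \<eta> R \<le> CJ * (\<eta> * sqrt (real d) / R) powr \<theta>"
    using jump_mean_le[OF \<theta>] by blast
  define \<delta> where "\<delta> = 1 / \<nu> - 1"
  have \<delta>: "\<delta> > 0" using \<nu> by (simp add: \<delta>_def)
  define p1 where "p1 = chi_const \<nu> / \<nu>"
  have p1: "p1 > 0" using chi_const_pos[OF \<nu>(1)] \<nu> by (simp add: p1_def)
  define A0 where "A0 = sqrt (2 * pi) * chi_const \<nu>"
  have A0: "A0 > 0" using chi_const_pos[OF \<nu>(1)] by (simp add: A0_def)
  \<comment> \<open>Collects ln (M^2 / (\<epsilon> / 2)) into a multiple of \<open>l\<close>: half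
    of \<epsilon> is reserved for the source term, whence ln 2.\<close>
  define K2 where "K2 = 1 + ln 2 + 2 * ln K0"
  have K2: "K2 \<ge> 1" using K0(1) by (simp add: K2_def)
  define K3 where "K3 = b + b * K2 + 2 * A0 * K2"
  have K3: "K3 > 0" using b K2 A0 by (simp add: K3_def add_pos_pos)
  \<comment> \<open>256 = 2 * 2 * 64, from the factors 2 M^2 and 2 J and from the 64 in
    \<open>t\<close>; 4 powr \<theta> comes from R being a quarter of B sqrt d.\<close>
  define K4 where "K4 = 256 * K0\<^sup>2 * K3 * CJ * 4 powr \<theta> * p1 / a powr (\<nu> / 4)"
  have K4: "K4 > 0" using K0(1) K3 CJ(1) p1 a by (simp add: K4_def)
  define K5 where "K5 = (33 + 3 * K0\<^sup>2) * p1 + 32 * K0 + K4"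
  have K5: "K5 > 0" using K0(1) p1 K4 by (simp add: K5_def add_pos_pos)
  \<comment> \<open>128 p1 makes the target tail \<open>t\<close> at most 1/2 and \<open>p\<close>
    at most 1/2; 4 K5 makes the source term at most \<epsilon> / 4.\<close>
  define K1 where "K1 = 1 + 128 * p1 + 4 * K5"
  have K1: "K1 \<ge> 1" "K1 \<ge> 128 * p1" "K1 \<ge> 4 * K5" "K1 \<ge> 2 * p1" using p1 K5 by (auto simp: K1_def)
  show ?thesis
  proof (rule that[of "K3 * K1 powr \<delta> / a"])
    show "K3 * K1 powr \<delta> / a > 0" using K3 K1 a by simp
    fix d :: nat and \<eta> \<epsilon> :: real and xm
    assume d: "d \<ge> 1" and \<epsilon>: "0 < \<epsilon>" "\<epsilon> < 1" and lo: "a / real d powr (1 / 2 + 4 / \<nu>) \<le> \<eta>" and hi: "\<eta> \<le> b"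
      and m: "minimizer d (cauchy_potential d \<nu>) xm"
    define D where "D = real d powr (1 / 2 + 4 / \<nu>)"
    define l where "l = 1 + ln (real d) + ln (1 / \<epsilon>)"
    \<comment> \<open>X = B^\<nu> is the inverse tail mass of the target at scale B sqrt d, up to
      constants. It has to exceed D for the jump budget and l / \<epsilon> for the final accuracy;
      the logarithm \<open>l\<close> is there because the iteration count contains it.\<close>
    define X0 where "X0 = max D (1 / \<epsilon>) * l"
    define X where "X = K1 * X0"
    have d1: "real d \<ge> 1" using d by simp
    have Dd: "D \<ge> real d"
    proof -
      have "4 / \<nu> \<ge> 4" using \<nu> by (simp add: le_divide_eq)
      then have "real d powr 1 \<le> D" unfolding D_def using d1 by (intro powr_mono) auto
      then show ?thesis using d1 by simp
    qed
    have l1: "l \<ge> 1" using d1 \<epsilon> by (simp add: l_def)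
    have XD: "X \<ge> K1 * D" and Xe: "X \<ge> K1 * l / \<epsilon>"
    proof -
      have "D * 1 \<le> X0" unfolding X0_def using l1 Dd d1 by (intro mult_mono) auto
      then show "X \<ge> K1 * D" unfolding X_def using K1 by (intro mult_left_mono) auto
      have "1 / \<epsilon> * l \<le> X0" unfolding X0_def using l1 by (intro mult_right_mono) auto
      then have "K1 * (1 / \<epsilon> * l) \<le> K1 * X0" using K1 by (intro mult_left_mono) auto
      then show "X \<ge> K1 * l / \<epsilon>" by (simp add: X_def)
    qed
    have "1 * D \<le> K1 * D" using K1(1) Dd d1 by (intro mult_right_mono) auto
    then have DX: "D \<le> X" using XD by simp
    have X1: "X \<ge> 1" using DX Dd d1 by linarith
    have \<eta>D: "a / D \<le> \<eta>" using lo by (simp add: D_def)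
    have "a / D > 0" using a Dd d1 by simp
    then have \<eta>: "\<eta> > 0" using \<eta>D by linarith
    define B where "B = X powr (1 / \<nu>)"
    have B: "B > 0" using X1 by (simp add: B_def)
    have B\<nu>: "B powr \<nu> = X" using \<nu> X1 by (simp add: B_def powr_powr)
    have B\<delta>: "B powr (1 - \<nu>) = X powr \<delta>" using \<nu> by (simp add: B_def powr_powr \<delta>_def diff_divide_distrib)
    define R where "R = B * sqrt (real d) / 4"
    have R: "R > 0" using B d1 by (simp add: R_def)
    define M where "M = K0 * sqrt (real d)"
    have M: "M > 0" using K0(1) d1 by (simp add: M_def)
    note bd = K0(2)[OF d, folded M_def]
    have M2: "M\<^sup>2 = K0\<^sup>2 * real d" using d by (simp add: M_def power_mult_distrib)
    \<comment> \<open>sqrt d divided by R / (8 d) is 32 d / B, and (32 d)^\<nu> is bounded by 32 d,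
      so the bound 2 p1 (32 d / B)^\<nu> of \<open>target_tail\<close> becomes this.\<close>
    define t where "t = 64 * p1 * real d / X"
    have t0: "t \<ge> 0" using p1 X1 by (simp add: t_def)
    have tle: "t \<le> 1 / 2"
    proof -
      have "128 * p1 * real d \<le> K1 * D" using K1 p1 Dd d1 by (intro mult_mono) auto
      then have "128 * p1 * real d \<le> X" using XD by linarith
      then show ?thesis using X1 by (simp add: t_def divide_le_eq)
    qed
    have tail: "emeasure (target_law d \<nu>) {x\<in>space (Rd d). nrm d x \<ge> R / (8 * real d)} \<le> ennreal t"
    proof -
      have "emeasure (target_law d \<nu>) {x\<in>space (Rd d). nrm d x \<ge> R / (8 * real d)} \<le>
        ennreal (2 * p1 * (sqrt (real d) / (R / (8 * real d))) powr \<nu>)"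
        unfolding p1_def using R d1 \<nu> by (intro target_tail[OF d]) auto
      also have "\<dots> \<le> ennreal t"
      proof (rule ennreal_leI)
        have "sqrt (real d) / (R / (8 * real d)) = 32 * real d / B" using d1 B by (simp add: R_def)
        then have "(sqrt (real d) / (R / (8 * real d))) powr \<nu> = (32 * real d) powr \<nu> / X" by (simp add: powr_divide B\<nu>)
        also have "\<dots> \<le> (32 * real d) powr 1 / X" using d1 \<nu> X1 by (intro divide_right_mono powr_mono) auto
        finally have "(sqrt (real d) / (R / (8 * real d))) powr \<nu> \<le> 32 * real d / X" by simp
        then have "2 * p1 * (sqrt (real d) / (R / (8 * real d))) powr \<nu> \<le> 2 * p1 * (32 * real d / X)"
          using p1 by (intro mult_left_mono) auto
        then show "2 * p1 * (sqrt (real d) / (R / (8 * real d))) powr \<nu> \<le> t" by (simp add: t_def)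
      qed
      finally show ?thesis .
    qed
    have half: "emeasure (target_law d \<nu>) {x\<in>space (Rd d). 8 * real d * nrm d x \<le> R} \<ge> ennreal (1 / 2)"
    proof -
      interpret T: prob_space "target_law d \<nu>" by (rule prob_space_target_law[OF \<nu>(1)])
      define Q where "Q = {x\<in>space (Rd d). nrm d x \<ge> R / (8 * real d)}"
      define Q' where "Q' = {x\<in>space (Rd d). 8 * real d * nrm d x \<le> R}"
      have [measurable]: "Q \<in> sets (Rd d)" "Q' \<in> sets (Rd d)" unfolding Q_def Q'_def by measurable
      have "measure (target_law d \<nu>) Q \<le> t"
        using tail t0 unfolding Q_def[symmetric] T.emeasure_eq_measure by (subst (asm) ennreal_le_iff) auto
      moreover have "1 - measure (target_law d \<nu>) Q = measure (target_law d \<nu>) (space (target_law d \<nu>) - Q)"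
        by (rule T.prob_compl[symmetric]) simp
      moreover have "measure (target_law d \<nu>) (space (target_law d \<nu>) - Q) \<le> measure (target_law d \<nu>) Q'"
        using d1 by (intro T.finite_measure_mono) (auto simp: Q_def Q'_def not_le less_divide_eq mult.commute)
      ultimately have "1 / 2 \<le> measure (target_law d \<nu>) Q'" using tle by linarith
      then show ?thesis unfolding Q'_def[symmetric] T.emeasure_eq_measure by (rule ennreal_leI)
    qed
    define p where "p = p1 / X"
    have p: "emeasure (chi_law \<nu>) {..1 / B} \<le> ennreal p" "0 \<le> p" "p \<le> 1 / 2"
    proof -
      have "emeasure (chi_law \<nu>) {..1 / B} \<le> ennreal (p1 * (1 / B) powr \<nu>)"
        unfolding p1_def using B by (intro chi_law_lower_tail[OF \<nu>(1)]) simp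
      then show "emeasure (chi_law \<nu>) {..1 / B} \<le> ennreal p" by (simp add: powr_divide B\<nu> p_def)
      show "0 \<le> p" using p1 X1 by (simp add: p_def)
      have "2 * p1 * 1 \<le> K1 * D" using K1 p1 Dd d1 by (intro mult_mono) auto
      then have "2 * p1 \<le> X" using XD by linarith
      then show "p \<le> 1 / 2" using X1 by (simp add: p_def divide_le_eq)
    qed
    define J where "J = CJ * (4 * \<eta> / B) powr \<theta>"
    have J: "jump_mean d \<eta> R \<le> J"
    proof -
      have "\<eta> * sqrt (real d) / R = 4 * \<eta> / B" using d1 B by (simp add: R_def)
      then show ?thesis using CJ(2)[OF d \<eta> R] by (simp add: J_def)
    qed
    define A where "A = A0 * X powr \<delta>"
    have A: "A = sqrt (2 * pi) * chi_const \<nu> * B powr (1 - \<nu>)" by (simp add: A_def A0_def B\<delta>)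
    have Xd1: "X powr \<delta> \<ge> 1" using X1 \<delta> by (intro ge_one_powr_ge_zero) auto
    have Apos: "A > 0" unfolding A_def by (rule mult_pos_pos[OF A0 order_less_le_trans[OF zero_less_one Xd1]])
    \<comment> \<open>The number of steps that brings the divergence from at most M^2 to within
      \<epsilon> / 2 of the source level 2 S. It is fixed before S, because S depends on it through
      the accumulated jumps.\<close>
    define N where "N = 1 + (1 + 1 / (\<eta> / (2 * A))) * ln (M\<^sup>2 / (\<epsilon> / 2))"
    have M21: "M\<^sup>2 \<ge> 1"
    proof -
      have "1 * 1 \<le> K0\<^sup>2 * real d" using K0(1) d1 by (intro mult_mono) auto
      then show ?thesis by (simp add: M2)
    qed
    have lnW: "0 \<le> ln (M\<^sup>2 / (\<epsilon> / 2))" "ln (M\<^sup>2 / (\<epsilon> / 2)) \<le> K2 * l"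
    proof -
      show "0 \<le> ln (M\<^sup>2 / (\<epsilon> / 2))" using M21 \<epsilon> by (simp add: le_divide_eq)
      have "M\<^sup>2 / (\<epsilon> / 2) = 2 * (K0\<^sup>2 * (real d * (1 / \<epsilon>)))" by (simp add: M2)
      moreover have "real d * (1 / \<epsilon>) > 0" "1 / \<epsilon> > 0" "real d > 0" "K0\<^sup>2 > 0" "K0\<^sup>2 * (real d * (1 / \<epsilon>)) > 0"
        using d1 \<epsilon> K0(1) by auto
      ultimately have "ln (M\<^sup>2 / (\<epsilon> / 2)) = ln 2 + (ln (K0\<^sup>2) + (ln (real d) + ln (1 / \<epsilon>)))"
        by (simp only: ln_mult_pos zero_less_numeral)
      also have "ln (K0\<^sup>2) = 2 * ln K0" using K0(1) by (simp add: ln_realpow)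
      finally have "ln (M\<^sup>2 / (\<epsilon> / 2)) \<le> (ln 2 + 2 * ln K0) * 1 + l" by (simp add: l_def)
      also have "\<dots> \<le> (ln 2 + 2 * ln K0) * l + l" using l1 K0(1) by (intro add_right_mono mult_left_mono) auto
      finally show "ln (M\<^sup>2 / (\<epsilon> / 2)) \<le> K2 * l" by (simp add: K2_def algebra_simps)
    qed
    have Nle: "N \<le> K3 * X powr \<delta> * l / \<eta>"
    proof -
      have xl: "X powr \<delta> * l \<ge> 1" using Xd1 l1 mult_mono[of 1 "X powr \<delta>" 1 l] by simp
      have b\<eta>: "1 \<le> b / \<eta>" using hi \<eta> by simp
      have 1: "1 \<le> b / \<eta> * (X powr \<delta> * l)" using mult_mono[OF b\<eta> xl] b \<eta> by simp
      have "(1 + 2 * A / \<eta>) * ln (M\<^sup>2 / (\<epsilon> / 2)) \<le> (b / \<eta> * X powr \<delta> + 2 * A / \<eta>) * (K2 * l)"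
      proof (rule mult_mono)
        have "1 * 1 \<le> b / \<eta> * X powr \<delta>" using b\<eta> Xd1 b \<eta> by (intro mult_mono) auto
        then show "1 + 2 * A / \<eta> \<le> b / \<eta> * X powr \<delta> + 2 * A / \<eta>" by simp
      qed (use lnW b \<eta> Apos in auto)
      also have "\<dots> = (b * K2 + 2 * A0 * K2) / \<eta> * (X powr \<delta> * l)" by (simp add: A_def algebra_simps add_divide_distrib)
      finally have "N \<le> b / \<eta> * (X powr \<delta> * l) + (b * K2 + 2 * A0 * K2) / \<eta> * (X powr \<delta> * l)"
        using 1 by (simp add: N_def)
      also have "\<dots> = K3 * X powr \<delta> * l / \<eta>" by (simp add: K3_def algebra_simps add_divide_distrib)
      finally show ?thesis .
    qed
    define e where "e = 16 / (M * B\<^sup>2) + N * (2 * J * t)"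
    define S where "S = (33 + M\<^sup>2 * (3 / 4) ^ d) * p + 2 * M\<^sup>2 * e"
    have J0: "J \<ge> 0" using CJ(1) by (simp add: J_def)
    have N0: "N \<ge> 0" using lnW(1) \<eta> Apos by (simp add: N_def)
    have e0: "e \<ge> 0" using M N0 J0 t0 by (simp add: e_def)
    \<comment> \<open>M^2 grows linearly in d, so the geometric factor from short Gaussian vectors
      keeps the bracket bounded.\<close>
    have S1: "(33 + M\<^sup>2 * (3 / 4) ^ d) * p \<le> (33 + 3 * K0\<^sup>2) * p1 * (l / X)"
    proof -
      have "M\<^sup>2 * (3 / 4) ^ d \<le> K0\<^sup>2 * 3"
        unfolding M2 mult.assoc by (intro mult_left_mono linear_times_geometric_le) auto
      then have "(33 + M\<^sup>2 * (3 / 4) ^ d) * p \<le> (33 + 3 * K0\<^sup>2) * (p1 * (l / X))"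
        unfolding p_def using p1 X1 l1 by (intro mult_mono) (auto simp: divide_right_mono)
      then show ?thesis by (simp add: mult.assoc)
    qed
    \<comment> \<open>This term equals 32 K0 sqrt d / B^2 and is small with room to spare, since B
      >= X >= d.\<close>
    have S2: "2 * M\<^sup>2 * (16 / (M * B\<^sup>2)) \<le> 32 * K0 * (l / X)"
    proof -
      have "B \<ge> X powr 1" unfolding B_def using X1 \<nu> by (intro powr_mono) auto
      then have BX: "B \<ge> X" using X1 by simp
      have "sqrt (real d) \<le> real d" using d1 by (intro real_le_lsqrt) (auto simp: power2_eq_square)
      then have "sqrt (real d) \<le> l * X" using Dd DX l1 d1 mult_mono[of 1 l "sqrt (real d)" X] by simp
      then have "sqrt (real d) * (X * X) \<le> l * X * (B * B)" using BX X1 l1 d1 by (intro mult_mono) auto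
      then have "sqrt (real d) / (B * B) \<le> l / X" using X1 B by (simp add: divide_le_eq le_divide_eq mult_ac)
      then have "32 * K0 * (sqrt (real d) / (B * B)) \<le> 32 * K0 * (l / X)" using K0(1) by (intro mult_left_mono) auto
      moreover have "2 * M\<^sup>2 * (16 / (M * B\<^sup>2)) = 32 * K0 * (sqrt (real d) / (B * B))"
      proof -
        have "2 * M\<^sup>2 * (16 / (M * B\<^sup>2)) = 32 * M / B\<^sup>2" using M by (simp add: power2_eq_square)
        then show ?thesis by (simp add: M_def power2_eq_square)
      qed
      ultimately show ?thesis by simp
    qed
    \<comment> \<open>One factor d comes from M^2 and another from \<open>t\<close>; the remaining
      powers are exactly those of \<open>jump_budget\<close>, and l / X is left over.\<close>
    have S3: "2 * M\<^sup>2 * (N * (2 * J * t)) \<le> K4 * (l / X)"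
    proof -
      have "2 * M\<^sup>2 * (N * (2 * J * t)) \<le> 2 * M\<^sup>2 * (K3 * X powr \<delta> * l / \<eta> * (2 * J * t))"
        using Nle J0 t0 by (intro mult_left_mono mult_right_mono) auto
      also have "\<dots> = 256 * K0\<^sup>2 * K3 * CJ * 4 powr \<theta> * p1 * ((real d)\<^sup>2 * (X powr \<delta> / \<eta> * (\<eta> / B) powr \<theta>)) * (l / X)"
      proof -
        have "(4 * \<eta> / B) powr \<theta> = 4 powr \<theta> * (\<eta> / B) powr \<theta>" using powr_mult[of 4 "\<eta> / B" \<theta>] by simp
        then show ?thesis unfolding M2 J_def t_def by (simp add: power2_eq_square mult_ac)
      qed
      also have "\<dots> \<le> 256 * K0\<^sup>2 * K3 * CJ * 4 powr \<theta> * p1 * (1 / a powr (\<nu> / 4)) * (l / X)"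
      proof (intro mult_right_mono mult_left_mono)
        show "(real d)\<^sup>2 * (X powr \<delta> / \<eta> * (\<eta> / B) powr \<theta>) \<le> 1 / a powr (\<nu> / 4)"
          unfolding \<delta>_def B_def \<theta>_def by (rule jump_budget[OF d1 \<nu> a D_def DX \<eta>D])
      qed (use K0(1) K3 CJ(1) p1 l1 X1 in auto)
      finally show ?thesis by (simp add: K4_def)
    qed
    \<comment> \<open>All three parts of S are multiples of l / X, which is at most \<epsilon> / K1
      by the choice of X.\<close>
    have S\<epsilon>: "2 * S \<le> \<epsilon> / 2"
    proof -
      have "S \<le> K5 * (l / X)" using S1 S2 S3 by (simp add: S_def e_def K5_def algebra_simps)
      also have "l / X \<le> \<epsilon> / K1"
        using Xe X1 K1 \<epsilon> by (simp add: divide_le_eq le_divide_eq mult_ac)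
      also have "K5 * (\<epsilon> / K1) \<le> \<epsilon> / 4"
        using mult_right_mono[OF K1(3), of \<epsilon>] K1(1) \<epsilon> by (simp add: divide_le_eq mult_ac)
      finally show ?thesis using K5 by simp
    qed
    have "\<exists>k. real k \<le> N \<and> chi2 d \<nu> \<eta> k - 2 * S \<le> \<epsilon> / 2"
    proof (rule geometric_decay_upto[OF _ N_def])
      show "\<eta> / (2 * A) > 0" using \<eta> Apos by simp
      show "\<epsilon> / 2 > 0" "\<epsilon> / 2 \<le> M\<^sup>2" using \<epsilon> M21 by auto
      have "S \<ge> 0" using p e0 by (simp add: S_def)
      then show "chi2 d \<nu> \<eta> 0 - 2 * S \<le> M\<^sup>2" using ennreal_chi2(2)[OF \<eta> \<nu>(1) bd, of 0] by simp
      fix k assume k: "real (Suc k) \<le> N"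
      have em: "(\<integral>\<^sup>+x. ennreal (excess d \<nu> \<eta> R M (Suc k) x) \<partial>target_law d \<nu>) \<le> ennreal e"
        unfolding e_def by (rule excess_mass_le[OF d \<eta> \<nu>(1) B R_def M bd tail t0 J k])
      show "(chi2 d \<nu> \<eta> (Suc k) - 2 * S) * (1 + \<eta> / (2 * A)) \<le> chi2 d \<nu> \<eta> k - 2 * S"
        by (rule chi2_contraction_weak[OF d \<eta> \<nu> B R_def M bd half p em e0 A S_def])
    qed
    then obtain k where k: "real k \<le> N" "chi2 d \<nu> \<eta> k \<le> \<epsilon>" using S\<epsilon> by fastforce
    have "iterations_required d \<nu> \<eta> xm \<epsilon> \<le> ennreal N"
      by (rule iterations_required_le_chi2[OF \<eta> \<nu>(1) m bd k(2,1)])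
    also have "N \<le> K3 * K1 powr \<delta> / a * (D * X0 powr \<delta> * l)"
    proof -
      have "1 / \<eta> \<le> D / a" using \<eta>D a \<eta> Dd d1 by (simp add: field_simps)
      then have "K3 * X powr \<delta> * l * (1 / \<eta>) \<le> K3 * X powr \<delta> * l * (D / a)" using K3 l1 by (intro mult_left_mono) auto
      moreover have "X powr \<delta> = K1 powr \<delta> * X0 powr \<delta>" by (simp add: X_def powr_mult)
      ultimately show ?thesis using Nle by (simp add: mult_ac)
    qed
    finally show "iterations_required d \<nu> \<eta> xm \<epsilon> \<le> ennreal (K3 * K1 powr \<delta> / a * (real d powr (1 / 2 + 4 / \<nu>) *
      (max (real d powr (1 / 2 + 4 / \<nu>)) (1 / \<epsilon>) * (1 + ln (real d) + ln (1 / \<epsilon>))) powr (1 / \<nu> - 1) *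
      (1 + ln (real d) + ln (1 / \<epsilon>))))"
      by (simp add: D_def X0_def l_def \<delta>_def ennreal_leI)
  qed
qed

text \<open>The explicit bound is D max (D, 1 / \<epsilon>)^\<delta> up to logarithms, with D =
  d^(1/2 + 4 / \<nu>) and \<delta> = 1 / \<nu> - 1. The two cases of its maximum match the two terms
  of the claim, and the factors of c cost only a constant because c is bounded below uniformly in
  d.\<close>

theorem iterations_weak_FPI:
  fixes \<nu> a b \<epsilon>0 :: real
  assumes \<nu>: "0 < \<nu>" "\<nu> < 1" and ab: "0 < a" "a \<le> b" and \<epsilon>0: "\<epsilon>0 < 1"
  shows "\<exists>K>0. \<exists>m::nat. \<forall>d::nat. \<forall>\<eta> \<epsilon> c :: real. \<forall>xm.
    d \<ge> 1 \<longrightarrow> 0 < \<epsilon> \<longrightarrow> \<epsilon> \<le> \<epsilon>0 \<longrightarrow>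
    a * (real d powr (- 1 / 2) * (real d + \<nu>) powr (- 4 / \<nu>)) \<le> \<eta> \<longrightarrow>
    \<eta> \<le> b * (real d powr (- 1 / 2) * (real d + \<nu>) powr (- 4 / \<nu>)) \<longrightarrow>
    minimizer d (cauchy_potential d \<nu>) xm \<longrightarrow>
    c > 0 \<longrightarrow>
    satisfies_weak_FPI d (cauchy_target d \<nu>) (\<lambda>r. c * (1 + r powr (- (1 - \<nu>) / \<nu>))) \<longrightarrow>
    iterations_required d \<nu> \<eta> xm \<epsilon>
      \<le> ennreal (K * max (c powr (1 / \<nu>) * real d powr (1 / (2 * \<nu>) + 4 / \<nu>\<^sup>2))
                       (c * real d powr (1 / 2 + 4 / \<nu>) * \<epsilon> powr (- 1 / \<nu> + 1))
                 * (1 + ln (real d) + ln (1 / \<epsilon>)) ^ m)"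
proof -
  have ap: "a * 2 powr (- 4 / \<nu>) > 0" and bp: "b > 0" using ab by auto
  obtain K where K: "K > 0" "\<And>(d::nat) \<eta> \<epsilon> xm. d \<ge> 1 \<Longrightarrow> 0 < \<epsilon> \<Longrightarrow> \<epsilon> < 1 \<Longrightarrow>
    a * 2 powr (- 4 / \<nu>) / real d powr (1 / 2 + 4 / \<nu>) \<le> \<eta> \<Longrightarrow> \<eta> \<le> b \<Longrightarrow> minimizer d (cauchy_potential d \<nu>) xm \<Longrightarrow>
    iterations_required d \<nu> \<eta> xm \<epsilon> \<le> ennreal (K * (real d powr (1 / 2 + 4 / \<nu>) *
      (max (real d powr (1 / 2 + 4 / \<nu>)) (1 / \<epsilon>) * (1 + ln (real d) + ln (1 / \<epsilon>))) powr (1 / \<nu> - 1) *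
      (1 + ln (real d) + ln (1 / \<epsilon>))))"
    using iterations_weak_FPI_core[OF \<nu> ap bp] by blast
  obtain \<kappa> where \<kappa>: "\<kappa> > 0" "\<And>d c. d \<ge> 1 \<Longrightarrow> c > 0 \<Longrightarrow>
    satisfies_weak_FPI d (cauchy_target d \<nu>) (\<lambda>r. c * (1 + r powr (- (1 - \<nu>) / \<nu>))) \<Longrightarrow> c \<ge> \<kappa>"
    using weak_FPI_constant_lower_bound[OF \<nu>(1)] by blast
  define \<delta> where "\<delta> = 1 / \<nu> - 1"
  have \<delta>: "\<delta> > 0" using \<nu> by (simp add: \<delta>_def)
  \<comment> \<open>The first entry bounds c^(1 / \<nu>) from below, the second c itself, one for
    each term of the maximum.\<close>
  define \<mu> where "\<mu> = min (\<kappa> powr (1 / \<nu>)) \<kappa>"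
  have \<mu>: "\<mu> > 0" using \<kappa>(1) by (simp add: \<mu>_def)
  \<comment> \<open>The logarithm occurs to the power \<delta> inside X and once more in the
    iteration count; the sum is rounded up to a natural exponent.\<close>
  define m where "m = nat \<lceil>\<delta> + 1\<rceil>"
  have m: "\<delta> + 1 \<le> real m" unfolding m_def by linarith
  have main: "iterations_required d \<nu> \<eta> xm \<epsilon>
      \<le> ennreal (K / \<mu> * max (c powr (1 / \<nu>) * real d powr (1 / (2 * \<nu>) + 4 / \<nu>\<^sup>2))
                       (c * real d powr (1 / 2 + 4 / \<nu>) * \<epsilon> powr (- 1 / \<nu> + 1))
                 * (1 + ln (real d) + ln (1 / \<epsilon>)) ^ m)"
    if d: "d \<ge> 1" and \<epsilon>: "0 < \<epsilon>" "\<epsilon> \<le> \<epsilon>0"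
      and lo: "a * (real d powr (- 1 / 2) * (real d + \<nu>) powr (- 4 / \<nu>)) \<le> \<eta>"
      and hi: "\<eta> \<le> b * (real d powr (- 1 / 2) * (real d + \<nu>) powr (- 4 / \<nu>))"
      and xm: "minimizer d (cauchy_potential d \<nu>) xm" and c: "c > 0"
      and F: "satisfies_weak_FPI d (cauchy_target d \<nu>) (\<lambda>r. c * (1 + r powr (- (1 - \<nu>) / \<nu>)))"
    for d \<eta> \<epsilon> c xm
  proof -
    have d1: "real d \<ge> 1" and \<epsilon>1: "\<epsilon> < 1" using d \<epsilon> \<epsilon>0 by auto
    define D where "D = real d powr (1 / 2 + 4 / \<nu>)"
    define l where "l = 1 + ln (real d) + ln (1 / \<epsilon>)"
    have D0: "D > 0" using d1 by (simp add: D_def)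
    have l1: "l \<ge> 1" using d1 \<epsilon>(1) \<epsilon>1 by (simp add: l_def)
    have "b > 0" using ab by simp
    note sb = step_size_bounds[OF d1 \<nu> ab(1) this lo hi]
    have c\<kappa>: "c \<ge> \<kappa>" by (rule \<kappa>(2)[OF d c F])
    define U where "U = max (c powr (1 / \<nu>) * real d powr (1 / (2 * \<nu>) + 4 / \<nu>\<^sup>2)) (c * D * \<epsilon> powr (- 1 / \<nu> + 1))"
    \<comment> \<open>If D dominates, D^(1 + \<delta>) = D^(1 / \<nu>) is the power 1 / (2 \<nu>) +
      4 / \<nu>^2 of d; otherwise \<epsilon>^(- \<delta>) is the power of \<epsilon> in the second
      term.\<close>
    have cU: "\<mu> * (D * max D (1 / \<epsilon>) powr \<delta>) \<le> U"
    proof (cases "1 / \<epsilon> \<le> D")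
      case True
      have "D * D powr \<delta> = D powr (1 + \<delta>)" using D0 by (simp add: powr_add)
      also have "\<dots> = real d powr ((1 / 2 + 4 / \<nu>) * (1 / \<nu>))" by (simp add: D_def powr_powr \<delta>_def)
      also have "(1 / 2 + 4 / \<nu>) * (1 / \<nu>) = 1 / (2 * \<nu>) + 4 / \<nu>\<^sup>2"
        by (simp add: add_divide_distrib power2_eq_square)
      finally have e: "D * D powr \<delta> = real d powr (1 / (2 * \<nu>) + 4 / \<nu>\<^sup>2)" .
      have "\<kappa> powr (1 / \<nu>) \<le> c powr (1 / \<nu>)" using c\<kappa> \<kappa>(1) \<nu> by (intro powr_mono2) auto
      then have "\<mu> \<le> c powr (1 / \<nu>)" by (simp add: \<mu>_def)
      then have "\<mu> * (D * D powr \<delta>) \<le> c powr (1 / \<nu>) * real d powr (1 / (2 * \<nu>) + 4 / \<nu>\<^sup>2)"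
        unfolding e by (intro mult_right_mono) auto
      moreover have "max D (1 / \<epsilon>) = D" using True by simp
      ultimately show ?thesis unfolding U_def by (simp add: le_max_iff_disj)
    next
      case False
      have "(1 / \<epsilon>) powr \<delta> = \<epsilon> powr (- \<delta>)" by (simp add: powr_divide powr_minus_divide)
      also have "- \<delta> = - 1 / \<nu> + 1" by (simp add: \<delta>_def)
      finally have e: "(1 / \<epsilon>) powr \<delta> = \<epsilon> powr (- 1 / \<nu> + 1)" .
      have "\<mu> \<le> c" using c\<kappa> by (simp add: \<mu>_def)
      then have "\<mu> * (D * (1 / \<epsilon>) powr \<delta>) \<le> c * (D * \<epsilon> powr (- 1 / \<nu> + 1))"
        unfolding e using D0 by (intro mult_right_mono) auto
      moreover have "max D (1 / \<epsilon>) = 1 / \<epsilon>" using False by simp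
      ultimately show ?thesis unfolding U_def by (simp add: le_max_iff_disj mult.assoc)
    qed
    have ll: "l powr \<delta> * l \<le> l ^ m"
    proof -
      have "l powr \<delta> * l = l powr (\<delta> + 1)" using l1 by (simp add: powr_add)
      also have "\<dots> \<le> l powr real m" using l1 m by (intro powr_mono) auto
      also have "\<dots> = l ^ m" using l1 by (intro powr_realpow) auto
      finally show ?thesis .
    qed
    have "iterations_required d \<nu> \<eta> xm \<epsilon> \<le> ennreal (K * (D * (max D (1 / \<epsilon>) * l) powr \<delta> * l))"
      using K(2)[OF d \<epsilon>(1) \<epsilon>1 sb xm] by (simp add: D_def l_def \<delta>_def)
    also have "\<dots> \<le> ennreal (K / \<mu> * U * l ^ m)"
    proof (rule ennreal_leI)
      have "K * (D * (max D (1 / \<epsilon>) * l) powr \<delta> * l) = K / \<mu> * (\<mu> * (D * max D (1 / \<epsilon>) powr \<delta>)) * (l powr \<delta> * l)"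
        using \<mu> by (simp add: powr_mult mult_ac)
      also have "\<dots> \<le> K / \<mu> * U * l ^ m"
      proof (rule mult_mono[OF _ ll])
        show "K / \<mu> * (\<mu> * (D * max D (1 / \<epsilon>) powr \<delta>)) \<le> K / \<mu> * U" using K(1) \<mu> cU by (intro mult_left_mono) auto
        have "0 \<le> \<mu> * (D * max D (1 / \<epsilon>) powr \<delta>)" using \<mu> D0 by simp
        then show "0 \<le> K / \<mu> * U" using cU K(1) \<mu> by simp
      qed (use l1 in simp)
      finally show "K * (D * (max D (1 / \<epsilon>) * l) powr \<delta> * l) \<le> K / \<mu> * U * l ^ m" .
    qed
    finally show ?thesis unfolding U_def l_def D_def .
  qed
  have "K / \<mu> > 0" using K(1) \<mu> by simp
  then show ?thesis using main by blast
qed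

text \<open>The constants a and b express the order of the step size. \<open>K\<close> and
  \<open>m\<close> are chosen before d, \<eta>, \<epsilon> and the Poincare constants, so the
  estimates are uniform in these. Keeping \<epsilon> below a fixed \<epsilon>0 < 1 holds
  \<open>ln (real d / \<epsilon>)\<close> away from 0 also in dimension one.\<close>

theorem corollary3p3:
  shows
    "(\<forall>\<nu>::real. \<nu> \<ge> 1 \<longrightarrow>
       (\<forall>a b \<epsilon>0 :: real. 0 < a \<longrightarrow> a \<le> b \<longrightarrow> 0 < \<epsilon>0 \<longrightarrow> \<epsilon>0 < 1 \<longrightarrow>
         (\<exists>K>0. \<forall>d::nat. \<forall>\<eta> \<epsilon> C :: real. \<forall>xm.
            d \<ge> 1 \<longrightarrow> 0 < \<epsilon> \<longrightarrow> \<epsilon> \<le> \<epsilon>0 \<longrightarrow>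
            a * (real d powr (- 1 / 2) * (real d + \<nu>) powr (- 4)) \<le> \<eta> \<longrightarrow>
            \<eta> \<le> b * (real d powr (- 1 / 2) * (real d + \<nu>) powr (- 4)) \<longrightarrow>
            minimizer d (cauchy_potential d \<nu>) xm \<longrightarrow>
            satisfies_FPI d (cauchy_target d \<nu>) C \<longrightarrow>
            iterations_required d \<nu> \<eta> xm \<epsilon>
              \<le> ennreal (K * (C * real d powr (1 / 2) * (real d + \<nu>) ^ 4 * ln (real d / \<epsilon>))))))
     \<and>
     (\<forall>\<nu>::real. 0 < \<nu> \<longrightarrow> \<nu> < 1 \<longrightarrow>
       (\<forall>a b \<epsilon>0 :: real. 0 < a \<longrightarrow> a \<le> b \<longrightarrow> 0 < \<epsilon>0 \<longrightarrow> \<epsilon>0 < 1 \<longrightarrow>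
         (\<exists>K>0. \<exists>m::nat. \<forall>d::nat. \<forall>\<eta> \<epsilon> c :: real. \<forall>xm.
            d \<ge> 1 \<longrightarrow> 0 < \<epsilon> \<longrightarrow> \<epsilon> \<le> \<epsilon>0 \<longrightarrow>
            a * (real d powr (- 1 / 2) * (real d + \<nu>) powr (- 4 / \<nu>)) \<le> \<eta> \<longrightarrow>
            \<eta> \<le> b * (real d powr (- 1 / 2) * (real d + \<nu>) powr (- 4 / \<nu>)) \<longrightarrow>
            minimizer d (cauchy_potential d \<nu>) xm \<longrightarrow>
            c > 0 \<longrightarrow>
            satisfies_weak_FPI d (cauchy_target d \<nu>) (\<lambda>r. c * (1 + r powr (- (1 - \<nu>) / \<nu>))) \<longrightarrow>
            iterations_required d \<nu> \<eta> xm \<epsilon>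
              \<le> ennreal (K * max (c powr (1 / \<nu>) * real d powr (1 / (2 * \<nu>) + 4 / \<nu>\<^sup>2))
                               (c * real d powr (1 / 2 + 4 / \<nu>) * \<epsilon> powr (- 1 / \<nu> + 1))
                         * (1 + ln (real d) + ln (1 / \<epsilon>)) ^ m))))"
proof (intro conjI allI impI)
  fix \<nu> a b \<epsilon>0 :: real
  assume \<nu>: "\<nu> \<ge> 1" and a: "0 < a" and \<epsilon>0: "0 < \<epsilon>0" "\<epsilon>0 < 1"
  obtain K where "K > 0" and K: "\<forall>d::nat. \<forall>\<eta> \<epsilon> C :: real. \<forall>xm.
      d \<ge> 1 \<longrightarrow> 0 < \<epsilon> \<longrightarrow> \<epsilon> \<le> \<epsilon>0 \<longrightarrow>
      a * (real d powr (- 1 / 2) * (real d + \<nu>) powr (- 4)) \<le> \<eta> \<longrightarrow>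
      minimizer d (cauchy_potential d \<nu>) xm \<longrightarrow>
      satisfies_FPI d (cauchy_target d \<nu>) C \<longrightarrow>
      iterations_required d \<nu> \<eta> xm \<epsilon> \<le> ennreal (K * (C * real d powr (1 / 2) * (real d + \<nu>) ^ 4 * ln (real d / \<epsilon>)))"
    using iterations_FPI[OF \<nu> a \<epsilon>0] by blast
  then show "\<exists>K>0. \<forall>d::nat. \<forall>\<eta> \<epsilon> C :: real. \<forall>xm.
      d \<ge> 1 \<longrightarrow> 0 < \<epsilon> \<longrightarrow> \<epsilon> \<le> \<epsilon>0 \<longrightarrow>
      a * (real d powr (- 1 / 2) * (real d + \<nu>) powr (- 4)) \<le> \<eta> \<longrightarrow>
      \<eta> \<le> b * (real d powr (- 1 / 2) * (real d + \<nu>) powr (- 4)) \<longrightarrow>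
      minimizer d (cauchy_potential d \<nu>) xm \<longrightarrow>
      satisfies_FPI d (cauchy_target d \<nu>) C \<longrightarrow>
      iterations_required d \<nu> \<eta> xm \<epsilon> \<le> ennreal (K * (C * real d powr (1 / 2) * (real d + \<nu>) ^ 4 * ln (real d / \<epsilon>)))"
    by blast
qed (rule iterations_weak_FPI)

end
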